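(* Let $\{\tilde Z^{(r)}\}_{r\in(0,1)}$ be the family of $J$-dimensional SRBMs with initial states $\tilde Z^{(r)}(0)$, drift vectors $\theta^{(r)}$, covariance matrix $\Gamma$ and reflection matrix $R$ described in the context. Suppose: (i) for all $r\in(0,1)$, $\theta^{(r)}=-R\delta^{(r)}$ with $\delta^{(r)}=[\gamma_1(r),\dots,\gamma_J(r)]'$; (ii) there is an $\mathbb R_+^J$-valued random vector $\tilde\xi$ such that $\big(\gamma_1(r)\tilde Z_1^{(r)}(0),\gamma_1(r)\tilde Z_2^{(r)}(0),\dots,\gamma_1(r)\tilde Z_J^{(r)}(0)\big)\Longrightarrow\tilde\xi$ as $r\to0$. Then, as $r\to0$, $$\Big\{\big(\gamma_1(r)\tilde Z_1^{(r)}(t/\gamma_1^2(r)),\dots,\gamma_J(r)\tilde Z_J^{(r)}(t/\gamma_J^2(r))\big);\ t\ge0\Big\}\Longrightarrow\tilde Z^*,$$ where $\tilde Z^*$ is a $J$-dimensional process whose components are mutually independent. Specifically, each coordinate process $\tilde Z_j^*$ is the first coordinate process of a $(J-j+1)$-dimensional SRBM with initial state $\tilde\xi^{(j)}$, drift vector $-G^{(j)}_{[j:J],j}$, covariance matrix $(E^{(j)}\Gamma(E^{(j)})')_{[j:J],[j:J]}$, and reflection matrix $G^{(j)}_{[j:J],[j:J]}$. Here $\tilde\xi^{(j)}$ is the $(J-j+1)$-dimensional vector equal to $\tilde\xi$ for $j=1$ and $\mathbf 0$ for $j>1$.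
   Context: $J\ge1$. $M_{A,B}$ is the submatrix of $M$ with rows in $A$ and columns in $B$; $[\ell:k]=\{\ell,\dots,k\}$; $M_{A,k}=M_{A,\{k\}}$; prime denotes transpose. Scale functions. $\gamma_1,\dots,\gamma_J:(0,1)\to(0,\infty)$ are strictly increasing, $\lim_{r\to0}\gamma_j(r)=0$, $\lim_{r\to0}\gamma_j(r)/\gamma_i(r)=0$ for $i<j$, and, for a fixed $\varepsilon\in(0,1)$, $\lim_{r\to0}\gamma_1(r)^{(2-\varepsilon)/(2+\varepsilon)}\sqrt{\log\log(1/\gamma_1(r))}\,\log\log(1/\gamma_J(r))=0$. Skorokhod map and SRBM. A matrix $R$ is an $\mathcal M$-matrix if $R=sI-B$ with $s>0$, $B\ge0$ entrywise and spectral radius of $B$ less than $s$. For an $\mathcal M$-matrix $R\in\mathbb R^{d\times d}$ and a càdlàg path $x$ in $\mathbb R^d$ with $x(0)\in\mathbb R_+^d$, there is a unique pair $(z,y)=(\Phi(x;R),\Psi(x;R))$ of càdlàg $\mathbb R_+^d$-valued paths with $z=x+Ry$, each $y_j$ nondecreasing with $y_j(0)=0$, and $\int_0^\infty z_j\,dy_j=0$. An SRBM with initial state $x_0$, drift $\theta$, covariance matrix $\Sigma$ and reflection matrix $R$ is $\Phi(X;R)$ with $X(t)=x_0+\theta t+MW(t)$, where $MM'=\Sigma$ and $W$ is a standard Brownian motion independent of $x_0$. SRBM family. $\Gamma$ is a positive definite $J\times J$ matrix with Cholesky decomposition $\Gamma=LL'$, $R$ is a $J\times J$ $\mathcal M$-matrix,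 $W$ is a $J$-dimensional standard Brownian motion; $\Gamma,R,W$ do not depend on $r$. For each $r\in(0,1)$, $\tilde Z^{(r)}(0)$ is an $\mathbb R_+^J$-valued random vector independent of $W$, and $\tilde Z^{(r)}=\Phi(\tilde X^{(r)};R)$ with $\tilde X^{(r)}(t)=\tilde Z^{(r)}(0)+\theta^{(r)}t+LW(t)$. Matrices $E^{(k)},G^{(k)}$. For $k=2,\dots,J$ put $C^{(k)}=R_{[k:J],[1:k-1]}$, $A^{(k)}=R_{[1:k-1],[1:k-1]}$ (invertible), $$E^{(k)}=\begin{bmatrix}I_{k-1}&0\\-C^{(k)}(A^{(k)})^{-1}&I_{J-k+1}\end{bmatrix},\qquad G^{(k)}=E^{(k)}R,$$ and $E^{(1)}=I$, $G^{(1)}=R$; each $G^{(k)}_{[k:J],[k:J]}$ is an $\mathcal M$-matrix. $\Longrightarrow$ denotes weak convergence, for processes in the path space with the topology of uniform convergence on compact time intervals. *)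

theory Defs
  imports
    "HOL-Probability.Probability"
    "Jordan_Normal_Form.Matrix"
    "Jordan_Normal_Form.DL_Submatrix"
    "Jordan_Normal_Form.Gauss_Jordan_Elimination"
    "Jordan_Normal_Form.Spectral_Radius"
begin

(* Vectors and matrices are those of Jordan_Normal_Form, because the dimension J - j + 1 of the
   limiting SRBMs varies with j.  Indices start at 0: row, column or component j of the
   usual 1-based notation is j - 1 here, and the index range [l:k] becomes {l-1..<k}. *)

unbundle no vec_syntax
hide_type (open) Finite_Cartesian_Product.vec
hide_const (open) Finite_Cartesian_Product.vec Finite_Cartesian_Product.mat
  Finite_Cartesian_Product.row Finite_Cartesian_Product.column
  Finite_Cartesian_Product.transpose Determinants.det

definition nonneg_vec :: "nat \<Rightarrow> real vec \<Rightarrow> bool" where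
  "nonneg_vec d v \<longleftrightarrow> v \<in> carrier_vec d \<and> (\<forall>i<d. 0 \<le> v $ i)"

definition M_matrix :: "nat \<Rightarrow> real mat \<Rightarrow> bool" where
  "M_matrix d R \<longleftrightarrow>
     (\<exists>s B. 0 < s \<and> B \<in> carrier_mat d d \<and> (\<forall>i<d. \<forall>j<d. 0 \<le> B $$ (i, j)) \<and>
            spectral_radius (map_mat complex_of_real B) < s \<and>
            R = s \<cdot>\<^sub>m 1\<^sub>m d - B)"

definition positive_definite :: "nat \<Rightarrow> real mat \<Rightarrow> bool" where
  "positive_definite d A \<longleftrightarrow>
     A \<in> carrier_mat d d \<and> transpose_mat A = A \<and>
     (\<forall>v \<in> carrier_vec d. v \<noteq> 0\<^sub>v d \<longrightarrow> 0 < v \<bullet> (A *\<^sub>v v))"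

definition cholesky_factor :: "nat \<Rightarrow> real mat \<Rightarrow> real mat \<Rightarrow> bool" where
  "cholesky_factor d A L \<longleftrightarrow>
     L \<in> carrier_mat d d \<and> upper_triangular (transpose_mat L) \<and>
     (\<forall>i<d. 0 < L $$ (i, i)) \<and> A = L * transpose_mat L"

(* For k = 0 (the 1-based k = 1) the first block row and column are absent. *)
definition E_mat :: "nat \<Rightarrow> real mat \<Rightarrow> nat \<Rightarrow> real mat" where
  "E_mat J R k =
     (if k = 0 then 1\<^sub>m J
      else let A = submatrix R {..<k} {..<k}; C = submatrix R {k..<J} {..<k}
           in four_block_mat (1\<^sub>m k) (0\<^sub>m k (J - k))
                (- (C * the (mat_inverse A))) (1\<^sub>m (J - k)))"

definition G_mat :: "nat \<Rightarrow> real mat \<Rightarrow> nat \<Rightarrow> real mat" where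
  "G_mat J R k = E_mat J R k * R"

definition vec_topology :: "nat \<Rightarrow> real vec topology" where
  "vec_topology d =
     pullback_topology (carrier_vec d) (\<lambda>v. \<lambda>i\<in>{..<d}. v $ i)
       (product_topology (\<lambda>_. euclideanreal) {..<d})"

(* A path is a function on the reals of which only the values at times t >= 0 matter. *)
definition cadlag :: "nat \<Rightarrow> (real \<Rightarrow> real vec) \<Rightarrow> bool" where
  "cadlag d x \<longleftrightarrow>
     (\<forall>t\<ge>0. x t \<in> carrier_vec d \<and> limitin (vec_topology d) x (x t) (at_right t)) \<and>
     (\<forall>t>0. \<exists>l. limitin (vec_topology d) x l (at_left t))"

(* Since eps is existentially quantified, the pointwise strict inequality on {0..T} gives the
   same neighbourhoods as the supremum norm on {0..T}. *)
definition path_topology :: "nat \<Rightarrow> (real \<Rightarrow> real vec) topology" where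
  "path_topology d = topology (\<lambda>U.
     U \<subseteq> Collect (cadlag d) \<and>
     (\<forall>x\<in>U. \<exists>T>0. \<exists>\<epsilon>>0. \<forall>y. cadlag d y \<longrightarrow>
        (\<forall>t\<in>{0..T}. \<forall>i<d. \<bar>y t $ i - x t $ i\<bar> < \<epsilon>) \<longrightarrow> y \<in> U))"

lemma openin_path_topology:
  "openin (path_topology d) U \<longleftrightarrow>
     U \<subseteq> Collect (cadlag d) \<and>
     (\<forall>x\<in>U. \<exists>T>0. \<exists>\<epsilon>>0. \<forall>y. cadlag d y \<longrightarrow>
        (\<forall>t\<in>{0..T}. \<forall>i<d. \<bar>y t $ i - x t $ i\<bar> < \<epsilon>) \<longrightarrow> y \<in> U)"
proof -
  define P where "P = (\<lambda>(U :: (real \<Rightarrow> real vec) set) x. \<exists>T>0. \<exists>\<epsilon>>0. \<forall>y. cadlag d y \<longrightarrow>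
        (\<forall>t\<in>{0..T}. \<forall>i<d. \<bar>y t $ i - x t $ i\<bar> < (\<epsilon>::real)) \<longrightarrow> y \<in> U)"
  have mono: "P V x" if "P U x" "U \<subseteq> V" for U V x
    using that unfolding P_def by blast
  have int: "P (U \<inter> V) x" if U: "P U x" and V: "P V x" for U V x
  proof -
    from U obtain T \<epsilon> where 1: "T > 0" "\<epsilon> > 0" and
      U': "\<And>y. cadlag d y \<Longrightarrow> (\<forall>t\<in>{0..T}. \<forall>i<d. \<bar>y t $ i - x t $ i\<bar> < \<epsilon>) \<Longrightarrow> y \<in> U"
      unfolding P_def by blast
    from V obtain T' \<epsilon>' where 2: "T' > 0" "\<epsilon>' > 0" and
      V': "\<And>y. cadlag d y \<Longrightarrow> (\<forall>t\<in>{0..T'}. \<forall>i<d. \<bar>y t $ i - x t $ i\<bar> < \<epsilon>') \<Longrightarrow> y \<in> V"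
      unfolding P_def by blast
    have "y \<in> U \<inter> V" if c: "cadlag d y"
      and *: "\<forall>t\<in>{0..max T T'}. \<forall>i<d. \<bar>y t $ i - x t $ i\<bar> < min \<epsilon> \<epsilon>'" for y
    proof
      have "\<forall>t\<in>{0..T}. \<forall>i<d. \<bar>y t $ i - x t $ i\<bar> < \<epsilon>"
      proof (intro ballI allI impI)
        fix t i assume "t \<in> {0..T}" "i < d"
        then have "t \<in> {0..max T T'}" by (simp add: le_max_iff_disj)
        with * \<open>i < d\<close> show "\<bar>y t $ i - x t $ i\<bar> < \<epsilon>" by (meson min_less_iff_conj)
      qed
      then show "y \<in> U" by (rule U'[OF c])
      have "\<forall>t\<in>{0..T'}. \<forall>i<d. \<bar>y t $ i - x t $ i\<bar> < \<epsilon>'"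
      proof (intro ballI allI impI)
        fix t i assume "t \<in> {0..T'}" "i < d"
        then have "t \<in> {0..max T T'}" by (simp add: le_max_iff_disj)
        with * \<open>i < d\<close> show "\<bar>y t $ i - x t $ i\<bar> < \<epsilon>'" by (meson min_less_iff_conj)
      qed
      then show "y \<in> V" by (rule V'[OF c])
    qed
    moreover have "max T T' > 0" "min \<epsilon> \<epsilon>' > 0"
      using 1 2 by simp_all
    ultimately show ?thesis
      unfolding P_def by blast
  qed
  have "istopology (\<lambda>U. U \<subseteq> Collect (cadlag d) \<and> (\<forall>x\<in>U. P U x))"
    unfolding istopology_def
  proof (intro conjI allI impI)
    fix U V assume "U \<subseteq> Collect (cadlag d) \<and> (\<forall>x\<in>U. P U x)"
      and "V \<subseteq> Collect (cadlag d) \<and> (\<forall>x\<in>V. P V x)"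
    then show "U \<inter> V \<subseteq> Collect (cadlag d)" "\<forall>x\<in>U \<inter> V. P (U \<inter> V) x"
      using int by blast+
  next
    fix K assume *: "\<forall>U\<in>K. U \<subseteq> Collect (cadlag d) \<and> (\<forall>x\<in>U. P U x)"
    then show "\<Union>K \<subseteq> Collect (cadlag d)" by blast
    show "\<forall>x\<in>\<Union>K. P (\<Union>K) x"
    proof
      fix x assume "x \<in> \<Union>K"
      then obtain U where "U \<in> K" "x \<in> U" by blast
      with * mono[of U x "\<Union>K"] show "P (\<Union>K) x" by blast
    qed
  qed
  then show ?thesis
    unfolding path_topology_def P_def by (simp add: topology_inverse')
qed

lemma topspace_path_topology: "topspace (path_topology d) = Collect (cadlag d)"
proof
  show "topspace (path_topology d) \<subseteq> Collect (cadlag d)"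
    using openin_topspace[of "path_topology d"] unfolding openin_path_topology by (rule conjunct1)
  have "\<exists>T>0. \<exists>\<epsilon>>0. \<forall>y. cadlag d y \<longrightarrow>
      (\<forall>t\<in>{0..T}. \<forall>i<d. \<bar>y t $ i - x t $ i\<bar> < \<epsilon>) \<longrightarrow> y \<in> Collect (cadlag d)" for x
    by (intro exI[of _ "1::real"] conjI allI impI) simp_all
  then have "openin (path_topology d) (Collect (cadlag d))"
    unfolding openin_path_topology by (intro conjI subset_refl ballI) blast
  then show "Collect (cadlag d) \<subseteq> topspace (path_topology d)"
    by (rule openin_subset)
qed

definition borel_of :: "'b topology \<Rightarrow> 'b measure" where
  "borel_of T = sigma (topspace T) {U. openin T U}"

abbreviation vec_borel :: "nat \<Rightarrow> real vec measure" where
  "vec_borel d \<equiv> borel_of (vec_topology d)"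

(* For T = path_topology d the space is not separable, but the random elements of interest have
   continuous paths, i.e. values in a separable subspace, and so are Borel measurable. *)
definition converges_weakly ::
  "'b topology \<Rightarrow> 'r filter \<Rightarrow> 'a measure \<Rightarrow> ('r \<Rightarrow> 'a \<Rightarrow> 'b) \<Rightarrow> 'c measure \<Rightarrow> ('c \<Rightarrow> 'b) \<Rightarrow> bool"
where
  "converges_weakly T F M X N Y \<longleftrightarrow>
     (\<forall>\<^sub>F r in F. X r \<in> M \<rightarrow>\<^sub>M borel_of T) \<and> Y \<in> N \<rightarrow>\<^sub>M borel_of T \<and>
     (\<forall>f. continuous_map T euclideanreal f \<and> bounded (f ` topspace T) \<longrightarrow>
        ((\<lambda>r. \<integral>\<omega>. f (X r \<omega>) \<partial>M) \<longlongrightarrow> (\<integral>\<omega>. f (Y \<omega>) \<partial>N)) F)"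

(* The library's indep_var requires both random elements to have values in the same type. *)
definition indep_elements ::
  "'a measure \<Rightarrow> 'b measure \<Rightarrow> ('a \<Rightarrow> 'b) \<Rightarrow> 'c measure \<Rightarrow> ('a \<Rightarrow> 'c) \<Rightarrow> bool" where
  "indep_elements M S X T Y \<longleftrightarrow>
     X \<in> M \<rightarrow>\<^sub>M S \<and> Y \<in> M \<rightarrow>\<^sub>M T \<and>
     prob_space.indep_set M
       {X -` A \<inter> space M | A. A \<in> sets S} {Y -` B \<inter> space M | B. B \<in> sets T}"

definition std_brownian_motion ::
  "'a measure \<Rightarrow> nat \<Rightarrow> ('a \<Rightarrow> real \<Rightarrow> real vec) \<Rightarrow> bool" where
  "std_brownian_motion M d W \<longleftrightarrow>
     prob_space M \<and>
     (\<forall>t\<ge>0. (\<lambda>\<omega>. W \<omega> t) \<in> M \<rightarrow>\<^sub>M vec_borel d) \<and>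
     (\<forall>\<omega>\<in>space M. W \<omega> 0 = 0\<^sub>v d \<and>
        continuous_map (top_of_set {0..}) (vec_topology d) (W \<omega>)) \<and>
     (\<forall>s t. 0 \<le> s \<and> s < t \<longrightarrow>
        indep_elements M
          (\<Pi>\<^sub>M u\<in>{0..s}. vec_borel d) (\<lambda>\<omega>. \<lambda>u\<in>{0..s}. W \<omega> u)
          (vec_borel d) (\<lambda>\<omega>. W \<omega> t - W \<omega> s) \<and>
        prob_space.indep_vars M (\<lambda>_. borel) (\<lambda>i \<omega>. (W \<omega> t - W \<omega> s) $ i) {..<d} \<and>
        (\<forall>i<d. distributed M lborel (\<lambda>\<omega>. (W \<omega> t - W \<omega> s) $ i)
                 (normal_density 0 (sqrt (t - s)))))"

(* The graph of the Skorokhod map x \<mapsto> (z, y). The Lebesgue-Stieltjes measure dy_j is taken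
   for y_j extended constantly to negative times, so it has no mass on {..0} (y_j(0) = 0). *)
definition skorokhod ::
  "nat \<Rightarrow> real mat \<Rightarrow> (real \<Rightarrow> real vec) \<Rightarrow> (real \<Rightarrow> real vec) \<Rightarrow> (real \<Rightarrow> real vec) \<Rightarrow> bool"
where
  "skorokhod d R x z y \<longleftrightarrow>
     cadlag d x \<and> nonneg_vec d (x 0) \<and> cadlag d z \<and> cadlag d y \<and>
     (\<forall>t\<ge>0. nonneg_vec d (z t) \<and> nonneg_vec d (y t) \<and> z t = x t + R *\<^sub>v y t) \<and>
     (\<forall>j<d. mono_on {0..} (\<lambda>t. y t $ j) \<and> y 0 $ j = 0 \<and>
        (\<integral>\<^sup>+ t\<in>{0..}. ennreal (z t $ j) \<partial>interval_measure (\<lambda>t. y (max 0 t) $ j)) = 0)"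

(* Z = Phi(X;R) with X(t) = x0 + theta t + A W(t), on t >= 0. *)
definition srbm_driven_by ::
  "'a measure \<Rightarrow> nat \<Rightarrow> real mat \<Rightarrow> ('a \<Rightarrow> real \<Rightarrow> real vec) \<Rightarrow>
   ('a \<Rightarrow> real vec) \<Rightarrow> real vec \<Rightarrow> real mat \<Rightarrow> ('a \<Rightarrow> real \<Rightarrow> real vec) \<Rightarrow> bool"
where
  "srbm_driven_by M d A W x0 \<theta> R Z \<longleftrightarrow>
     std_brownian_motion M d W \<and> A \<in> carrier_mat d d \<and> \<theta> \<in> carrier_vec d \<and> M_matrix d R \<and>
     x0 \<in> M \<rightarrow>\<^sub>M vec_borel d \<and> (\<forall>\<omega>\<in>space M. nonneg_vec d (x0 \<omega>)) \<and>
     indep_elements M (vec_borel d) x0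
       (\<Pi>\<^sub>M t\<in>{0..}. vec_borel d) (\<lambda>\<omega>. \<lambda>t\<in>{0..}. W \<omega> t) \<and>
     (\<forall>\<omega>\<in>space M. \<exists>y. skorokhod d R (\<lambda>t. x0 \<omega> + t \<cdot>\<^sub>v \<theta> + A *\<^sub>v W \<omega> t) (Z \<omega>) y)"

definition srbm ::
  "'a measure \<Rightarrow> nat \<Rightarrow> ('a \<Rightarrow> real vec) \<Rightarrow> real vec \<Rightarrow> real mat \<Rightarrow> real mat \<Rightarrow>
   ('a \<Rightarrow> real \<Rightarrow> real vec) \<Rightarrow> bool"
where
  "srbm M d x0 \<theta> \<Sigma> R Z \<longleftrightarrow>
     (\<exists>A W. A * transpose_mat A = \<Sigma> \<and> srbm_driven_by M d A W x0 \<theta> R Z)"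

definition scale_functions :: "nat \<Rightarrow> real \<Rightarrow> (nat \<Rightarrow> real \<Rightarrow> real) \<Rightarrow> bool" where
  "scale_functions J \<epsilon> \<gamma> \<longleftrightarrow>
     (\<forall>j<J. (\<forall>r\<in>{0<..<1}. 0 < \<gamma> j r) \<and> strict_mono_on {0<..<1} (\<gamma> j) \<and>
            (\<gamma> j \<longlongrightarrow> 0) (at_right 0)) \<and>
     (\<forall>i j. i < j \<and> j < J \<longrightarrow> ((\<lambda>r. \<gamma> j r / \<gamma> i r) \<longlongrightarrow> 0) (at_right 0)) \<and>
     ((\<lambda>r. \<gamma> 0 r powr ((2 - \<epsilon>) / (2 + \<epsilon>)) * sqrt (ln (ln (1 / \<gamma> 0 r)))
            * ln (ln (1 / \<gamma> (J - 1) r))) \<longlongrightarrow> 0) (at_right 0)"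

(* The initial state of the SRBM for j = 0 is a copy on N of xi, which lives on P. *)
definition limit_process ::
  "nat \<Rightarrow> real mat \<Rightarrow> real mat \<Rightarrow> 'c measure \<Rightarrow> ('c \<Rightarrow> real vec) \<Rightarrow>
   'b measure \<Rightarrow> ('b \<Rightarrow> real \<Rightarrow> real vec) \<Rightarrow> bool"
where
  "limit_process J \<Gamma> R P \<xi> N Zstar \<longleftrightarrow>
     prob_space N \<and>
     (\<forall>\<omega>\<in>space N. \<forall>t\<ge>0. Zstar \<omega> t \<in> carrier_vec J) \<and>
     prob_space.indep_vars N (\<lambda>_. \<Pi>\<^sub>M t\<in>{0..}. borel)
       (\<lambda>j \<omega>. \<lambda>t\<in>{0..}. Zstar \<omega> t $ j) {..<J} \<and>
     (\<forall>j<J. \<exists>\<xi>j Zj.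
        srbm N (J - j) \<xi>j
          (- col (submatrix (G_mat J R j) {j..<J} {j}) 0)
          (submatrix (E_mat J R j * \<Gamma> * transpose_mat (E_mat J R j)) {j..<J} {j..<J})
          (submatrix (G_mat J R j) {j..<J} {j..<J}) Zj \<and>
        (if j = 0 then distr N (vec_borel J) \<xi>j = distr P (vec_borel J) \<xi>
         else \<forall>\<omega>\<in>space N. \<xi>j \<omega> = 0\<^sub>v (J - j)) \<and>
        (\<forall>\<omega>\<in>space N. \<forall>t\<ge>0. Zstar \<omega> t $ j = Zj \<omega> t $ 0))"

end

theory Submission
 imports Defs
begin

text \<open>The argument is a pathwise coupling. Brownian motions \<open>W_1, ..., W_J\<close>, independent of each other and
of the initial states, are spliced over consecutive windows of time into one Brownian motion whose rescaling at
scale \<open>\<gamma>_j\<close> is close to \<open>W_j\<close>; this works because the scales separate. The Skorokhod map is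
continuous, and on the scale \<open>\<gamma>_j\<close> the drift of a coordinate \<open>i < j\<close> explodes downwards, so a Lyapunov
function of the form \<open>max v_i / w_i\<close> shows that the coordinate vanishes in the limit. Eliminating these
coordinates gives \<open>G^(j)\<close> and \<open>E^(j)\<close>. The excess drift of the coordinates \<open>i > j\<close> tends to zero, as
does the rescaled initial state when \<open>j > 1\<close>. Only the block with \<open>j = 1\<close> sees the random initial
state, and continuity of the Skorokhod map in it passes from \<open>\<xi>\<close> to the limit.\<close>

text \<open>All prelimit processes share one Brownian motion, and the limit lives on another space,
  so pathwise convergence of the given processes is not to be expected; only their laws can be used.
  The law of a continuous process is encoded by its finite-dimensional characteristic functions.
  Sampling a path on a grid and interpolating linearly shows that these determine the expectation of
  every bounded functional that is continuous for locally uniform convergence. Hence any process may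
  be replaced by a coupled copy, and no tightness argument in the nonseparable path space is made.
  The initial states converge in law only and are not coupled: they are frozen at vectors
  \<open>v_n\<close> tending to \<open>v\<close>, the Brownian part is averaged out, and the
  averages converge for every such sequence. A window of length
  \<open>1 / (\<gamma>_j \<gamma>_(j+1))\<close> is the geometric mean of the two neighbouring time
  scales, hence long on the one and short on the other. M-matrices enter through a positive vector
  \<open>w\<close> with \<open>R w \<ge> 1\<close>; a single \<open>w\<close> serves the Lipschitz
  bound of the reflection map, the Lyapunov function and every elimination step.\<close>

section \<open>Characteristic functions determine laws on countable products\<close>

text \<open>With \<open>c\<close> the common mass of \<open>U\<close>, the image under
  \<open>X\<close> of the probability measure with density \<open>U / c\<close> has as
  characteristic function the integral in \<open>eq\<close> divided by \<open>c\<close>, so Levy's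
  uniqueness theorem applies. If \<open>c = 0\<close>, the weight vanishes almost
  everywhere.\<close>

lemma nonneg_weight_char_unique:
 fixes U X :: "'a \<Rightarrow> real"
 assumes M: "prob_space M" "prob_space M'" and s: "sets M' = sets M"
  and X: "X \<in> borel_measurable M" and U: "U \<in> borel_measurable M" "\<And>w. 0 \<le> U w \<and> U w \<le> b"
  and eq: "\<And>t. (\<integral>w. U w * iexp (t * X w) \<partial>M) = (\<integral>w. U w * iexp (t * X w) \<partial>M')"
  and A: "A \<in> sets borel"
 shows "(\<integral>w. U w * indicator A (X w) \<partial>M) = (\<integral>w. U w * indicator A (X w) \<partial>M')"
proof -
 define c where "c = (\<integral>w. U w \<partial>M)"
 have "complex_of_real c = complex_of_real (\<integral>w. U w \<partial>M')" using eq[of 0] unfolding c_def by simp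
 then have c': "(\<integral>w. U w \<partial>M') = c" by (simp only: of_real_eq_iff)
 have "c \<ge> 0" unfolding c_def by (rule integral_nonneg_AE) (use U in auto)
 have N: "prob_space N" "X \<in> borel_measurable N" "U \<in> borel_measurable N" "(\<integral>w. U w \<partial>N) = c" if "N \<in> {M, M'}" for N
  using that M X U c' by (auto simp: c_def measurable_cong_sets[OF s refl])
 have int: "integrable N U" if "N \<in> {M, M'}" for N
 proof -
  interpret prob_space N by (rule N(1)[OF that])
  show ?thesis by (rule integrable_const_bound[of _ b]) (use U N[OF that] in auto)
 qed
 show ?thesis
 proof (cases "c = 0")
  case True
  have "(\<integral>w. U w * indicator A (X w) \<partial>N) = 0" if "N \<in> {M, M'}" for N
  proof -
   have "AE w in N. U w = 0" using integral_nonneg_eq_0_iff_AE[OF int[OF that]] N(4)[OF that] U True by auto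
   then show ?thesis by (intro integral_eq_zero_AE) auto
  qed
  from this[of M] this[of M'] show ?thesis by simp
 next
  case False
  with \<open>c \<ge> 0\<close> have c: "c > 0" by simp
  define D where "D N = distr (density N (\<lambda>w. ennreal (U w / c))) borel X" for N
  have rd: "real_distribution (D N)" if n: "N \<in> {M, M'}" for N
  proof -
   note [measurable] = N(2,3)[OF n]
   have "emeasure (density N (\<lambda>w. ennreal (U w / c))) (space N) = (\<integral>\<^sup>+w. ennreal (U w / c) \<partial>N)"
    by (subst emeasure_density) (auto intro!: nn_integral_cong)
   also have "\<dots> = ennreal (\<integral>w. U w / c \<partial>N)" by (rule nn_integral_eq_integral) (use int[OF n] U c in auto)
   also have "\<dots> = 1" using c N(4)[OF n] by simp
   finally have "prob_space (density N (\<lambda>w. ennreal (U w / c)))" by (intro prob_spaceI) simp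
   then show ?thesis unfolding D_def by (intro prob_space.real_distribution_distr) simp_all
  qed
  have I: "(\<integral>x. g x \<partial>D N) = (\<integral>w. (U w / c) *\<^sub>R g (X w) \<partial>N)"
   if [measurable]: "g \<in> borel_measurable borel" and n: "N \<in> {M, M'}" for N and g :: "real \<Rightarrow> 'z::{banach,second_countable_topology}"
  proof -
   note [measurable] = N(2,3)[OF n]
   show ?thesis unfolding D_def by (subst integral_distr, simp, simp, subst integral_density) (use U c in auto)
  qed
  have ch: "char (D N) t = (1/c) *\<^sub>R (\<integral>w. U w * iexp (t * X w) \<partial>N)" if n: "N \<in> {M, M'}" for N t
   unfolding char_def by (subst I[OF _ n], simp, subst integral_scaleR_right[symmetric]) (auto simp: scaleR_conv_of_real)
  have mem: "M \<in> {M, M'}" "M' \<in> {M, M'}" by simp_all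
  have "char (D M) = char (D M')" by (rule ext) (simp only: ch[OF mem(1)] ch[OF mem(2)] eq)
  then have D: "D M = D M'" by (intro Levy_uniqueness rd mem)
  note i = I[OF borel_measurable_indicator[OF A]]
  have "(\<integral>w. (U w / c) *\<^sub>R indicat_real A (X w) \<partial>M) = (\<integral>w. (U w / c) *\<^sub>R indicat_real A (X w) \<partial>M')"
   unfolding i[OF mem(1), symmetric] i[OF mem(2), symmetric] D ..
  then show ?thesis using c by simp
 qed
qed

text \<open>The real and imaginary parts of \<open>U\<close> have modulus at most \<open>b\<close>,
  so adding \<open>b\<close> turns them into nonnegative weights; hypothesis \<open>ch\<close> takes
  care of the added constant.\<close>

lemma complex_weight_char_unique:
 fixes X :: "'a \<Rightarrow> real" and U :: "'a \<Rightarrow> complex"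
 assumes M: "prob_space M" "prob_space M'" and s: "sets M' = sets M"
  and X: "X \<in> borel_measurable M" and U: "U \<in> borel_measurable M" "\<And>w. norm (U w) \<le> b"
  and ch: "\<And>t. (\<integral>w. iexp (t * X w) \<partial>M) = (\<integral>w. iexp (t * X w) \<partial>M')"
  and eq: "\<And>t. (\<integral>w. U w * iexp (t * X w) \<partial>M) = (\<integral>w. U w * iexp (t * X w) \<partial>M')"
  and A: "A \<in> sets borel"
 shows "(\<integral>w. U w * indicator A (X w) \<partial>M) = (\<integral>w. U w * indicator A (X w) \<partial>M')"
proof -
 have N: "prob_space N" "X \<in> borel_measurable N" "U \<in> borel_measurable N"
  "V \<in> borel_measurable M \<Longrightarrow> V \<in> borel_measurable N" if "N \<in> {M, M'}" for N and V :: "'a \<Rightarrow> real"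
  using that M X U by (auto simp: measurable_cong_sets[OF s refl])
 have int: "integrable N f" if "N \<in> {M, M'}" "f \<in> borel_measurable N" "\<And>w. norm (f w) \<le> k"
  for N k and f :: "'a \<Rightarrow> 'z::{banach,second_countable_topology}"
  by (rule finite_measure.integrable_const_bound[of _ _ k])
    (use N(1)[OF that(1)] that in \<open>auto simp: prob_space_def\<close>)
 have V: "(\<integral>w. V w * indicator A (X w) \<partial>M) = (\<integral>w. V w * indicator A (X w) \<partial>M')"
  if Vm: "V \<in> borel_measurable M" and Vb: "\<And>w. \<bar>V w\<bar> \<le> b"
   and Ve: "\<And>t. (\<integral>w. V w * iexp (t * X w) \<partial>M) = (\<integral>w. V w * iexp (t * X w) \<partial>M')" for V :: "'a \<Rightarrow> real"
 proof -
  have sum: "(\<integral>w. complex_of_real (V w + b) * iexp (t * X w) \<partial>N) =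
    (\<integral>w. V w * iexp (t * X w) \<partial>N) + b * (\<integral>w. iexp (t * X w) \<partial>N)"
   and ind: "(\<integral>w. (V w + b) * indicat_real A (X w) \<partial>N) =
    (\<integral>w. V w * indicator A (X w) \<partial>N) + b * (\<integral>w. 1 * indicator A (X w) \<partial>N)" if n: "N \<in> {M, M'}" for N t
  proof -
   note [measurable] = N(2)[OF n] N(4)[OF n Vm] A
   have "integrable N (\<lambda>w. V w * iexp (t * X w))" "integrable N (\<lambda>w. iexp (t * X w))"
    by (rule int[OF n, of _ b] int[OF n, of _ 1]; (use Vb in \<open>auto simp: norm_mult\<close>))+
   then show "(\<integral>w. complex_of_real (V w + b) * iexp (t * X w) \<partial>N) =
     (\<integral>w. V w * iexp (t * X w) \<partial>N) + b * (\<integral>w. iexp (t * X w) \<partial>N)" by (simp add: distrib_right)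
   have "\<bar>V w * indicat_real A (X w)\<bar> \<le> b" for w using Vb[of w] by (auto simp: indicator_def)
   then have "integrable N (\<lambda>w. V w * indicat_real A (X w))" "integrable N (\<lambda>w. indicat_real A (X w))"
    by (intro int[OF n, of _ b] int[OF n, of _ 1]; auto simp: indicator_def)+
   then show "(\<integral>w. (V w + b) * indicat_real A (X w) \<partial>N) =
    (\<integral>w. V w * indicator A (X w) \<partial>N) + b * (\<integral>w. 1 * indicator A (X w) \<partial>N)" by (simp add: distrib_right)
  qed
  have "0 \<le> V w + b \<and> V w + b \<le> 2 * b" for w using Vb[of w] by linarith
  then have "(\<integral>w. (V w + b) * indicator A (X w) \<partial>M) = (\<integral>w. (V w + b) * indicator A (X w) \<partial>M')"
   by (rule nonneg_weight_char_unique[OF M s X _ _ _ A, rotated]) (use Vm sum Ve ch in auto)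
  moreover have "(\<integral>w. 1 * indicator A (X w) \<partial>M) = (\<integral>w. 1 * indicat_real A (X w) \<partial>M')"
   by (rule nonneg_weight_char_unique[OF M s X _ _ _ A, of _ 1]) (use ch in auto)
  ultimately show ?thesis using ind by simp
 qed
 define F where "F t w = U w * iexp (t * X w)" for t w
 \<comment> \<open>Conjugation reverses the sign of the frequency, so the transforms of
   \<open>Re U\<close> and \<open>Im U\<close> are combinations of the transform of \<open>U\<close>
   at \<open>t\<close> and the conjugate of the one at \<open>- t\<close>.\<close>
 have part: "(\<integral>w. complex_of_real (Re (U w)) * iexp (t * X w) \<partial>N) = ((\<integral>w. F t w \<partial>N) + cnj (\<integral>w. F (- t) w \<partial>N)) / 2"
  "(\<integral>w. complex_of_real (Im (U w)) * iexp (t * X w) \<partial>N) = ((\<integral>w. F t w \<partial>N) - cnj (\<integral>w. F (- t) w \<partial>N)) / (2 * \<i>)"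
  if n: "N \<in> {M, M'}" for N t
 proof -
  note [measurable] = N(2,3)[OF n]
  have i: "integrable N (F t)" for t unfolding F_def by (rule int[OF n, of _ b]) (use U in \<open>auto simp: norm_mult\<close>)
  have "complex_of_real (Re (U w)) * iexp (t * X w) = (F t w + cnj (F (- t) w)) / 2"
   "complex_of_real (Im (U w)) * iexp (t * X w) = (F t w - cnj (F (- t) w)) / (2 * \<i>)" for w
   by (simp_all add: F_def complex_eq_iff Re_exp Im_exp Re_divide Im_divide power2_eq_square)
  then show "(\<integral>w. complex_of_real (Re (U w)) * iexp (t * X w) \<partial>N) = ((\<integral>w. F t w \<partial>N) + cnj (\<integral>w. F (- t) w \<partial>N)) / 2"
   "(\<integral>w. complex_of_real (Im (U w)) * iexp (t * X w) \<partial>N) = ((\<integral>w. F t w \<partial>N) - cnj (\<integral>w. F (- t) w \<partial>N)) / (2 * \<i>)"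
   using i[of t] i[of "- t"] by (simp_all only: integral_divide_zero Bochner_Integration.integral_add
    Bochner_Integration.integral_diff integrable_cnj Bochner_Integration.integral_cnj)
 qed
 have mem: "M \<in> {M, M'}" "M' \<in> {M, M'}" by simp_all
 have UA: "(\<integral>w. U w * indicator A (X w) \<partial>N) = complex_of_real (\<integral>w. Re (U w) * indicator A (X w) \<partial>N) +
   \<i> * complex_of_real (\<integral>w. Im (U w) * indicator A (X w) \<partial>N)" if n: "N \<in> {M, M'}" for N
 proof -
  note [measurable] = N(2,3)[OF n] A
  have "norm (U w * indicator A (X w)) \<le> b" for w
   using U(2)[of w] order_trans[OF norm_ge_zero U(2)[of w]] by (auto simp: indicator_def)
  then have i: "integrable N (\<lambda>w. U w * indicator A (X w))" by (intro int[OF n]) auto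
  have "Re (U w * indicator A (X w)) = Re (U w) * indicator A (X w)"
   "Im (U w * indicator A (X w)) = Im (U w) * indicator A (X w)" for w by (simp_all add: indicator_def)
  then show ?thesis using integral_Re[OF i] integral_Im[OF i] by (simp only: complex_eq)
 qed
 have "(\<integral>w. Re (U w) * indicator A (X w) \<partial>M) = (\<integral>w. Re (U w) * indicator A (X w) \<partial>M')"
  by (rule V, use U in measurable, rule order_trans[OF abs_Re_le_cmod U(2)],
    (simp only: part[OF mem(1)] part[OF mem(2)] eq F_def)?)
 moreover have "(\<integral>w. Im (U w) * indicator A (X w) \<partial>M) = (\<integral>w. Im (U w) * indicator A (X w) \<partial>M')"
  by (rule V, use U in measurable, rule order_trans[OF abs_Im_le_cmod U(2)],
    (simp only: part[OF mem(1)] part[OF mem(2)] eq F_def)?)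
 ultimately show ?thesis by (simp add: UA)
qed

text \<open>Induction peels off one coordinate and moves its indicator into the weight. The
  exponentials of the remaining coordinates then belong to the weight of a one-dimensional problem,
  which is why that problem has to be solved for complex weights.\<close>

lemma char_unique_rectangle:
 fixes X :: "'i \<Rightarrow> 'a \<Rightarrow> real" and U :: "'a \<Rightarrow> complex"
 assumes M: "prob_space M" "prob_space M'" and s: "sets M' = sets M" and "finite K"
  and "\<And>k. k \<in> K \<Longrightarrow> X k \<in> borel_measurable M" and "\<And>k. k \<in> K \<Longrightarrow> A k \<in> sets borel"
  and "\<And>a. (\<integral>w. iexp (\<Sum>k\<in>K. a k * X k w) \<partial>M) = (\<integral>w. iexp (\<Sum>k\<in>K. a k * X k w) \<partial>M')"
  and "U \<in> borel_measurable M" "\<And>w. norm (U w) \<le> b"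
  and "\<And>a. (\<integral>w. U w * iexp (\<Sum>k\<in>K. a k * X k w) \<partial>M) = (\<integral>w. U w * iexp (\<Sum>k\<in>K. a k * X k w) \<partial>M')"
 shows "(\<integral>w. U w * (\<Prod>k\<in>K. indicator (A k) (X k w)) \<partial>M) = (\<integral>w. U w * (\<Prod>k\<in>K. indicator (A k) (X k w)) \<partial>M')"
 using assms(4-)
proof (induction K arbitrary: U rule: finite_induct)
 case empty
 then show ?case by simp
next
 case (insert k K)
 have [measurable]: "\<And>j. j \<in> K \<Longrightarrow> X j \<in> borel_measurable M" "X k \<in> borel_measurable M" "A k \<in> sets borel" "U \<in> borel_measurable M"
  using insert.prems by auto
 \<comment> \<open>Overwriting the coefficient of \<open>k\<close> by \<open>t\<close> serves twice:
   for general \<open>t\<close> it gives the transform in the peeled coordinate, and for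
   \<open>t = 0\<close> the transform over \<open>K\<close> alone.\<close>
 have e: "(\<Sum>j\<in>insert k K. (a(k := t)) j * X j w) = (\<Sum>j\<in>K. a j * X j w) + t * X k w" for a t w
 proof -
  have "(\<Sum>j\<in>K. (a(k := t)) j * X j w) = (\<Sum>j\<in>K. a j * X j w)" by (rule sum.cong) (use insert.hyps in auto)
  then show ?thesis using insert.hyps by simp
 qed
 have b: "norm (U w * indicator (A k) (X k w)) \<le> b" for w
  using insert.prems(5)[of w] order_trans[OF norm_ge_zero insert.prems(5)[of w]] by (auto simp: indicator_def)
 have e1: "(\<integral>w. (U w * indicator (A k) (X k w)) * iexp (\<Sum>j\<in>K. a j * X j w) \<partial>M) =
   (\<integral>w. (U w * indicator (A k) (X k w)) * iexp (\<Sum>j\<in>K. a j * X j w) \<partial>M')" for a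
 proof -
  define V where "V w = U w * iexp (\<Sum>j\<in>K. a j * X j w)" for w
  have "(\<integral>w. V w * indicator (A k) (X k w) \<partial>M) = (\<integral>w. V w * indicator (A k) (X k w) \<partial>M')"
  proof (rule complex_weight_char_unique[OF M s])
   show "V \<in> borel_measurable M" unfolding V_def by measurable
   show "norm (V w) \<le> b" for w using insert.prems(5) by (simp add: V_def norm_mult)
   show "(\<integral>w. iexp (t * X k w) \<partial>M) = (\<integral>w. iexp (t * X k w) \<partial>M')" for t
    using insert.prems(3)[of "(\<lambda>_. 0)(k := t)"] unfolding e by simp
   show "(\<integral>w. V w * iexp (t * X k w) \<partial>M) = (\<integral>w. V w * iexp (t * X k w) \<partial>M')" for t
    using insert.prems(6)[of "a(k := t)"] unfolding e V_def of_real_add distrib_left exp_add mult.assoc .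
  qed measurable
  then show ?thesis unfolding V_def by (simp only: ac_simps)
 qed
 have e2: "(\<integral>w. iexp (\<Sum>j\<in>K. a j * X j w) \<partial>M) = (\<integral>w. iexp (\<Sum>j\<in>K. a j * X j w) \<partial>M')" for a
  using insert.prems(3)[of "a(k := 0)"] unfolding e by simp
 have "(\<integral>w. (U w * indicator (A k) (X k w)) * (\<Prod>j\<in>K. indicator (A j) (X j w)) \<partial>M) =
   (\<integral>w. (U w * indicator (A k) (X k w)) * (\<Prod>j\<in>K. indicator (A j) (X j w)) \<partial>M')"
  by (rule insert.IH[OF _ _ e2 _ b e1]) (use insert.prems(2) in \<open>auto intro!: borel_measurable_indicator\<close>)
 then show ?case using insert.hyps by (simp add: mult.assoc)
qed

text \<open>For a countable index type the Borel sets of the function space form the product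
  sigma-algebra, so it suffices to compare the image measures on cylinders over finite
  rectangles.\<close>

lemma char_determines_distr:
 fixes V :: "'a \<Rightarrow> ('i::countable \<Rightarrow> real)" and V' :: "'b \<Rightarrow> ('i \<Rightarrow> real)"
 assumes M: "prob_space M" and M': "prob_space M'"
  and V: "V \<in> borel_measurable M" and V': "V' \<in> borel_measurable M'"
  and eq: "\<And>K a. finite K \<Longrightarrow> (\<integral>w. iexp (\<Sum>k\<in>K. a k * V w k) \<partial>M) = (\<integral>w. iexp (\<Sum>k\<in>K. a k * V' w k) \<partial>M')"
 shows "distr M borel V = distr M' borel V'"
proof -
 let ?P = "Pi\<^sub>M UNIV (\<lambda>i::'i. borel::real measure)"
 have s: "sets ?P = sets borel" by (rule sets_PiM_equal_borel)
 have mV: "V \<in> measurable M ?P" "V' \<in> measurable M' ?P" using V V' by (simp_all add: measurable_cong_sets[OF refl s])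
 define D where "D = distr M ?P V"
 define D' where "D' = distr M' ?P V'"
 have D: "prob_space D" "prob_space D'" unfolding D_def D'_def
  by (rule prob_space.prob_space_distr[OF M mV(1)], rule prob_space.prob_space_distr[OF M' mV(2)])
 have c[measurable]: "(\<lambda>v. v k) \<in> borel_measurable ?P" "(\<lambda>v. v k) \<in> borel_measurable D" for k :: 'i
  unfolding D_def using measurable_component_singleton[of k UNIV "\<lambda>i::'i. borel::real measure"] by simp_all
 have ch: "(\<integral>v. iexp (\<Sum>k\<in>K. a k * v k) \<partial>D) = (\<integral>v. iexp (\<Sum>k\<in>K. a k * v k) \<partial>D')" if "finite K" for K a
  unfolding D_def D'_def by (subst (1 2) integral_distr) (use mV eq[OF that] in auto)
 have "D = D'"
 proof (rule measure_eqI_PiM_infinite)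
  show "sets D = sets ?P" "sets D' = sets ?P" by (simp_all add: D_def D'_def)
  show "finite_measure D" using D(1) by (simp add: prob_space_def)
  fix A and K :: "'i set" assume K: "finite K" "K \<subseteq> UNIV" "\<And>i. i \<in> K \<Longrightarrow> A i \<in> sets (borel::real measure)"
  let ?E = "prod_emb UNIV (\<lambda>i. borel) K (Pi\<^sub>E K A)"
  have E: "?E \<in> sets ?P" by (rule sets_PiM_I) (use K in auto)
  have e: "indicator ?E v = (\<Prod>k\<in>K. indicator (A k) (v k) :: complex)" for v
   using K(1) by (auto simp: prod_emb_def PiE_def Pi_def indicator_def prod_eq_1_iff intro!: prod_zero[symmetric])
  have "(\<integral>v. 1 * (\<Prod>k\<in>K. indicator (A k) (v k) :: complex) \<partial>D) = (\<integral>v. 1 * (\<Prod>k\<in>K. indicator (A k) (v k)) \<partial>D')"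
   by (rule char_unique_rectangle[OF D, of K "\<lambda>k v. v k" A _ 1]) (use K ch in \<open>auto simp: D_def D'_def\<close>)
  moreover have "(\<integral>v. 1 * (\<Prod>k\<in>K. indicator (A k) (v k) :: complex) \<partial>N) = complex_of_real (measure N ?E)"
   if N: "sets N = sets ?P" for N
  proof -
   have "1 * (\<Prod>k\<in>K. indicator (A k) (v k) :: complex) = complex_of_real (indicat_real ?E v)" for v
    unfolding e[symmetric] by (simp add: indicator_def)
   moreover have "?E \<inter> space N = ?E" using sets.sets_into_space[of ?E N] E N by blast
   ultimately show ?thesis by simp
  qed
  from this[of D] this[of D'] have "(\<integral>v. 1 * (\<Prod>k\<in>K. indicator (A k) (v k) :: complex) \<partial>D) = complex_of_real (measure D ?E)"
   "(\<integral>v. 1 * (\<Prod>k\<in>K. indicator (A k) (v k) :: complex) \<partial>D') = complex_of_real (measure D' ?E)" by (simp_all add: D_def D'_def)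
  ultimately have "measure D ?E = measure D' ?E" by (simp only: of_real_eq_iff)
  then show "emeasure D ?E = emeasure D' ?E" using D by (simp add: finite_measure.emeasure_eq_measure prob_space_def)
 qed
 then show ?thesis unfolding D_def D'_def by (metis distr_cong s)
qed

section \<open>Path functionals and finite-dimensional laws\<close>

type_synonym fvec = "nat \<Rightarrow> real"
type_synonym fmat = "nat \<Rightarrow> nat \<Rightarrow> real"
type_synonym rpath = "real \<Rightarrow> nat \<Rightarrow> real"

text \<open>Vectors, matrices and paths are total functions without a dimension of their own; each
  notion takes a dimension \<open>d\<close> and looks only at indices below \<open>d\<close> and
  times \<open>t \<ge> 0\<close>. Carrier conditions disappear, and a block of a matrix is a shift
  of indices.\<close>

definition cpath :: "nat \<Rightarrow> rpath \<Rightarrow> bool" where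
 "cpath d x \<longleftrightarrow> (\<forall>i<d. continuous_on {0..} (\<lambda>t. x t i))"

definition lunif :: "nat \<Rightarrow> (nat \<Rightarrow> real \<Rightarrow> nat \<Rightarrow> real) \<Rightarrow> rpath \<Rightarrow> bool" where
 "lunif d xs x \<longleftrightarrow> (\<forall>T. \<forall>i<d. uniform_limit {0..T} (\<lambda>n t. xs n t i) (\<lambda>t. x t i) sequentially)"

text \<open>Sequential continuity at continuous paths only; the values at other functions are
  unconstrained. Continuous functions on the path topology restrict to such functionals
  (\<open>pcont_path_functional\<close>), and composition with the reflection map preserves the
  property (\<open>pcont_zmap\<close>).\<close>

definition pcont :: "nat \<Rightarrow> (rpath \<Rightarrow> real) \<Rightarrow> bool" where
 "pcont d F \<longleftrightarrow> (\<forall>xs x. (\<forall>n. cpath d (xs n)) \<longrightarrow> cpath d x \<longrightarrow> lunif d xs x \<longrightarrow>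
   (\<lambda>n. F (xs n)) \<longlonglongrightarrow> F x)"

definition cproc :: "'a measure \<Rightarrow> nat \<Rightarrow> ('a \<Rightarrow> real \<Rightarrow> nat \<Rightarrow> real) \<Rightarrow> bool" where
 "cproc M d X \<longleftrightarrow> (\<forall>w\<in>space M. cpath d (X w)) \<and>
   (\<forall>t\<ge>0. \<forall>i<d. (\<lambda>w. X w t i) \<in> borel_measurable M)"

definition fdd_char :: "'a measure \<Rightarrow> nat \<Rightarrow> ('a \<Rightarrow> real \<Rightarrow> nat \<Rightarrow> real) \<Rightarrow>
  nat \<Rightarrow> fvec \<Rightarrow> fmat \<Rightarrow> complex" where
 "fdd_char M d X m \<tau> a = (\<integral>w. iexp (\<Sum>k<m. \<Sum>i<d. a k i * X w (\<tau> k) i) \<partial>M)"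

definition same_fdd :: "nat \<Rightarrow> 'a measure \<Rightarrow> ('a \<Rightarrow> real \<Rightarrow> nat \<Rightarrow> real) \<Rightarrow>
  'b measure \<Rightarrow> ('b \<Rightarrow> real \<Rightarrow> nat \<Rightarrow> real) \<Rightarrow> bool" where
 "same_fdd d M X M' X' \<longleftrightarrow>
   (\<forall>m \<tau> a. (\<forall>k. 0 \<le> \<tau> k) \<longrightarrow> fdd_char M d X m \<tau> a = fdd_char M' d X' m \<tau> a)"

text \<open>Coordinates \<open>i \<ge> d\<close> are filled with zeros, so that the sampled values
  form a random element of one fixed countable product, whatever \<open>d\<close> and
  \<open>m\<close> are.\<close>

definition grid :: "nat \<Rightarrow> nat \<Rightarrow> rpath \<Rightarrow> nat \<times> nat \<Rightarrow> real" where
 "grid m d x = (\<lambda>(k, i). if i < d then x (real k / real m) i else 0)"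

text \<open>Piecewise linear interpolation with mesh \<open>1 / m\<close> on \<open>[0, m]\<close>,
  constant afterwards. Written as a sum of ramps it is visibly continuous both in \<open>t\<close>
  and in the node values \<open>v\<close>.\<close>

definition gridpath :: "nat \<Rightarrow> (nat \<times> nat \<Rightarrow> real) \<Rightarrow> real \<Rightarrow> nat \<Rightarrow> real" where
 "gridpath m v t i = v (0, i) +
   (\<Sum>k<m*m. (v (Suc k, i) - v (k, i)) * max 0 (min 1 (real m * t - real k)))"

abbreviation interp :: "nat \<Rightarrow> nat \<Rightarrow> rpath \<Rightarrow> real \<Rightarrow> nat \<Rightarrow> real" where
 "interp n d x \<equiv> gridpath (Suc n) (grid (Suc n) d x)"

lemma lunifI:
 assumes "\<And>T i. i < d \<Longrightarrow> T > 0 \<Longrightarrow> \<exists>c. c \<longlonglongrightarrow> 0 \<and> (\<forall>\<^sub>F n in sequentially. \<forall>t\<in>{0..T}. \<bar>xs n t i - x t i\<bar> \<le> c n)"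
 shows "lunif d xs x" unfolding lunif_def
proof (intro allI impI)
 fix T i assume i: "i < d"
 obtain c where c: "c \<longlonglongrightarrow> 0" "\<forall>\<^sub>F n in sequentially. \<forall>t\<in>{0..max 1 T}. \<bar>xs n t i - x t i\<bar> \<le> c n"
 proof -
  have "max 1 T > 0" by simp
  from assms[OF i this] that show ?thesis by blast
 qed
 show "uniform_limit {0..T} (\<lambda>n t. xs n t i) (\<lambda>t. x t i) sequentially" unfolding uniform_limit_iff
 proof (intro allI impI)
  fix e :: real assume "e > 0"
  then have "\<forall>\<^sub>F n in sequentially. c n < e" using c(1) by (simp add: order_tendstoD)
  with c(2) show "\<forall>\<^sub>F n in sequentially. \<forall>t\<in>{0..T}. dist (xs n t i) (x t i) < e"
  proof eventually_elim
   case (elim n)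
   show ?case
   proof
    fix t assume "t \<in> {0..T}"
    then have "t \<in> {0..max 1 T}" by auto
    with elim have "\<bar>xs n t i - x t i\<bar> \<le> c n" by blast
    with elim show "dist (xs n t i) (x t i) < e" by (simp add: dist_real_def)
   qed
  qed
 qed
qed

lemma lunifD:
 assumes "lunif d xs x" "e > 0"
 shows "\<forall>\<^sub>F n in sequentially. \<forall>t\<in>{0..T}. \<forall>i<d. \<bar>xs n t i - x t i\<bar> < e"
proof -
 have "\<forall>\<^sub>F n in sequentially. \<forall>i\<in>{..<d}. \<forall>t\<in>{0..T}. dist (xs n t i) (x t i) < e"
  using assms unfolding lunif_def uniform_limit_iff by (intro eventually_ball_finite) auto
 then show ?thesis by eventually_elim (auto simp: dist_real_def)
qed

lemma lunif_tendsto: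
 assumes "lunif d xs x" "0 \<le> t" "i < d"
 shows "(\<lambda>n. xs n t i) \<longlonglongrightarrow> x t i"
proof -
 have "uniform_limit {0..t} (\<lambda>n t. xs n t i) (\<lambda>t. x t i) sequentially"
  using assms unfolding lunif_def by blast
 from tendsto_uniform_limitI[OF this, of t] show ?thesis using assms by simp
qed

lemma lunif_eqI: "(\<And>n t i. 0 \<le> t \<Longrightarrow> i < d \<Longrightarrow> xs n t i = x t i) \<Longrightarrow> lunif d xs x"
 by (rule lunifI) (auto intro!: exI[of _ "\<lambda>_. 0"])

lemma pcont_cong:
 assumes "pcont d F" "cpath d x" "\<And>t i. 0 \<le> t \<Longrightarrow> i < d \<Longrightarrow> x t i = y t i"
 shows "F x = F y"
proof -
 have y: "cpath d y" using assms(2,3) unfolding cpath_def by (metis (no_types, lifting) atLeast_iff continuous_on_cong)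
 have "(\<lambda>n. F x) \<longlonglongrightarrow> F y"
  using assms(1)[unfolded pcont_def, rule_format, of "\<lambda>_. x" y] assms y by (auto intro: lunif_eqI)
 then show ?thesis by (simp add: LIMSEQ_const_iff)
qed

lemma cpath_gridpath: "cpath d (gridpath m v)" unfolding cpath_def gridpath_def by (auto intro!: continuous_intros)

text \<open>At a time in cell \<open>k\<close> the ramps before \<open>k\<close> are complete and
  telescope to \<open>v (k, i) - v (0, i)\<close>, ramp \<open>k\<close> contributes the fraction
  \<open>f\<close>, and later ramps are still zero.\<close>

lemma gridpath_between:
 assumes m: "m > 0" and t: "0 \<le> t" "t < real m"
 shows "\<exists>k f. 0 \<le> f \<and> f \<le> 1 \<and> real m * t = real k + f \<and>
  (\<forall>v i. gridpath m v t i = (1 - f) * v (k, i) + f * v (Suc k, i))"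
proof -
 define k where "k = nat \<lfloor>real m * t\<rfloor>"
 define f where "f = real m * t - real k"
 have mt: "0 \<le> real m * t" using t by simp
 have k: "real k \<le> real m * t" "real m * t < real k + 1" using mt unfolding k_def by (simp_all add: of_nat_nat)
 have "real k < real m * real m" using k(1) t m by (meson le_less_trans mult_strict_left_mono of_nat_0_less_iff)
 then have km: "k < m * m" by (metis of_nat_less_iff of_nat_mult)
 have "gridpath m v t i = (1 - f) * v (k, i) + f * v (Suc k, i)" for v i
 proof -
  let ?g = "\<lambda>l. (v (Suc l, i) - v (l, i)) * max 0 (min 1 (real m * t - real l))"
  have "(\<Sum>l<m*m. ?g l) = (\<Sum>l<Suc k. ?g l)"
  proof (rule sum.mono_neutral_right)
   show "\<forall>l\<in>{..<m * m} - {..<Suc k}. ?g l = 0"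
   proof
    fix l assume "l \<in> {..<m * m} - {..<Suc k}"
    then have "real l \<ge> real k + 1" by auto
    with k have "real m * t - real l \<le> 0" by linarith
    then show "?g l = 0" by simp
   qed
  qed (use km in auto)
  also have "\<dots> = (\<Sum>l<k. ?g l) + (v (Suc k, i) - v (k, i)) * f" using k by (simp add: f_def max_def min_def)
  also have "(\<Sum>l<k. ?g l) = (\<Sum>l<k. v (Suc l, i) - v (l, i))"
  proof (rule sum.cong)
   fix l assume "l \<in> {..<k}"
   then have "real l + 1 \<le> real k" by auto
   with k have "real m * t - real l \<ge> 1" by linarith
   then show "?g l = v (Suc l, i) - v (l, i)" by simp
  qed simp
  also have "\<dots> = v (k, i) - v (0, i)" by (rule sum_lessThan_telescope)
  finally show ?thesis unfolding gridpath_def by (simp add: algebra_simps)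
 qed
 moreover have "0 \<le> f" "f \<le> 1" "real m * t = real k + f" using k by (auto simp: f_def)
 ultimately show ?thesis by blast
qed

text \<open>The interpolant is a convex combination of two values of the path at distance at most
  one mesh, so uniform continuity on a compact interval suffices. The interval reaches one unit
  beyond \<open>T\<close> because the right node of the cell of \<open>t\<close> may lie
  there.\<close>

lemma lunif_interp:
 assumes x: "cpath d x"
 shows "lunif d (\<lambda>n. interp n d x) x" unfolding lunif_def uniform_limit_iff
proof (intro allI impI)
 fix T i e assume i: "i < d" and e: "e > (0::real)"
 have "continuous_on {0..\<bar>T\<bar>+1} (\<lambda>t. x t i)"
  using x i unfolding cpath_def by (auto intro: continuous_on_subset)
 then have "uniformly_continuous_on {0..\<bar>T\<bar>+1} (\<lambda>t. x t i)" by (intro compact_uniformly_continuous) auto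
 then obtain \<delta> where \<delta>: "\<delta> > 0"
   "\<And>s t. s \<in> {0..\<bar>T\<bar>+1} \<Longrightarrow> t \<in> {0..\<bar>T\<bar>+1} \<Longrightarrow> dist t s < \<delta> \<Longrightarrow> dist (x t i) (x s i) < e"
  unfolding uniformly_continuous_on_def using e by metis
 have "\<forall>\<^sub>F n in sequentially. 1 / real (Suc n) < \<delta>"
  using order_tendstoD(2)[OF LIMSEQ_inverse_real_of_nat \<delta>(1)] by (simp add: inverse_eq_divide)
 moreover have "\<forall>\<^sub>F n in sequentially. \<bar>T\<bar> + 1 < real n"
  using filterlim_real_sequentially by (auto simp: filterlim_at_top_dense)
 ultimately show "\<forall>\<^sub>F n in sequentially. \<forall>t\<in>{0..T}. dist (interp n d x t i) (x t i) < e"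
 proof eventually_elim
  case (elim n)
  show ?case
  proof
   fix t assume t: "t \<in> {0..T}"
   define m where "m = Suc n"
   have m: "m > 0" "t < real m" "1 / real m < \<delta>" "real m \<ge> 1" using elim t by (auto simp: m_def)
   obtain k f where kf: "0 \<le> f" "f \<le> 1" "real m * t = real k + f"
    "\<And>v i. gridpath m v t i = (1 - f) * v (k, i) + f * v (Suc k, i)"
    using gridpath_between[OF m(1) _ m(2)] t by auto
   have kt: "real k / real m = t - f / real m" "real (Suc k) / real m = t + (1 - f) / real m"
    using kf(3) m by (auto simp: field_simps)
   have fm: "0 \<le> f / real m" "f / real m \<le> 1 / real m" "0 \<le> (1 - f) / real m" "(1 - f) / real m \<le> 1 / real m" "1 / real m \<le> 1"
    using kf m by (auto simp: field_simps)
   have "real k / real m \<ge> 0" by simp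
   then have r: "real k / real m \<in> {0..\<bar>T\<bar>+1}" "real (Suc k) / real m \<in> {0..\<bar>T\<bar>+1}" "t \<in> {0..\<bar>T\<bar>+1}"
    using fm t unfolding kt by (auto simp del: of_nat_Suc)
   have 1: "\<bar>x (real k / real m) i - x t i\<bar> < e" "\<bar>x (real (Suc k) / real m) i - x t i\<bar> < e"
    using \<delta>(2)[OF r(3) r(1)] \<delta>(2)[OF r(3) r(2)] fm m(3) unfolding kt dist_real_def by auto
   have "gridpath m (grid m d x) t i - x t i =
     (1 - f) * (x (real k / real m) i - x t i) + f * (x (real (Suc k) / real m) i - x t i)"
    unfolding kf(4) grid_def using i by (simp add: algebra_simps)
   also have "\<bar>\<dots>\<bar> \<le> (1 - f) * \<bar>x (real k / real m) i - x t i\<bar> + f * \<bar>x (real (Suc k) / real m) i - x t i\<bar>"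
    using kf by (intro order_trans[OF abs_triangle_ineq]) (simp add: abs_mult)
   also have "\<dots> < e" using convex_bound_lt[OF 1, of "1 - f" f] kf by simp
   finally show "dist (interp n d x t i) (x t i) < e" by (simp add: dist_real_def m_def)
  qed
 qed
qed

lemma tendsto_fun_iff:
 fixes f :: "'a \<Rightarrow> 'i \<Rightarrow> 'b::topological_space"
 shows "(f \<longlongrightarrow> l) F \<longleftrightarrow> (\<forall>i. ((\<lambda>x. f x i) \<longlongrightarrow> l i) F)"
proof -
 have "limitin (product_topology (\<lambda>i. euclidean) UNIV) f l F \<longleftrightarrow> (\<forall>i. limitin euclidean (\<lambda>x. f x i) (l i) F)"
  unfolding limitin_componentwise by simp
 then show ?thesis unfolding euclidean_product_topology limitin_canonical_iff .
qed

text \<open>Every ramp has values in \<open>[0, 1]\<close>, so the distance of two interpolants is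
  bounded, uniformly in time, by the distances of their initial nodes and node increments.\<close>

lemma lunif_gridpath:
 assumes "vs \<longlonglongrightarrow> v"
 shows "lunif d (\<lambda>n. gridpath m (vs n)) (gridpath m v)"
proof (rule lunifI)
 fix T i
 have v: "(\<lambda>n. vs n c) \<longlonglongrightarrow> v c" for c using assms unfolding tendsto_fun_iff by blast
 define c where "c n = \<bar>vs n (0, i) - v (0, i)\<bar> + (\<Sum>k<m*m. \<bar>(vs n (Suc k, i) - vs n (k, i)) - (v (Suc k, i) - v (k, i))\<bar>)" for n
 have "c \<longlonglongrightarrow> \<bar>v (0, i) - v (0, i)\<bar> + (\<Sum>k<m*m. \<bar>(v (Suc k, i) - v (k, i)) - (v (Suc k, i) - v (k, i))\<bar>)"
  unfolding c_def by (intro tendsto_intros v)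
 then have "c \<longlonglongrightarrow> 0" by simp
 moreover have "\<bar>gridpath m (vs n) t i - gridpath m v t i\<bar> \<le> c n" for n t
 proof -
  have "gridpath m (vs n) t i - gridpath m v t i = (vs n (0, i) - v (0, i)) +
   (\<Sum>k<m*m. ((vs n (Suc k, i) - vs n (k, i)) - (v (Suc k, i) - v (k, i))) * max 0 (min 1 (real m * t - real k)))"
   unfolding gridpath_def by (simp add: sum_subtractf left_diff_distrib)
  also have "\<bar>\<dots>\<bar> \<le> c n" unfolding c_def
   by (intro order_trans[OF abs_triangle_ineq] add_mono order_refl order_trans[OF sum_abs] sum_mono)
     (simp add: abs_mult mult_left_le)
  finally show ?thesis .
 qed
 ultimately show "\<exists>c. c \<longlonglongrightarrow> 0 \<and> (\<forall>\<^sub>F n in sequentially. \<forall>t\<in>{0..T}. \<bar>gridpath m (vs n) t i - gridpath m v t i\<bar> \<le> c n)"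
  by (intro exI[of _ c]) auto
qed

lemma continuous_pcont_gridpath:
 assumes "pcont d F"
 shows "continuous_on UNIV (\<lambda>v. F (gridpath m v))" unfolding continuous_on_sequentially comp_def
proof (intro ballI allI impI)
 fix vs v assume "(\<forall>n. vs n \<in> UNIV) \<and> vs \<longlonglongrightarrow> (v :: nat \<times> nat \<Rightarrow> real)"
 then have "lunif d (\<lambda>n. gridpath m (vs n)) (gridpath m v)" by (intro lunif_gridpath) simp
 then show "(\<lambda>n. F (gridpath m (vs n))) \<longlonglongrightarrow> F (gridpath m v)"
  using assms[unfolded pcont_def, rule_format, of "\<lambda>n. gridpath m (vs n)" "gridpath m v"]
  by (simp add: cpath_gridpath)
qed

lemma grid_measurable:
 assumes "cproc M d X"
 shows "(\<lambda>w. grid m d (X w)) \<in> borel_measurable M"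
proof (rule measurable_coordinatewise_then_product)
 fix c show "(\<lambda>w. grid m d (X w) c) \<in> borel_measurable M"
  using assms by (cases c; cases "snd c < d") (simp_all add: grid_def cproc_def)
qed

lemma pcont_interp_measurable:
 assumes "cproc M d X" "pcont d F"
 shows "(\<lambda>w. F (interp n d (X w))) \<in> borel_measurable M"
 using measurable_compose[OF grid_measurable[OF assms(1)]
   borel_measurable_continuous_onI[OF continuous_pcont_gridpath[OF assms(2)]]] .

lemma pcont_interp_tendsto:
 assumes "cpath d x" "pcont d F"
 shows "(\<lambda>n. F (interp n d x)) \<longlonglongrightarrow> F x"
 using assms lunif_interp[OF assms(1)] unfolding pcont_def by (simp add: cpath_gridpath)

text \<open>\<open>F\<close> after interpolation is a continuous, hence Borel, function of countably
  many real random variables, and \<open>F (X w)\<close> is the pointwise limit of these as the grid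
  is refined. No sigma-algebra on paths is involved.\<close>

lemma pcont_measurable:
 assumes "cproc M d X" "pcont d F"
 shows "(\<lambda>w. F (X w)) \<in> borel_measurable M"
proof (rule borel_measurable_LIMSEQ_real)
 show "(\<lambda>n. F (interp n d (X w))) \<longlonglongrightarrow> F (X w)" if "w \<in> space M" for w
  using assms that by (intro pcont_interp_tendsto) (simp_all add: cproc_def)
 show "(\<lambda>w. F (interp n d (X w))) \<in> borel_measurable M" for n by (rule pcont_interp_measurable[OF assms])
qed

lemma grid_distr_eq:
 assumes "prob_space M" "prob_space M'" "cproc M d X" "cproc M' d X'" "same_fdd d M X M' X'"
 shows "distr M borel (\<lambda>w. grid m d (X w)) = distr M' borel (\<lambda>w. grid m d (X' w))"
proof (rule char_determines_distr[OF assms(1,2) grid_measurable[OF assms(3)] grid_measurable[OF assms(4)]])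
 fix K :: "(nat \<times> nat) set" and a :: "nat \<times> nat \<Rightarrow> real" assume K: "finite K"
 define m' where "m' = Suc (Max (insert 0 (fst ` K)))"
 \<comment> \<open>Zero coefficients extend the arbitrary finite set \<open>K\<close> of nodes to a
   full rectangle of times and coordinates, the form in which \<open>fdd_char\<close> is
   stated.\<close>
 define a' where "a' k i = (if (k, i) \<in> K then a (k, i) else 0)" for k i
 have m': "k < m'" if "(k, i) \<in> K" for k i unfolding m'_def using K that by (force intro!: le_imp_less_Suc Max_ge)
 have "(\<Sum>c\<in>K. a c * grid m d x c) = (\<Sum>k<m'. \<Sum>i<d. a' k i * x (real k / real m) i)" for x
 proof -
  have "(\<Sum>k<m'. \<Sum>i<d. a' k i * x (real k / real m) i) =
   (\<Sum>c\<in>{..<m'}\<times>{..<d}. (if c \<in> K then a c * grid m d x c else 0))"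
   by (subst sum.cartesian_product) (auto intro!: sum.cong simp: a'_def grid_def)
  also have "\<dots> = (\<Sum>c\<in>({..<m'}\<times>{..<d}) \<inter> K. a c * grid m d x c)"
   by (subst sum.inter_restrict) auto
  also have "\<dots> = (\<Sum>c\<in>K. a c * grid m d x c)"
   by (rule sum.mono_neutral_left) (use K m' in \<open>auto simp: grid_def split: if_splits\<close>)
  finally show ?thesis by simp
 qed
 then show "(\<integral>w. iexp (\<Sum>k\<in>K. a k * grid m d (X w) k) \<partial>M) = (\<integral>w. iexp (\<Sum>k\<in>K. a k * grid m d (X' w) k) \<partial>M')"
  using assms(5) unfolding same_fdd_def fdd_char_def by simp
qed

text \<open>The substitute for tightness: the grid values have equal laws, hence the expectations
  agree on interpolated paths, and dominated convergence along refining grids reaches the paths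
  themselves.\<close>

lemma pcont_integral_eq:
 assumes "prob_space M" "prob_space M'" "cproc M d X" "cproc M' d X'" "same_fdd d M X M' X'"
  and F: "pcont d F" "\<And>x. \<bar>F x\<bar> \<le> b"
 shows "(\<integral>w. F (X w) \<partial>M) = (\<integral>w. F (X' w) \<partial>M')"
proof -
 interpret M: prob_space M by fact
 interpret M': prob_space M' by fact
 have e: "(\<integral>w. F (interp n d (X w)) \<partial>M) = (\<integral>w. F (interp n d (X' w)) \<partial>M')" for n
  using arg_cong[OF grid_distr_eq[OF assms(1-5), of "Suc n"], of "\<lambda>D. \<integral>v. F (gridpath (Suc n) v) \<partial>D"]
  by (subst (asm) integral_distr[OF grid_measurable[OF assms(3)] borel_measurable_continuous_onI[OF continuous_pcont_gridpath[OF F(1)]]],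
    subst (asm) integral_distr[OF grid_measurable[OF assms(4)] borel_measurable_continuous_onI[OF continuous_pcont_gridpath[OF F(1)]]])
 have lim: "(\<lambda>n. \<integral>w. F (interp n d (Y w)) \<partial>N) \<longlonglongrightarrow> (\<integral>w. F (Y w) \<partial>N)"
  if N: "prob_space N" and Y: "cproc N d Y" for N :: "'x measure" and Y
 proof (rule integral_dominated_convergence)
  interpret N: prob_space N by fact
  show "integrable N (\<lambda>_. b)" by simp
  show "(\<lambda>w. F (Y w)) \<in> borel_measurable N" by (rule pcont_measurable[OF Y F(1)])
  show "(\<lambda>w. F (interp n d (Y w))) \<in> borel_measurable N" for n by (rule pcont_interp_measurable[OF Y F(1)])
  show "AE w in N. (\<lambda>n. F (interp n d (Y w))) \<longlonglongrightarrow> F (Y w)"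
   using Y F(1) by (intro AE_I2 pcont_interp_tendsto) (simp_all add: cproc_def)
  show "AE w in N. norm (F (interp n d (Y w))) \<le> b" for n using F(2) by simp
 qed
 have 1: "(\<lambda>n. \<integral>w. F (interp n d (X w)) \<partial>M) \<longlonglongrightarrow> (\<integral>w. F (X w) \<partial>M)"
  by (rule lim[OF assms(1,3)])
 have 2: "(\<lambda>n. \<integral>w. F (interp n d (X' w)) \<partial>M') \<longlonglongrightarrow> (\<integral>w. F (X' w) \<partial>M')"
  by (rule lim[OF assms(2,4)])
 show ?thesis using LIMSEQ_unique[OF 1] 2 e by simp
qed

section \<open>The vector and path topologies\<close>

lemma topspace_vec_topology [simp]: "topspace (vec_topology d) = carrier_vec d"
 unfolding vec_topology_def topspace_pullback_topology by auto

lemma continuous_map_vec_index: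
 assumes "i < d" shows "continuous_map (vec_topology d) euclideanreal (\<lambda>v. v $ i)"
proof -
 have "continuous_map (vec_topology d) euclideanreal ((\<lambda>x. x i) \<circ> (\<lambda>v. \<lambda>i\<in>{..<d}. v $ i))"
  unfolding vec_topology_def
  by (rule continuous_map_pullback) (use assms in \<open>auto intro: continuous_map_product_projection\<close>)
 then show ?thesis using assms by (simp add: comp_def)
qed

lemma limitin_vec_topologyD:
 assumes "limitin (vec_topology d) f l F" "i < d"
 shows "((\<lambda>t. f t $ i) \<longlongrightarrow> l $ i) F"
 using continuous_map_limit[OF continuous_map_vec_index[OF assms(2)] assms(1)] by (simp add: comp_def)

lemma limitin_vec_topologyI:
 assumes "l \<in> carrier_vec d" "\<forall>\<^sub>F t in F. f t \<in> carrier_vec d"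
  "\<And>i. i < d \<Longrightarrow> ((\<lambda>t. f t $ i) \<longlongrightarrow> l $ i) F"
 shows "limitin (vec_topology d) f l F" unfolding limitin_def
proof (intro conjI allI impI)
 fix U assume U: "openin (vec_topology d) U \<and> l \<in> U"
 then obtain V where V: "openin (product_topology (\<lambda>_. euclideanreal) {..<d}) V"
  "U = (\<lambda>v. \<lambda>i\<in>{..<d}. v $ i) -` V \<inter> carrier_vec d"
  unfolding vec_topology_def openin_pullback_topology by auto
 have "limitin (product_topology (\<lambda>_. euclideanreal) {..<d}) (\<lambda>t. \<lambda>i\<in>{..<d}. f t $ i) (\<lambda>i\<in>{..<d}. l $ i) F"
  unfolding limitin_componentwise using assms(3) by auto
 then have "\<forall>\<^sub>F t in F. (\<lambda>i\<in>{..<d}. f t $ i) \<in> V" using V U by (auto simp: limitin_def)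
 with assms(2) show "\<forall>\<^sub>F t in F. f t \<in> U" by eventually_elim (use V in auto)
qed (use assms in auto)

lemma cadlag_cpath:
 assumes "cpath d x" and y: "\<And>t. 0 \<le> t \<Longrightarrow> y t = vec d (x t)"
 shows "cadlag d y"
proof -
 have c: "((\<lambda>s. x s i) \<longlongrightarrow> x t i) (at t within {0..})" if "i < d" "t \<ge> 0" for i t
  using assms that unfolding cpath_def continuous_on_def by auto
 have r: "((\<lambda>s. x s i) \<longlongrightarrow> x t i) (at_right t)" if "i < d" "t \<ge> 0" for i t
  by (rule tendsto_within_subset[OF c[OF that]]) (use that in auto)
 have l: "((\<lambda>s. x s i) \<longlongrightarrow> x t i) (at_left t)" if "i < d" "t > 0" for i t
 proof -
  have "(at_left t) = at t within {0<..<t}" by (rule at_within_nhd[of t "{0<..}"]) (use that in auto)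
  moreover have "{0<..<t} \<subseteq> {0..}" by auto
  ultimately show ?thesis using tendsto_within_subset[OF c[OF that(1)], of t "{0<..<t}"] that by auto
 qed
 have ev: "\<forall>\<^sub>F s in at t within S. 0 \<le> s" if "t > 0 \<or> t = 0 \<and> S = {0<..}" for t :: real and S
  using that
 proof
  assume "t > 0"
  then have "\<forall>\<^sub>F s in at t within S. 0 < s" by (intro order_tendstoD(1)[OF tendsto_ident_at])
  then show ?thesis by eventually_elim simp
 qed (auto simp: eventually_at_filter)
 have R: "limitin (vec_topology d) y (y t) (at_right t)" if "t \<ge> 0" for t
 proof -
  have e: "\<forall>\<^sub>F s in at_right t. y s = vec d (x s)"
  proof -
   have "\<forall>\<^sub>F s in at_right t. 0 \<le> s" by (rule ev) (use that in auto)
   then show ?thesis by eventually_elim (rule y)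
  qed
  show ?thesis unfolding y[OF that]
  proof (rule limitin_vec_topologyI)
   show "\<forall>\<^sub>F s in at_right t. y s \<in> carrier_vec d" using e by eventually_elim simp
   fix i assume i: "i < d"
   have "\<forall>\<^sub>F s in at_right t. y s $ i = x s i" using e by eventually_elim (simp add: i)
   then show "((\<lambda>s. y s $ i) \<longlongrightarrow> vec d (x t) $ i) (at_right t)"
    using r[OF i that] i by (simp add: tendsto_cong)
  qed simp
 qed
 have L: "limitin (vec_topology d) y (y t) (at_left t)" if "t > 0" for t
 proof -
  have e: "\<forall>\<^sub>F s in at_left t. y s = vec d (x s)"
  proof -
   have "\<forall>\<^sub>F s in at_left t. 0 \<le> s" by (rule ev) (use that in auto)
   then show ?thesis by eventually_elim (rule y)
  qed
  show ?thesis unfolding y[OF less_imp_le[OF that]]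
  proof (rule limitin_vec_topologyI)
   show "\<forall>\<^sub>F s in at_left t. y s \<in> carrier_vec d" using e by eventually_elim simp
   fix i assume i: "i < d"
   have "\<forall>\<^sub>F s in at_left t. y s $ i = x s i" using e by eventually_elim (simp add: i)
   then show "((\<lambda>s. y s $ i) \<longlongrightarrow> vec d (x t) $ i) (at_left t)"
    using l[OF i that] i by (simp add: tendsto_cong)
  qed simp
 qed
 show ?thesis unfolding cadlag_def using R L y by auto
qed

text \<open>As the path space is not separable, an open set \<open>U\<close> need not be a countable
  union of balls. Instead, \<open>B m x\<close> says that the open ball of radius
  \<open>1 / (m + 1)\<close> around \<open>x\<close>, for the supremum norm on
  \<open>[0, m + 1]\<close>, lies in \<open>U\<close>. For interpolated paths this is a closed
  condition on the node values, and a continuous path lies in \<open>U\<close> exactly if for some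
  \<open>m\<close> its interpolants eventually satisfy \<open>B m\<close>.\<close>

lemma cproc_measurable_path:
 assumes X: "cproc M d X"
 shows "(\<lambda>w t. vec d (X w t)) \<in> M \<rightarrow>\<^sub>M borel_of (path_topology d)" unfolding borel_of_def
proof (rule measurable_measure_of)
 show "{U. openin (path_topology d) U} \<subseteq> Pow (topspace (path_topology d))" by (auto dest: openin_subset)
 show "(\<lambda>w t. vec d (X w t)) \<in> space M \<rightarrow> topspace (path_topology d)"
  using X by (auto simp: topspace_path_topology cproc_def cadlag_cpath[OF _ refl])
next
 fix U assume "U \<in> {U. openin (path_topology d) U}"
 then have U: "\<And>x. x \<in> U \<Longrightarrow> \<exists>T>0. \<exists>\<epsilon>>0. \<forall>y. cadlag d y \<longrightarrow>
    (\<forall>t\<in>{0..T}. \<forall>i<d. \<bar>y t $ i - x t $ i\<bar> < \<epsilon>) \<longrightarrow> y \<in> U"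
  unfolding openin_path_topology by blast
 \<comment> \<open>The number \<open>e\<close> strictly below \<open>1 / (m + 1)\<close> leaves room
   for a small change of \<open>x\<close>; this is what makes the condition closed under limits of
   node values.\<close>
 define B where "B m x \<longleftrightarrow> (\<forall>y e. cadlag d y \<longrightarrow> e < 1 / real (Suc m) \<longrightarrow>
   (\<forall>t\<in>{0..real (Suc m)}. \<forall>i<d. \<bar>y t $ i - x t i\<bar> \<le> e) \<longrightarrow> y \<in> U)" for m and x :: rpath
 have "closed {v. B m (gridpath n v)}" for m n unfolding closed_sequential_limits
 proof (intro allI impI)
  fix vs v assume v: "(\<forall>k. vs k \<in> {v. B m (gridpath n v)}) \<and> vs \<longlonglongrightarrow> v"
  have "B m (gridpath n v)" unfolding B_def
  proof (intro allI impI)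
   fix y e assume y: "cadlag d y" "e < 1 / real (Suc m)"
    and ye: "\<forall>t\<in>{0..real (Suc m)}. \<forall>i<d. \<bar>y t $ i - gridpath n v t i\<bar> \<le> e"
   define \<delta> where "\<delta> = (1 / real (Suc m) - e) / 2"
   have "\<delta> > 0" using y by (simp add: \<delta>_def)
   from lunifD[OF lunif_gridpath[of vs v d n] this, of "real (Suc m)"] v
   obtain k where k: "\<forall>t\<in>{0..real (Suc m)}. \<forall>i<d. \<bar>gridpath n (vs k) t i - gridpath n v t i\<bar> < \<delta>"
    unfolding eventually_sequentially by auto
   have "\<forall>t\<in>{0..real (Suc m)}. \<forall>i<d. \<bar>y t $ i - gridpath n (vs k) t i\<bar> \<le> e + \<delta>"
    using k ye by (smt (verit, best))
   moreover have "e + (K - e) / 2 < K" if "e < K" for K using that by (simp add: field_simps)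
   then have "e + \<delta> < 1 / real (Suc m)" unfolding \<delta>_def using y(2) by blast
   ultimately show "y \<in> U" using v y(1) unfolding B_def by blast
  qed
  then show "v \<in> {v. B m (gridpath n v)}" by simp
 qed
 then have "(\<lambda>w. grid (Suc n) d (X w)) -` {v. B m (gridpath (Suc n) v)} \<inter> space M \<in> sets M" for m n
  by (intro measurable_sets[OF grid_measurable[OF X]] borel_closed)
 moreover have "(\<lambda>w. grid (Suc n) d (X w)) -` {v. B m (gridpath (Suc n) v)} \<inter> space M =
   {w \<in> space M. B m (interp n d (X w))}" for m n by auto
 ultimately have m[measurable]: "Measurable.pred M (\<lambda>w. B m (interp n d (X w)))" for m n unfolding pred_def by simp
 have "(\<lambda>t. vec d (X w t)) \<in> U \<longleftrightarrow> (\<exists>m N. \<forall>n\<ge>N. B m (interp n d (X w)))" if w: "w \<in> space M" for w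
 proof
  have cX: "cpath d (X w)" using X w by (auto simp: cproc_def)
  note lX = lunif_interp[OF cX]
  { assume "(\<lambda>t. vec d (X w t)) \<in> U"
   from U[OF this] obtain T e where T12: "T > 0" "e > 0" and
    T3: "\<forall>y. cadlag d y \<longrightarrow> (\<forall>t\<in>{0..T}. \<forall>i<d. \<bar>y t $ i - vec d (X w t) $ i\<bar> < e) \<longrightarrow> y \<in> U"
    by blast
   have "y \<in> U" if "cadlag d y" "\<forall>t\<in>{0..T}. \<forall>i<d. \<bar>y t $ i - X w t i\<bar> < e" for y
    using T3[rule_format, OF that(1)] that(2) by simp
   note T = T12 this
   obtain m1 :: nat where m1: "T < m1" using reals_Archimedean2 by blast
   obtain m2 where m2: "1 / real (Suc m2) < e / 2" using T(2) nat_approx_posE[of "e/2"] by auto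
   \<comment> \<open>The horizon \<open>m + 1\<close> has to exceed \<open>T\<close>, and the radius
     has to be below half of \<open>e\<close>; the other half is spent on the distance between the
     path and its interpolant.\<close>
   define m where "m = max m1 m2"
   have m: "T < real (Suc m)" "1 / real (Suc m) < e / 2"
   proof -
    show "T < real (Suc m)" using m1 by (auto simp: m_def)
    have "1 / real (Suc m) \<le> 1 / real (Suc m2)" by (rule frac_le) (auto simp: m_def)
    with m2 show "1 / real (Suc m) < e / 2" by linarith
   qed
   have "\<forall>\<^sub>F n in sequentially. \<forall>t\<in>{0..T}. \<forall>i<d. \<bar>interp n d (X w) t i - X w t i\<bar> < e / 2"
    by (rule lunifD[OF lX]) (use T(2) in simp)
   then have "\<forall>\<^sub>F n in sequentially. B m (interp n d (X w))"
   proof eventually_elim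
    case (elim n)
    show ?case unfolding B_def
    proof (intro allI impI)
     fix y e' assume y: "cadlag d y" "e' < 1 / real (Suc m)"
      "\<forall>t\<in>{0..real (Suc m)}. \<forall>i<d. \<bar>y t $ i - interp n d (X w) t i\<bar> \<le> e'"
     show "y \<in> U"
     proof (rule T(3)[OF y(1)], intro ballI allI impI)
      fix t i assume ti: "t \<in> {0..T}" "i < d"
      have "t \<in> {0..real (Suc m)}" using ti m(1) by auto
      with y(3) ti have "\<bar>y t $ i - interp n d (X w) t i\<bar> \<le> e'" by blast
      moreover have "\<bar>interp n d (X w) t i - X w t i\<bar> < e / 2" using elim ti by blast
      ultimately show "\<bar>y t $ i - X w t i\<bar> < e" using y(2) m(2) by linarith
     qed
    qed
   qed
   then show "\<exists>m N. \<forall>n\<ge>N. B m (interp n d (X w))" by (auto simp: eventually_sequentially) }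
  { assume "\<exists>m N. \<forall>n\<ge>N. B m (interp n d (X w))"
   then obtain m N where mN: "\<And>n. n \<ge> N \<Longrightarrow> B m (interp n d (X w))" by blast
   have "\<forall>\<^sub>F n in sequentially. \<forall>t\<in>{0..real (Suc m)}. \<forall>i<d. \<bar>interp n d (X w) t i - X w t i\<bar> < 1 / real (Suc m) / 2"
    by (rule lunifD[OF lX]) simp
   with eventually_ge_at_top[of N] have "\<forall>\<^sub>F n in sequentially. (\<lambda>t. vec d (X w t)) \<in> U"
   proof eventually_elim
    case (elim n)
    have "\<forall>t\<in>{0..real (Suc m)}. \<forall>i<d. \<bar>vec d (X w t) $ i - interp n d (X w) t i\<bar> \<le> 1 / real (Suc m) / 2"
     using elim(2) by (auto simp: abs_minus_commute less_imp_le)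
    moreover have "1 / real (Suc m) / 2 < 1 / real (Suc m)" by (simp add: field_simps)
    ultimately show ?case using mN[OF elim(1)] cadlag_cpath[OF cX refl] unfolding B_def by blast
   qed
   then show "(\<lambda>t. vec d (X w t)) \<in> U" by simp }
 qed
 then have "(\<lambda>w t. vec d (X w t)) -` U \<inter> space M = {w\<in>space M. \<exists>m N. \<forall>n\<ge>N. B m (interp n d (X w))}"
  by auto
 also have "\<dots> \<in> sets M" by measurable
 finally show "(\<lambda>w t. vec d (X w t)) -` U \<inter> space M \<in> sets M" .
qed

section \<open>The reflection map as a least regulator\<close>

text \<open>The classical characterization of nonsingular M-matrices: off-diagonal entries at most
  zero and a positive vector \<open>w\<close> with positive image, scaled to
  \<open>R w \<ge> 1\<close>. The estimates below use the weighted maximum norm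
  \<open>max |v_i| / w_i\<close>.\<close>

definition Mmat :: "nat \<Rightarrow> fmat \<Rightarrow> fvec \<Rightarrow> bool" where
 "Mmat d R w \<longleftrightarrow> (\<forall>i<d. 0 < w i \<and> 1 \<le> (\<Sum>j<d. R i j * w j) \<and> (\<forall>j<d. j \<noteq> i \<longrightarrow> R i j \<le> 0))"

lemma sum_remove_lessThan:
 "(i::nat) < d \<Longrightarrow> (\<Sum>j<d. f j) = f i + (\<Sum>j\<in>{..<d} - {i}. f j :: real)"
 using sum.remove[of "{..<d}" i f] by simp

lemma Mmat_diag:
 assumes "Mmat d R w" "i < d"
 shows "1 \<le> R i i * w i" "0 < R i i"
proof -
 have "(\<Sum>j\<in>{..<d} - {i}. R i j * w j) \<le> 0"
  using assms unfolding Mmat_def by (intro sum_nonpos) (auto simp: mult_nonpos_nonneg less_imp_le)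
 moreover have "1 \<le> (\<Sum>j<d. R i j * w j)" "0 < w i" using assms unfolding Mmat_def by auto
 ultimately show 1: "1 \<le> R i i * w i" using sum_remove_lessThan[OF assms(2), of "\<lambda>j. R i j * w j"] by linarith
 then have "0 < R i i * w i" by linarith
 then show "0 < R i i" using \<open>0 < w i\<close> by (simp add: zero_less_mult_iff)
qed

text \<open>The last clause says that \<open>y\<^sub>i\<close> is the least regulator, i.e.\ \<open>R\<^sub>i\<^sub>i y\<^sub>i(t)\<close> is the running supremum
 of the negative part of the other summands; this form makes sense without continuity of \<open>y\<close>.\<close>

definition rsol :: "nat \<Rightarrow> fmat \<Rightarrow> rpath \<Rightarrow> rpath \<Rightarrow> bool" where
 "rsol d R x y \<longleftrightarrow> (\<forall>i<d. (\<forall>t\<ge>0. 0 \<le> y t i) \<and> (\<forall>s t. 0 \<le> s \<and> s \<le> t \<longrightarrow> y s i \<le> y t i) \<and>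
   (\<forall>t\<ge>0. 0 \<le> x t i + (\<Sum>j<d. R i j * y t j)) \<and>
   (\<forall>t\<ge>0. \<forall>c\<ge>0. (\<forall>u\<in>{0..t}. 0 \<le> x u i + R i i * c + (\<Sum>j\<in>{..<d}-{i}. R i j * y u j)) \<longrightarrow> y t i \<le> c))"

lemma rsolD:
 assumes "rsol d R x y" "i < d"
 shows "0 \<le> t \<Longrightarrow> 0 \<le> y t i" "0 \<le> s \<Longrightarrow> s \<le> t \<Longrightarrow> y s i \<le> y t i"
  "0 \<le> t \<Longrightarrow> 0 \<le> x t i + (\<Sum>j<d. R i j * y t j)"
  "0 \<le> t \<Longrightarrow> 0 \<le> c \<Longrightarrow> (\<And>u. 0 \<le> u \<Longrightarrow> u \<le> t \<Longrightarrow> 0 \<le> x u i + R i i * c + (\<Sum>j\<in>{..<d}-{i}. R i j * y u j)) \<Longrightarrow> y t i \<le> c"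
 using assms unfolding rsol_def by auto

text \<open>The number \<open>y' u i + c\<close> is an admissible level in the minimality clause for
  \<open>y\<close>: the inputs differ by at most \<open>\<kappa>\<close>, and by
  \<open>R w \<ge> 1\<close> the off-diagonal terms cost at most \<open>m (R_ii w_i - 1)\<close>.
  When \<open>m > \<kappa>\<close>, the resulting bound is strictly better than the bound
  \<open>m\<close> from which it started.\<close>

lemma rsol_compare:
 assumes R: "Mmat d R w" and y: "rsol d R x y" and y': "rsol d R x' y'" and i: "i < d"
  and m: "0 \<le> m" and \<kappa>: "0 \<le> \<kappa>" and u: "0 \<le> u"
  and x: "\<And>v. 0 \<le> v \<Longrightarrow> v \<le> u \<Longrightarrow> \<bar>x v i - x' v i\<bar> \<le> \<kappa>"
  and ym: "\<And>v j. 0 \<le> v \<Longrightarrow> v \<le> u \<Longrightarrow> j < d \<Longrightarrow> \<bar>y v j - y' v j\<bar> \<le> m * w j"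
 shows "y u i - y' u i \<le> (m + (\<kappa> - m) / (R i i * w i)) * w i"
proof -
 note D = Mmat_diag[OF R i]
 have w: "w i > 0" using R i by (simp add: Mmat_def)
 define c where "c = (\<kappa> + m * (R i i * w i - 1)) / R i i"
 have c0: "0 \<le> c" unfolding c_def using D m \<kappa> by (intro divide_nonneg_pos add_nonneg_nonneg mult_nonneg_nonneg) auto
 have Rc: "R i i * c = \<kappa> + m * (R i i * w i - 1)" using D by (simp add: c_def)
 have "y u i \<le> y' u i + c"
 proof (rule rsolD(4)[OF y i u])
  show "0 \<le> y' u i + c" using rsolD(1)[OF y' i u] c0 by simp
  fix v assume v: "0 \<le> v" "v \<le> u"
  have 1: "0 \<le> x' v i + R i i * y' v i + (\<Sum>j\<in>{..<d}-{i}. R i j * y' v j)"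
   using rsolD(3)[OF y' i v(1)] by (simp add: sum_remove_lessThan[OF i])
  have 2: "R i i * y' v i \<le> R i i * y' u i" using rsolD(2)[OF y' i v] D by simp
  have "(\<Sum>j\<in>{..<d}-{i}. R i j * y' v j) \<le> (\<Sum>j\<in>{..<d}-{i}. R i j * y v j - m * (R i j * w j))"
  proof (rule sum_mono)
   fix j assume j: "j \<in> {..<d}-{i}"
   then have "R i j \<le> 0" using R i by (auto simp: Mmat_def)
   moreover have "\<bar>y v j - y' v j\<bar> \<le> m * w j" using ym[OF v, of j] j by blast
   then have "y v j - m * w j \<le> y' v j" by linarith
   ultimately have "R i j * y' v j \<le> R i j * (y v j - m * w j)" by (rule mult_left_mono_neg[rotated])
   then show "R i j * y' v j \<le> R i j * y v j - m * (R i j * w j)" by (simp add: algebra_simps)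
  qed
  then have 3: "(\<Sum>j\<in>{..<d}-{i}. R i j * y' v j) \<le> (\<Sum>j\<in>{..<d}-{i}. R i j * y v j) - m * (\<Sum>j\<in>{..<d}-{i}. R i j * w j)"
   by (simp add: sum_subtractf sum_distrib_left)
  have "1 \<le> (\<Sum>j<d. R i j * w j)" using R i by (simp add: Mmat_def)
  then have "1 \<le> R i i * w i + (\<Sum>j\<in>{..<d}-{i}. R i j * w j)" by (simp only: sum_remove_lessThan[OF i])
  then have "m * (1 - R i i * w i) \<le> m * (\<Sum>j\<in>{..<d}-{i}. R i j * w j)" by (intro mult_left_mono m) linarith
  moreover have "m * (1 - R i i * w i) = - (m * (R i i * w i - 1))" by (simp add: algebra_simps)
  moreover have "R i i * (y' u i + c) = R i i * y' u i + (\<kappa> + m * (R i i * w i - 1))"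
   by (simp only: distrib_left Rc)
  ultimately show "0 \<le> x v i + R i i * (y' u i + c) + (\<Sum>j\<in>{..<d}-{i}. R i j * y v j)"
   using 1 2 3 abs_le_D1[OF x[OF v]] abs_le_D2[OF x[OF v]] by linarith
 qed
 moreover have "c = (m + (\<kappa> - m) / (R i i * w i)) * w i"
 proof -
  have "c = (m * (R i i * w i) + (\<kappa> - m)) / R i i" by (simp add: c_def algebra_simps)
  also have "\<dots> = (m + (\<kappa> - m) / (R i i * w i)) * w i" using D w by (simp add: add_divide_distrib distrib_right)
  finally show ?thesis .
 qed
 ultimately show ?thesis by simp
qed

text \<open>The supremum \<open>m\<close> of the weighted distance over \<open>[0, T]\<close> is
  finite because regulators are monotone. Were \<open>m > \<kappa>\<close>, one application of
  \<open>rsol_compare\<close> would bound all members by \<open>m - (m - \<kappa>) \<delta>\<close>,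
  where \<open>\<delta>\<close> is the smallest of the numbers \<open>1 / (R_ii w_i)\<close>,
  contradicting the choice of \<open>m\<close>.\<close>

lemma rsol_lipschitz:
 assumes R: "Mmat d R w" and y: "rsol d R x y" and y': "rsol d R x' y'" and \<kappa>: "0 \<le> \<kappa>"
  and x: "\<And>v i. 0 \<le> v \<Longrightarrow> v \<le> T \<Longrightarrow> i < d \<Longrightarrow> \<bar>x v i - x' v i\<bar> \<le> \<kappa>"
  and u: "0 \<le> u" "u \<le> T" and i: "i < d"
 shows "\<bar>y u i - y' u i\<bar> \<le> \<kappa> * w i"
proof -
 have T: "0 \<le> T" using u by linarith
 have w: "w j > 0" if "j < d" for j using R that by (simp add: Mmat_def)
 define S where "S = (\<lambda>(v, j). \<bar>y v j - y' v j\<bar> / w j) ` ({0..T} \<times> {..<d})"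
 have ne: "S \<noteq> {}" using T i unfolding S_def by auto
 have bdd: "bdd_above S" unfolding bdd_above_def
 proof (intro exI ballI)
  fix s assume "s \<in> S"
  then obtain v j where vj: "0 \<le> v" "v \<le> T" "j < d" "s = \<bar>y v j - y' v j\<bar> / w j" unfolding S_def by auto
  have "\<bar>y v j - y' v j\<bar> \<le> y T j + y' T j"
   using rsolD(1)[OF y vj(3,1)] rsolD(1)[OF y' vj(3,1)] rsolD(2)[OF y vj(3,1,2)] rsolD(2)[OF y' vj(3,1,2)] by linarith
  then have "s \<le> (y T j + y' T j) / w j" using w[OF vj(3)] vj(4) by (simp add: divide_right_mono)
  also have "\<dots> \<le> (\<Sum>j<d. (y T j + y' T j) / w j)" by (rule member_le_sum)
     (use vj(3) in \<open>auto intro!: divide_nonneg_pos add_nonneg_nonneg w rsolD(1)[OF y _ T] rsolD(1)[OF y' _ T]\<close>)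
  finally show "s \<le> (\<Sum>j<d. (y T j + y' T j) / w j)" .
 qed
 have up: "\<bar>y v j - y' v j\<bar> \<le> Sup S * w j" if "0 \<le> v" "v \<le> T" "j < d" for v j
   proof -
  have "\<bar>y v j - y' v j\<bar> / w j \<in> S" unfolding S_def using that by (intro image_eqI[of _ _ "(v, j)"]) auto
  from cSup_upper[OF this bdd] show ?thesis using w[OF that(3)] by (simp add: pos_divide_le_eq)
 qed
 define m where "m = Sup S"
 have "0 \<le> m * w i" using up[OF u i] unfolding m_def by linarith
 then have m0: "0 \<le> m" using w[OF i] by (simp add: zero_le_mult_iff)
 have "m \<le> \<kappa>"
 proof (rule ccontr)
  assume "\<not> m \<le> \<kappa>"
  then have mk: "m > \<kappa>" by simp
  define \<delta> where "\<delta> = Min ((\<lambda>j. 1 / (R j j * w j)) ` {..<d})"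
  have fin: "finite ((\<lambda>j. 1 / (R j j * w j)) ` {..<d})" "(\<lambda>j. 1 / (R j j * w j)) ` {..<d} \<noteq> {}"
   using i by auto
  have \<delta>0: "\<delta> > 0" unfolding \<delta>_def Min_gr_iff[OF fin] using Mmat_diag[OF R] w by auto
  have \<delta>1: "\<delta> \<le> 1 / (R j j * w j)" if "j < d" for j unfolding \<delta>_def by (rule Min_le) (use that in auto)
  have "s \<le> m - (m - \<kappa>) * \<delta>" if "s \<in> S" for s
  proof -
   from that obtain v j where vj: "0 \<le> v" "v \<le> T" "j < d" "s = \<bar>y v j - y' v j\<bar> / w j"
    unfolding S_def by auto
   have "y v j - y' v j \<le> (m + (\<kappa> - m) / (R j j * w j)) * w j"
    by (rule rsol_compare[OF R y y' vj(3) m0 \<kappa> vj(1)]) (use x up vj in \<open>auto simp: m_def\<close>)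
   moreover have "y' v j - y v j \<le> (m + (\<kappa> - m) / (R j j * w j)) * w j"
    by (rule rsol_compare[OF R y' y vj(3) m0 \<kappa> vj(1)])
      (use x up vj in \<open>auto simp: m_def abs_minus_commute\<close>)
   ultimately have "\<bar>y v j - y' v j\<bar> \<le> (m + (\<kappa> - m) / (R j j * w j)) * w j" by linarith
   then have "s \<le> m + (\<kappa> - m) / (R j j * w j)" using vj(4) w[OF vj(3)] by (simp add: pos_divide_le_eq)
   also have "(\<kappa> - m) / (R j j * w j) = - ((m - \<kappa>) * (1 / (R j j * w j)))" by (simp add: minus_divide_left)
   also have "m + - ((m - \<kappa>) * (1 / (R j j * w j))) \<le> m - (m - \<kappa>) * \<delta>"
    using mult_left_mono[OF \<delta>1[OF vj(3)], of "m - \<kappa>"] mk by simp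
   finally show ?thesis .
  qed
  then have "m \<le> m - (m - \<kappa>) * \<delta>" unfolding m_def by (intro cSup_least[OF ne]) auto
  then show False using mk \<delta>0 by (simp add: mult_le_0_iff)
 qed
 then have "m * w i \<le> \<kappa> * w i" using w[OF i] by (intro mult_right_mono) auto
 then show ?thesis using up[OF u i] unfolding m_def by linarith
qed

lemma rsol_unique:
 assumes "Mmat d R w" "rsol d R x y" "rsol d R x' y'" "\<And>t i. 0 \<le> t \<Longrightarrow> i < d \<Longrightarrow> x t i = x' t i" "0 \<le> u" "i < d"
 shows "y u i = y' u i" using rsol_lipschitz[OF assms(1-3), of 0 u u i] assms by simp

lemma rsol_stop:
 assumes y: "rsol d R x y" and t0: "0 \<le> t0"
 shows "rsol d R (\<lambda>u. x (min u t0)) (\<lambda>u. y (min u t0))" unfolding rsol_def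
proof (intro allI impI conjI)
 fix i t c assume i: "i < d" and t: "0 \<le> t" "0 \<le> c"
  and *: "\<forall>u\<in>{0..t}. 0 \<le> x (min u t0) i + R i i * c + (\<Sum>j\<in>{..<d} - {i}. R i j * y (min u t0) j)"
 show "y (min t t0) i \<le> c"
 proof (rule rsolD(4)[OF y i])
  fix u assume "0 \<le> u" "u \<le> min t t0"
  then show "0 \<le> x u i + R i i * c + (\<Sum>j\<in>{..<d} - {i}. R i j * y u j)"
   using *[rule_format, of u] by (simp add: min_absorb1)
 qed (use t t0 in auto)
next
 fix i t assume i: "i < d" and t: "0 \<le> (t::real)"
 then have m: "0 \<le> min t t0" using t0 by simp
 show "0 \<le> y (min t t0) i" by (rule rsolD(1)[OF y i m])
 show "0 \<le> x (min t t0) i + (\<Sum>j<d. R i j * y (min t t0) j)" by (rule rsolD(3)[OF y i m])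
next
 fix i and s t :: real assume i: "i < d" and "0 \<le> s \<and> s \<le> t"
 then have "0 \<le> min s t0" "min s t0 \<le> min t t0" using t0 by auto
 then show "y (min s t0) i \<le> y (min t t0) i" by (rule rsolD(2)[OF y i])
qed

text \<open>The regulator stopped at \<open>s\<close> is a regulator of the input stopped at
  \<open>s\<close>. Up to time \<open>t\<close> the stopped and the original input differ by at most
  \<open>\<kappa>\<close>, so the Lipschitz bound turns into a modulus of continuity.\<close>

lemma rsol_modulus:
 assumes R: "Mmat d R w" and y: "rsol d R x y" and st: "0 \<le> s" "s \<le> t" and i: "i < d" and \<kappa>: "0 \<le> \<kappa>"
  and x: "\<And>u j. s \<le> u \<Longrightarrow> u \<le> t \<Longrightarrow> j < d \<Longrightarrow> \<bar>x u j - x s j\<bar> \<le> \<kappa>"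
 shows "\<bar>y t i - y s i\<bar> \<le> \<kappa> * w i"
proof -
 have "\<bar>y t i - y (min t s) i\<bar> \<le> \<kappa> * w i"
 proof (rule rsol_lipschitz[OF R y rsol_stop[OF y st(1)] \<kappa>, of t])
  fix v j assume v: "0 \<le> v" "v \<le> t" "j < d"
  then show "\<bar>x v j - x (min v s) j\<bar> \<le> \<kappa>"
   using x[of v j] \<kappa> by (cases "v \<le> s") (auto simp: min_def)
 qed (use st i in auto)
 then show ?thesis using st by (simp add: min_absorb2)
qed

lemma rsol_cpath:
 assumes R: "Mmat d R w" and y: "rsol d R x y" and x: "cpath d x"
 shows "cpath d y" unfolding cpath_def
proof (intro allI impI)
 fix i assume i: "i < d"
 have w: "w i > 0" using R i by (simp add: Mmat_def)
 show "continuous_on {0..} (\<lambda>t. y t i)" unfolding continuous_on_iff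
 proof (intro ballI allI impI)
  fix t0 e :: real assume t0: "t0 \<in> {0..}" and e: "e > 0"
  \<comment> \<open>Measuring the oscillation from \<open>min t t0\<close> instead of
    \<open>t0\<close> doubles it to \<open>2 \<kappa>\<close>, so the regulator moves by at most
    \<open>e / 2\<close>.\<close>
  define \<kappa> where "\<kappa> = e / (4 * w i)"
  have \<kappa>: "\<kappa> > 0" using e w by (simp add: \<kappa>_def)
  have "\<forall>\<^sub>F t in at t0 within {0..}. \<forall>j\<in>{..<d}. dist (x t j) (x t0 j) < \<kappa>"
   using x t0 \<kappa> unfolding cpath_def continuous_on_def by (intro eventually_ball_finite) (auto intro!: tendstoD)
  then obtain \<delta> where \<delta>: "\<delta> > 0"
   "\<And>t j. 0 \<le> t \<Longrightarrow> t \<noteq> t0 \<Longrightarrow> dist t t0 < \<delta> \<Longrightarrow> j < d \<Longrightarrow> dist (x t j) (x t0 j) < \<kappa>"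
   unfolding eventually_at by auto
  have x0: "\<bar>x t j - x t0 j\<bar> < \<kappa>" if "0 \<le> t" "dist t t0 < \<delta>" "j < d" for t j
   using \<delta>(2)[of t j] that \<kappa> by (cases "t = t0") (auto simp: dist_real_def)
  have "dist (y t i) (y t0 i) < e" if t: "0 \<le> t" "dist t t0 < \<delta>" for t
  proof -
   have lo: "0 \<le> min t t0" using t t0 by auto
   have "\<bar>y (max t t0) i - y (min t t0) i\<bar> \<le> (2 * \<kappa>) * w i"
   proof (rule rsol_modulus[OF R y lo _ i])
    fix u j assume u: "min t t0 \<le> u" "u \<le> max t t0" "j < d"
    have d1: "dist u t0 < \<delta>" "dist (min t t0) t0 < \<delta>" using t u \<delta>(1) by (auto simp: dist_real_def)
    have "0 \<le> u" using lo u by linarith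
    then show "\<bar>x u j - x (min t t0) j\<bar> \<le> 2 * \<kappa>"
     using x0[OF _ d1(1) u(3)] x0[OF lo d1(2) u(3)] by linarith
   qed (use \<kappa> in auto)
   also have "(2 * \<kappa>) * w i < e" using w e by (simp add: \<kappa>_def field_simps)
   finally show ?thesis by (auto simp: dist_real_def max_def min_def abs_minus_commute split: if_splits)
  qed
  then show "\<exists>\<delta>>0. \<forall>t\<in>{0..}. dist t t0 < \<delta> \<longrightarrow> dist (y t i) (y t0 i) < e"
   using \<delta>(1) by (auto intro!: exI[of _ \<delta>])
 qed
qed

lemma cpath_bounded:
 assumes "cpath d x"
 shows "\<exists>m\<ge>0. \<forall>u\<in>{0..T}. \<forall>i<d. \<bar>x u i\<bar> \<le> m"
proof -
 have "\<exists>m. \<forall>u\<in>{0..T}. \<bar>x u i\<bar> \<le> m" if "i < d" for i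
 proof -
  have "compact ((\<lambda>u. x u i) ` {0..T})"
   using assms that unfolding cpath_def by (intro compact_continuous_image) (auto intro: continuous_on_subset)
  then show ?thesis using compact_imp_bounded by (fastforce simp: bounded_iff)
 qed
 then obtain m where m: "\<And>i u. i < d \<Longrightarrow> u \<in> {0..T} \<Longrightarrow> \<bar>x u i\<bar> \<le> m i" by metis
 have "\<bar>x u i\<bar> \<le> (\<Sum>i<d. \<bar>m i\<bar>)" if "i < d" "u \<in> {0..T}" for u i
  using m[OF that] member_le_sum[of i "{..<d}" "\<lambda>i. \<bar>m i\<bar>"] that by auto
 then show ?thesis by (intro exI[of _ "\<Sum>i<d. \<bar>m i\<bar>"]) (auto intro: sum_nonneg)
qed

text \<open>The regulator is the pointwise infimum of all feasible ones, those that are nonnegative,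
  monotone and keep the reflected path nonnegative. Since off-diagonal entries are nonpositive,
  lowering the other coordinates only helps a row, and therefore the infimum is feasible
  again.\<close>

lemma rsol_exists:
 assumes R: "Mmat d R w" and x: "cpath d x"
 shows "\<exists>y. rsol d R x y"
proof -
 define \<Theta> where "\<Theta> = {v. \<forall>i<d. (\<forall>t\<ge>0. 0 \<le> v t i) \<and> (\<forall>s t. 0 \<le> s \<and> s \<le> t \<longrightarrow> v s i \<le> v t i) \<and>
   (\<forall>t\<ge>0. 0 \<le> x t i + (\<Sum>j<d. R i j * v t j))}"
 have \<Theta>: "0 \<le> t \<Longrightarrow> 0 \<le> v t i" "0 \<le> s \<Longrightarrow> s \<le> t \<Longrightarrow> v s i \<le> v t i"
  "0 \<le> t \<Longrightarrow> 0 \<le> x t i + (R i i * v t i + (\<Sum>j\<in>{..<d}-{i}. R i j * v t j))" if "v \<in> \<Theta>" "i < d" for v i s t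
 proof -
  have "(\<forall>t\<ge>0. 0 \<le> v t i) \<and> (\<forall>s t. 0 \<le> s \<and> s \<le> t \<longrightarrow> v s i \<le> v t i) \<and> (\<forall>t\<ge>0. 0 \<le> x t i + (\<Sum>j<d. R i j * v t j))"
   using that unfolding \<Theta>_def by blast
  then show "0 \<le> t \<Longrightarrow> 0 \<le> v t i" "0 \<le> s \<Longrightarrow> s \<le> t \<Longrightarrow> v s i \<le> v t i"
   "0 \<le> t \<Longrightarrow> 0 \<le> x t i + (R i i * v t i + (\<Sum>j\<in>{..<d}-{i}. R i j * v t j))"
   unfolding sum_remove_lessThan[OF that(2)] by simp_all
 qed
 have Rn: "R i j \<le> 0" if "i < d" "j \<in> {..<d}-{i}" for i j using R that by (auto simp: Mmat_def)
 define m where "m t = (SUP u\<in>{0..t}. \<Sum>i<d. \<bar>x u i\<bar>)" for t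
 have bdd: "bdd_above ((\<lambda>u. \<Sum>i<d. \<bar>x u i\<bar>) ` {0..t})" for t
 proof -
  obtain k where "\<forall>u\<in>{0..t}. \<forall>i<d. \<bar>x u i\<bar> \<le> k" using cpath_bounded[OF x] by blast
  then have "(\<Sum>i<d. \<bar>x u i\<bar>) \<le> (\<Sum>i<d. k)" if "u \<in> {0..t}" for u using that by (intro sum_mono) auto
  then show ?thesis unfolding bdd_above_def by blast
 qed
 have m: "\<bar>x t i\<bar> \<le> m t" "0 \<le> m t" if "0 \<le> t" "i < d" for t i
 proof -
  have "\<bar>x t i\<bar> \<le> (\<Sum>i<d. \<bar>x t i\<bar>)" by (rule member_le_sum) (use that in auto)
  also have "\<dots> \<le> m t" unfolding m_def by (rule cSUP_upper[OF _ bdd]) (use that in simp)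
  finally show "\<bar>x t i\<bar> \<le> m t" .
  then show "0 \<le> m t" by linarith
 qed
 \<comment> \<open>A feasible element: the running supremum of the size of the input times
   \<open>w\<close>, which dominates the input because \<open>R w \<ge> 1\<close>.\<close>
 have "(\<lambda>t i. m t * w i) \<in> \<Theta>" unfolding \<Theta>_def
 proof (intro CollectI allI impI conjI)
  fix i assume i: "i < d"
  have wi: "0 < w i" "1 \<le> (\<Sum>j<d. R i j * w j)" using R i by (simp_all add: Mmat_def)
  show "0 \<le> m t * w i" if "0 \<le> t" for t using m(2)[OF that i] wi by simp
  show "m s * w i \<le> m t * w i" if "0 \<le> s \<and> s \<le> t" for s t
  proof (rule mult_right_mono)
   show "m s \<le> m t" unfolding m_def by (rule cSUP_subset_mono[OF _ bdd]) (use that in auto)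
  qed (use wi in simp)
  fix t :: real assume t: "0 \<le> t"
  have "m t * 1 \<le> m t * (\<Sum>j<d. R i j * w j)" by (rule mult_left_mono[OF wi(2) m(2)[OF t i]])
  also have "\<dots> = (\<Sum>j<d. R i j * (m t * w j))" by (simp add: sum_distrib_left mult.left_commute)
  finally show "0 \<le> x t i + (\<Sum>j<d. R i j * (m t * w j))" using m(1)[OF t i] by linarith
 qed
 then have ne: "\<Theta> \<noteq> {}" by blast
 define y where "y t i = (INF v\<in>\<Theta>. v t i)" for t i
 have y_le: "y t i \<le> v t i" if v: "v \<in> \<Theta>" and t: "0 \<le> t" and i: "i < d" for v t i unfolding y_def
 proof (rule cINF_lower[OF _ v])
  show "bdd_below ((\<lambda>v. v t i) ` \<Theta>)" unfolding bdd_below_def using \<Theta>(1)[OF _ i t] by blast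
 qed
 have y_ge: "c \<le> y t i" if "\<And>v. v \<in> \<Theta> \<Longrightarrow> c \<le> v t i" for c t i
  unfolding y_def by (rule cINF_greatest[OF ne that])
 have y: "0 \<le> t \<Longrightarrow> 0 \<le> y t i" "0 \<le> s \<Longrightarrow> s \<le> t \<Longrightarrow> y s i \<le> y t i"
  "0 \<le> t \<Longrightarrow> 0 \<le> x t i + (R i i * y t i + (\<Sum>j\<in>{..<d}-{i}. R i j * y t j))" if i: "i < d" for i s t
 proof -
  show "0 \<le> y t i" if "0 \<le> t" by (rule y_ge[OF \<Theta>(1)[OF _ i that]])
  show "y s i \<le> y t i" if "0 \<le> s" "s \<le> t" by (rule y_ge, rule order_trans[OF y_le \<Theta>(2)]) (use that i in auto)
  assume t: "0 \<le> t"
  have "(- x t i - (\<Sum>j\<in>{..<d}-{i}. R i j * y t j)) / R i i \<le> y t i"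
  proof (rule y_ge)
   fix v assume v: "v \<in> \<Theta>"
   have "(\<Sum>j\<in>{..<d}-{i}. R i j * v t j) \<le> (\<Sum>j\<in>{..<d}-{i}. R i j * y t j)"
    by (intro sum_mono mult_left_mono_neg y_le[OF v t] Rn[OF i]) auto
   then have "- x t i - (\<Sum>j\<in>{..<d}-{i}. R i j * y t j) \<le> R i i * v t i" using \<Theta>(3)[OF v i t] by linarith
   then show "(- x t i - (\<Sum>j\<in>{..<d}-{i}. R i j * y t j)) / R i i \<le> v t i"
    using Mmat_diag[OF R i] by (simp add: pos_divide_le_eq mult.commute)
  qed
  then have "- x t i - (\<Sum>j\<in>{..<d}-{i}. R i j * y t j) \<le> R i i * y t i"
   using Mmat_diag[OF R i] by (simp add: pos_divide_le_eq mult.commute)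
  then show "0 \<le> x t i + (R i i * y t i + (\<Sum>j\<in>{..<d}-{i}. R i j * y t j))" by linarith
 qed
 have least: "y t i \<le> c" if i: "i < d" and t: "0 \<le> t" and c: "0 \<le> c"
  and cu: "\<forall>u\<in>{0..t}. 0 \<le> x u i + R i i * c + (\<Sum>j\<in>{..<d}-{i}. R i j * y u j)" for i t c
 proof -
  \<comment> \<open>Capping \<open>y_i\<close> at \<open>c\<close> up to time \<open>t\<close> keeps
    feasibility: in row \<open>i\<close> by the assumption on \<open>c\<close>, in the other rows by
    the sign of the entries. The infimum lies below the capped path.\<close>
  define v where "v s k = (if k = i \<and> s \<le> t then min (y s i) c else y s k)" for s k
  have vy: "v s k \<le> y s k" for s k by (simp add: v_def)
  have "v \<in> \<Theta>" unfolding \<Theta>_def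
  proof (intro CollectI allI impI conjI)
   fix k assume k: "k < d"
   show "0 \<le> v s k" if "0 \<le> s" for s using y(1)[OF k that] c by (cases "k = i") (simp_all add: v_def)
   show "v r k \<le> v s k" if "0 \<le> r \<and> r \<le> s" for r s
   proof -
    have rs: "y r k \<le> y s k" using y(2)[OF k] that by blast
    show ?thesis
    proof (cases "k = i \<and> s \<le> t")
     case True
     then have "r \<le> t" using that by linarith
     then show ?thesis using True min.mono[OF rs order_refl, of c] by (simp add: v_def)
    next
     case False
     then have "v s k = y s k" unfolding v_def by (rule if_not_P)
     then show ?thesis using vy[of r k] rs by linarith
    qed
   qed
   fix s :: real assume s: "0 \<le> s"
   have sum: "(\<Sum>j\<in>{..<d}-{k}. R k j * y s j) \<le> (\<Sum>j\<in>{..<d}-{k}. R k j * v s j)"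
    by (intro sum_mono mult_left_mono_neg vy Rn[OF k])
   have "0 \<le> x s k + (R k k * v s k + (\<Sum>j\<in>{..<d}-{k}. R k j * y s j))"
   proof (cases "k = i \<and> s \<le> t \<and> c < y s i")
    case True
    then have "v s k = c" by (simp add: v_def)
    moreover have "0 \<le> x s i + R i i * c + (\<Sum>j\<in>{..<d}-{i}. R i j * y s j)" using cu s True by simp
    ultimately show ?thesis using True by simp
   next
    case False
    then have "v s k = y s k" unfolding v_def min_def by (cases "k = i \<and> s \<le> t") auto
    then show ?thesis using y(3)[OF k s] by simp
   qed
   then show "0 \<le> x s k + (\<Sum>j<d. R k j * v s j)" unfolding sum_remove_lessThan[OF k] using sum by linarith
  qed
  from y_le[OF this t i] show ?thesis by (simp add: v_def)
 qed
 have "rsol d R x y" unfolding rsol_def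
 proof (intro allI impI conjI)
  fix i assume i: "i < d"
  show "0 \<le> y t i" if "0 \<le> t" for t by (rule y(1)[OF i that])
  show "y s i \<le> y t i" if "0 \<le> s \<and> s \<le> t" for s t using y(2)[OF i] that by blast
  show "0 \<le> x t i + (\<Sum>j<d. R i j * y t j)" if "0 \<le> t" for t
   unfolding sum_remove_lessThan[OF i] by (rule y(3)[OF i that])
  show "y t i \<le> c" if "0 \<le> t" "0 \<le> c" "\<forall>u\<in>{0..t}. 0 \<le> x u i + R i i * c + (\<Sum>j\<in>{..<d} - {i}. R i j * y u j)" for t c
   by (rule least[OF i that])
 qed
 then show ?thesis by blast
qed

text \<open>The complementarity form of the problem, with constancy on intervals where the reflected
  coordinate is positive in place of an integral against \<open>dy_i\<close>. It refers only to
  \<open>y_i\<close> and the sign of the reflected coordinate, so it carries over directly to a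
  block of coordinates after elimination.\<close>

definition refl_sol :: "nat \<Rightarrow> fmat \<Rightarrow> rpath \<Rightarrow> rpath \<Rightarrow> bool" where
 "refl_sol d R x y \<longleftrightarrow> cpath d y \<and>
   (\<forall>i<d. (\<forall>t\<ge>0. 0 \<le> y t i) \<and> (\<forall>s t. 0 \<le> s \<and> s \<le> t \<longrightarrow> y s i \<le> y t i) \<and>
    (\<forall>t\<ge>0. 0 \<le> x t i + (\<Sum>j<d. R i j * y t j)) \<and>
    (\<forall>p q. 0 \<le> p \<and> p \<le> q \<and> (\<forall>u\<in>{p..q}. 0 < x u i + (\<Sum>j<d. R i j * y u j)) \<longrightarrow> y q i = y p i) \<and>
    (0 < x 0 i + (\<Sum>j<d. R i j * y 0 j) \<longrightarrow> y 0 i = 0))"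

text \<open>If the reflected coordinate is at least \<open>R_ii \<delta>\<close> on
  \<open>[p, q]\<close>, then \<open>max (y p i) (y q i - \<delta>)\<close> is an admissible level
  up to \<open>q\<close>, so minimality excludes any growth on the interval. The same argument with
  level \<open>max 0 (y 0 i - \<delta>)\<close> settles time 0.\<close>

lemma rsol_imp_refl_sol:
 assumes R: "Mmat d R w" and y: "rsol d R x y" and x: "cpath d x"
 shows "refl_sol d R x y"
proof -
 note cy = rsol_cpath[OF R y x]
 have flat: "y q i = y p i" if i: "i < d" and pq: "0 \<le> p" "p \<le> q"
   and z: "\<forall>u\<in>{p..q}. 0 < x u i + (\<Sum>j<d. R i j * y u j)" for p q i
 proof -
  have "continuous_on {p..q} (\<lambda>u. x u i + (\<Sum>j<d. R i j * y u j))" using x cy i pq unfolding cpath_def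
   by (intro continuous_intros) (auto intro: continuous_on_subset[of "{0..}"])
  then obtain u0 where u0: "u0 \<in> {p..q}"
   "\<And>u. u \<in> {p..q} \<Longrightarrow> x u0 i + (\<Sum>j<d. R i j * y u0 j) \<le> x u i + (\<Sum>j<d. R i j * y u j)"
   using continuous_attains_inf[of "{p..q}" "\<lambda>u. x u i + (\<Sum>j<d. R i j * y u j)"] pq by auto
  define \<delta> where "\<delta> = (x u0 i + (\<Sum>j<d. R i j * y u0 j)) / R i i"
  note D = Mmat_diag[OF R i]
  have \<delta>: "\<delta> > 0" using z u0(1) D by (simp add: \<delta>_def)
  have "y q i \<le> max (y p i) (y q i - \<delta>)"
  proof (rule rsolD(4)[OF y i])
   show "0 \<le> max (y p i) (y q i - \<delta>)" using rsolD(1)[OF y i pq(1)] by simp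
   fix u assume u: "0 \<le> u" "u \<le> q"
   have z': "0 \<le> x u i + R i i * y u i + (\<Sum>j\<in>{..<d} - {i}. R i j * y u j)"
    using rsolD(3)[OF y i u(1)] by (simp add: sum_remove_lessThan[OF i])
   show "0 \<le> x u i + R i i * max (y p i) (y q i - \<delta>) + (\<Sum>j\<in>{..<d} - {i}. R i j * y u j)"
   proof (cases "u \<le> p")
    case True
    have "R i i * y u i \<le> R i i * max (y p i) (y q i - \<delta>)"
     using rsolD(2)[OF y i u(1) True] D by (intro mult_left_mono) auto
    then show ?thesis using z' by linarith
   next
    case False
    then have "R i i * \<delta> \<le> x u i + (\<Sum>j<d. R i j * y u j)" using u0(2)[of u] u D by (simp add: \<delta>_def)
    then have "R i i * \<delta> \<le> x u i + R i i * y u i + (\<Sum>j\<in>{..<d} - {i}. R i j * y u j)"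
     by (simp add: sum_remove_lessThan[OF i])
    moreover have "R i i * y u i - R i i * \<delta> \<le> R i i * max (y p i) (y q i - \<delta>)"
     using rsolD(2)[OF y i u] D unfolding right_diff_distrib[symmetric] by (intro mult_left_mono) auto
    ultimately show ?thesis by linarith
   qed
  qed (use pq in auto)
  then have "y q i \<le> y p i" using \<delta> by (auto simp: max_def split: if_splits)
  then show ?thesis using rsolD(2)[OF y i pq] by linarith
 qed
 have init: "y 0 i = 0" if i: "i < d" and z: "0 < x 0 i + (\<Sum>j<d. R i j * y 0 j)" for i
 proof -
  note D = Mmat_diag[OF R i]
  define \<delta> where "\<delta> = (x 0 i + (\<Sum>j<d. R i j * y 0 j)) / R i i"
  have \<delta>: "\<delta> > 0" using z D by (simp add: \<delta>_def)
  have "y 0 i \<le> max 0 (y 0 i - \<delta>)"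
  proof (rule rsolD(4)[OF y i])
   fix u :: real assume "0 \<le> u" "u \<le> 0"
   then have u: "u = 0" by simp
   have "R i i * (y 0 i - \<delta>) \<le> R i i * max 0 (y 0 i - \<delta>)" using D by (intro mult_left_mono) auto
   moreover have "R i i * \<delta> = x 0 i + R i i * y 0 i + (\<Sum>j\<in>{..<d} - {i}. R i j * y 0 j)"
    using D by (simp add: \<delta>_def sum_remove_lessThan[OF i])
   ultimately show "0 \<le> x u i + R i i * max 0 (y 0 i - \<delta>) + (\<Sum>j\<in>{..<d} - {i}. R i j * y u j)"
    unfolding u by (simp add: right_diff_distrib)
  qed auto
  then show ?thesis using \<delta> rsolD(1)[OF y i, of 0] by (auto simp: max_def split: if_splits)
 qed
 show ?thesis unfolding refl_sol_def
 proof (intro conjI allI impI)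
  fix i p q assume i: "i < d" and a: "0 \<le> p \<and> p \<le> q \<and> (\<forall>u\<in>{p..q}. 0 < x u i + (\<Sum>j<d. R i j * y u j))"
  show "y q i = y p i" by (rule flat) (use i a in auto)
 qed (use cy init rsolD(1-3)[OF y] in auto)
qed

text \<open>If \<open>y_i\<close> passed an admissible level \<open>c\<close>, the intermediate
  value theorem would give a time \<open>p\<close> at which it is halfway between \<open>c\<close>
  and \<open>y t i\<close>. Above \<open>c\<close> the reflected coordinate is positive, so
  \<open>y_i\<close> would have to be constant on \<open>[p, t]\<close>.\<close>

lemma refl_sol_imp_rsol:
 assumes R: "Mmat d R w" and y: "refl_sol d R x y"
 shows "rsol d R x y" unfolding rsol_def
proof (intro allI impI conjI)
 fix i t c assume i: "i < d" and t: "0 \<le> t" and c: "0 \<le> (c::real)"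
  and *: "\<forall>u\<in>{0..t}. 0 \<le> x u i + R i i * c + (\<Sum>j\<in>{..<d} - {i}. R i j * y u j)"
 note D = Mmat_diag[OF R i]
 have flat: "y q i = y p i" if "0 \<le> p" "p \<le> q" "\<forall>u\<in>{p..q}. 0 < x u i + (\<Sum>j<d. R i j * y u j)" for p q
  using y i that unfolding refl_sol_def by blast
 have mono: "y p i \<le> y q i" if "0 \<le> p" "p \<le> q" for p q using y i that unfolding refl_sol_def by blast
 have z: "0 < x u i + (\<Sum>j<d. R i j * y u j)" if "u \<in> {0..t}" "y u i > c" for u
 proof -
  have "R i i * c < R i i * y u i" using that D by simp
  then show ?thesis using *[rule_format, OF that(1)] by (simp add: sum_remove_lessThan[OF i])
 qed
 show "y t i \<le> c"
 proof (rule ccontr)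
  assume "\<not> y t i \<le> c"
  then have yt: "y t i > c" by simp
  show False
  proof (cases "y 0 i > c")
   case True
   then have "0 < x 0 i + (\<Sum>j<d. R i j * y 0 j)" using z[of 0] t by simp
   then have "y 0 i = 0" using y i unfolding refl_sol_def by blast
   then show False using True c by simp
  next
   case False
   have "continuous_on {0..t} (\<lambda>u. y u i)"
    using y i unfolding refl_sol_def cpath_def by (auto intro: continuous_on_subset)
   then obtain p where p: "0 \<le> p" "p \<le> t" "y p i = (c + y t i) / 2"
    using IVT'[of "\<lambda>u. y u i" 0 "(c + y t i) / 2" t] False yt t by auto
   have "y t i = y p i"
   proof (rule flat[OF p(1,2)], intro ballI z)
    fix u assume "u \<in> {p..t}"
    then show "u \<in> {0..t}" "c < y u i" using p yt mono[of p u] by auto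
   qed
   then show False using p yt by simp
  qed
 qed
qed (use y in \<open>auto simp: refl_sol_def\<close>)

text \<open>A chosen solution, determined at \<open>t \<ge> 0\<close> and \<open>i < d\<close> by
  \<open>rsol_unique\<close> when \<open>Mmat\<close> holds and the input is continuous; other
  values are arbitrary, hence the congruence lemmas below.\<close>

definition rmap :: "nat \<Rightarrow> fmat \<Rightarrow> rpath \<Rightarrow> real \<Rightarrow> nat \<Rightarrow> real" where
 "rmap d R x = (SOME y. rsol d R x y)"

definition zmap :: "nat \<Rightarrow> fmat \<Rightarrow> rpath \<Rightarrow> real \<Rightarrow> nat \<Rightarrow> real" where
 "zmap d R x t i = x t i + (\<Sum>j<d. R i j * rmap d R x t j)"

lemma rsol_rmap: "Mmat d R w \<Longrightarrow> cpath d x \<Longrightarrow> rsol d R x (rmap d R x)"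
 unfolding rmap_def by (rule someI_ex[OF rsol_exists])

lemma zmap_eqI:
 assumes "Mmat d R w" "rsol d R x' y" "cpath d x" "\<And>t i. 0 \<le> t \<Longrightarrow> i < d \<Longrightarrow> x t i = x' t i" "0 \<le> t" "i < d"
 shows "zmap d R x t i = x' t i + (\<Sum>j<d. R i j * y t j)" unfolding zmap_def
 using rsol_unique[OF assms(1) rsol_rmap[OF assms(1,3)] assms(2) assms(4) assms(5)] assms by simp

lemma cpath_zmap:
 assumes "Mmat d R w" "cpath d x" shows "cpath d (zmap d R x)"
 using assms(2) rsol_cpath[OF assms(1) rsol_rmap[OF assms] assms(2)]
 unfolding cpath_def zmap_def by (auto intro!: continuous_intros)

lemma lunif_zmap:
 assumes R: "Mmat d R w" and "\<And>n. cpath d (xs n)" "cpath d x" "lunif d xs x"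
 shows "lunif d (\<lambda>n. zmap d R (xs n)) (zmap d R x)"
proof (rule lunifI)
 fix T i assume i: "i < d" and T: "T > (0::real)"
 \<comment> \<open>The Lipschitz constant of the reflected coordinate: one for the input, and
   \<open>|R_ij| w_j\<close> for each regulator.\<close>
 define C where "C = 1 + (\<Sum>j<d. \<bar>R i j\<bar> * w j)"
 have w: "w j > 0" if "j < d" for j using R that by (simp add: Mmat_def)
 have C: "C > 0" unfolding C_def using w by (intro add_pos_nonneg sum_nonneg) (auto simp: less_imp_le)
 have *: "\<bar>zmap d R (xs n) t i - zmap d R x t i\<bar> \<le> C * \<kappa>"
  if k: "\<forall>t\<in>{0..T}. \<forall>i<d. \<bar>xs n t i - x t i\<bar> \<le> \<kappa>" "0 \<le> \<kappa>" and t: "t \<in> {0..T}" for n t \<kappa>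
 proof -
  have y: "\<bar>rmap d R (xs n) t j - rmap d R x t j\<bar> \<le> \<kappa> * w j" if "j < d" for j
   by (rule rsol_lipschitz[OF R rsol_rmap[OF R assms(2)] rsol_rmap[OF R assms(3)] k(2), where T=T]) (use k t that in auto)
  have "\<bar>zmap d R (xs n) t i - zmap d R x t i\<bar> = \<bar>(xs n t i - x t i) + (\<Sum>j<d. R i j * (rmap d R (xs n) t j - rmap d R x t j))\<bar>"
   unfolding zmap_def by (simp add: algebra_simps sum_subtractf)
  also have "\<dots> \<le> \<bar>xs n t i - x t i\<bar> + (\<Sum>j<d. \<bar>R i j\<bar> * \<bar>rmap d R (xs n) t j - rmap d R x t j\<bar>)"
   by (intro order_trans[OF abs_triangle_ineq] add_mono order_refl order_trans[OF sum_abs]) (simp add: abs_mult)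
  also have "\<dots> \<le> \<kappa> + (\<Sum>j<d. \<bar>R i j\<bar> * (\<kappa> * w j))"
   by (intro add_mono sum_mono mult_left_mono y) (use k t i in auto)
  also have "\<dots> = C * \<kappa>" unfolding C_def by (simp add: algebra_simps sum_distrib_left)
  finally show ?thesis .
 qed
 define c where "c n = (SUP t\<in>{0..T}. \<bar>zmap d R (xs n) t i - zmap d R x t i\<bar>)" for n
 have bdd: "bdd_above ((\<lambda>t. \<bar>zmap d R (xs n) t i - zmap d R x t i\<bar>) ` {0..T})" for n
 proof -
  obtain m1 m2 where m: "m1 \<ge> 0" "\<And>u i. u \<in> {0..T} \<Longrightarrow> i < d \<Longrightarrow> \<bar>xs n u i\<bar> \<le> m1"
   "m2 \<ge> 0" "\<And>u i. u \<in> {0..T} \<Longrightarrow> i < d \<Longrightarrow> \<bar>x u i\<bar> \<le> m2"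
   using cpath_bounded[OF assms(2)[of n], of T] cpath_bounded[OF assms(3), of T] by auto
  have "\<forall>t\<in>{0..T}. \<forall>i<d. \<bar>xs n t i - x t i\<bar> \<le> m1 + m2"
   by (intro ballI allI impI order_trans[OF abs_triangle_ineq4] add_mono m(2,4))
  from *[OF this] have "\<And>t. t \<in> {0..T} \<Longrightarrow> \<bar>zmap d R (xs n) t i - zmap d R x t i\<bar> \<le> C * (m1 + m2)"
   using m(1,3) by simp
  then show ?thesis unfolding bdd_above_def by blast
 qed
 have "c \<longlonglongrightarrow> 0"
 proof (rule LIMSEQ_I)
  fix e :: real assume e: "e > 0"
  have "\<forall>\<^sub>F n in sequentially. \<forall>t\<in>{0..T}. \<forall>i<d. \<bar>xs n t i - x t i\<bar> < e / (2 * C)"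
   using lunifD[OF assms(4)] e C by simp
  then obtain N where N: "\<And>n. n \<ge> N \<Longrightarrow> \<forall>t\<in>{0..T}. \<forall>i<d. \<bar>xs n t i - x t i\<bar> < e / (2 * C)"
   by (auto simp: eventually_sequentially)
  have "norm (c n - 0) < e" if "n \<ge> N" for n
  proof -
   have "c n \<le> C * (e / (2 * C))" unfolding c_def
   proof (rule cSUP_least)
    fix t assume "t \<in> {0..T}"
    then show "\<bar>zmap d R (xs n) t i - zmap d R x t i\<bar> \<le> C * (e / (2 * C))"
     using N[OF that] e C by (intro *) (auto intro: less_imp_le)
   qed (use T in simp)
   moreover have "0 \<le> c n" unfolding c_def by (rule order_trans[OF _ cSUP_upper[OF _ bdd, of 0]]) (use T in auto)
   ultimately show ?thesis using C e by (simp add: field_simps)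
  qed
  then show "\<exists>N. \<forall>n\<ge>N. norm (c n - 0) < e" by blast
 qed
 moreover have "\<bar>zmap d R (xs n) t i - zmap d R x t i\<bar> \<le> c n" if "t \<in> {0..T}" for n t
  unfolding c_def by (rule cSUP_upper[OF that bdd])
 ultimately show "\<exists>c. c \<longlonglongrightarrow> 0 \<and> (\<forall>\<^sub>F n in sequentially. \<forall>t\<in>{0..T}. \<bar>zmap d R (xs n) t i - zmap d R x t i\<bar> \<le> c n)"
  by (intro exI[of _ c]) auto
qed

section \<open>Equivalence with the Skorokhod problem\<close>

text \<open>If \<open>f\<close> exceeds \<open>c\<close> at time \<open>t\<close>, then
  \<open>df\<close> gives mass at least \<open>f t - c\<close> to the set in \<open>[0, t]\<close>
  where \<open>f > c\<close>. There \<open>g \<ge> \<eta>\<close>, so the integral of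
  \<open>g\<close> could not vanish.\<close>

lemma interval_measure_not_flat:
 fixes f g :: "real \<Rightarrow> real"
 assumes mono: "\<And>s t. 0 \<le> s \<Longrightarrow> s \<le> t \<Longrightarrow> f s \<le> f t" and f0: "f 0 = 0"
  and rc: "\<And>a. 0 \<le> a \<Longrightarrow> (f \<longlongrightarrow> f a) (at_right a)"
  and int: "(\<integral>\<^sup>+ t\<in>{0..}. ennreal (g t) \<partial>interval_measure (\<lambda>t. f (max 0 t))) = 0"
  and t: "0 \<le> t" and c: "0 \<le> c" "c < f t" and \<eta>: "0 < \<eta>"
  and g: "\<And>u. 0 \<le> u \<Longrightarrow> u \<le> t \<Longrightarrow> c < f u \<Longrightarrow> \<eta> \<le> g u"
 shows False
proof -
 define F where "F t = f (max 0 t)" for t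
 define M where "M = interval_measure F"
 have Fm: "F s \<le> F t" if "s \<le> t" for s t unfolding F_def by (rule mono) (use that in auto)
 have Fr: "continuous (at_right a) F" for a
 proof (cases "0 \<le> a")
  case True
  have "\<forall>\<^sub>F u in at_right a. f u = F u"
   unfolding eventually_at_filter by (rule always_eventually) (use True in \<open>auto simp: F_def\<close>)
  moreover have "(f \<longlongrightarrow> F a) (at_right a)" using rc[OF True] True by (simp add: F_def)
  ultimately show ?thesis unfolding continuous_within by (rule Lim_transform_eventually[rotated])
 next
  case False
  have "\<forall>\<^sub>F u in at_right a. u < 0" using False by (intro order_tendstoD(2)[OF tendsto_ident_at]) auto
  then have "\<forall>\<^sub>F u in at_right a. f 0 = F u" by eventually_elim (simp add: F_def)
  moreover have "((\<lambda>_. f 0) \<longlongrightarrow> F a) (at_right a)" using False by (simp add: F_def max_def)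
  ultimately show ?thesis unfolding continuous_within by (rule Lim_transform_eventually[rotated])
 qed
 have [measurable]: "F \<in> borel_measurable borel" by (rule borel_measurable_mono) (auto simp: mono_def Fm)
 have Ioc: "emeasure M {a<..b} = ennreal (F b - F a)" if "a \<le> b" for a b
  unfolding M_def by (rule emeasure_interval_measure_Ioc[OF that Fm Fr]) 
 have sM [simp]: "sets M = sets borel" "space M = UNIV" by (simp_all add: M_def)
 have F1: "F (-1) = 0" by (simp add: F_def f0)
 have Ioc1: "emeasure M {-1<..b} \<le> ennreal c" if "F b \<le> c" for b
 proof (cases "-1 \<le> b")
  case True then show ?thesis using that by (simp add: Ioc F1 ennreal_leI)
 qed simp
 \<comment> \<open>The half-open intervals start at \<open>-1\<close> so that time 0 belongs to
   them; the extension of \<open>f\<close> to negative times is zero there.\<close>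
 define L where "L = {u \<in> {-1<..t}. F u \<le> c}"
 define U where "U = {u \<in> {-1<..t}. c < F u}"
 have [measurable]: "L \<in> sets M" "U \<in> sets M" unfolding L_def U_def by auto
 have L0: "0 \<in> L" using t c f0 by (simp add: L_def F_def)
 have Lb: "bdd_above L" unfolding L_def by (auto simp: bdd_above_def)
 define \<tau> where "\<tau> = Sup L"
 have L\<tau>: "u \<le> \<tau>" if "u \<in> L" for u unfolding \<tau>_def by (rule cSup_upper[OF that Lb])
 have "emeasure M L \<le> ennreal c"
 proof (cases "\<tau> \<in> L")
  case True
  have "emeasure M L \<le> emeasure M {-1<..\<tau>}"
  proof (rule emeasure_mono)
   show "L \<subseteq> {-1<..\<tau>}" proof
    fix u assume "u \<in> L"
    then show "u \<in> {-1<..\<tau>}" using L\<tau>[of u] unfolding L_def by auto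
   qed
  qed simp
  also have "\<dots> \<le> ennreal c" by (rule Ioc1) (use True in \<open>simp add: L_def\<close>)
  finally show ?thesis .
 next
  case False
  \<comment> \<open>Here \<open>F\<close> jumps across the level \<open>c\<close> at
    \<open>\<tau>\<close>, so \<open>L\<close> is exhausted from the left by intervals that end
    before \<open>\<tau>\<close>.\<close>
  define A where "A n = {-1<..\<tau> - inverse (real (Suc n))}" for n
  have "L \<subseteq> (\<Union>n. A n)"
  proof
   fix u assume u: "u \<in> L"
   then have "u < \<tau>" using L\<tau>[OF u] False by (cases "u = \<tau>") auto
   then obtain n where "inverse (real (Suc n)) < \<tau> - u" using reals_Archimedean[of "\<tau> - u"] by auto
   then have "u \<in> A n" using u by (auto simp: A_def L_def)
   then show "u \<in> (\<Union>n. A n)" by blast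
  qed
  then have "emeasure M L \<le> emeasure M (\<Union>n. A n)" by (rule emeasure_mono) (auto simp: A_def)
  also have "\<dots> = (SUP n. emeasure M (A n))"
  proof (rule SUP_emeasure_incseq[symmetric])
   show "incseq A"
   proof (rule incseq_SucI)
    fix n
    have "inverse (real (Suc (Suc n))) \<le> inverse (real (Suc n))" by (rule le_imp_inverse_le) auto
    then have le: "\<tau> - inverse (real (Suc n)) \<le> \<tau> - inverse (real (Suc (Suc n)))" by linarith
    show "A n \<subseteq> A (Suc n)" unfolding A_def using order_trans[OF _ le] by auto
   qed
  qed (auto simp: A_def)
  also have "\<dots> \<le> ennreal c"
  proof (rule SUP_least)
   fix n
   have "\<tau> - inverse (real (Suc n)) < Sup L" by (simp add: \<tau>_def)
   then obtain l where l: "l \<in> L" "\<tau> - inverse (real (Suc n)) < l" using less_cSup_iff[OF _ Lb] L0 by blast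
   then have "F (\<tau> - inverse (real (Suc n))) \<le> c"
    using Fm[of "\<tau> - inverse (real (Suc n))" l] by (auto simp: L_def)
   then show "emeasure M (A n) \<le> ennreal c" unfolding A_def by (rule Ioc1)
  qed
  finally show ?thesis .
 qed
 moreover have "ennreal (f t) = emeasure M L + emeasure M U"
 proof -
  have "{-1<..t} = L \<union> U" "L \<inter> U = {}" by (auto simp: L_def U_def)
  with \<open>L \<in> sets M\<close> \<open>U \<in> sets M\<close> have "emeasure M {-1<..t} = emeasure M L + emeasure M U" using plus_emeasure[of L M U] by simp
  then show ?thesis using t by (simp add: Ioc F1) (simp add: F_def)
 qed
 ultimately have 1: "ennreal (f t) \<le> ennreal c + emeasure M U" by (simp add: add_right_mono)
 have "ennreal \<eta> * emeasure M U = (\<integral>\<^sup>+u. ennreal \<eta> * indicator U u \<partial>M)"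
  using \<open>U \<in> sets M\<close> by (rule nn_integral_cmult_indicator[symmetric])
 also have "\<dots> \<le> (\<integral>\<^sup>+u\<in>{0..}. ennreal (g u) \<partial>M)"
 proof (rule nn_integral_mono)
  fix u
  show "ennreal \<eta> * indicator U u \<le> ennreal (g u) * indicator {0..} u"
  proof (cases "u \<in> U")
   case True
   then have "0 \<le> u" using c f0 by (auto simp: U_def F_def max_def split: if_splits)
   moreover have "c < f u" "u \<le> t" using True \<open>0 \<le> u\<close> by (auto simp: U_def F_def)
   ultimately show ?thesis using True g[of u] by (simp add: ennreal_leI)
  qed simp
 qed
 also have "\<dots> = 0" using int unfolding M_def F_def .
 finally have "emeasure M U = 0" using \<eta> by simp
 with 1 c show False by (simp add: ennreal_le_iff)
qed

lemma mult_mat_vec_index: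
 assumes "A \<in> carrier_mat n m" "v \<in> carrier_vec m" "i < n"
 shows "(A *\<^sub>v v) $ i = (\<Sum>j<m. A $$ (i, j) * v $ j)" using assms by (simp add: scalar_prod_def atLeast0LessThan)

text \<open>If the regulator exceeded an admissible level \<open>c\<close>, then beyond the midpoint
  \<open>c'\<close> between \<open>c\<close> and \<open>y t $ i\<close> the reflected coordinate
  would be at least \<open>A_ii (c' - c)\<close>, although \<open>dy_i\<close> charges that range.
  The argument uses right continuity only and hence covers every cadlag pair.\<close>

lemma skorokhod_imp_rsol:
 assumes sk: "skorokhod d A x z y" and A: "A \<in> carrier_mat d d" and R: "Mmat d (\<lambda>i j. A $$ (i, j)) w"
 shows "rsol d (\<lambda>i j. A $$ (i, j)) (\<lambda>t i. x t $ i) (\<lambda>t i. y t $ i)"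
  and "\<And>t i. 0 \<le> t \<Longrightarrow> i < d \<Longrightarrow> z t $ i = x t $ i + (\<Sum>j<d. A $$ (i, j) * y t $ j)"
proof -
 have sk1: "\<forall>t\<ge>0. nonneg_vec d (z t) \<and> nonneg_vec d (y t) \<and> z t = x t + A *\<^sub>v y t"
  and sk2: "\<forall>j<d. mono_on {0..} (\<lambda>t. y t $ j) \<and> y 0 $ j = 0 \<and>
    (\<integral>\<^sup>+ t\<in>{0..}. ennreal (z t $ j) \<partial>interval_measure (\<lambda>t. y (max 0 t) $ j)) = 0"
  and cad: "cadlag d x" "cadlag d y" using sk unfolding skorokhod_def by blast+
 have cz: "z t \<in> carrier_vec d" "y t \<in> carrier_vec d" "x t \<in> carrier_vec d"
   "z t = x t + A *\<^sub>v y t" and zy: "\<And>i. i < d \<Longrightarrow> 0 \<le> z t $ i" "\<And>i. i < d \<Longrightarrow> 0 \<le> y t $ i" if "0 \<le> t" for t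
 proof -
  have "nonneg_vec d (z t)" "nonneg_vec d (y t)" "z t = x t + A *\<^sub>v y t" using sk1 that by blast+
  moreover have "x t \<in> carrier_vec d" using cad(1) that unfolding cadlag_def by blast
  ultimately show "z t \<in> carrier_vec d" "y t \<in> carrier_vec d" "x t \<in> carrier_vec d" "z t = x t + A *\<^sub>v y t"
   "\<And>i. i < d \<Longrightarrow> 0 \<le> z t $ i" "\<And>i. i < d \<Longrightarrow> 0 \<le> y t $ i"
   unfolding nonneg_vec_def by blast+
 qed
 show z: "z t $ i = x t $ i + (\<Sum>j<d. A $$ (i, j) * y t $ j)" if "0 \<le> t" "i < d" for t i
 proof -
  have "z t $ i = x t $ i + (A *\<^sub>v y t) $ i"
   unfolding cz(4)[OF that(1)] using A that(2) by (intro index_add_vec(1)) simp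
  then show ?thesis by (simp only: mult_mat_vec_index[OF A cz(2)[OF that(1)] that(2)])
 qed
 have mono: "y s $ i \<le> y t $ i" if "0 \<le> s" "s \<le> t" "i < d" for s t i
 proof -
  have "mono_on {0..} (\<lambda>t. y t $ i)" using sk2 that(3) by blast
  then show ?thesis by (rule mono_onD) (use that in auto)
 qed
 show "rsol d (\<lambda>i j. A $$ (i, j)) (\<lambda>t i. x t $ i) (\<lambda>t i. y t $ i)" unfolding rsol_def
 proof (intro allI impI conjI)
  fix i t c assume i: "i < d" and t: "0 \<le> t" and c: "0 \<le> (c::real)"
   and *: "\<forall>u\<in>{0..t}. 0 \<le> x u $ i + A $$ (i, i) * c + (\<Sum>j\<in>{..<d} - {i}. A $$ (i, j) * y u $ j)"
  note D = Mmat_diag[OF R i]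
  show "y t $ i \<le> c"
  proof (rule ccontr)
   assume "\<not> y t $ i \<le> c"
   then have yt: "c < y t $ i" by simp
   define c' where "c' = (c + y t $ i) / 2"
   have c': "0 \<le> c'" "c' < y t $ i" "c < c'" using yt c by (auto simp: c'_def)
   show False
   proof (rule interval_measure_not_flat[of "\<lambda>t. y t $ i" "\<lambda>t. z t $ i" t c' "A $$ (i, i) * (c' - c)"])
    show "y 0 $ i = 0" "(\<integral>\<^sup>+ t\<in>{0..}. ennreal (z t $ i) \<partial>interval_measure (\<lambda>t. y (max 0 t) $ i)) = 0"
     using sk2 i by blast+
    show "((\<lambda>t. y t $ i) \<longlongrightarrow> y a $ i) (at_right a)" if "0 \<le> a" for a
    proof (rule limitin_vec_topologyD[OF _ i])
     show "limitin (vec_topology d) y (y a) (at_right a)" using cad(2) that unfolding cadlag_def by blast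
    qed
    show "A $$ (i, i) * (c' - c) \<le> z u $ i" if u: "0 \<le> u" "u \<le> t" "c' < y u $ i" for u
    proof -
     have "A $$ (i, i) * (c' - c) \<le> A $$ (i, i) * (y u $ i - c)" using u D by (intro mult_left_mono) auto
     also have "\<dots> = A $$ (i, i) * y u $ i - A $$ (i, i) * c" by (rule right_diff_distrib)
     also have "\<dots> \<le> x u $ i + A $$ (i, i) * y u $ i + (\<Sum>j\<in>{..<d} - {i}. A $$ (i, j) * y u $ j)"
      using *[rule_format, of u] u by auto
     also have "\<dots> = z u $ i" using z[OF u(1) i] by (simp add: sum_remove_lessThan[OF i])
     finally show ?thesis .
    qed
   qed (use c' D t mono i in auto)
  qed
 next
  fix i t assume i: "i < d" and t: "0 \<le> (t::real)"
  show "0 \<le> y t $ i" by (rule zy[OF t i])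
  show "0 \<le> x t $ i + (\<Sum>j<d. A $$ (i, j) * y t $ j)" using zy(1)[OF t i] z[OF t i] by simp
 qed (use mono in auto)
qed

text \<open>By continuity, the positive times with \<open>z_j > 0\<close> are covered by countably
  many intervals with rational endpoints on which \<open>z_j\<close> stays positive. There
  \<open>y_j\<close> is constant, so \<open>dy_j\<close> does not charge them; time 0 is null
  because \<open>y_j\<close> is extended constantly to the left.\<close>

lemma refl_sol_imp_skorokhod:
 assumes y: "refl_sol d (\<lambda>i j. A $$ (i, j)) (\<lambda>t i. x t $ i) y"
  and A: "A \<in> carrier_mat d d" and x: "\<And>t. 0 \<le> t \<Longrightarrow> x t \<in> carrier_vec d"
  and cx: "cpath d (\<lambda>t i. x t $ i)" and x0: "\<And>i. i < d \<Longrightarrow> 0 \<le> x 0 $ i"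
  and y0: "\<And>i. i < d \<Longrightarrow> y 0 i = 0"
 shows "skorokhod d A x (\<lambda>t. vec d (\<lambda>i. x t $ i + (\<Sum>j<d. A $$ (i, j) * y t j))) (\<lambda>t. vec d (y t))"
proof -
 define z where "z t i = x t $ i + (\<Sum>j<d. A $$ (i, j) * y t j)" for t i
 have cy: "cpath d y" using y by (simp add: refl_sol_def)
 have cz: "cpath d z" using cx cy unfolding cpath_def z_def by (auto intro!: continuous_intros)
 have y_nn: "0 \<le> y t i" and z_nn: "0 \<le> z t i" if "0 \<le> t" "i < d" for t i
  using y that unfolding refl_sol_def z_def by auto
 have mono: "y s i \<le> y t i" if "0 \<le> s" "s \<le> t" "i < d" for s t i using y that unfolding refl_sol_def by blast
 have flat: "y q i = y p i" if "0 \<le> p" "p \<le> q" "i < d" "\<forall>u\<in>{p..q}. 0 < z u i" for p q i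
  using y that unfolding refl_sol_def z_def by blast
 have dy: "(\<integral>\<^sup>+ t\<in>{0..}. ennreal (z t j) \<partial>interval_measure (\<lambda>t. y (max 0 t) j)) = 0" if j: "j < d" for j
 proof -
  define F where "F t = y (max 0 t) j" for t
  have Fm: "F s \<le> F t" if "s \<le> t" for s t unfolding F_def by (rule mono) (use that j in auto)
  have "continuous_on UNIV F"
  proof -
   have "continuous_on UNIV ((\<lambda>t. y t j) \<circ> (\<lambda>t. max 0 t))" using cy j unfolding cpath_def
    by (intro continuous_on_compose) (auto intro!: continuous_intros intro: continuous_on_subset)
   then show ?thesis by (simp add: F_def comp_def)
  qed
  then have Fr: "continuous (at_right a) F" for a
   by (simp add: continuous_on_eq_continuous_at continuous_at_imp_continuous_within)
  have null: "AE t in interval_measure F. t \<notin> {a<..b}" if "a \<le> b" "F a = F b" for a b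
   by (rule AE_not_in) (use that in \<open>auto simp: null_sets_def emeasure_interval_measure_Ioc[OF that(1) Fm Fr]\<close>)
  have "AE t in interval_measure F. \<forall>p q::rat. 0 \<le> p \<longrightarrow> p \<le> q \<longrightarrow>
    (\<forall>u\<in>{real_of_rat p..real_of_rat q}. 0 < z u j) \<longrightarrow> t \<notin> {real_of_rat p<..real_of_rat q}"
  proof (unfold AE_all_countable, intro allI)
   fix p q :: rat
   show "AE t in interval_measure F. 0 \<le> p \<longrightarrow> p \<le> q \<longrightarrow>
    (\<forall>u\<in>{real_of_rat p..real_of_rat q}. 0 < z u j) \<longrightarrow> t \<notin> {real_of_rat p<..real_of_rat q}"
   proof (cases "0 \<le> p \<and> p \<le> q \<and> (\<forall>u\<in>{real_of_rat p..real_of_rat q}. 0 < z u j)")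
    case True
    then have "F (real_of_rat p) = F (real_of_rat q)"
     using flat[of "real_of_rat p" "real_of_rat q" j] j by (auto simp: F_def of_rat_less_eq max_def)
    from null[OF _ this] True show ?thesis by (auto simp: of_rat_less_eq elim: eventually_mono)
   qed auto
  qed
  moreover have "AE t in interval_measure F. t \<notin> {-1<..0}" by (rule null) (auto simp: F_def)
  ultimately have "AE t in interval_measure F. ennreal (z t j) * indicator {0..} t = 0"
  proof eventually_elim
   case (elim t)
   show ?case
   proof (cases "0 < t")
    case True
    have "\<not> 0 < z t j"
    proof
     assume zt: "0 < z t j"
     have "continuous_on {0..} (\<lambda>t. z t j)" using cz j by (simp add: cpath_def)
     then have "((\<lambda>t. z t j) \<longlongrightarrow> z t j) (at t within {0..})" using True by (simp add: continuous_on_def)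
     then have "\<forall>\<^sub>F u in at t within {0..}. 0 < z u j" using zt by (rule order_tendstoD)
     then obtain \<delta> where \<delta>: "\<delta> > 0" "\<And>u. 0 \<le> u \<Longrightarrow> u \<noteq> t \<Longrightarrow> dist u t < \<delta> \<Longrightarrow> 0 < z u j"
      unfolding eventually_at by auto
     obtain p where p: "max 0 (t - \<delta>) < real_of_rat p" "real_of_rat p < t"
      using of_rat_dense[of "max 0 (t - \<delta>)" t] True \<delta>(1) by auto
     obtain q where q: "t < real_of_rat q" "real_of_rat q < t + \<delta>"
      using of_rat_dense[of t "t + \<delta>"] \<delta>(1) by auto
     have "0 < z u j" if "u \<in> {real_of_rat p..real_of_rat q}" for u
     proof (cases "u = t")
      case False
      then show ?thesis
      proof (rule \<delta>(2)[rotated])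
       have "0 < real_of_rat p" by (rule le_less_trans[OF max.cobounded1 p(1)])
       moreover have "real_of_rat p \<le> u" using that by simp
       ultimately show "0 \<le> u" by linarith
       have "t - \<delta> < u" "u < t + \<delta>" using that p q by auto
       then show "dist u t < \<delta>" unfolding dist_real_def by linarith
      qed
     qed (use zt in simp)
     moreover have "0 \<le> p" "p \<le> q"
     proof -
      have "real_of_rat 0 \<le> real_of_rat p" using p by simp
      then show "0 \<le> p" by (simp only: of_rat_less_eq)
      have "real_of_rat p \<le> real_of_rat q" using p q by simp
      then show "p \<le> q" by (simp only: of_rat_less_eq)
     qed
     moreover have "t \<in> {real_of_rat p<..real_of_rat q}" using p q by auto
     ultimately show False using elim(1) by blast
    qed
    then show ?thesis by (simp add: ennreal_neg)
   next
    case False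
    then show ?thesis using elim(2) by (cases "t = 0") auto
   qed
  qed
  then have "(\<integral>\<^sup>+ t\<in>{0..}. ennreal (z t j) \<partial>interval_measure F) = (\<integral>\<^sup>+ t. 0 \<partial>interval_measure F)"
   by (rule nn_integral_cong_AE)
  then show ?thesis unfolding F_def by simp
 qed
 show ?thesis unfolding skorokhod_def z_def[symmetric]
 proof (intro conjI allI impI)
  show "cadlag d x" by (rule cadlag_cpath[OF cx]) (use x in auto)
  show "nonneg_vec d (x 0)" using x[of 0] x0 by (simp add: nonneg_vec_def)
  show "cadlag d (\<lambda>t. vec d (z t))" by (rule cadlag_cpath[OF cz refl])
  show "cadlag d (\<lambda>t. vec d (y t))" by (rule cadlag_cpath[OF cy refl])
  fix t :: real assume t: "0 \<le> t"
  show "nonneg_vec d (vec d (z t))" "nonneg_vec d (vec d (y t))" using z_nn[OF t] y_nn[OF t] by (auto simp: nonneg_vec_def)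
  show "vec d (z t) = x t + A *\<^sub>v vec d (y t)"
  proof (rule eq_vecI)
   fix i assume "i < dim_vec (x t + A *\<^sub>v vec d (y t))"
   then have i: "i < d" using A by simp
   have "(A *\<^sub>v vec d (y t)) $ i = (\<Sum>j<d. A $$ (i, j) * y t j)"
    using mult_mat_vec_index[OF A, of "vec d (y t)" i] i by simp
   then show "vec d (z t) $ i = (x t + A *\<^sub>v vec d (y t)) $ i" using i A by (simp add: z_def)
  qed (use A in simp)
 next
  fix j assume j: "j < d"
  show "mono_on {0..} (\<lambda>t. vec d (y t) $ j)" using j mono by (auto simp: mono_on_def)
  show "vec d (y 0) $ j = 0" using j y0 by simp
  show "(\<integral>\<^sup>+ t\<in>{0..}. ennreal (vec d (z t) $ j) \<partial>interval_measure (\<lambda>t. vec d (y (max 0 t)) $ j)) = 0"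
   using dy[OF j] j by simp
 qed
qed

lemma rsol_scale:
 assumes y: "rsol d R x y" and ab: "0 < a" "0 < b"
 shows "rsol d R (\<lambda>t i. a * x (b * t) i) (\<lambda>t i. a * y (b * t) i)" unfolding rsol_def
proof (intro allI impI conjI)
 fix i t c assume i: "i < d" and t: "0 \<le> t" and c: "0 \<le> (c::real)"
  and *: "\<forall>u\<in>{0..t}. 0 \<le> a * x (b * u) i + R i i * c + (\<Sum>j\<in>{..<d} - {i}. R i j * (a * y (b * u) j))"
 have "y (b * t) i \<le> c / a"
 proof (rule rsolD(4)[OF y i])
  fix u assume u: "0 \<le> u" "u \<le> b * t"
  then have "u / b \<in> {0..t}" using ab by (simp add: pos_divide_le_eq mult.commute)
  from *[rule_format, OF this] have "0 \<le> (a * x u i + R i i * c + (\<Sum>j\<in>{..<d} - {i}. R i j * (a * y u j))) / a"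
   using ab by simp
  also have "\<dots> = x u i + R i i * (c / a) + (\<Sum>j\<in>{..<d} - {i}. R i j * y u j)"
   using ab by (simp add: add_divide_distrib sum_divide_distrib)
  finally show "0 \<le> x u i + R i i * (c / a) + (\<Sum>j\<in>{..<d} - {i}. R i j * y u j)" .
 qed (use ab t c in auto)
 then show "a * y (b * t) i \<le> c" using ab by (simp add: pos_le_divide_eq mult.commute)
next
 fix i t assume i: "i < d" and t: "0 \<le> (t::real)"
 then have bt: "0 \<le> b * t" using ab by simp
 show "0 \<le> a * y (b * t) i" using rsolD(1)[OF y i bt] ab by simp
 have "a * x (b * t) i + (\<Sum>j<d. R i j * (a * y (b * t) j)) = a * (x (b * t) i + (\<Sum>j<d. R i j * y (b * t) j))"
  by (simp add: distrib_left sum_distrib_left mult.left_commute)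
 then show "0 \<le> a * x (b * t) i + (\<Sum>j<d. R i j * (a * y (b * t) j))" using rsolD(3)[OF y i bt] ab by simp
next
 fix i and s t :: real assume i: "i < d" and st: "0 \<le> s \<and> s \<le> t"
 then show "a * y (b * s) i \<le> a * y (b * t) i" using ab rsolD(2)[OF y i, of "b * s" "b * t"] by simp
qed

lemma cpath_scale:
 assumes "cpath d x" "0 \<le> b"
 shows "cpath d (\<lambda>t i. a * x (b * t) i)" unfolding cpath_def
proof (intro allI impI)
 fix i assume "i < d"
 then have "continuous_on {0..} ((\<lambda>t. x t i) \<circ> (\<lambda>t. b * t))"
  using assms unfolding cpath_def by (intro continuous_on_compose continuous_intros) (auto intro: continuous_on_subset)
 then show "continuous_on {0..} (\<lambda>t. a * x (b * t) i)" by (auto simp: comp_def intro!: continuous_intros)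
qed

lemma zmap_scale:
 assumes R: "Mmat d R w" and x: "cpath d x" and ab: "0 < a" "0 < b" and "0 \<le> t" "i < d"
 shows "zmap d R (\<lambda>t i. a * x (b * t) i) t i = a * zmap d R x (b * t) i"
proof -
 have "zmap d R (\<lambda>t i. a * x (b * t) i) t i = a * x (b * t) i + (\<Sum>j<d. R i j * (a * rmap d R x (b * t) j))"
  by (rule zmap_eqI[OF R rsol_scale[OF rsol_rmap[OF R x] ab]]) (use assms in \<open>auto intro: cpath_scale\<close>)
 also have "\<dots> = a * zmap d R x (b * t) i"
  unfolding zmap_def by (simp add: distrib_left sum_distrib_left mult.left_commute)
 finally show ?thesis .
qed

section \<open>M-matrices, Schur complements and covariance blocks\<close>

lemma spectral_radius_smult_less:
 assumes B: "B \<in> carrier_mat d d" and d: "0 < d" and r: "spectral_radius B < r" "0 < r"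
 shows "spectral_radius (complex_of_real (1 / r) \<cdot>\<^sub>m B) < 1"
proof -
 let ?A = "complex_of_real (1 / r) \<cdot>\<^sub>m B"
 have A: "?A \<in> carrier_mat d d" using B by simp
 from spectral_radius_mem_max(1)[OF A d] obtain l where l: "eigenvalue ?A l" "spectral_radius ?A = norm l"
  unfolding spectrum_def by auto
 from l(1) obtain v where v: "v \<in> carrier_vec d" "v \<noteq> 0\<^sub>v d" "?A *\<^sub>v v = l \<cdot>\<^sub>v v"
  unfolding eigenvalue_def eigenvector_def using A by auto
 have "B *\<^sub>v v = (complex_of_real r * l) \<cdot>\<^sub>v v"
 proof (rule eq_vecI)
  fix i assume "i < dim_vec ((complex_of_real r * l) \<cdot>\<^sub>v v)"
  then have i: "i < d" using v by simp
  have 1: "(?A *\<^sub>v v) $ i = l * v $ i" using v i by (simp only: v(3)) simp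
  have 2: "(?A *\<^sub>v v) $ i = complex_of_real (1 / r) * (B *\<^sub>v v) $ i"
   using B v(1) i by (simp add: scalar_prod_def sum_distrib_left mult.assoc)
  have "(B *\<^sub>v v) $ i = complex_of_real r * (complex_of_real (1 / r) * (B *\<^sub>v v) $ i)"
   using r(2) by (simp del: index_mult_mat_vec)
  also have "\<dots> = complex_of_real r * (l * v $ i)" by (simp only: 1 2[symmetric])
  finally show "(B *\<^sub>v v) $ i = ((complex_of_real r * l) \<cdot>\<^sub>v v) $ i"
   using i v by (simp del: index_mult_mat_vec)
 qed (use B v in auto)
 then have "eigenvalue B (complex_of_real r * l)" unfolding eigenvalue_def eigenvector_def using v B by auto
 then have "norm (complex_of_real r * l) \<le> spectral_radius B"
  by (intro spectral_radius_mem_max(2)[OF B d]) (auto simp: spectrum_def)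
 moreover have "norm (complex_of_real r * l) = r * norm l" using r(2) by (simp add: norm_mult)
 ultimately have "r * norm l < r * 1" using r(1) by linarith
 then have "norm l < 1" using r(2) by (simp only: mult_less_cancel_left_pos)
 then show ?thesis using l(2) by simp
qed

text \<open>The vector \<open>w\<close> is a truncated Neumann series: with \<open>u_k\<close> the
  image of the all-ones vector under \<open>(B / s)^k\<close> and
  \<open>w = (2 / s) (u_0 + ... + u_(N-1))\<close>, the product \<open>R w\<close> telescopes to
  \<open>2 (u_0 - u_N)\<close>, which is at least 1 once \<open>u_N \<le> 1 / 2\<close>.\<close>

lemma M_matrix_imp_Mmat:
 assumes "M_matrix d R"
 shows "R \<in> carrier_mat d d" "\<exists>w. Mmat d (\<lambda>i j. R $$ (i, j)) w"
proof -
 obtain s B where s: "0 < s" and B: "B \<in> carrier_mat d d" and Bn: "\<And>i j. i < d \<Longrightarrow> j < d \<Longrightarrow> 0 \<le> B $$ (i, j)"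
  and sr: "spectral_radius (map_mat complex_of_real B) < s" and R: "R = s \<cdot>\<^sub>m 1\<^sub>m d - B"
  using assms unfolding M_matrix_def by blast
 show "R \<in> carrier_mat d d" unfolding R by (rule minus_carrier_mat[OF B])
 show "\<exists>w. Mmat d (\<lambda>i j. R $$ (i, j)) w"
 proof (cases "d = 0")
  case True then show ?thesis by (simp add: Mmat_def)
 next
  case False
  then have d: "0 < d" by simp
  \<comment> \<open>Dividing \<open>B\<close> by a number strictly between its spectral radius and
    \<open>s\<close> makes the powers bounded; the factor \<open>(\<rho> / s)^k\<close> then drives
    \<open>u_k\<close> to zero.\<close>
  obtain \<rho> where \<rho>: "0 < \<rho>" "\<rho> < s" "spectral_radius (map_mat complex_of_real B) < \<rho>"
  proof -
   have "max 0 (spectral_radius (map_mat complex_of_real B)) < s" using sr s by simp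
   from dense[OF this] obtain \<rho> where "max 0 (spectral_radius (map_mat complex_of_real B)) < \<rho>" "\<rho> < s" by blast
   then have "0 < \<rho>" "\<rho> < s" "spectral_radius (map_mat complex_of_real B) < \<rho>" by simp_all
   then show ?thesis by (rule that)
  qed
  let ?B = "map_mat complex_of_real B"
  define A where "A = complex_of_real (1 / \<rho>) \<cdot>\<^sub>m ?B"
  have cB: "?B \<in> carrier_mat d d" using B by simp
  have A: "A \<in> carrier_mat d d" using B by (simp add: A_def)
  have "spectral_radius A < 1" unfolding A_def by (rule spectral_radius_smult_less[OF cB d \<rho>(3,1)])
  from spectral_radius_jnf_norm_bound_less_1_upper_triangular[OF A this]
  obtain c where c: "\<And>k. norm_bound (A ^\<^sub>m k) c" by blast
  define g where "g x = (\<lambda>i. \<Sum>j<d. B $$ (i, j) / \<rho> * x j)" for x :: "nat \<Rightarrow> real"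
  have P: "vec d (\<lambda>i. complex_of_real ((g ^^ k) x i)) = A ^\<^sub>m k *\<^sub>v vec d (\<lambda>i. complex_of_real (x i))" for k x
  proof (induction k arbitrary: x)
   case 0
   have "vec d (\<lambda>i. complex_of_real (x i)) \<in> carrier_vec d" by simp
   then show ?case using A by simp
  next
   case (Suc k)
   have "vec d (\<lambda>i. complex_of_real (g x i)) = A *\<^sub>v vec d (\<lambda>i. complex_of_real (x i))"
    by (rule eq_vecI) (use A B in \<open>auto simp: A_def g_def scalar_prod_def atLeast0LessThan intro!: sum.cong\<close>)
   then have "A ^\<^sub>m k *\<^sub>v (A *\<^sub>v vec d (\<lambda>i. complex_of_real (x i))) = vec d (\<lambda>i. complex_of_real ((g ^^ k) (g x) i))"
    using Suc.IH[of "g x"] by simp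
   moreover have "A ^\<^sub>m Suc k *\<^sub>v vec d (\<lambda>i. complex_of_real (x i)) = A ^\<^sub>m k *\<^sub>v (A *\<^sub>v vec d (\<lambda>i. complex_of_real (x i)))"
    using A by (simp add: assoc_mult_mat_vec[OF pow_carrier_mat[OF A] A])
   ultimately show ?case by (simp add: funpow_swap1)
  qed
  define y where "y k = (g ^^ k) (\<lambda>_. 1)" for k
  have yb: "\<bar>y k i\<bar> \<le> real d * c" if i: "i < d" for k i
  proof -
   have "complex_of_real (y k i) = (A ^\<^sub>m k *\<^sub>v vec d (\<lambda>i. 1)) $ i"
    using arg_cong[OF P[of k "\<lambda>_. 1"], of "\<lambda>v. v $ i"] i by (simp add: y_def)
   also have "\<dots> = (\<Sum>j<d. (A ^\<^sub>m k) $$ (i, j))"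
    using mult_mat_vec_index[OF pow_carrier_mat[OF A, of k], of "vec d (\<lambda>i. 1)" i] i by simp
   finally have "norm (complex_of_real (y k i)) \<le> (\<Sum>j<d. norm ((A ^\<^sub>m k) $$ (i, j)))"
    by (simp only: norm_sum)
   also have "\<dots> \<le> (\<Sum>j<d. c)"
    using c[of k, unfolded norm_bound_def carrier_matD[OF pow_carrier_mat[OF A]]] i by (intro sum_mono) blast
   finally show ?thesis by simp
  qed
  have y_nn: "0 \<le> y k i" if "i < d" for k i using that
  proof (induction k arbitrary: i)
   case (Suc k)
   then show ?case using Bn \<rho>(1) unfolding y_def by (auto simp: g_def intro!: sum_nonneg)
  qed (simp add: y_def)
  have c0: "0 \<le> real d * c" using yb[OF d, of 0] by (simp add: y_def)
  define u where "u k i = (\<rho> / s) ^ k * y k i" for k i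
  have u_step: "(\<Sum>j<d. B $$ (i, j) * u k j) = s * u (Suc k) i" for k i
   unfolding u_def y_def using \<rho>(1) s by (simp add: g_def sum_distrib_left field_simps)
  have "(\<lambda>k. (\<rho> / s) ^ k * (real d * c)) \<longlonglongrightarrow> 0"
   using \<rho> s by (intro tendsto_mult_left_zero LIMSEQ_power_zero) auto
  then have "\<forall>\<^sub>F k in sequentially. (\<rho> / s) ^ k * (real d * c) < 1 / 2" by (rule order_tendstoD) simp
  moreover have "\<forall>\<^sub>F k in sequentially. 1 \<le> k" by (rule eventually_ge_at_top)
  ultimately have "\<forall>\<^sub>F k in sequentially. (\<rho> / s) ^ k * (real d * c) < 1 / 2 \<and> 1 \<le> k" by eventually_elim simp
  then obtain N where N: "(\<rho> / s) ^ N * (real d * c) < 1 / 2" "1 \<le> N" unfolding eventually_sequentially by blast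
  have uN: "u N i \<le> 1 / 2" if "i < d" for i
  proof -
   have "u N i \<le> (\<rho> / s) ^ N * (real d * c)" unfolding u_def
    using yb[OF that, of N] \<rho> s by (intro mult_left_mono) auto
   then show ?thesis using N by linarith
  qed
  define w where "w i = (2 / s) * (\<Sum>k<N. u k i)" for i
  have "Mmat d (\<lambda>i j. R $$ (i, j)) w" unfolding Mmat_def
  proof (intro allI impI conjI)
   fix i assume i: "i < d"
   have "u 0 i \<le> (\<Sum>k<N. u k i)"
    by (rule member_le_sum) (use N(2) y_nn[OF i] \<rho> s in \<open>auto simp: u_def\<close>)
   then show "0 < w i" using s by (simp add: w_def u_def y_def)
   have "(\<Sum>j<d. R $$ (i, j) * w j) = (\<Sum>j<d. (if j = i then s * w j else 0) - B $$ (i, j) * w j)"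
    by (rule sum.cong) (use R B i in \<open>auto simp: left_diff_distrib\<close>)
   also have "\<dots> = s * w i - (\<Sum>j<d. B $$ (i, j) * w j)" using i by (simp add: sum_subtractf)
   also have "(\<Sum>j<d. B $$ (i, j) * w j) = (2 / s) * (\<Sum>j<d. \<Sum>k<N. B $$ (i, j) * u k j)"
    unfolding w_def by (simp add: sum_distrib_left mult.left_commute)
   also have "\<dots> = (2 / s) * (\<Sum>k<N. s * u (Suc k) i)" by (subst sum.swap) (simp only: u_step)
   also have "s * w i - (2 / s) * (\<Sum>k<N. s * u (Suc k) i) = 2 * (\<Sum>k<N. u k i - u (Suc k) i)"
    using s by (simp add: w_def sum_distrib_left[symmetric] sum_subtractf)
   also have "(\<Sum>k<N. u k i - u (Suc k) i) = u 0 i - u N i" by (rule sum_lessThan_telescope')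
   finally show "1 \<le> (\<Sum>j<d. R $$ (i, j) * w j)" using uN[OF i] by (simp add: u_def y_def)
   fix j assume "j < d" "j \<noteq> i"
   then show "R $$ (i, j) \<le> 0" using i R B Bn by simp
  qed
  then show ?thesis by blast
 qed
qed

text \<open>The matrix \<open>B = s I - A\<close> is nonnegative and \<open>B w < s w\<close>.
  Reading the equation of an eigenvector \<open>v\<close> in the coordinate where
  \<open>|v_i| / w_i\<close> is largest bounds the modulus of the eigenvalue strictly by
  \<open>s\<close>.\<close>

lemma Mmat_imp_M_matrix:
 assumes R: "Mmat d (\<lambda>i j. A $$ (i, j)) w" and A: "A \<in> carrier_mat d d" and d: "0 < d"
 shows "M_matrix d A"
proof -
 define s where "s = 1 + (\<Sum>i<d. \<bar>A $$ (i, i)\<bar>)"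
 define B where "B = s \<cdot>\<^sub>m 1\<^sub>m d - A"
 have s0: "0 < s" unfolding s_def by (intro add_pos_nonneg sum_nonneg) auto
 have B: "B \<in> carrier_mat d d" unfolding B_def by (rule minus_carrier_mat[OF A])
 have w: "0 < w i" if "i < d" for i using R that by (simp add: Mmat_def)
 have Bn: "0 \<le> B $$ (i, j)" if "i < d" "j < d" for i j
 proof (cases "i = j")
  case True
  have "\<bar>A $$ (i, i)\<bar> \<le> (\<Sum>i<d. \<bar>A $$ (i, i)\<bar>)" by (rule member_le_sum) (use that in auto)
  then show ?thesis using True that A by (simp add: B_def s_def)
 next
  case False then show ?thesis using that A R by (simp add: B_def Mmat_def)
 qed
 have Bw: "(\<Sum>j<d. B $$ (i, j) * w j) < s * w i" if i: "i < d" for i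
 proof -
  have "(\<Sum>j<d. B $$ (i, j) * w j) = (\<Sum>j<d. (if j = i then s * w j else 0) - A $$ (i, j) * w j)"
   by (rule sum.cong) (use A i in \<open>auto simp: B_def left_diff_distrib\<close>)
  also have "\<dots> = s * w i - (\<Sum>j<d. A $$ (i, j) * w j)" using i by (simp add: sum_subtractf)
  finally have "(\<Sum>j<d. B $$ (i, j) * w j) = s * w i - (\<Sum>j<d. A $$ (i, j) * w j)" .
  moreover have "1 \<le> (\<Sum>j<d. A $$ (i, j) * w j)" using R i by (simp add: Mmat_def)
  ultimately show ?thesis by linarith
 qed
 let ?B = "map_mat complex_of_real B"
 have cB: "?B \<in> carrier_mat d d" using B by simp
 from spectral_radius_mem_max(1)[OF cB d] obtain l where l: "eigenvalue ?B l" "spectral_radius ?B = norm l"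
  unfolding spectrum_def by auto
 from l(1) obtain v where v: "v \<in> carrier_vec d" "v \<noteq> 0\<^sub>v d" "?B *\<^sub>v v = l \<cdot>\<^sub>v v"
  unfolding eigenvalue_def eigenvector_def using B by auto
 define q where "q i = norm (v $ i) / w i" for i
 have "\<exists>i\<in>{..<d}. \<forall>j\<in>{..<d}. q j \<le> q i"
 proof -
  have "Max (q ` {..<d}) \<in> q ` {..<d}" using d by (intro Max_in) auto
  then obtain i where "i < d" "q i = Max (q ` {..<d})" by auto
  then show ?thesis by (intro bexI[of _ i]) auto
 qed
 then obtain i where i: "i < d" and qi: "\<And>j. j < d \<Longrightarrow> q j \<le> q i" by auto
 have vq: "norm (v $ j) = q j * w j" if "j < d" for j using w[OF that] by (simp add: q_def)
 have "0 < q i"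
 proof (rule ccontr)
  assume "\<not> 0 < q i"
  then have "q j \<le> 0" if "j < d" for j using qi[OF that] by linarith
  then have "norm (v $ j) \<le> 0" if "j < d" for j using that vq[OF that] w[OF that] by (simp add: mult_nonpos_nonneg)
  then have "v = 0\<^sub>v d" using v(1) by (intro eq_vecI) auto
  then show False using v(2) by blast
 qed
 have "l * v $ i = (\<Sum>j<d. complex_of_real (B $$ (i, j)) * v $ j)"
  using arg_cong[OF v(3), of "\<lambda>v. v $ i"] v(1) i B by (simp add: scalar_prod_def atLeast0LessThan)
 then have "norm (l * v $ i) \<le> (\<Sum>j<d. norm (complex_of_real (B $$ (i, j)) * v $ j))" by (simp only: norm_sum)
 also have "\<dots> \<le> (\<Sum>j<d. q i * (B $$ (i, j) * w j))"
 proof (rule sum_mono)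
  fix j assume "j \<in> {..<d}"
  then have j: "j < d" by simp
  have "B $$ (i, j) * (q j * w j) \<le> B $$ (i, j) * (q i * w j)"
   using Bn[OF i j] qi[OF j] w[OF j] by (intro mult_left_mono mult_right_mono) auto
  then show "norm (complex_of_real (B $$ (i, j)) * v $ j) \<le> q i * (B $$ (i, j) * w j)"
   using Bn[OF i j] vq[OF j] by (simp add: norm_mult mult.left_commute)
 qed
 also have "\<dots> = q i * (\<Sum>j<d. B $$ (i, j) * w j)" by (simp add: sum_distrib_left)
 also have "\<dots> < q i * (s * w i)" using Bw[OF i] \<open>0 < q i\<close> by (rule mult_strict_left_mono)
 finally have "norm l * (q i * w i) < s * (q i * w i)" using vq[OF i] by (simp add: norm_mult mult.left_commute)
 then have "norm l < s" using \<open>0 < q i\<close> w[OF i] by (simp add: mult_less_cancel_right)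
 moreover have "A = s \<cdot>\<^sub>m 1\<^sub>m d - B" using A by (intro eq_matI) (auto simp: B_def)
 ultimately have "A = s \<cdot>\<^sub>m 1\<^sub>m d - B" "spectral_radius ?B < s" using l(2) by simp_all
 then show ?thesis unfolding M_matrix_def using s0 B Bn by (intro exI[of _ s] exI[of _ B] conjI allI impI)
qed

text \<open>In the coordinate \<open>k\<close> that minimizes \<open>q_k = v_k / w_k\<close>, a
  negative minimum would give \<open>(R v)_k \<le> q_k (R w)_k < 0\<close>.\<close>

lemma Mmat_nonneg:
 assumes R: "Mmat d R w" and v: "\<And>i. i < d \<Longrightarrow> 0 \<le> (\<Sum>j<d. R i j * v j)" and i: "i < d"
 shows "0 \<le> v i"
proof (rule ccontr)
 assume neg: "\<not> 0 \<le> v i"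
 have w: "0 < w i" if "i < d" for i using R that by (simp add: Mmat_def)
 define q where "q j = v j / w j" for j
 have "Min (q ` {..<d}) \<in> q ` {..<d}" using i by (intro Min_in) auto
 then obtain k where k: "k < d" "q k = Min (q ` {..<d})" by auto
 have qk: "q k \<le> q j" if "j < d" for j unfolding k(2) using that by (intro Min_le) auto
 have "q i < 0" using neg w[OF i] by (simp add: q_def divide_neg_pos)
 then have q0: "q k < 0" using qk[OF i] by linarith
 have vq: "v j = q j * w j" if "j < d" for j using w[OF that] by (simp add: q_def)
 have "(\<Sum>j<d. R k j * v j) \<le> (\<Sum>j<d. q k * (R k j * w j))"
 proof (rule sum_mono)
  fix j assume "j \<in> {..<d}"
  then have j: "j < d" by simp
  show "R k j * v j \<le> q k * (R k j * w j)"
  proof (cases "j = k")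
   case False
   then have "R k j \<le> 0" using R j k by (simp add: Mmat_def)
   moreover have "q k * w j \<le> v j" using vq[OF j] qk[OF j] w[OF j] by simp
   ultimately have "R k j * v j \<le> R k j * (q k * w j)" by (intro mult_left_mono_neg)
   then show ?thesis by (simp add: mult.left_commute)
  qed (use vq k in simp)
 qed
 also have "\<dots> = q k * (\<Sum>j<d. R k j * w j)" by (simp add: sum_distrib_left)
 also have "\<dots> \<le> q k * 1" using R k q0 by (intro mult_left_mono_neg) (auto simp: Mmat_def)
 finally show False using v[OF k(1)] q0 by simp
qed

lemma Mmat_block:
 assumes R: "Mmat d R w" and k: "k \<le> d"
 shows "Mmat k R w" unfolding Mmat_def
proof (intro allI impI conjI)
 fix i assume i: "i < k"
 have "(\<Sum>j<d. R i j * w j) = (\<Sum>j<k. R i j * w j) + (\<Sum>j\<in>{k..<d}. R i j * w j)"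
  using sum.atLeastLessThan_concat[of 0 k d "\<lambda>j. R i j * w j"] k by (simp add: atLeast0LessThan)
 moreover have "(\<Sum>j\<in>{k..<d}. R i j * w j) \<le> 0"
  using R i k by (intro sum_nonpos) (auto simp: Mmat_def mult_nonpos_nonneg less_imp_le)
 moreover have "1 \<le> (\<Sum>j<d. R i j * w j)" using R i k by (simp add: Mmat_def)
 ultimately show "1 \<le> (\<Sum>j<k. R i j * w j)" by linarith
qed (use R k in \<open>auto simp: Mmat_def\<close>)

text \<open>\<open>Mmat_nonneg\<close> applied to a kernel vector and its negative shows that the
  kernel is trivial; applied to the columns of the inverse it shows that these are
  nonnegative.\<close>

lemma Mmat_inverse:
 assumes R: "Mmat k (\<lambda>i j. A $$ (i, j)) w" and A: "A \<in> carrier_mat k k"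
 shows "\<exists>B. mat_inverse A = Some B \<and> B \<in> carrier_mat k k \<and> A * B = 1\<^sub>m k \<and> B * A = 1\<^sub>m k \<and>
  (\<forall>i<k. \<forall>j<k. 0 \<le> B $$ (i, j))"
proof -
 have "det A \<noteq> 0"
 proof
  assume "det A = 0"
  then obtain v where v: "v \<in> carrier_vec k" "v \<noteq> 0\<^sub>v k" "A *\<^sub>v v = 0\<^sub>v k"
   using det_0_iff_vec_prod_zero_field[OF A] by blast
  have z: "(\<Sum>j<k. A $$ (i, j) * v $ j) = 0" if "i < k" for i
   using mult_mat_vec_index[OF A v(1) that] v(3) that by simp
  have "v $ i = 0" if i: "i < k" for i
  proof -
   have "0 \<le> v $ i" by (rule Mmat_nonneg[OF R _ i]) (simp add: z)
   moreover have "0 \<le> - v $ i" by (rule Mmat_nonneg[OF R _ i, of "\<lambda>i. - v $ i"]) (simp add: z sum_negf)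
   ultimately show ?thesis by simp
  qed
  then show False using v by (auto intro: eq_vecI)
 qed
 then have "mat_inverse A \<noteq> None"
  using mat_inverse(1)[OF A, where b = "()"] det_non_zero_imp_unit[OF A, where b = "()"] by blast
 then obtain B where B: "mat_inverse A = Some B" by auto
 from mat_inverse(2)[OF A B] have AB: "A * B = 1\<^sub>m k" "B * A = 1\<^sub>m k" "B \<in> carrier_mat k k" by auto
 have "0 \<le> B $$ (i, j)" if i: "i < k" and j: "j < k" for i j
 proof (rule Mmat_nonneg[OF R _ i])
  fix i assume i: "i < k"
  have "(\<Sum>l<k. A $$ (i, l) * B $$ (l, j)) = (A * B) $$ (i, j)"
   using A AB(3) i j by (simp add: scalar_prod_def atLeast0LessThan)
  then show "0 \<le> (\<Sum>l<k. A $$ (i, l) * B $$ (l, j))" using AB(1) i j by simp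
 qed
 then show ?thesis using B AB by blast
qed

lemma pick_atLeastLessThan: "l < b - a \<Longrightarrow> pick {a..<b} l = a + l"
proof -
 assume l: "l < b - a"
 have "{x \<in> {a..<b}. x < a + l} = {a..<a + l}" using l by auto
 then have "card {x \<in> {a..<b}. x < a + l} = l" by simp
 then show ?thesis using pick_card_in_set[of "a + l" "{a..<b}"] l by auto
qed

lemma submatrix_interval:
 assumes A: "A \<in> carrier_mat n m" and "b \<le> n" "b' \<le> m"
 shows "submatrix A {a..<b} {a'..<b'} \<in> carrier_mat (b - a) (b' - a')"
  and "i < b - a \<Longrightarrow> j < b' - a' \<Longrightarrow> submatrix A {a..<b} {a'..<b'} $$ (i, j) = A $$ (a + i, a' + j)"
proof -
 have e: "{i. i < dim_row A \<and> i \<in> {a..<b}} = {a..<b}" "{i. i < dim_col A \<and> i \<in> {a'..<b'}} = {a'..<b'}"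
  using assms by auto
 show "submatrix A {a..<b} {a'..<b'} \<in> carrier_mat (b - a) (b' - a')"
  by (rule carrier_matI) (simp_all only: dim_submatrix e card_atLeastLessThan)
 assume "i < b - a" "j < b' - a'"
 then show "submatrix A {a..<b} {a'..<b'} $$ (i, j) = A $$ (a + i, a' + j)"
  by (subst submatrix_index) (simp_all only: e card_atLeastLessThan pick_atLeastLessThan)
qed

text \<open>Entry of row \<open>k + l\<close> after subtracting the combination of the first
  \<open>k\<close> rows with coefficients \<open>H\<close>. For \<open>H = C A^(-1)\<close> this
  yields the lower rows of \<open>G^(k)\<close> from \<open>R\<close>, and those of
  \<open>E^(k) L\<close> from \<open>L\<close>. The row index of \<open>H\<close> is absolute,
  whereas \<open>l\<close> counts from \<open>k\<close>.\<close>

definition Gfun :: "fmat \<Rightarrow> fmat \<Rightarrow> nat \<Rightarrow> nat \<Rightarrow> nat \<Rightarrow> real" where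
 "Gfun R H k l m = R (k + l) m - (\<Sum>i<k. H (k + l) i * R i m)"

lemma mult_transpose_index:
 assumes "X \<in> carrier_mat n m" "i < n" "j < n"
 shows "(X * transpose_mat X) $$ (i, j) = (\<Sum>q<m. X $$ (i, q) * X $$ (j, q))"
 using assms by (simp add: scalar_prod_def atLeast0LessThan)

text \<open>\<open>AI\<close> is the inverse of the leading block of \<open>R\<close>. The bundle
  translates every matrix expression of the statement into sums over \<open>Gfun\<close>, so that
  the analysis does not have to mention \<open>mat_inverse\<close> or
  \<open>four_block_mat\<close>.\<close>

definition eliminates :: "nat \<Rightarrow> real mat \<Rightarrow> real mat \<Rightarrow> fvec \<Rightarrow> nat \<Rightarrow>
  fmat \<Rightarrow> fmat \<Rightarrow> bool" where
 "eliminates J R L w k AI H \<longleftrightarrow> (\<forall>i<k. \<forall>m<k. 0 \<le> AI i m) \<and>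
   (\<forall>i<k. \<forall>l<k. (\<Sum>m<k. AI i m * R $$ (m, l)) = (if i = l then 1 else 0)) \<and>
   (\<forall>i<k. \<forall>l<k. (\<Sum>m<k. R $$ (i, m) * AI m l) = (if i = l then 1 else 0)) \<and>
   (\<forall>l<J - k. \<forall>m<k. Gfun (\<lambda>i j. R $$ (i, j)) H k l m = 0) \<and>
   Mmat (J - k) (\<lambda>l m. Gfun (\<lambda>i j. R $$ (i, j)) H k l (k + m)) (\<lambda>l. w (k + l)) \<and>
   submatrix (G_mat J R k) {k..<J} {k..<J} = mat (J - k) (J - k) (\<lambda>(l, m). Gfun (\<lambda>i j. R $$ (i, j)) H k l (k + m)) \<and>
   col (submatrix (G_mat J R k) {k..<J} {k}) 0 = vec (J - k) (\<lambda>l. Gfun (\<lambda>i j. R $$ (i, j)) H k l k) \<and>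
   submatrix (E_mat J R k * (L * transpose_mat L) * transpose_mat (E_mat J R k)) {k..<J} {k..<J} =
    mat (J - k) (J - k) (\<lambda>(l, l'). \<Sum>m<J. Gfun (\<lambda>i j. L $$ (i, j)) H k l m * Gfun (\<lambda>i j. L $$ (i, j)) H k l' m)"

text \<open>The Schur complement inherits the weights \<open>w\<close>: the multipliers
  \<open>- H\<close> are nonnegative, so adding these multiples of the first rows can only increase
  \<open>(R w)_(k+l) \<ge> 1\<close>, and off-diagonal entries stay nonpositive.\<close>

lemma elimination:
 assumes R: "R \<in> carrier_mat J J" and w: "Mmat J (\<lambda>i j. R $$ (i, j)) w" and k: "k < J"
  and L: "L \<in> carrier_mat J J"
 shows "\<exists>AI H. eliminates J R L w k AI H"
proof -
 let ?R = "\<lambda>i j. R $$ (i, j)"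
 define A where "A = submatrix R {..<k} {..<k}"
 define C where "C = submatrix R {k..<J} {..<k}"
 have A: "A \<in> carrier_mat k k" "\<And>i j. i < k \<Longrightarrow> j < k \<Longrightarrow> A $$ (i, j) = R $$ (i, j)"
  using submatrix_interval[OF R, where a = 0 and a' = 0 and b = k and b' = k] k by (auto simp: A_def lessThan_atLeast0)
 have C: "C \<in> carrier_mat (J - k) k" "\<And>i j. i < J - k \<Longrightarrow> j < k \<Longrightarrow> C $$ (i, j) = R $$ (k + i, j)"
  using submatrix_interval[OF R, where a = k and a' = 0 and b = J and b' = k] k by (auto simp: C_def lessThan_atLeast0)
 have wk: "Mmat k ?R w" by (rule Mmat_block[OF w]) (use k in simp)
 have "Mmat k (\<lambda>i j. A $$ (i, j)) w" using wk A(2) by (simp add: Mmat_def)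
 from Mmat_inverse[OF this A(1)] obtain B where B: "mat_inverse A = Some B" "B \<in> carrier_mat k k"
  "A * B = 1\<^sub>m k" "B * A = 1\<^sub>m k" "\<And>i j. i < k \<Longrightarrow> j < k \<Longrightarrow> 0 \<le> B $$ (i, j)" by blast
 define AI where "AI i m = B $$ (i, m)" for i m
 define H where "H l i = (C * B) $$ (l - k, i)" for l i
 have H: "H (k + l) i = (\<Sum>m<k. R $$ (k + l, m) * AI m i)" if "l < J - k" "i < k" for l i
  unfolding H_def AI_def using that C B(2) by (simp add: scalar_prod_def atLeast0LessThan)
 have E: "E_mat J R k \<in> carrier_mat J J" using R k C(1) B(2)
  unfolding E_mat_def Let_def by (auto simp: A_def[symmetric] C_def[symmetric] B(1))
 have Eix: "E_mat J R k $$ (k + l, m) = (if m < k then - H (k + l) m else if m = k + l then 1 else 0)"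
  if l: "l < J - k" and m: "m < J" for l m
 proof (cases "k = 0")
  case True then show ?thesis using l m by (auto simp: E_mat_def)
 next
  case False
  have "E_mat J R k = four_block_mat (1\<^sub>m k) (0\<^sub>m k (J - k)) (- (C * B)) (1\<^sub>m (J - k))"
   unfolding E_mat_def Let_def using False by (simp add: A_def[symmetric] C_def[symmetric] B(1))
  then show ?thesis using l m C(1) B(2) k unfolding H_def by auto
 qed
 have EX: "(E_mat J R k * X) $$ (k + l, m) = Gfun (\<lambda>i j. X $$ (i, j)) H k l m"
  if X: "X \<in> carrier_mat J n" and l: "l < J - k" and m: "m < n" for X n l m
 proof -
  have "(E_mat J R k * X) $$ (k + l, m) = (\<Sum>i<J. E_mat J R k $$ (k + l, i) * X $$ (i, m))"
   using E X l m by (simp add: scalar_prod_def atLeast0LessThan)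
  also have "\<dots> = (\<Sum>i<J. (if i < k then - (H (k + l) i * X $$ (i, m)) else 0) + (if i = k + l then X $$ (i, m) else 0))"
   by (rule sum.cong) (use Eix[OF l] in auto)
  also have "\<dots> = - (\<Sum>i<k. H (k + l) i * X $$ (i, m)) + X $$ (k + l, m)"
  proof -
   have "(\<Sum>i<J. (if i < k then - (H (k + l) i * X $$ (i, m)) else 0)) = (\<Sum>i<k. - (H (k + l) i * X $$ (i, m)))"
    by (rule sum.mono_neutral_cong_right) (use k in auto)
   then show ?thesis using l by (simp add: sum.distrib sum_negf)
  qed
  finally show ?thesis by (simp add: Gfun_def)
 qed
 have G: "G_mat J R k \<in> carrier_mat J J" using E R by (simp add: G_mat_def)
 have 1: "(\<Sum>m<k. AI i m * R $$ (m, l)) = (if i = l then 1 else 0)" if "i < k" "l < k" for i l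
 proof -
  have "(\<Sum>m<k. AI i m * R $$ (m, l)) = (B * A) $$ (i, l)"
   using that A B(2) by (simp add: AI_def scalar_prod_def atLeast0LessThan)
  then show ?thesis using that B(4) by simp
 qed
 have 2: "(\<Sum>m<k. R $$ (i, m) * AI m l) = (if i = l then 1 else 0)" if "i < k" "l < k" for i l
 proof -
  have "(\<Sum>m<k. R $$ (i, m) * AI m l) = (A * B) $$ (i, l)"
   using that A B(2) by (simp add: AI_def scalar_prod_def atLeast0LessThan)
  then show ?thesis using that B(3) by simp
 qed
 have HR: "(\<Sum>i<k. H (k + l) i * R $$ (i, m)) = (\<Sum>n<k. R $$ (k + l, n) * (\<Sum>i<k. AI n i * R $$ (i, m)))"
  if l: "l < J - k" for l m
 proof -
  have "(\<Sum>i<k. H (k + l) i * R $$ (i, m)) = (\<Sum>i<k. \<Sum>n<k. R $$ (k + l, n) * AI n i * R $$ (i, m))"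
   by (rule sum.cong) (simp_all add: H[OF l] sum_distrib_right)
  also have "\<dots> = (\<Sum>n<k. \<Sum>i<k. R $$ (k + l, n) * AI n i * R $$ (i, m))" by (rule sum.swap)
  finally show ?thesis by (simp add: sum_distrib_left mult.assoc)
 qed
 have 3: "Gfun ?R H k l m = 0" if l: "l < J - k" and m: "m < k" for l m
 proof -
  have "(\<Sum>n<k. R $$ (k + l, n) * (\<Sum>i<k. AI n i * R $$ (i, m))) = (\<Sum>n<k. if n = m then R $$ (k + l, n) else 0)"
   by (rule sum.cong) (simp_all add: 1 m)
  also have "\<dots> = R $$ (k + l, m)" using m by simp
  finally show ?thesis unfolding Gfun_def HR[OF l] by simp
 qed
 have Rneg: "R $$ (i, j) \<le> 0" if "i < J" "j < J" "i \<noteq> j" for i j using w that by (simp add: Mmat_def)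
 have Hneg: "H (k + l) i \<le> 0" if "l < J - k" "i < k" for l i
  unfolding H[OF that] using that k B(5) by (intro sum_nonpos mult_nonpos_nonneg Rneg) (auto simp: AI_def)
 have 4: "Mmat (J - k) (\<lambda>l m. Gfun ?R H k l (k + m)) (\<lambda>l. w (k + l))" unfolding Mmat_def
 proof (intro allI impI conjI)
  fix l assume l: "l < J - k"
  show "0 < w (k + l)" using w l by (simp add: Mmat_def)
  have split: "(\<Sum>m<J. f m) = (\<Sum>m<k. f m) + (\<Sum>m<J - k. f (k + m))" for f :: "nat \<Rightarrow> real"
  proof -
   have "(\<Sum>m<J. f m) = (\<Sum>m<k. f m) + (\<Sum>m\<in>{k..<J}. f m)"
    using sum.atLeastLessThan_concat[of 0 k J f] k by (simp add: atLeast0LessThan)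
   also have "(\<Sum>m\<in>{k..<J}. f m) = (\<Sum>m<J - k. f (k + m))"
    using sum.shift_bounds_nat_ivl[of f 0 k "J - k"] k by (simp add: atLeast0LessThan add.commute)
   finally show ?thesis .
  qed
  have "(\<Sum>m<J. Gfun ?R H k l m * w m) = (\<Sum>m<J - k. Gfun ?R H k l (k + m) * w (k + m))"
   unfolding split by (simp add: 3[OF l])
  moreover have "(\<Sum>m<J. Gfun ?R H k l m * w m) = (\<Sum>m<J. R $$ (k + l, m) * w m) - (\<Sum>i<k. H (k + l) i * (\<Sum>m<J. R $$ (i, m) * w m))"
  proof -
   have "(\<Sum>m<J. Gfun ?R H k l m * w m) = (\<Sum>m<J. R $$ (k + l, m) * w m) - (\<Sum>m<J. \<Sum>i<k. H (k + l) i * (R $$ (i, m) * w m))"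
    unfolding Gfun_def by (simp add: left_diff_distrib sum_subtractf sum_distrib_right mult.assoc)
   then show ?thesis by (subst (asm) sum.swap) (simp add: sum_distrib_left)
  qed
  moreover have "(\<Sum>i<k. H (k + l) i * (\<Sum>m<J. R $$ (i, m) * w m)) \<le> 0"
  proof (intro sum_nonpos mult_nonpos_nonneg Hneg l)
   fix i assume "i \<in> {..<k}"
   then show "i < k" by simp
   then have "1 \<le> (\<Sum>m<J. R $$ (i, m) * w m)" using w k by (simp add: Mmat_def)
   then show "0 \<le> (\<Sum>m<J. R $$ (i, m) * w m)" by linarith
  qed
  moreover have "1 \<le> (\<Sum>m<J. R $$ (k + l, m) * w m)" using w l by (simp add: Mmat_def)
  ultimately show "1 \<le> (\<Sum>m<J - k. Gfun ?R H k l (k + m) * w (k + m))" by linarith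
  fix m assume m: "m < J - k" "m \<noteq> l"
  have "0 \<le> (\<Sum>i<k. H (k + l) i * R $$ (i, k + m))"
   by (intro sum_nonneg mult_nonpos_nonpos Hneg Rneg l) (use m k in auto)
  moreover have "R $$ (k + l, k + m) \<le> 0" by (rule Rneg) (use l m in auto)
  ultimately show "Gfun ?R H k l (k + m) \<le> 0" by (simp add: Gfun_def)
 qed
 have 5: "submatrix (G_mat J R k) {k..<J} {k..<J} = mat (J - k) (J - k) (\<lambda>(l, m). Gfun ?R H k l (k + m))"
  by (rule eq_matI) (use submatrix_interval[OF G, where a = k and a' = k and b = J and b' = J] k EX[OF R] in \<open>auto simp: G_mat_def\<close>)
 have 6: "col (submatrix (G_mat J R k) {k..<J} {k}) 0 = vec (J - k) (\<lambda>l. Gfun ?R H k l k)"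
 proof -
  have "{k} = {k..<Suc k}" by auto
  then show ?thesis using submatrix_interval[OF G, where a = k and a' = k and b = J and b' = "Suc k"] k EX[OF R]
   by (intro eq_vecI) (auto simp: G_mat_def)
 qed
 \<comment> \<open>In the form \<open>(E L) (E L)'\<close> the covariance block becomes a matrix of
   inner products of eliminated rows of \<open>L\<close>.\<close>
 have T: "E_mat J R k * (L * transpose_mat L) * transpose_mat (E_mat J R k) = (E_mat J R k * L) * transpose_mat (E_mat J R k * L)"
  using E L by (simp add: transpose_mult assoc_mult_mat[of _ J J _ J _ J])
 have EL: "E_mat J R k * L \<in> carrier_mat J J" using E L by simp
 have 7: "submatrix (E_mat J R k * (L * transpose_mat L) * transpose_mat (E_mat J R k)) {k..<J} {k..<J} =
    mat (J - k) (J - k) (\<lambda>(l, l'). \<Sum>m<J. Gfun (\<lambda>i j. L $$ (i, j)) H k l m * Gfun (\<lambda>i j. L $$ (i, j)) H k l' m)"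
  unfolding T
 proof (rule eq_matI)
  have c: "(E_mat J R k * L) * transpose_mat (E_mat J R k * L) \<in> carrier_mat J J" using EL by simp
  note s = submatrix_interval[OF c, where a = k and a' = k and b = J and b' = J]
  fix l l' assume "l < dim_row (mat (J - k) (J - k) (\<lambda>(l, l'). \<Sum>m<J. Gfun (\<lambda>i j. L $$ (i, j)) H k l m * Gfun (\<lambda>i j. L $$ (i, j)) H k l' m))"
   "l' < dim_col (mat (J - k) (J - k) (\<lambda>(l, l'). \<Sum>m<J. Gfun (\<lambda>i j. L $$ (i, j)) H k l m * Gfun (\<lambda>i j. L $$ (i, j)) H k l' m))"
  then have l: "l < J - k" "l' < J - k" by auto
  have "((E_mat J R k * L) * transpose_mat (E_mat J R k * L)) $$ (k + l, k + l') =
    (\<Sum>m<J. (E_mat J R k * L) $$ (k + l, m) * (E_mat J R k * L) $$ (k + l', m))"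
   by (rule mult_transpose_index[OF EL]) (use l in auto)
  also have "\<dots> = (\<Sum>m<J. Gfun (\<lambda>i j. L $$ (i, j)) H k l m * Gfun (\<lambda>i j. L $$ (i, j)) H k l' m)"
   by (rule sum.cong) (simp_all add: EX[OF L l(1)] EX[OF L l(2)] del: index_mult_mat)
  finally show "submatrix (E_mat J R k * L * transpose_mat (E_mat J R k * L)) {k..<J} {k..<J} $$ (l, l') =
   mat (J - k) (J - k) (\<lambda>(l, l'). \<Sum>m<J. Gfun (\<lambda>i j. L $$ (i, j)) H k l m * Gfun (\<lambda>i j. L $$ (i, j)) H k l' m) $$ (l, l')"
   using s(2)[of l l'] l by (simp del: index_mult_mat)
 qed (use submatrix_interval(1)[of "E_mat J R k * L * transpose_mat (E_mat J R k * L)" J J J J k k] EL E in auto)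
 show ?thesis unfolding eliminates_def
  by (rule exI[of _ AI], rule exI[of _ H]) (use 1 2 3 4 5 6 7 B(5) in \<open>auto simp: AI_def\<close>)
qed

text \<open>Gram-Schmidt: the first row is split off and the others are replaced by their components
  orthogonal to it, which yields a lower triangular factor. The eliminated rows of \<open>L\<close>
  have \<open>J\<close> columns, whereas an SRBM of dimension \<open>J - j\<close> needs a square
  factor.\<close>

lemma gram_square_root:
 fixes S :: fmat
 shows "\<exists>A. \<forall>l<n. \<forall>l'<n. (\<Sum>m<n. A l m * A l' m) = (\<Sum>m<J. S l m * S l' m)"
proof (induction n arbitrary: S)
 case (Suc n)
 define ip where "ip l l' = (\<Sum>m<J. S l m * S l' m)" for l l'
 define c where "c = sqrt (ip 0 0)"
 have cc: "ip 0 0 = c * c" unfolding c_def ip_def by (simp add: sum_nonneg)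
 \<comment> \<open>If the first row is zero, the quotients by \<open>c = 0\<close> evaluate to zero,
   which is the right value because all inner products with that row vanish.\<close>
 have ip0: "ip l 0 = 0" if "c = 0" for l
 proof -
  have "(\<Sum>m<J. S 0 m * S 0 m) = 0" using cc that by (simp add: ip_def)
  then have "\<forall>m\<in>{..<J}. S 0 m * S 0 m = 0" by (subst (asm) sum_nonneg_eq_0_iff) auto
  then show ?thesis unfolding ip_def by (intro sum.neutral) auto
 qed
 define b where "b l = ip (Suc l) 0 / (c * c)" for l
 define S' where "S' l m = S (Suc l) m - b l * S 0 m" for l m
 have S': "(\<Sum>m<J. S' l m * S' l' m) = ip (Suc l) (Suc l') - (ip (Suc l) 0 / c) * (ip (Suc l') 0 / c)" for l l'
 proof -
  have "(\<Sum>m<J. S' l m * S' l' m) = ip (Suc l) (Suc l') - b l' * ip (Suc l) 0 - b l * ip (Suc l') 0 + b l * b l' * ip 0 0"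
   unfolding S'_def ip_def sum_distrib_left sum_subtractf[symmetric] sum.distrib[symmetric]
   by (rule sum.cong) (simp_all add: algebra_simps)
  moreover have "b l' * ip (Suc l) 0 = (ip (Suc l) 0 / c) * (ip (Suc l') 0 / c)" for l l' by (simp add: b_def)
  moreover have "b l * b l' * (c * c) = (ip (Suc l) 0 / c) * (ip (Suc l') 0 / c)" by (cases "c = 0") (simp_all add: b_def)
  ultimately show ?thesis unfolding cc by (simp add: mult.commute)
 qed
 obtain A where A: "\<And>l l'. l < n \<Longrightarrow> l' < n \<Longrightarrow> (\<Sum>m<n. A l m * A l' m) = (\<Sum>m<J. S' l m * S' l' m)"
  using Suc.IH[of S'] by blast
 define A' where "A' l m = (case l of 0 \<Rightarrow> if m = 0 then c else 0
   | Suc l \<Rightarrow> (case m of 0 \<Rightarrow> ip (Suc l) 0 / c | Suc m \<Rightarrow> A l m))" for l m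
 have "(\<Sum>m<Suc n. A' l m * A' l' m) = ip l l'" if "l < Suc n" "l' < Suc n" for l l'
 proof -
  have comm: "ip 0 (Suc k) = ip (Suc k) 0" for k by (simp add: ip_def mult.commute)
  show ?thesis unfolding sum.lessThan_Suc_shift using that ip0
   by (cases l; cases l'; cases "c = 0") (simp_all add: A'_def cc A S' comm)
 qed
 then show ?case unfolding ip_def by blast
qed simp

section \<open>Brownian motion: measurability, independence, characteristic functions\<close>

lemma continuous_map_measurable:
 assumes "continuous_map T euclidean f"
 shows "f \<in> borel_measurable (borel_of T)"
proof (rule borel_measurableI)
 fix S :: "'b set" assume "open S"
 then have "openin T {x \<in> topspace T. f x \<in> S}" using assms by (intro openin_continuous_map_preimage) auto
 moreover have "f -` S \<inter> space (borel_of T) = {x \<in> topspace T. f x \<in> S}"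
  unfolding borel_of_def by (subst space_measure_of) (auto dest: openin_subset)
 ultimately show "f -` S \<inter> space (borel_of T) \<in> sets (borel_of T)"
  unfolding borel_of_def by (subst sets_measure_of) (auto dest: openin_subset)
qed

lemma vec_index_measurable: "i < d \<Longrightarrow> (\<lambda>v. v $ i) \<in> borel_measurable (vec_borel d)"
 by (rule continuous_map_measurable[OF continuous_map_vec_index])

lemma openin_vec_Pow: "{U. openin (vec_topology d) U} \<subseteq> Pow (carrier_vec d)"
proof
 fix U assume "U \<in> {U. openin (vec_topology d) U}"
 then have "openin (vec_topology d) U" by simp
 from openin_subset[OF this] show "U \<in> Pow (carrier_vec d)" by simp
qed

lemma space_vec_borel [simp]: "space (vec_borel d) = carrier_vec d"
 unfolding borel_of_def using space_measure_of[OF openin_vec_Pow] by simp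

text \<open>A vector is extended by zeros to a function on the naturals, where measurability can be
  checked coordinatewise; open sets of \<open>vec_topology\<close> are preimages of open sets of
  that countable product.\<close>

lemma measurable_vec_borelI:
 assumes c: "\<And>w. w \<in> space M \<Longrightarrow> X w \<in> carrier_vec d"
  and m: "\<And>i. i < d \<Longrightarrow> (\<lambda>w. X w $ i) \<in> borel_measurable M"
 shows "X \<in> M \<rightarrow>\<^sub>M vec_borel d" unfolding borel_of_def
proof (rule measurable_measure_of)
 show "{U. openin (vec_topology d) U} \<subseteq> Pow (topspace (vec_topology d))" using openin_vec_Pow by simp
 show "X \<in> space M \<rightarrow> topspace (vec_topology d)" using c by auto
 fix U assume "U \<in> {U. openin (vec_topology d) U}"
 then obtain V where V: "openin (product_topology (\<lambda>_. euclideanreal) {..<d}) V"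
  "U = (\<lambda>v. \<lambda>i\<in>{..<d}. v $ i) -` V \<inter> carrier_vec d"
  unfolding vec_topology_def openin_pullback_topology by auto
 have "continuous_map (product_topology (\<lambda>_. euclideanreal) UNIV) (product_topology (\<lambda>_. euclideanreal) {..<d}) (\<lambda>x. restrict x {..<d})"
  unfolding continuous_map_componentwise
 proof (intro conjI ballI)
  fix k assume "k \<in> {..<d}"
  then show "continuous_map (product_topology (\<lambda>_. euclideanreal) UNIV) euclideanreal (\<lambda>x. restrict x {..<d} k)"
   using continuous_map_product_projection[of k UNIV "\<lambda>_. euclideanreal"] by simp
 qed auto
 from openin_continuous_map_preimage[OF this V(1)]
 have "openin euclidean {x. restrict x {..<d} \<in> V}"
  unfolding euclidean_product_topology topspace_euclidean by (simp only: UNIV_I simp_thms)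
 then have o: "open {x. restrict x {..<d} \<in> V}" by (rule open_openin[THEN iffD2])
 define Y where "Y w = (\<lambda>i. if i < d then X w $ i else 0)" for w
 have "Y \<in> borel_measurable M"
 proof (rule measurable_coordinatewise_then_product)
  fix i show "(\<lambda>w. Y w i) \<in> borel_measurable M" using m by (cases "i < d") (simp_all add: Y_def)
 qed
 then have 1: "Y -` {x. restrict x {..<d} \<in> V} \<inter> space M \<in> sets M" by (rule measurable_sets) (use o in simp)
 have r: "restrict (Y w) {..<d} = (\<lambda>i\<in>{..<d}. X w $ i)" for w by (rule ext) (simp add: Y_def)
 have "restrict (Y w) {..<d} \<in> V \<longleftrightarrow> X w \<in> U" if "w \<in> space M" for w
  unfolding V(2) r using c[OF that] by (simp only: vimage_eq Int_iff simp_thms)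
 then have "Y -` {x. restrict x {..<d} \<in> V} \<inter> space M = X -` U \<inter> space M" by blast
 with 1 show "X -` U \<inter> space M \<in> sets M" by simp
qed

lemma indep_elements_indep_var:
 assumes M: "prob_space M" and ind: "indep_elements M S X T Y"
  and g: "g \<in> S \<rightarrow>\<^sub>M N" and h: "h \<in> T \<rightarrow>\<^sub>M N'"
 shows "prob_space.indep_var M N (\<lambda>w. g (X w)) N' (\<lambda>w. h (Y w))"
proof -
 interpret prob_space M by fact
 have X: "X \<in> M \<rightarrow>\<^sub>M S" and Y: "Y \<in> M \<rightarrow>\<^sub>M T"
  and I: "indep_set {X -` A \<inter> space M | A. A \<in> sets S} {Y -` B \<inter> space M | B. B \<in> sets T}"
  using ind unfolding indep_elements_def by auto
 have gX: "(\<lambda>w. g (X w)) \<in> M \<rightarrow>\<^sub>M N" by (rule measurable_compose[OF X g])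
 have hY: "(\<lambda>w. h (Y w)) \<in> M \<rightarrow>\<^sub>M N'" by (rule measurable_compose[OF Y h])
 have 1: "{(\<lambda>w. g (X w)) -` A \<inter> space M | A. A \<in> sets N} \<subseteq> {X -` A \<inter> space M | A. A \<in> sets S}"
 proof
  fix B assume "B \<in> {(\<lambda>w. g (X w)) -` A \<inter> space M | A. A \<in> sets N}"
  then obtain A where A: "A \<in> sets N" "B = (\<lambda>w. g (X w)) -` A \<inter> space M" by auto
  have "B = X -` (g -` A \<inter> space S) \<inter> space M" using A(2) measurable_space[OF X] by auto
  moreover have "g -` A \<inter> space S \<in> sets S" by (rule measurable_sets[OF g A(1)])
  ultimately show "B \<in> {X -` A \<inter> space M | A. A \<in> sets S}" by blast
 qed
 have 2: "{(\<lambda>w. h (Y w)) -` A \<inter> space M | A. A \<in> sets N'} \<subseteq> {Y -` A \<inter> space M | A. A \<in> sets T}"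
 proof
  fix B assume "B \<in> {(\<lambda>w. h (Y w)) -` A \<inter> space M | A. A \<in> sets N'}"
  then obtain A where A: "A \<in> sets N'" "B = (\<lambda>w. h (Y w)) -` A \<inter> space M" by auto
  have "B = Y -` (h -` A \<inter> space T) \<inter> space M" using A(2) measurable_space[OF Y] by auto
  moreover have "h -` A \<inter> space T \<in> sets T" by (rule measurable_sets[OF h A(1)])
  ultimately show "B \<in> {Y -` A \<inter> space M | A. A \<in> sets T}" by blast
 qed
 have "indep_sets (\<lambda>b. {case_bool (\<lambda>w. g (X w)) (\<lambda>w. h (Y w)) b -` A \<inter> space M | A. A \<in> sets (case_bool N N' b)}) UNIV"
  using I unfolding indep_set_def by (rule indep_sets_mono_sets) (use 1 2 in \<open>auto split: bool.splits\<close>)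
 then show ?thesis unfolding indep_var_def indep_vars_def2 using gX hY by (auto split: bool.split)
qed

lemma indep_elements_integral:
 fixes g :: "_ \<Rightarrow> complex"
 assumes M: "prob_space M" and ind: "indep_elements M S X T Y"
  and g: "g \<in> borel_measurable S" "\<And>x. norm (g x) \<le> 1" and h: "h \<in> borel_measurable T" "\<And>x. norm (h x) \<le> 1"
 shows "(\<integral>w. g (X w) * h (Y w) \<partial>M) = (\<integral>w. g (X w) \<partial>M) * (\<integral>w. h (Y w) \<partial>M)"
proof -
 interpret prob_space M by fact
 have X: "X \<in> M \<rightarrow>\<^sub>M S" and Y: "Y \<in> M \<rightarrow>\<^sub>M T"
  using ind unfolding indep_elements_def by auto
 have "integrable M (\<lambda>w. g (X w))"
  by (rule integrable_const_bound[of _ 1]) (use g measurable_compose[OF X g(1)] in auto)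
 moreover have "integrable M (\<lambda>w. h (Y w))"
  by (rule integrable_const_bound[of _ 1]) (use h measurable_compose[OF Y h(1)] in auto)
 ultimately show ?thesis by (rule indep_var_lebesgue_integral[OF indep_elements_indep_var[OF M ind g(1) h(1)]])
qed

lemma std_brownian_motion_prob_space: "std_brownian_motion M d W \<Longrightarrow> prob_space M"
 by (simp add: std_brownian_motion_def)

lemma bm_measurable:
 assumes "std_brownian_motion M d W" "0 \<le> t"
 shows "(\<lambda>w. W w t) \<in> M \<rightarrow>\<^sub>M vec_borel d" "i < d \<Longrightarrow> (\<lambda>w. W w t $ i) \<in> borel_measurable M"
proof -
 show 1: "(\<lambda>w. W w t) \<in> M \<rightarrow>\<^sub>M vec_borel d"
  using assms unfolding std_brownian_motion_def by blast
 show "i < d \<Longrightarrow> (\<lambda>w. W w t $ i) \<in> borel_measurable M"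
  by (rule measurable_compose[OF 1 vec_index_measurable])
qed

lemma bm_path:
 assumes "std_brownian_motion M d W" "w \<in> space M"
 shows "W w 0 = 0\<^sub>v d" "cpath d (\<lambda>t i. W w t $ i)" "0 \<le> t \<Longrightarrow> W w t \<in> carrier_vec d"
proof -
 have c: "continuous_map (top_of_set {0..}) (vec_topology d) (W w)"
  and "W w 0 = 0\<^sub>v d" using assms unfolding std_brownian_motion_def by auto
 then show "W w 0 = 0\<^sub>v d" by simp
 show "cpath d (\<lambda>t i. W w t $ i)" unfolding cpath_def
 proof (intro allI impI)
  fix i assume "i < d"
  from continuous_map_compose[OF c continuous_map_vec_index[OF this]]
  show "continuous_on {0..} (\<lambda>t. W w t $ i)" by (simp add: comp_def)
 qed
 show "0 \<le> t \<Longrightarrow> W w t \<in> carrier_vec d" using continuous_map_image_subset_topspace[OF c] by auto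
qed

lemma bm_cproc:
 assumes "std_brownian_motion M d W"
 shows "cproc M d (\<lambda>w t i. W w t $ i)"
 unfolding cproc_def using bm_path(2)[OF assms] bm_measurable(2)[OF assms] by auto

lemma normal_char:
 assumes M: "prob_space M" and X: "distributed M lborel X (normal_density 0 \<sigma>)" and \<sigma>: "0 < \<sigma>"
 shows "(\<integral>w. iexp (u * X w) \<partial>M) = complex_of_real (exp (- (\<sigma>\<^sup>2 * u\<^sup>2) / 2))"
proof -
 interpret prob_space M by fact
 have "distributed M lborel (\<lambda>x. (X x - 0) / \<sigma>) std_normal_density"
  using X \<sigma> by (subst (asm) normal_standard_normal_convert) auto
 then have D: "distributed M lborel (\<lambda>x. X x / \<sigma>) std_normal_density" by simp
 then have d: "distr M lborel (\<lambda>x. X x / \<sigma>) = std_normal_distribution"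
  and m: "(\<lambda>x. X x / \<sigma>) \<in> M \<rightarrow>\<^sub>M lborel" unfolding distributed_def by auto
 have "(\<integral>w. iexp (u * X w) \<partial>M) = (\<integral>w. iexp ((u * \<sigma>) * (X w / \<sigma>)) \<partial>M)"
  using \<sigma> by simp
 also have "\<dots> = (\<integral>x. iexp ((u * \<sigma>) * x) \<partial>distr M lborel (\<lambda>x. X x / \<sigma>))"
  by (subst integral_distr[OF m]) auto
 also have "\<dots> = char std_normal_distribution (u * \<sigma>)" unfolding d char_def by simp
 also have "\<dots> = complex_of_real (exp (- (\<sigma>\<^sup>2 * u\<^sup>2) / 2))"
  unfolding char_std_normal_distribution by (simp add: power_mult_distrib mult.commute)
 finally show ?thesis .
qed

lemma bm_increment_char:
 assumes W: "std_brownian_motion M d W" and st: "0 \<le> s" "s < t"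
 shows "(\<integral>w. iexp (\<Sum>i<d. u i * (W w t - W w s) $ i) \<partial>M) = complex_of_real (exp (- ((t - s) * (\<Sum>i<d. u i * u i)) / 2))"
proof -
 interpret prob_space M using W by (rule std_brownian_motion_prob_space)
 have ind: "indep_vars (\<lambda>_. borel) (\<lambda>i w. (W w t - W w s) $ i) {..<d}"
  and D: "\<And>i. i < d \<Longrightarrow> distributed M lborel (\<lambda>w. (W w t - W w s) $ i) (normal_density 0 (sqrt (t - s)))"
  using W st unfolding std_brownian_motion_def by auto
 have ind': "indep_vars (\<lambda>_. borel) (\<lambda>i w. iexp (u i * (W w t - W w s) $ i)) {..<d}"
  by (rule indep_vars_compose2[OF ind]) simp
 have rv: "(\<lambda>w. (W w t - W w s) $ i) \<in> borel_measurable M" if "i < d" for i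
  using D[OF that] unfolding distributed_def by simp
 have "(\<integral>w. iexp (\<Sum>i<d. u i * (W w t - W w s) $ i) \<partial>M) = (\<integral>w. (\<Prod>i<d. iexp (u i * (W w t - W w s) $ i)) \<partial>M)"
  by (simp add: exp_sum sum_distrib_left)
 also have "\<dots> = (\<Prod>i<d. (\<integral>w. iexp (u i * (W w t - W w s) $ i) \<partial>M))"
 proof (rule indep_vars_lebesgue_integral[OF _ ind'])
  fix i assume "i \<in> {..<d}"
  then have [measurable]: "(\<lambda>w. (W w t - W w s) $ i) \<in> borel_measurable M" using rv by simp
  show "integrable M (\<lambda>w. iexp (u i * (W w t - W w s) $ i))" by (rule integrable_const_bound[of _ 1]) auto
 qed simp
 also have "\<dots> = (\<Prod>i<d. complex_of_real (exp (- ((sqrt (t - s))\<^sup>2 * (u i)\<^sup>2) / 2)))"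
  by (rule prod.cong[OF refl], rule normal_char[OF prob_space_axioms D]) (use st in auto)
 also have "\<dots> = complex_of_real (exp (\<Sum>i<d. - ((t - s) * (u i * u i)) / 2))"
  using st by (simp add: exp_sum power2_eq_square)
 also have "(\<Sum>i<d. - ((t - s) * (u i * u i)) / 2) = - ((t - s) * (\<Sum>i<d. u i * u i)) / 2"
  by (simp add: sum_negf sum_distrib_left sum_divide_distrib)
 finally show ?thesis .
qed

text \<open>How the exponent in \<open>bm_char\<close> splits when a latest time \<open>k\<close> is
  separated from the others; \<open>min\<close> is the covariance of Brownian motion.\<close>

lemma min_quadratic_form_insert:
 fixes ip :: "'k \<Rightarrow> 'k \<Rightarrow> real" and \<tau> :: "'k \<Rightarrow> real"
 assumes K: "finite K" "k \<notin> K" and max: "\<And>l. l \<in> K \<Longrightarrow> \<tau> l \<le> \<tau> k" and sym: "\<And>l l'. ip l l' = ip l' l"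
 shows "(\<Sum>l\<in>insert k K. \<Sum>l'\<in>insert k K. min (\<tau> l) (\<tau> l') * ip l l') =
  (\<Sum>l\<in>K. \<Sum>l'\<in>K. min (\<tau> l) (\<tau> l') * ip l l') + 2 * (\<Sum>l\<in>K. \<tau> l * ip l k) + \<tau> k * ip k k"
proof -
 have 1: "(\<Sum>l'\<in>K. min (\<tau> k) (\<tau> l') * ip k l') = (\<Sum>l\<in>K. \<tau> l * ip l k)"
  by (rule sum.cong) (use max sym in \<open>simp_all add: min_absorb2\<close>)
 have 2: "(\<Sum>l\<in>K. min (\<tau> l) (\<tau> k) * ip l k) = (\<Sum>l\<in>K. \<tau> l * ip l k)"
  by (rule sum.cong) (use max in \<open>simp_all add: min_absorb1\<close>)
 show ?thesis using K by (simp add: sum.distrib 1 2)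
qed

text \<open>Companion of the previous splitting: the coefficients \<open>c\<close> of a removed
  latest time are added to those of the latest remaining time \<open>q\<close>. The two forms differ
  only in the factor in front of the last sum.\<close>

lemma min_quadratic_form_merge:
 fixes a b :: "'k \<Rightarrow> nat \<Rightarrow> real" and \<tau> :: "'k \<Rightarrow> real" and c :: "nat \<Rightarrow> real"
 assumes b_def: "b = (\<lambda>l i. a l i + (if l = q then c i else 0))" and K: "finite K" "q \<in> K" and max: "\<And>l. l \<in> K \<Longrightarrow> \<tau> l \<le> \<tau> q"
 shows "(\<Sum>l\<in>K. \<Sum>l'\<in>K. min (\<tau> l) (\<tau> l') * (\<Sum>i<d. b l i * b l' i)) =
  (\<Sum>l\<in>K. \<Sum>l'\<in>K. min (\<tau> l) (\<tau> l') * (\<Sum>i<d. a l i * a l' i)) + 2 * (\<Sum>l\<in>K. \<tau> l * (\<Sum>i<d. a l i * c i)) + \<tau> q * (\<Sum>i<d. c i * c i)"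
proof -
 have ipb: "min (\<tau> l) (\<tau> l') * (\<Sum>i<d. b l i * b l' i) = min (\<tau> l) (\<tau> l') * (\<Sum>i<d. a l i * a l' i) +
   (if l' = q then \<tau> l * (\<Sum>i<d. a l i * c i) else 0) + (if l = q then \<tau> l' * (\<Sum>i<d. a l' i * c i) else 0) +
   (if l = q then (if l' = q then \<tau> q * (\<Sum>i<d. c i * c i) else 0) else 0)" if "l \<in> K" "l' \<in> K" for l l'
 proof -
  have m: "min (\<tau> l) (\<tau> q) = \<tau> l" "min (\<tau> q) (\<tau> l') = \<tau> l'" using max that by auto
  have "(\<Sum>i<d. b l i * b l' i) = (\<Sum>i<d. a l i * a l' i) + (if l' = q then (\<Sum>i<d. a l i * c i) else 0) +
    (if l = q then (\<Sum>i<d. a l' i * c i) else 0) + (if l = q then (if l' = q then (\<Sum>i<d. c i * c i) else 0) else 0)"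
   unfolding b_def by (simp add: distrib_left distrib_right sum.distrib mult.commute)
  then show ?thesis using m by (simp add: distrib_left)
 qed
 have "(\<Sum>l\<in>K. \<Sum>l'\<in>K. min (\<tau> l) (\<tau> l') * (\<Sum>i<d. b l i * b l' i)) =
  (\<Sum>l\<in>K. \<Sum>l'\<in>K. min (\<tau> l) (\<tau> l') * (\<Sum>i<d. a l i * a l' i) +
   (if l' = q then \<tau> l * (\<Sum>i<d. a l i * c i) else 0) + (if l = q then \<tau> l' * (\<Sum>i<d. a l' i * c i) else 0) +
   (if l = q then (if l' = q then \<tau> q * (\<Sum>i<d. c i * c i) else 0) else 0))" by (intro sum.cong refl ipb)
 also have "\<dots> = (\<Sum>l\<in>K. (\<Sum>l'\<in>K. min (\<tau> l) (\<tau> l') * (\<Sum>i<d. a l i * a l' i)) + \<tau> l * (\<Sum>i<d. a l i * c i) +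
   (if l = q then (\<Sum>l'\<in>K. \<tau> l' * (\<Sum>i<d. a l' i * c i)) + \<tau> q * (\<Sum>i<d. c i * c i) else 0))"
  by (rule sum.cong) (use K in \<open>simp_all add: sum.distrib\<close>)
 also have "\<dots> = (\<Sum>l\<in>K. \<Sum>l'\<in>K. min (\<tau> l) (\<tau> l') * (\<Sum>i<d. a l i * a l' i)) + 2 * (\<Sum>l\<in>K. \<tau> l * (\<Sum>i<d. a l i * c i)) + \<tau> q * (\<Sum>i<d. c i * c i)"
  using K by (simp add: sum.distrib)
 finally show ?thesis .
qed

lemma bm_past_future:
 assumes W: "std_brownian_motion M d W" and K: "finite K" "\<And>k. k \<in> K \<Longrightarrow> 0 \<le> \<tau> k \<and> \<tau> k \<le> s" and st: "0 \<le> s" "s < t"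
 shows "(\<integral>w. iexp ((\<Sum>k\<in>K. \<Sum>i<d. a k i * W w (\<tau> k) $ i) + (\<Sum>i<d. u i * (W w t - W w s) $ i)) \<partial>M) =
  (\<integral>w. iexp (\<Sum>k\<in>K. \<Sum>i<d. a k i * W w (\<tau> k) $ i) \<partial>M) * complex_of_real (exp (- ((t - s) * (\<Sum>i<d. u i * u i)) / 2))"
proof -
 have ind: "indep_elements M (\<Pi>\<^sub>M u\<in>{0..s}. vec_borel d) (\<lambda>w. \<lambda>u\<in>{0..s}. W w u) (vec_borel d) (\<lambda>w. W w t - W w s)"
  using W st unfolding std_brownian_motion_def by blast
 define g where "g x = iexp (\<Sum>k\<in>K. \<Sum>i<d. a k i * x (\<tau> k) $ i)" for x :: "real \<Rightarrow> real vec"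
 define h where "h v = iexp (\<Sum>i<d. u i * v $ i)" for v :: "real vec"
 have [measurable]: "(\<lambda>x. x (\<tau> k) $ i) \<in> borel_measurable (\<Pi>\<^sub>M u\<in>{0..s}. vec_borel d)" if "k \<in> K" "i < d" for k i
  by (rule measurable_compose[OF measurable_component_singleton[of "\<tau> k" "{0..s}" "\<lambda>_. vec_borel d"] vec_index_measurable])
    (use K that in auto)
 have [measurable]: "g \<in> borel_measurable (\<Pi>\<^sub>M u\<in>{0..s}. vec_borel d)" unfolding g_def by measurable
 have [measurable]: "h \<in> borel_measurable (vec_borel d)"
  unfolding h_def using vec_index_measurable[of _ d] by measurable
 have gW: "g (\<lambda>u\<in>{0..s}. W w u) = iexp (\<Sum>k\<in>K. \<Sum>i<d. a k i * W w (\<tau> k) $ i)" for w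
  unfolding g_def by (rule arg_cong[where f = iexp], intro sum.cong refl) (use K in simp)
 have "(\<integral>w. iexp ((\<Sum>k\<in>K. \<Sum>i<d. a k i * W w (\<tau> k) $ i) + (\<Sum>i<d. u i * (W w t - W w s) $ i)) \<partial>M) =
   (\<integral>w. g (\<lambda>u\<in>{0..s}. W w u) * h (W w t - W w s) \<partial>M)"
  unfolding gW h_def by (simp add: exp_add[symmetric] distrib_left)
 also have "\<dots> = (\<integral>w. g (\<lambda>u\<in>{0..s}. W w u) \<partial>M) * (\<integral>w. h (W w t - W w s) \<partial>M)"
  by (rule indep_elements_integral[OF std_brownian_motion_prob_space[OF W] ind \<open>g \<in> borel_measurable _\<close> _ \<open>h \<in> borel_measurable _\<close>])
   (unfold g_def h_def norm_exp_i_times, simp_all)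
 also have "(\<integral>w. h (W w t - W w s) \<partial>M) = complex_of_real (exp (- ((t - s) * (\<Sum>i<d. u i * u i)) / 2))"
  unfolding h_def by (rule bm_increment_char[OF W st])
 finally show ?thesis unfolding gW .
qed

text \<open>Induction on the number of times. The value at the latest time \<open>k\<close> is the
  value at the latest remaining time \<open>q\<close> plus an independent increment. The
  coefficients of \<open>k\<close> are merged into those of \<open>q\<close>, and the increment
  supplies the missing variance \<open>\<tau> k - \<tau> q\<close>. Coinciding times and time 0 have
  no increment density and are treated separately.\<close>

lemma bm_char:
 assumes W: "std_brownian_motion M d W"
 shows "finite K \<Longrightarrow> (\<And>k. k \<in> K \<Longrightarrow> 0 \<le> \<tau> k) \<Longrightarrow>
  (\<integral>w. iexp (\<Sum>k\<in>K. \<Sum>i<d. a k i * W w (\<tau> k) $ i) \<partial>M) =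
  complex_of_real (exp (- (\<Sum>k\<in>K. \<Sum>l\<in>K. min (\<tau> k) (\<tau> l) * (\<Sum>i<d. a k i * a l i)) / 2))"
proof (induction "card K" arbitrary: K a)
 case 0
 interpret prob_space M using W by (rule std_brownian_motion_prob_space)
 show ?case using 0 prob_space by simp
next
 case (Suc n)
 then have ne: "K \<noteq> {}" by auto
 have "Max (\<tau> ` K) \<in> \<tau> ` K" using Suc ne by (intro Max_in) auto
 then obtain k where k: "k \<in> K" "\<tau> k = Max (\<tau> ` K)" by auto
 have max: "\<tau> l \<le> \<tau> k" if "l \<in> K" for l unfolding k(2) using Suc that by (intro Max_ge) auto
 define K' where "K' = K - {k}"
 have K': "finite K'" "k \<notin> K'" "K = insert k K'" "card K' = n" using Suc k by (auto simp: K'_def)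
 have carrier: "W w t \<in> carrier_vec d" if "w \<in> space M" "0 \<le> t" for w t by (rule bm_path(3)[OF W that])
 have \<tau>k: "0 \<le> \<tau> k" by (rule Suc.prems(2)[OF k(1)])
 define ip where "ip l l' = (\<Sum>i<d. a l i * a l' i)" for l l'
 have Q: "(\<Sum>l\<in>K. \<Sum>l'\<in>K. min (\<tau> l) (\<tau> l') * ip l l') =
  (\<Sum>l\<in>K'. \<Sum>l'\<in>K'. min (\<tau> l) (\<tau> l') * ip l l') + 2 * (\<Sum>l\<in>K'. \<tau> l * ip l k) + \<tau> k * ip k k"
  unfolding K'(3) by (rule min_quadratic_form_insert) (use K' max in \<open>auto simp: ip_def mult.commute\<close>)
 show ?case
 proof (cases "K' = {}")
  case True
  show ?thesis
  proof (cases "\<tau> k = 0")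
   case t0: True
   interpret prob_space M using W by (rule std_brownian_motion_prob_space)
   have "(\<integral>w. iexp (\<Sum>k\<in>K. \<Sum>i<d. a k i * W w (\<tau> k) $ i) \<partial>M) = (\<integral>w. 1 \<partial>M)"
    by (rule Bochner_Integration.integral_cong) (simp_all add: K'(3) True t0 bm_path(1)[OF W])
   then show ?thesis using prob_space by (simp add: K'(3) True t0)
  next
   case False
   then have tk: "0 < \<tau> k" using \<tau>k by simp
   have "(\<integral>w. iexp (\<Sum>k\<in>K. \<Sum>i<d. a k i * W w (\<tau> k) $ i) \<partial>M) = (\<integral>w. iexp (\<Sum>i<d. a k i * (W w (\<tau> k) - W w 0) $ i) \<partial>M)"
    by (rule Bochner_Integration.integral_cong) (use carrier[OF _ \<tau>k] in \<open>simp_all add: K'(3) True bm_path(1)[OF W]\<close>)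
   also have "\<dots> = complex_of_real (exp (- ((\<tau> k - 0) * (\<Sum>i<d. a k i * a k i)) / 2))"
    by (rule bm_increment_char[OF W _ tk]) simp
   finally show ?thesis by (simp add: K'(3) True)
  qed
 next
  case False
  have "Max (\<tau> ` K') \<in> \<tau> ` K'" using K' False by (intro Max_in) auto
  then obtain q where q: "q \<in> K'" "\<tau> q = Max (\<tau> ` K')" by auto
  have maxq: "\<tau> l \<le> \<tau> q" if "l \<in> K'" for l unfolding q(2) using K' that by (intro Max_ge) auto
  have qK: "q \<in> K" using q K' by blast
  have \<tau>q: "0 \<le> \<tau> q" "\<tau> q \<le> \<tau> k" using Suc.prems(2)[OF qK] max[OF qK] by auto
  define b where "b l i = a l i + (if l = q then a k i else 0)" for l i
  have Qb: "(\<Sum>l\<in>K'. \<Sum>l'\<in>K'. min (\<tau> l) (\<tau> l') * (\<Sum>i<d. b l i * b l' i)) =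
   (\<Sum>l\<in>K'. \<Sum>l'\<in>K'. min (\<tau> l) (\<tau> l') * ip l l') + 2 * (\<Sum>l\<in>K'. \<tau> l * ip l k) + \<tau> q * ip k k"
   unfolding ip_def by (rule min_quadratic_form_merge[where b = b and c = "a k" and q = q, OF _ K'(1) q(1)]) (auto simp: b_def[abs_def] maxq)
  have IH: "(\<integral>w. iexp (\<Sum>l\<in>K'. \<Sum>i<d. b l i * W w (\<tau> l) $ i) \<partial>M) =
   complex_of_real (exp (- (\<Sum>l\<in>K'. \<Sum>l'\<in>K'. min (\<tau> l) (\<tau> l') * (\<Sum>i<d. b l i * b l' i)) / 2))"
   by (rule Suc.hyps(1)) (use K' Suc.prems in auto)
  have sb: "(\<Sum>l\<in>K'. \<Sum>i<d. b l i * W w (\<tau> l) $ i) = (\<Sum>l\<in>K'. \<Sum>i<d. a l i * W w (\<tau> l) $ i) + (\<Sum>i<d. a k i * W w (\<tau> q) $ i)" for w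
  proof -
   have "(\<Sum>l\<in>K'. \<Sum>i<d. b l i * W w (\<tau> l) $ i) =
    (\<Sum>l\<in>K'. (\<Sum>i<d. a l i * W w (\<tau> l) $ i) + (if l = q then (\<Sum>i<d. a k i * W w (\<tau> q) $ i) else 0))"
    by (rule sum.cong) (simp_all add: b_def distrib_right sum.distrib)
   then show ?thesis using K' q by (simp add: sum.distrib)
  qed
  have split: "(\<Sum>l\<in>K. \<Sum>i<d. a l i * W w (\<tau> l) $ i) =
    (\<Sum>l\<in>K'. \<Sum>i<d. b l i * W w (\<tau> l) $ i) + (\<Sum>i<d. a k i * (W w (\<tau> k) - W w (\<tau> q)) $ i)" if w: "w \<in> space M" for w
  proof -
   have "(\<Sum>i<d. a k i * (W w (\<tau> k) - W w (\<tau> q)) $ i) = (\<Sum>i<d. a k i * W w (\<tau> k) $ i) - (\<Sum>i<d. a k i * W w (\<tau> q) $ i)"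
    using carrier[OF w \<tau>k] carrier[OF w \<tau>q(1)] by (simp add: right_diff_distrib sum_subtractf)
   then show ?thesis using K' sb[of w] by simp
  qed
  have "(\<integral>w. iexp (\<Sum>l\<in>K. \<Sum>i<d. a l i * W w (\<tau> l) $ i) \<partial>M) =
   (\<integral>w. iexp ((\<Sum>l\<in>K'. \<Sum>i<d. b l i * W w (\<tau> l) $ i) + (\<Sum>i<d. a k i * (W w (\<tau> k) - W w (\<tau> q)) $ i)) \<partial>M)"
   by (rule Bochner_Integration.integral_cong) (simp_all only: split)
  also have "\<dots> = (\<integral>w. iexp (\<Sum>l\<in>K'. \<Sum>i<d. b l i * W w (\<tau> l) $ i) \<partial>M) * complex_of_real (exp (- ((\<tau> k - \<tau> q) * ip k k) / 2))"
  proof (cases "\<tau> q = \<tau> k")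
   case True
   have "(\<Sum>i<d. a k i * (W w (\<tau> k) - W w (\<tau> q)) $ i) = 0" if "w \<in> space M" for w
    using carrier[OF that \<tau>k] unfolding True by simp
   then have "(\<integral>w. iexp ((\<Sum>l\<in>K'. \<Sum>i<d. b l i * W w (\<tau> l) $ i) + (\<Sum>i<d. a k i * (W w (\<tau> k) - W w (\<tau> q)) $ i)) \<partial>M)
    = (\<integral>w. iexp (\<Sum>l\<in>K'. \<Sum>i<d. b l i * W w (\<tau> l) $ i) \<partial>M)"
    by (intro Bochner_Integration.integral_cong) simp_all
   then show ?thesis using True by simp
  next
   case False
   then show ?thesis unfolding ip_def by (intro bm_past_future[OF W K'(1)]) (use maxq Suc.prems K' \<tau>q in auto)
  qed
  also have "\<dots> = complex_of_real (exp (- (\<Sum>l\<in>K. \<Sum>l'\<in>K. min (\<tau> l) (\<tau> l') * ip l l') / 2))"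
   unfolding IH Qb Q of_real_mult[symmetric] exp_add[symmetric]
   by (rule arg_cong[where f = complex_of_real], rule arg_cong[where f = exp]) (simp add: field_simps)
  finally show ?thesis unfolding ip_def .
 qed
qed

section \<open>The deterministic multi-scale limit\<close>

text \<open>On \<open>[0, 0]\<close> the input agrees with the constant path \<open>x 0\<close>,
  whose regulator is zero because it is nonnegative already.\<close>

lemma rsol_init:
 assumes R: "Mmat d R w" and y: "rsol d R x y" and x: "\<And>i. i < d \<Longrightarrow> 0 \<le> x 0 i" and i: "i < d"
 shows "y 0 i = 0"
proof -
 have "rsol d R (\<lambda>t. x 0) (\<lambda>t i. 0)" unfolding rsol_def using x by simp
 then have "\<bar>y 0 i - 0\<bar> \<le> 0 * w i"
 proof (rule rsol_lipschitz[OF R y, where T = 0])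
  fix v j assume "0 \<le> v" "v \<le> (0::real)"
  then show "\<bar>x v j - x 0 j\<bar> \<le> 0" by simp
 qed (use i in auto)
 then show ?thesis by simp
qed

lemma sum_lessThan_split:
 fixes f :: "nat \<Rightarrow> real"
 assumes "k \<le> J" shows "(\<Sum>m<J. f m) = (\<Sum>m<k. f m) + (\<Sum>m<J - k. f (k + m))"
proof -
 have "(\<Sum>m<J. f m) = (\<Sum>m<k. f m) + (\<Sum>m\<in>{k..<J}. f m)"
  using sum.atLeastLessThan_concat[of 0 k J f] assms by (simp add: atLeast0LessThan)
 also have "(\<Sum>m\<in>{k..<J}. f m) = (\<Sum>m<J - k. f (k + m))"
  using sum.shift_bounds_nat_ivl[of f 0 k "J - k"] assms by (simp add: atLeast0LessThan add.commute)
 finally show ?thesis .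
qed

text \<open>The largest weighted coordinate \<open>v\<^sub>i/w\<^sub>i\<close> is a Lyapunov function: while \<open>i\<close> is nearly maximal, the
 \<open>i\<close>-th coordinate of \<open>A v\<close> is positive, so \<open>v\<^sub>i\<close> is not being pushed.\<close>

lemma max_coordinate_bound:
 assumes A: "Mmat k A w"
 shows "\<exists>C\<ge>0. \<forall>v T m0 \<eta>. 0 \<le> T \<longrightarrow> 0 \<le> m0 \<longrightarrow> 0 \<le> \<eta> \<longrightarrow> cpath k v \<longrightarrow>
  (\<forall>i<k. v 0 i \<le> m0) \<longrightarrow>
  (\<forall>i<k. \<forall>s t. 0 \<le> s \<longrightarrow> s \<le> t \<longrightarrow> t \<le> T \<longrightarrow> (\<forall>u\<in>{s..t}. 0 < (\<Sum>m<k. A i m * v u m)) \<longrightarrow> v t i - v s i \<le> \<eta>) \<longrightarrow>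
  (\<forall>t\<in>{0..T}. \<forall>i<k. v t i \<le> C * (m0 + \<eta>))"
proof (cases "k = 0")
 case True then show ?thesis by (intro exI[of _ 0]) auto
next
 case False
 have w: "0 < w i" if "i < k" for i using A that by (simp add: Mmat_def)
 note D = Mmat_diag[OF A]
 \<comment> \<open>So small that in the band \<open>v_i \<ge> (1 - \<kappa>) Q w_i\<close> the
   diagonal term loses at most \<open>Q / 2\<close>, which leaves
   \<open>(A v)_i \<ge> Q / 2\<close>.\<close>
 define \<kappa> where "\<kappa> = Min ((\<lambda>i. 1 / (2 * (A i i * w i))) ` {..<k})"
 have fin: "finite ((\<lambda>i. 1 / (2 * (A i i * w i))) ` {..<k})" "(\<lambda>i. 1 / (2 * (A i i * w i))) ` {..<k} \<noteq> {}"
  using False by auto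
 have \<kappa>0: "0 < \<kappa>" unfolding \<kappa>_def Min_gr_iff[OF fin] using D w by auto
 have \<kappa>i: "\<kappa> * (A i i * w i) \<le> 1 / 2" if "i < k" for i
 proof -
  have "\<kappa> \<le> 1 / (2 * (A i i * w i))" unfolding \<kappa>_def by (rule Min_le) (use that in auto)
  moreover have "0 < A i i * w i" using D(1)[OF that] by linarith
  ultimately show ?thesis by (simp add: field_simps)
 qed
 have \<kappa>1: "\<kappa> \<le> 1"
 proof -
  have "\<kappa> * 1 \<le> \<kappa> * (A 0 0 * w 0)" using D(1)[of 0] False \<kappa>0 by (intro mult_left_mono) auto
  then show ?thesis using \<kappa>i[of 0] False by linarith
 qed
 \<comment> \<open>The maximizing coordinate is not known in advance; summing over all pairs
   converts a bound in coordinate \<open>i\<close> into one for every coordinate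
   \<open>j\<close>.\<close>
 define C where "C = (\<Sum>j<k. \<Sum>i<k. w j / (\<kappa> * w i))"
 have Cnn: "0 \<le> C" unfolding C_def using w \<kappa>0 by (intro sum_nonneg divide_nonneg_nonneg mult_nonneg_nonneg) (auto simp: less_imp_le)
 have Cge: "w j / (\<kappa> * w i) \<le> C" if "i < k" "j < k" for i j
 proof -
  have nn: "0 \<le> w j / (\<kappa> * w i)" if "i < k" "j < k" for i j using w[OF that(1)] w[OF that(2)] \<kappa>0 by simp
  have "w j / (\<kappa> * w i) \<le> (\<Sum>i<k. w j / (\<kappa> * w i))" by (rule member_le_sum) (use that nn in auto)
  also have "\<dots> \<le> C" unfolding C_def by (rule member_le_sum) (use that nn in \<open>auto intro!: sum_nonneg\<close>)
  finally show ?thesis .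
 qed
 have main: "v t j \<le> C * (m0 + \<eta>)"
  if T: "0 \<le> T" and m0: "0 \<le> m0" and \<eta>: "0 \<le> \<eta>" and cv: "cpath k v"
   and v0: "\<And>i. i < k \<Longrightarrow> v 0 i \<le> m0"
   and inc: "\<And>i s t. i < k \<Longrightarrow> 0 \<le> s \<Longrightarrow> s \<le> t \<Longrightarrow> t \<le> T \<Longrightarrow> (\<forall>u\<in>{s..t}. 0 < (\<Sum>m<k. A i m * v u m)) \<Longrightarrow> v t i - v s i \<le> \<eta>"
   and t: "t \<in> {0..T}" and j: "j < k" for v T m0 \<eta> t j
 proof -
  have cont: "continuous_on {0..a} (\<lambda>u. v u i)" if "i < k" for i a
   using cv that unfolding cpath_def by (auto intro: continuous_on_subset)
  have "\<exists>\<sigma>\<in>{0..T}. \<forall>u\<in>{0..T}. v u i \<le> v \<sigma> i" if "i < k" for i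
   using continuous_attains_sup[OF _ _ cont[OF that]] T by auto
  then obtain \<sigma> where \<sigma>: "\<And>i. i < k \<Longrightarrow> \<sigma> i \<in> {0..T}" "\<And>i u. i < k \<Longrightarrow> u \<in> {0..T} \<Longrightarrow> v u i \<le> v (\<sigma> i) i" by metis
  define q where "q i = v (\<sigma> i) i / w i" for i
  have "Max (q ` {..<k}) \<in> q ` {..<k}" using j by (intro Max_in) auto
  then obtain i where i: "i < k" "q i = Max (q ` {..<k})" by auto
  define Q where "Q = q i"
  have qQ: "q l \<le> Q" if "l < k" for l unfolding Q_def i(2) using that by (intro Max_ge) auto
  have vQ: "v u l \<le> Q * w l" if l: "l < k" and u: "u \<in> {0..T}" for u l
  proof -
   have "v u l \<le> q l * w l" using \<sigma>(2)[OF l u] w[OF l] by (simp add: q_def)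
   also have "\<dots> \<le> Q * w l" using qQ[OF l] w[OF l] by (intro mult_right_mono) auto
   finally show ?thesis .
  qed
  have key: "Q \<le> (m0 + \<eta>) / (\<kappa> * w i)"
  proof (cases "0 < Q")
   case False
   moreover have "0 \<le> (m0 + \<eta>) / (\<kappa> * w i)" using m0 \<eta> \<kappa>0 w[OF i(1)] by simp
   ultimately show ?thesis by linarith
  next
   case True
   \<comment> \<open>The lower edge of the band. The coordinate attains its maximum
     \<open>Q w_i\<close> at time \<open>p\<close>, and since its last visit to \<open>lv\<close> it
     has stayed in the band, so it climbed the width \<open>\<kappa> Q w_i\<close> under the
     hypothesis that limits such a climb by \<open>\<eta>\<close>. If it was above \<open>lv\<close>
     from the start, the initial bound \<open>m0\<close> is used.\<close>
   define lv where "lv = (1 - \<kappa>) * Q * w i"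
   define p where "p = \<sigma> i"
   have p: "0 \<le> p" "p \<le> T" "v p i = Q * w i"
    using \<sigma>(1)[OF i(1)] w[OF i(1)] by (auto simp: p_def Q_def q_def)
   have lvp: "lv < v p i" unfolding lv_def p using True w[OF i(1)] \<kappa>0 by (simp add: left_diff_distrib)
   have pos: "0 < (\<Sum>m<k. A i m * v u m)" if u: "u \<in> {0..T}" and vu: "lv \<le> v u i" for u
   proof -
    have "(\<Sum>m\<in>{..<k}-{i}. Q * (A i m * w m)) \<le> (\<Sum>m\<in>{..<k}-{i}. A i m * v u m)"
    proof (rule sum_mono)
     fix m assume m: "m \<in> {..<k}-{i}"
     then have "A i m \<le> 0" using A i by (auto simp: Mmat_def)
     moreover have "v u m \<le> Q * w m" using m by (intro vQ u) auto
     ultimately have "A i m * (Q * w m) \<le> A i m * v u m" by (rule mult_left_mono_neg[rotated])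
     then show "Q * (A i m * w m) \<le> A i m * v u m" by (simp add: mult.left_commute)
    qed
    moreover have "A i i * lv \<le> A i i * v u i" using D(2)[OF i(1)] vu by (intro mult_left_mono) auto
    moreover have "(\<Sum>m\<in>{..<k}-{i}. Q * (A i m * w m)) = Q * (\<Sum>m\<in>{..<k}-{i}. A i m * w m)" by (simp add: sum_distrib_left)
    moreover have "A i i * lv = Q * (A i i * w i) - Q * (\<kappa> * (A i i * w i))" by (simp add: lv_def algebra_simps)
    moreover have "Q * 1 \<le> Q * (\<Sum>m<k. A i m * w m)" using A i True by (intro mult_left_mono) (auto simp: Mmat_def)
    moreover have "Q * (\<Sum>m<k. A i m * w m) = Q * (A i i * w i) + Q * (\<Sum>m\<in>{..<k}-{i}. A i m * w m)"
     by (simp add: sum_remove_lessThan[OF i(1)] distrib_left)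
    moreover have "Q * (\<kappa> * (A i i * w i)) \<le> Q * (1 / 2)" using \<kappa>i[OF i(1)] True by (intro mult_left_mono) auto
    ultimately show ?thesis using True unfolding sum_remove_lessThan[OF i(1), of "\<lambda>m. A i m * v u m"] by linarith
   qed
   have "Q * (\<kappa> * w i) \<le> m0 + \<eta>"
   proof (cases "\<forall>u\<in>{0..p}. lv < v u i")
    case above: True
    have "v p i - v 0 i \<le> \<eta>" by (rule inc[OF i(1)]) (use p above in \<open>auto intro!: pos less_imp_le\<close>)
    then have "Q * w i \<le> m0 + \<eta>" using v0[OF i(1)] p by linarith
    moreover have "Q * (\<kappa> * w i) \<le> Q * (1 * w i)"
     using \<kappa>1 True w[OF i(1)] by (intro mult_left_mono mult_right_mono) auto
    ultimately show ?thesis by linarith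
   next
    case False
    define B where "B = {u \<in> {0..p}. v u i \<le> lv}"
    have "B = {0..p} \<inter> (\<lambda>u. v u i) -` {..lv}" by (auto simp: B_def)
    then have "closed B" by (simp only:) (intro continuous_closed_preimage cont[OF i(1)] closed_atLeastAtMost closed_atMost)
    moreover have "B \<noteq> {}" "bdd_above B" using False unfolding B_def by (auto simp: bdd_above_def not_less)
    ultimately have SB: "Sup B \<in> B" by (intro closed_contains_Sup)
    define s where "s = Sup B"
    have s: "0 \<le> s" "s \<le> p" "v s i \<le> lv" using SB unfolding B_def s_def by auto
    have ub: "u \<le> s" if "u \<in> B" for u unfolding s_def by (rule cSup_upper[OF that \<open>bdd_above B\<close>])
    have vs: "v s i = lv"
    proof (rule ccontr)
     assume "v s i \<noteq> lv"
     then have "v s i < lv" using s by simp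
     moreover have "continuous_on {s..p} (\<lambda>u. v u i)" by (rule continuous_on_subset[OF cont[OF i(1), of p]]) (use s in auto)
     ultimately obtain u where u: "s \<le> u" "u \<le> p" "v u i = lv"
      using IVT'[of "\<lambda>u. v u i" s lv p] lvp s by auto
     then have "u \<le> s" using s by (intro ub) (auto simp: B_def)
     then show False using u \<open>v s i < lv\<close> by simp
    qed
    have "v p i - v s i \<le> \<eta>"
    proof (rule inc[OF i(1) s(1,2) p(2)], intro ballI pos)
     fix u assume u: "u \<in> {s..p}"
     then show "u \<in> {0..T}" using s p by auto
     show "lv \<le> v u i"
     proof (rule ccontr)
      assume n: "\<not> lv \<le> v u i"
      then have "u \<le> s" using u s by (intro ub) (auto simp: B_def)
      then have "u = s" using u by auto
      then show False using vs n by simp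
     qed
    qed
    then have "Q * (\<kappa> * w i) \<le> \<eta>" using vs p by (simp add: lv_def algebra_simps)
    then show ?thesis using m0 by linarith
   qed
   then show ?thesis using \<kappa>0 w[OF i(1)] by (simp add: pos_le_divide_eq)
  qed
  have "v t j \<le> Q * w j" by (rule vQ[OF j t])
  also have "\<dots> \<le> (m0 + \<eta>) / (\<kappa> * w i) * w j" using key w[OF j] by (intro mult_right_mono) auto
  also have "\<dots> = (w j / (\<kappa> * w i)) * (m0 + \<eta>)" by simp
  also have "\<dots> \<le> C * (m0 + \<eta>)" using Cge[OF i(1) j] m0 \<eta> by (intro mult_right_mono) auto
  finally show ?thesis .
 qed
 show ?thesis
 proof (rule exI[of _ C], intro conjI Cnn allI impI ballI)
  fix v T m0 \<eta> t i
  assume a: "0 \<le> T" "0 \<le> m0" "0 \<le> \<eta>" "cpath k v" "\<forall>i<k. v 0 i \<le> m0"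
   "\<forall>i<k. \<forall>s t. 0 \<le> s \<longrightarrow> s \<le> t \<longrightarrow> t \<le> T \<longrightarrow> (\<forall>u\<in>{s..t}. 0 < (\<Sum>m<k. A i m * v u m)) \<longrightarrow> v t i - v s i \<le> \<eta>"
   "t \<in> {0..T}" "i < k"
  show "v t i \<le> C * (m0 + \<eta>)" by (rule main[OF a(1-4) _ _ a(7,8)]) (use a(5,6) in blast)+
 qed
qed

text \<open>On time steps shorter than \<open>\<delta>\<close> the increment is controlled by
  uniform continuity of the limit \<open>b\<close>; on longer ones the diverging drift outweighs the
  total oscillation of \<open>b\<close>.\<close>

lemma steep_modulus:
 fixes b :: "real \<Rightarrow> real"
 assumes lim: "uniform_limit {0..T} bs b sequentially" and b: "continuous_on {0..T} b"
  and c: "filterlim c at_top sequentially" and e: "0 < e"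
 shows "\<forall>\<^sub>F n in sequentially. \<forall>s t. 0 \<le> s \<longrightarrow> s \<le> t \<longrightarrow> t \<le> T \<longrightarrow> bs n t - bs n s - c n * (t - s) \<le> e"
proof -
 have "uniformly_continuous_on {0..T} b" using b by (intro compact_uniformly_continuous) auto
 then obtain \<delta> where \<delta>: "\<delta> > 0" "\<And>s t. s \<in> {0..T} \<Longrightarrow> t \<in> {0..T} \<Longrightarrow> dist t s < \<delta> \<Longrightarrow> dist (b t) (b s) < e / 3"
  unfolding uniformly_continuous_on_def using e by (metis divide_pos_pos zero_less_numeral)
 have "compact (b ` {0..T})" using b by (intro compact_continuous_image) auto
 then obtain m where m: "\<And>t. t \<in> {0..T} \<Longrightarrow> \<bar>b t\<bar> \<le> m" using compact_imp_bounded by (fastforce simp: bounded_iff)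
 have "\<forall>\<^sub>F n in sequentially. \<forall>t\<in>{0..T}. dist (bs n t) (b t) < e / 3"
  using uniform_limitD[OF lim, of "e/3"] e by simp
 moreover have "\<forall>\<^sub>F n in sequentially. 2 * (\<bar>m\<bar> + e) / \<delta> \<le> c n" using c by (simp add: filterlim_at_top)
 ultimately show ?thesis
 proof eventually_elim
  case (elim n)
  have "0 \<le> 2 * (\<bar>m\<bar> + e) / \<delta>" using \<delta>(1) e by (intro divide_nonneg_nonneg) auto
  then have c0: "0 \<le> c n" using elim(2) by linarith
  show ?case
  proof (intro allI impI)
   fix s t assume st: "0 \<le> s" "s \<le> t" "t \<le> T"
   have d: "\<bar>bs n t - b t\<bar> < e / 3" "\<bar>bs n s - b s\<bar> < e / 3"
    using elim(1) st by (auto simp: dist_real_def)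
   show "bs n t - bs n s - c n * (t - s) \<le> e"
   proof (cases "t - s < \<delta>")
    case True
    have "dist (b t) (b s) < e / 3" by (rule \<delta>(2)) (use st True in \<open>auto simp: dist_real_def\<close>)
    then have "b t - b s < e / 3" unfolding dist_real_def by linarith
    moreover have "0 \<le> c n * (t - s)" using c0 st by simp
    ultimately show ?thesis using d by linarith
   next
    case False
    have "2 * (\<bar>m\<bar> + e) / \<delta> * \<delta> \<le> c n * (t - s)" using elim(2) False c0 \<delta>(1) by (intro mult_mono) auto
    then have 1: "2 * \<bar>m\<bar> + 2 * e \<le> c n * (t - s)" using \<delta>(1) by simp
    have "\<bar>b t\<bar> \<le> m" "\<bar>b s\<bar> \<le> m" using st by (auto intro: m)
    then have "b t - b s \<le> 2 * m" by linarith
    moreover have "bs n t - b t < e / 3" "b s - bs n s < e / 3" using d by linarith+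
    moreover have "m \<le> \<bar>m\<bar>" by simp
    ultimately have "bs n t - bs n s \<le> 2 * \<bar>m\<bar> + 2 * e" using e by linarith
    with 1 e show ?thesis by linarith
   qed
  qed
 qed
qed

lemma lunif_lincomb:
 fixes d :: nat
 assumes "\<And>i. i < d \<Longrightarrow> uniform_limit S (\<lambda>n t. xs n t i) (\<lambda>t. x t i) sequentially"
 shows "uniform_limit S (\<lambda>n t. \<Sum>i<d. (a i :: real) * xs n t i) (\<lambda>t. \<Sum>i<d. a i * x t i) sequentially"
proof -
 have "uniform_limit S (\<lambda>n t. \<Sum>i\<in>{..<m}. a i * xs n t i) (\<lambda>t. \<Sum>i\<in>{..<m}. a i * x t i) sequentially" if "m \<le> d" for m :: nat
  using that
 proof (induction m)
  case 0 show ?case by (simp add: uniform_limit_const)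
 next
  case (Suc m)
  have "uniform_limit S (\<lambda>n t. a m * xs n t m) (\<lambda>t. a m * x t m) sequentially"
   by (rule bounded_linear.uniform_limit[OF bounded_linear_mult_right assms]) (use Suc.prems in simp)
  then show ?case using Suc by (auto intro!: uniform_limit_add)
 qed
 then show ?thesis by simp
qed

lemma uniform_limit_linear_drift:
 assumes "a \<longlonglongrightarrow> (a0 :: real)"
 shows "uniform_limit {0..T} (\<lambda>n t. t * a n) (\<lambda>t. t * a0) sequentially" unfolding uniform_limit_iff
proof (intro allI impI)
 fix e :: real assume e: "0 < e"
 have "\<forall>\<^sub>F n in sequentially. dist (a n) a0 < e / (\<bar>T\<bar> + 1)" using assms e by (intro tendstoD) auto
 then show "\<forall>\<^sub>F n in sequentially. \<forall>t\<in>{0..T}. dist (t * a n) (t * a0) < e"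
 proof eventually_elim
  case (elim n)
  show ?case
  proof
   fix t assume t: "t \<in> {0..T}"
   have "dist (t * a n) (t * a0) = t * dist (a n) a0"
    using t unfolding dist_real_def right_diff_distrib[symmetric] abs_mult by simp
   also have "\<dots> \<le> (\<bar>T\<bar> + 1) * dist (a n) a0" using t by (intro mult_right_mono) auto
   also have "\<dots> < (\<bar>T\<bar> + 1) * (e / (\<bar>T\<bar> + 1))" by (rule mult_strict_left_mono[OF elim]) auto
   also have "\<dots> = e" by simp
   finally show "dist (t * a n) (t * a0) < e" .
  qed
 qed
qed

text \<open>Time is already rescaled: \<open>c n i\<close> is the ratio of the \<open>i\<close>-th and the \<open>k\<close>-th drift scale.\<close>

locale multi_scale_input =
 fixes J k :: nat and R AI H :: fmat and w :: "nat \<Rightarrow> real"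
  and \<zeta> c :: fmat and b :: "nat \<Rightarrow> real \<Rightarrow> nat \<Rightarrow> real" and b0 :: rpath
  and \<zeta>0 :: "nat \<Rightarrow> real"
 assumes R: "Mmat J R w" and k: "k < J"
  and AI_nonneg: "\<And>i m. i < k \<Longrightarrow> m < k \<Longrightarrow> 0 \<le> AI i m"
  and AI_left: "\<And>i l. i < k \<Longrightarrow> l < k \<Longrightarrow> (\<Sum>m<k. AI i m * R m l) = (if i = l then 1 else 0)"
  and AI_right: "\<And>i l. i < k \<Longrightarrow> l < k \<Longrightarrow> (\<Sum>m<k. R i m * AI m l) = (if i = l then 1 else 0)"
  and G0: "\<And>l m. l < J - k \<Longrightarrow> m < k \<Longrightarrow> Gfun R H k l m = 0"
  and G: "Mmat (J - k) (\<lambda>l m. Gfun R H k l (k + m)) (\<lambda>l. w (k + l))"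
  and \<zeta>_nonneg: "\<And>n i. i < J \<Longrightarrow> 0 \<le> \<zeta> n i"
  and \<zeta>_lim: "\<And>i. i < J \<Longrightarrow> (\<lambda>n. \<zeta> n i) \<longlonglongrightarrow> \<zeta>0 i"
  and \<zeta>0: "\<And>i. i < J \<Longrightarrow> 0 < k \<Longrightarrow> \<zeta>0 i = 0"
  and c_top: "\<And>i. i < k \<Longrightarrow> filterlim (\<lambda>n. c n i) at_top sequentially"
  and c_k: "\<And>n. c n k = 1"
  and c_0: "\<And>i. k < i \<Longrightarrow> i < J \<Longrightarrow> (\<lambda>n. c n i) \<longlonglongrightarrow> 0"
  and b_cpath: "\<And>n. cpath J (b n)" and b0_cpath: "cpath J b0" and b_lim: "lunif J b b0"
  and b_init: "\<And>n i. i < J \<Longrightarrow> b n 0 i = 0"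
begin

definition x :: "nat \<Rightarrow> real \<Rightarrow> nat \<Rightarrow> real" where
 "x n t i = \<zeta> n i - t * (\<Sum>m<J. R i m * c n m) + b n t i"

abbreviation "y n \<equiv> rmap J R (x n)"
abbreviation "z n \<equiv> zmap J R (x n)"

lemma x_cpath: "cpath J (x n)" using b_cpath[of n] unfolding cpath_def x_def by (auto intro!: continuous_intros)

lemma y_rsol: "rsol J R (x n) (y n)" by (rule rsol_rmap[OF R x_cpath])

lemma y_refl: "refl_sol J R (x n) (y n)" by (rule rsol_imp_refl_sol[OF R y_rsol x_cpath])

lemma y_flat:
 assumes "i < J" "0 \<le> p" "p \<le> q" "\<forall>u\<in>{p..q}. 0 < x n u i + (\<Sum>j<J. R i j * y n u j)"
 shows "y n q i = y n p i" using y_refl[of n] assms unfolding refl_sol_def by blast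

lemma z_cpath: "cpath J (z n)" by (rule cpath_zmap[OF R x_cpath])

lemma z_nonneg: "0 \<le> t \<Longrightarrow> i < J \<Longrightarrow> 0 \<le> z n t i"
 unfolding zmap_def by (rule rsolD(3)[OF y_rsol])

lemma z_init: "i < J \<Longrightarrow> z n 0 i = \<zeta> n i"
proof -
 assume i: "i < J"
 have "0 \<le> x n 0 j" if "j < J" for j using that \<zeta>_nonneg b_init by (simp add: x_def)
 then have "y n 0 j = 0" if "j < J" for j by (rule rsol_init[OF R y_rsol _ that])
 then show ?thesis using i b_init by (simp add: zmap_def x_def)
qed

lemma c_lim: "l < J - k \<Longrightarrow> (\<lambda>n. c n (k + l)) \<longlonglongrightarrow> (if l = 0 then 1 else 0)"
 using c_k c_0[of "k + l"] by (cases "l = 0") auto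

text \<open>Multiplying the first \<open>k\<close> rows by the inverse of the leading block isolates
  \<open>y_i\<close> and turns the exploding part of the drift into \<open>- c n i\<close>. The
  regulators from \<open>k\<close> on push these combinations down, since \<open>AI \<ge> 0\<close>
  and the entries of \<open>R\<close> to the right of the block are nonpositive; hence an
  inequality.\<close>

lemma low_increment:
 assumes i: "i < k" and st: "0 \<le> s" "s \<le> t"
 shows "(\<Sum>m<k. AI i m * z n t m) - (\<Sum>m<k. AI i m * z n s m) \<le> y n t i - y n s i +
  (((\<Sum>m<k. AI i m * b n t m) - t * (\<Sum>m<k. AI i m * (\<Sum>l<J - k. R m (k + l) * c n (k + l)))) -
   ((\<Sum>m<k. AI i m * b n s m) - s * (\<Sum>m<k. AI i m * (\<Sum>l<J - k. R m (k + l) * c n (k + l)))) - c n i * (t - s))"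
proof -
 have inv: "(\<Sum>m<k. AI i m * (\<Sum>l<k. R m l * f l)) = f i" for f
 proof -
  have "(\<Sum>m<k. AI i m * (\<Sum>l<k. R m l * f l)) = (\<Sum>l<k. (\<Sum>m<k. AI i m * R m l) * f l)"
   by (simp add: sum_distrib_left sum_distrib_right mult.assoc) (rule sum.swap)
  also have "\<dots> = (\<Sum>l<k. if i = l then f l else 0)" by (rule sum.cong) (use i AI_left in auto)
  also have "\<dots> = f i" using i by simp
  finally show ?thesis .
 qed
 have v: "(\<Sum>m<k. AI i m * z n t m) = (\<Sum>m<k. AI i m * \<zeta> n m) - t * (c n i + (\<Sum>m<k. AI i m * (\<Sum>l<J - k. R m (k + l) * c n (k + l))))
   + (\<Sum>m<k. AI i m * b n t m) + y n t i + (\<Sum>m<k. AI i m * (\<Sum>l<J - k. R m (k + l) * y n t (k + l)))" for t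
 proof -
  have "AI i m * z n t m = AI i m * \<zeta> n m - t * (AI i m * (\<Sum>l<k. R m l * c n l) + AI i m * (\<Sum>l<J - k. R m (k + l) * c n (k + l)))
   + AI i m * b n t m + AI i m * (\<Sum>l<k. R m l * y n t l) + AI i m * (\<Sum>l<J - k. R m (k + l) * y n t (k + l))" for m
   unfolding zmap_def x_def using k by (simp add: sum_lessThan_split[of k J] algebra_simps)
  then have "(\<Sum>m<k. AI i m * z n t m) = (\<Sum>m<k. AI i m * \<zeta> n m) - t * ((\<Sum>m<k. AI i m * (\<Sum>l<k. R m l * c n l)) + (\<Sum>m<k. AI i m * (\<Sum>l<J - k. R m (k + l) * c n (k + l))))
   + (\<Sum>m<k. AI i m * b n t m) + (\<Sum>m<k. AI i m * (\<Sum>l<k. R m l * y n t l)) + (\<Sum>m<k. AI i m * (\<Sum>l<J - k. R m (k + l) * y n t (k + l)))"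
   by (simp only: sum.distrib sum_subtractf sum_distrib_left[symmetric])
  then show ?thesis by (simp only: inv)
 qed
 have mono: "(\<Sum>m<k. AI i m * (\<Sum>l<J - k. R m (k + l) * y n t (k + l))) \<le> (\<Sum>m<k. AI i m * (\<Sum>l<J - k. R m (k + l) * y n s (k + l)))"
 proof (rule sum_mono)
  fix m assume "m \<in> {..<k}"
  then have m: "m < k" by simp
  have "(\<Sum>l<J - k. R m (k + l) * y n t (k + l)) \<le> (\<Sum>l<J - k. R m (k + l) * y n s (k + l))"
  proof (rule sum_mono)
   fix l assume "l \<in> {..<J - k}"
   then have l: "k + l < J" by simp
   have "R m (k + l) \<le> 0" using R m l k by (simp add: Mmat_def)
   with rsolD(2)[OF y_rsol l st] show "R m (k + l) * y n t (k + l) \<le> R m (k + l) * y n s (k + l)"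
    by (rule mult_left_mono_neg)
  qed
  then show "AI i m * (\<Sum>l<J - k. R m (k + l) * y n t (k + l)) \<le> AI i m * (\<Sum>l<J - k. R m (k + l) * y n s (k + l))"
   using AI_nonneg[OF i m] by (rule mult_left_mono)
 qed
 show ?thesis unfolding v using mono by (simp add: algebra_simps)
qed

text \<open>For \<open>v = AI z\<close> one recovers \<open>z_i = (R v)_i\<close>. While this is
  positive, \<open>y_i\<close> is constant, so \<open>v_i\<close> increases at most by the
  increments of a convergent path with drift \<open>- c n i\<close>, which are small by
  \<open>steep_modulus\<close>. Thus \<open>v\<close> satisfies the hypotheses of
  \<open>max_coordinate_bound\<close>, and \<open>z = R v\<close> is small with it.\<close>

lemma low_coordinates_vanish:
 assumes i: "i < k"
 shows "uniform_limit {0..T} (\<lambda>n t. z n t i) (\<lambda>t. 0) sequentially"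
proof (cases "0 \<le> T")
 case False then show ?thesis by (simp add: uniform_limit_iff)
next
 case T: True
 have Rk: "Mmat k R w" by (rule Mmat_block[OF R]) (use k in simp)
 obtain C where C: "0 \<le> C" and bound: "\<And>v T m0 \<eta>. 0 \<le> T \<Longrightarrow> 0 \<le> m0 \<Longrightarrow> 0 \<le> \<eta> \<Longrightarrow> cpath k v \<Longrightarrow>
  (\<forall>i<k. v 0 i \<le> m0) \<Longrightarrow>
  (\<forall>i<k. \<forall>s t. 0 \<le> s \<longrightarrow> s \<le> t \<longrightarrow> t \<le> T \<longrightarrow> (\<forall>u\<in>{s..t}. 0 < (\<Sum>m<k. R i m * v u m)) \<longrightarrow> v t i - v s i \<le> \<eta>) \<Longrightarrow>
  (\<forall>t\<in>{0..T}. \<forall>i<k. v t i \<le> C * (m0 + \<eta>))" using max_coordinate_bound[OF Rk] by blast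
 \<comment> \<open>The noise and the part of the drift that stays bounded; the exploding part
   \<open>c n i\<close> is kept apart.\<close>
 define \<beta> where "\<beta> n i t = (\<Sum>m<k. AI i m * b n t m) - t * (\<Sum>m<k. AI i m * (\<Sum>l<J - k. R m (k + l) * c n (k + l)))" for n i t
 define \<beta>0 where "\<beta>0 i t = (\<Sum>m<k. AI i m * b0 t m) - t * (\<Sum>m<k. AI i m * (\<Sum>l<J - k. R m (k + l) * (if l = 0 then 1 else 0)))" for i t
 have \<beta>_lim: "uniform_limit {0..T} (\<lambda>n. \<beta> n i) (\<beta>0 i) sequentially" for i
  unfolding \<beta>_def \<beta>0_def
 proof (intro uniform_limit_minus lunif_lincomb uniform_limit_linear_drift tendsto_intros c_lim)
  fix m assume "m < k"
  then show "uniform_limit {0..T} (\<lambda>n t. b n t m) (\<lambda>t. b0 t m) sequentially"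
   using b_lim k unfolding lunif_def by auto
 qed auto
 have \<beta>0_cont: "continuous_on {0..T} (\<beta>0 i)" for i using b0_cpath k unfolding \<beta>0_def cpath_def
  by (intro continuous_intros) (auto intro: continuous_on_subset[of "{0..}"])
 define v where "v n t i = (\<Sum>m<k. AI i m * z n t m)" for n t i
 have v_cpath: "cpath k (v n)" for n using z_cpath[of n] k unfolding v_def cpath_def by (auto intro!: continuous_intros)
 have zv: "z n t i = (\<Sum>m<k. R i m * v n t m)" if "i < k" for n t i
 proof -
  have "(\<Sum>m<k. R i m * v n t m) = (\<Sum>l<k. (\<Sum>m<k. R i m * AI m l) * z n t l)"
   unfolding v_def by (simp add: sum_distrib_left sum_distrib_right mult.assoc) (rule sum.swap)
  also have "\<dots> = (\<Sum>l<k. if i = l then z n t l else 0)" by (rule sum.cong) (use that AI_right in auto)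
  finally show ?thesis using that by simp
 qed
 have "\<forall>\<^sub>F n in sequentially. \<forall>t\<in>{0..T}. \<forall>i<k. v n t i \<le> C * (e + e)" if e: "0 < e" for e
 proof -
  have "\<forall>\<^sub>F n in sequentially. \<forall>i\<in>{..<k}. \<forall>s t. 0 \<le> s \<longrightarrow> s \<le> t \<longrightarrow> t \<le> T \<longrightarrow> \<beta> n i t - \<beta> n i s - c n i * (t - s) \<le> e"
   by (intro eventually_ball_finite ballI steep_modulus[OF \<beta>_lim \<beta>0_cont c_top e]) auto
  moreover have "\<forall>\<^sub>F n in sequentially. \<forall>i\<in>{..<k}. (\<Sum>m<k. AI i m * \<zeta> n m) < e"
  proof (intro eventually_ball_finite ballI)
   fix i assume i: "i \<in> {..<k}"
   have "(\<lambda>n. \<Sum>m<k. AI i m * \<zeta> n m) \<longlonglongrightarrow> (\<Sum>m<k. AI i m * 0)"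
   proof (intro tendsto_intros)
    fix m assume "m \<in> {..<k}"
    then show "(\<lambda>n. \<zeta> n m) \<longlonglongrightarrow> 0" using \<zeta>_lim[of m] \<zeta>0[of m] k i by auto
   qed
   then show "\<forall>\<^sub>F n in sequentially. (\<Sum>m<k. AI i m * \<zeta> n m) < e" using e by (intro order_tendstoD(2)) auto
  qed simp
  ultimately show ?thesis
  proof eventually_elim
   case (elim n)
   show ?case
   proof (rule bound[OF T _ _ v_cpath])
    show "\<forall>i<k. v n 0 i \<le> e"
    proof (intro allI impI)
     fix i assume "i < k"
     have "v n 0 i = (\<Sum>m<k. AI i m * \<zeta> n m)" unfolding v_def by (rule sum.cong) (use k z_init in auto)
     moreover have "(\<Sum>m<k. AI i m * \<zeta> n m) < e" using elim(2) \<open>i < k\<close> by blast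
     ultimately show "v n 0 i \<le> e" by linarith
    qed
    show "\<forall>i<k. \<forall>s t. 0 \<le> s \<longrightarrow> s \<le> t \<longrightarrow> t \<le> T \<longrightarrow> (\<forall>u\<in>{s..t}. 0 < (\<Sum>m<k. R i m * v n u m)) \<longrightarrow> v n t i - v n s i \<le> e"
    proof (intro allI impI)
     fix i s t assume i: "i < k" and st: "0 \<le> s" "s \<le> t" "t \<le> T" and pos: "\<forall>u\<in>{s..t}. 0 < (\<Sum>m<k. R i m * v n u m)"
     have "\<forall>u\<in>{s..t}. 0 < x n u i + (\<Sum>j<J. R i j * y n u j)"
      using pos unfolding zv[OF i, symmetric] zmap_def .
     then have "y n t i = y n s i" using i k st by (intro y_flat) auto
     moreover have "v n t i - v n s i \<le> y n t i - y n s i + (\<beta> n i t - \<beta> n i s - c n i * (t - s))"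
      using low_increment[OF i st(1,2), of n] unfolding v_def \<beta>_def .
     moreover have "\<beta> n i t - \<beta> n i s - c n i * (t - s) \<le> e" using elim(1) i st by blast
     ultimately show "v n t i - v n s i \<le> e" by linarith
    qed
   qed (use e in auto)
  qed
 qed note v_small = this
 define K where "K = (\<Sum>m<k. \<bar>R i m\<bar>)"
 have v_nonneg: "0 \<le> v n t m" if "0 \<le> t" "m < k" for n t m
  unfolding v_def using that k AI_nonneg z_nonneg by (intro sum_nonneg mult_nonneg_nonneg) auto
 show ?thesis unfolding uniform_limit_iff
 proof (intro allI impI)
  fix e :: real assume e: "0 < e"
  \<comment> \<open>Solves \<open>2 e' (C (K + 1) + 1) = e\<close>; the added ones keep the
    denominator positive and the final inequality strict.\<close>
  define e' where "e' = e / (2 * (C * (K + 1) + 1))"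
  have K0: "0 \<le> K" unfolding K_def by (intro sum_nonneg) auto
  have pos: "0 < C * (K + 1) + 1" using C K0 by (intro add_nonneg_pos mult_nonneg_nonneg) auto
  have e': "0 < e'" using e pos by (simp add: e'_def)
  from v_small[OF e'] show "\<forall>\<^sub>F n in sequentially. \<forall>t\<in>{0..T}. dist (z n t i) 0 < e"
  proof eventually_elim
   case (elim n)
   show ?case
   proof
    fix t assume t: "t \<in> {0..T}"
    have "z n t i \<le> (\<Sum>m<k. \<bar>R i m\<bar> * (C * (e' + e')))" unfolding zv[OF i]
    proof (rule sum_mono)
     fix m assume m: "m \<in> {..<k}"
     have "R i m * v n t m \<le> \<bar>R i m\<bar> * v n t m" using v_nonneg[of t m n] t m by (intro mult_right_mono) auto
     also have "\<dots> \<le> \<bar>R i m\<bar> * (C * (e' + e'))" using elim t m by (intro mult_left_mono) auto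
     finally show "R i m * v n t m \<le> \<bar>R i m\<bar> * (C * (e' + e'))" .
    qed
    also have "\<dots> = K * (C * (e' + e'))" by (simp only: K_def sum_distrib_right)
    also have "\<dots> = (C * K) * (2 * e')" by (simp add: algebra_simps)
    also have "\<dots> < (C * (K + 1) + 1) * (2 * e')"
     using e' C by (intro mult_strict_right_mono) (auto simp: algebra_simps)
    also have "\<dots> = e"
    proof -
     have "X * (2 * (e / (2 * X))) = e" if "0 < X" for X using that by simp
     from this[OF pos] show ?thesis unfolding e'_def .
    qed
    finally show "dist (z n t i) 0 < e" using z_nonneg[of t i n] t i k by (simp add: dist_real_def)
   qed
  qed
 qed
qed

text \<open>The limiting input of the eliminated problem. The drift is column \<open>k\<close> of
  the Schur complement, because after rescaling only \<open>c n k = 1\<close> survives, and an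
  initial state is left for \<open>k = 0\<close> only.\<close>

definition x' :: rpath where
 "x' t l = (if k = 0 then \<zeta>0 l else 0) - t * Gfun R H k l k + (b0 t (k + l) - (\<Sum>i<k. H (k + l) i * b0 t i))"

text \<open>Subtracting \<open>H\<close> times the first \<open>k\<close> rows cancels their
  regulators by \<open>G0\<close>, at the price of a term \<open>H z\<close> in the low coordinates,
  which vanishes in the limit. The remaining regulators solve the problem for the Schur complement
  with input \<open>xn\<close>: complementarity concerns the unchanged coordinates of
  \<open>z\<close>. Convergence of \<open>xn\<close> and continuity of the reflection map
  conclude.\<close>

lemma high_coordinates_limit:
 "lunif (J - k) (\<lambda>n t l. z n t (k + l)) (zmap (J - k) (\<lambda>l m. Gfun R H k l (k + m)) x')"
proof -
 let ?G = "\<lambda>l m. Gfun R H k l (k + m)"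
 define xn where "xn n t l = x n t (k + l) - (\<Sum>i<k. H (k + l) i * x n t i) + (\<Sum>i<k. H (k + l) i * z n t i)" for n t l
 have elim: "f (k + l) - (\<Sum>i<k. H (k + l) i * f i) = (\<Sum>m<J. Gfun R H k l m * g m)"
  if "\<And>i. i < J \<Longrightarrow> f i = (\<Sum>m<J. R i m * g m)" "l < J - k" for f g l
 proof -
  have "(\<Sum>i<k. H (k + l) i * f i) = (\<Sum>i<k. \<Sum>m<J. H (k + l) i * R i m * g m)"
   using k that by (intro sum.cong) (auto simp: sum_distrib_left mult.assoc)
  also have "\<dots> = (\<Sum>m<J. (\<Sum>i<k. H (k + l) i * R i m) * g m)"
   by (subst sum.swap) (simp add: sum_distrib_right)
  finally show ?thesis using that k unfolding Gfun_def by (simp add: left_diff_distrib sum_subtractf)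
 qed
 have Gsum: "(\<Sum>m<J. Gfun R H k l m * g m) = (\<Sum>m<J - k. ?G l m * g (k + m))" if "l < J - k" for l g
  using k G0[OF that] by (simp add: sum_lessThan_split[of k J])
 have z_eq: "z n t (k + l) = xn n t l + (\<Sum>m<J - k. ?G l m * y n t (k + m))" if l: "l < J - k" for n t l
 proof -
  have "(\<Sum>j<J. R (k + l) j * y n t j) - (\<Sum>i<k. H (k + l) i * (\<Sum>j<J. R i j * y n t j)) = (\<Sum>m<J - k. ?G l m * y n t (k + m))"
   using elim[of "\<lambda>i. \<Sum>j<J. R i j * y n t j" "y n t" l] Gsum[OF l] l by simp
  then show ?thesis unfolding xn_def zmap_def by (simp add: distrib_left sum.distrib)
 qed
 have xn_cpath: "cpath (J - k) (xn n)" for n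
  using x_cpath[of n] z_cpath[of n] k unfolding cpath_def xn_def by (auto intro!: continuous_intros)
 have rfl: "refl_sol (J - k) ?G (xn n) (\<lambda>t l. y n t (k + l))" for n unfolding refl_sol_def
 proof (intro conjI allI impI)
  show "cpath (J - k) (\<lambda>t l. y n t (k + l))" using y_refl[of n] k unfolding refl_sol_def cpath_def by auto
 next
  fix l t assume l: "l < J - k" and t: "0 \<le> (t::real)"
  then have kl: "k + l < J" by simp
  show "0 \<le> y n t (k + l)" by (rule rsolD(1)[OF y_rsol kl t])
  show "0 \<le> xn n t l + (\<Sum>j<J - k. ?G l j * y n t (k + j))" using z_nonneg[OF t kl, of n] unfolding z_eq[OF l] .
 next
  fix l and s t :: real assume l: "l < J - k" and st: "0 \<le> s \<and> s \<le> t"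
  then show "y n s (k + l) \<le> y n t (k + l)" by (intro rsolD(2)[OF y_rsol]) auto
 next
  fix l and p q :: real assume l: "l < J - k"
   and pq: "0 \<le> p \<and> p \<le> q \<and> (\<forall>u\<in>{p..q}. 0 < xn n u l + (\<Sum>j<J - k. ?G l j * y n u (k + j)))"
  have "\<forall>u\<in>{p..q}. 0 < x n u (k + l) + (\<Sum>j<J. R (k + l) j * y n u j)"
   using pq unfolding z_eq[OF l, symmetric] zmap_def by blast
  moreover have "k + l < J" using l by simp
  ultimately show "y n q (k + l) = y n p (k + l)" using pq by (intro y_flat) auto
 next
  fix l assume l: "l < J - k" and pos: "0 < xn n 0 l + (\<Sum>j<J - k. ?G l j * y n 0 (k + j))"
  have "0 < x n 0 (k + l) + (\<Sum>j<J. R (k + l) j * y n 0 j)" using pos unfolding z_eq[OF l, symmetric] zmap_def .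
  moreover have "k + l < J" using l by simp
  ultimately show "y n 0 (k + l) = 0" using y_refl[of n] unfolding refl_sol_def by blast
 qed
 have zn: "z n t (k + l) = zmap (J - k) ?G (xn n) t l" if "0 \<le> t" "l < J - k" for n t l unfolding z_eq[OF that(2)]
  by (rule zmap_eqI[OF G refl_sol_imp_rsol[OF G rfl] xn_cpath HOL.refl that, symmetric])
 have x'_cpath: "cpath (J - k) x'" using b0_cpath k unfolding cpath_def x'_def by (auto intro!: continuous_intros)
 have "lunif (J - k) xn x'" unfolding lunif_def
 proof (intro allI impI)
  fix T l assume l: "l < J - k"
  define zl where "zl n = \<zeta> n (k + l) - (\<Sum>i<k. H (k + l) i * \<zeta> n i)" for n
  have zl: "zl \<longlonglongrightarrow> (if k = 0 then \<zeta>0 l else 0)"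
  proof (cases "k = 0")
   case True then show ?thesis using \<zeta>_lim[of l] l by (simp add: zl_def[abs_def])
  next
   case False
   have "(\<lambda>n. \<zeta> n i) \<longlonglongrightarrow> 0" if "i < J" for i using \<zeta>_lim[OF that] \<zeta>0[OF that] False by simp
   then have "zl \<longlonglongrightarrow> 0 - (\<Sum>i<k. H (k + l) i * 0)"
    unfolding zl_def using l k by (intro tendsto_intros) auto
   then show ?thesis using False by simp
  qed
  have dl: "(\<lambda>n. \<Sum>m<J - k. ?G l m * c n (k + m)) \<longlonglongrightarrow> Gfun R H k l k"
  proof -
   have "(\<lambda>n. \<Sum>m<J - k. ?G l m * c n (k + m)) \<longlonglongrightarrow> (\<Sum>m<J - k. ?G l m * (if m = 0 then 1 else 0))"
    by (intro tendsto_intros c_lim) auto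
   also have "(\<Sum>m<J - k. ?G l m * (if m = 0 then 1 else 0)) = (\<Sum>m<J - k. if m = 0 then ?G l m else 0)"
    by (rule sum.cong) auto
   also have "\<dots> = Gfun R H k l k" using k by simp
   finally show ?thesis .
  qed
  have xn_eq: "xn n t l = zl n - t * (\<Sum>m<J - k. ?G l m * c n (k + m)) + (b n t (k + l) - (\<Sum>i<k. H (k + l) i * b n t i)) + (\<Sum>i<k. H (k + l) i * z n t i)" for n t
  proof -
   have "(\<Sum>m<J. R (k + l) m * c n m) - (\<Sum>i<k. H (k + l) i * (\<Sum>m<J. R i m * c n m)) = (\<Sum>m<J - k. ?G l m * c n (k + m))"
    using elim[of "\<lambda>i. \<Sum>j<J. R i j * c n j" "c n" l] Gsum[OF l] l by simp
   moreover have "(\<Sum>i<k. H (k + l) i * x n t i) = (\<Sum>i<k. H (k + l) i * \<zeta> n i) - t * (\<Sum>i<k. H (k + l) i * (\<Sum>m<J. R i m * c n m)) + (\<Sum>i<k. H (k + l) i * b n t i)"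
    unfolding x_def by (simp add: distrib_left right_diff_distrib sum.distrib sum_subtractf sum_distrib_left mult.left_commute)
   ultimately show ?thesis unfolding xn_def zl_def x_def[of n t "k + l"] by (simp add: right_diff_distrib[symmetric] algebra_simps)
  qed
  have bl: "uniform_limit {0..T} (\<lambda>n t. b n t i) (\<lambda>t. b0 t i) sequentially" if "i < J" for i
   using b_lim that unfolding lunif_def by blast
  have const: "uniform_limit {0..T} (\<lambda>n t. zl n) (\<lambda>t. if k = 0 then \<zeta>0 l else 0) sequentially"
   unfolding uniform_limit_iff using tendstoD[OF zl] by (auto elim: eventually_mono)
  have "uniform_limit {0..T} (\<lambda>n t. xn n t l) (\<lambda>t. (if k = 0 then \<zeta>0 l else 0) - t * Gfun R H k l k + (b0 t (k + l) - (\<Sum>i<k. H (k + l) i * b0 t i)) + (\<Sum>i<k. H (k + l) i * 0)) sequentially"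
   unfolding xn_eq
   by (intro uniform_limit_add uniform_limit_minus lunif_lincomb uniform_limit_linear_drift dl const bl low_coordinates_vanish)
     (use l k in auto)
  then show "uniform_limit {0..T} (\<lambda>n t. xn n t l) (\<lambda>t. x' t l) sequentially" by (simp add: x'_def)
 qed
 from lunif_zmap[OF G xn_cpath x'_cpath this]
 show ?thesis unfolding lunif_def
 proof (intro allI impI)
  fix T l assume *: "\<forall>T. \<forall>i<J - k. uniform_limit {0..T} (\<lambda>n t. zmap (J - k) ?G (xn n) t i) (\<lambda>t. zmap (J - k) ?G x' t i) sequentially"
   and l: "l < J - k"
  then have "uniform_limit {0..T} (\<lambda>n t. zmap (J - k) ?G (xn n) t l) (\<lambda>t. zmap (J - k) ?G x' t l) sequentially" by blast
  then show "uniform_limit {0..T} (\<lambda>n t. z n t (k + l)) (\<lambda>t. zmap (J - k) ?G x' t l) sequentially"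
   by (rule uniform_limit_cong'[THEN iffD1, rotated -1]) (use zn l in auto)
 qed
qed

end

section \<open>Continuous convergence and an extended continuous mapping theorem\<close>

lemma tendsto_if_subseq_tendsto:
 fixes x :: "nat \<Rightarrow> real"
 assumes "\<And>s. strict_mono s \<Longrightarrow> \<exists>s'. strict_mono (s' :: nat \<Rightarrow> nat) \<and> (\<lambda>n. x (s (s' n))) \<longlonglongrightarrow> l"
 shows "x \<longlonglongrightarrow> l"
proof (rule ccontr)
 assume "\<not> x \<longlonglongrightarrow> l"
 then obtain e where e: "e > 0" "\<not> (\<forall>\<^sub>F n in sequentially. dist (x n) l < e)"
  unfolding tendsto_iff by blast
 then have "infinite {n. \<not> dist (x n) l < e}" unfolding eventually_cofinite[symmetric] cofinite_eq_sequentially by simp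
 then obtain s :: "nat \<Rightarrow> nat" where s: "strict_mono s" "\<And>n. s n \<in> {n. \<not> dist (x n) l < e}"
  using infinite_enumerate by blast
 from assms[OF s(1)] obtain s' where s': "strict_mono s'" "(\<lambda>n. x (s (s' n))) \<longlonglongrightarrow> l" by blast
 have "\<forall>\<^sub>F n in sequentially. dist (x (s (s' n))) l < e" using s'(2) e(1) by (rule tendstoD)
 then obtain n where "dist (x (s (s' n))) l < e" unfolding eventually_sequentially by blast
 then show False using s(2)[of "s' n"] by simp
qed

lemma compact_box:
 fixes a :: "nat \<Rightarrow> real"
 shows "compact {v. \<forall>i. \<bar>v i\<bar> \<le> a i}"
proof -
 have "compactin (product_topology (\<lambda>_. euclideanreal) UNIV) (PiE UNIV (\<lambda>i. {- a i..a i}))"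
  unfolding compactin_PiE by simp
 moreover have "PiE UNIV (\<lambda>i. {- a i..a i}) = {v. \<forall>i. \<bar>v i\<bar> \<le> a i}"
  by (auto simp: PiE_def Pi_def abs_le_iff minus_le_iff)
 ultimately show ?thesis unfolding euclidean_product_topology compactin_euclidean_iff by simp
qed

text \<open>For each \<open>m\<close> an index \<open>r m \<ge> m\<close> is picked at which
  \<open>gs\<close> is already close to \<open>g\<close> at the point \<open>vs m\<close>;
  convergence of \<open>gs (r m) (vs m)\<close> then transfers to \<open>g (vs m)\<close>.\<close>

lemma continuous_convergence_limit_continuous:
 fixes g :: "fvec \<Rightarrow> real" and gs :: "nat \<Rightarrow> fvec \<Rightarrow> real"
 assumes cc: "\<And>(r :: nat \<Rightarrow> nat) vs v. filterlim r at_top sequentially \<Longrightarrow> vs \<longlonglongrightarrow> v \<Longrightarrow> (\<lambda>m. gs (r m) (vs m)) \<longlonglongrightarrow> g v"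
 shows "continuous_on UNIV g" unfolding continuous_on_sequentially comp_def
proof (intro ballI allI impI)
 fix vs v assume "(\<forall>n. vs n \<in> UNIV) \<and> vs \<longlonglongrightarrow> (v :: nat \<Rightarrow> real)"
 then have v: "vs \<longlonglongrightarrow> v" by simp
 have "\<exists>n\<ge>m. \<bar>gs n (vs m) - g (vs m)\<bar> < inverse (real (Suc m))" for m
 proof -
  have "(\<lambda>n. gs n (vs m)) \<longlonglongrightarrow> g (vs m)" using cc[of "\<lambda>n. n" "\<lambda>_. vs m"] by (simp add: filterlim_ident)
  then have "\<forall>\<^sub>F n in sequentially. dist (gs n (vs m)) (g (vs m)) < inverse (real (Suc m))"
   by (rule tendstoD) simp
  then have "\<forall>\<^sub>F n in sequentially. dist (gs n (vs m)) (g (vs m)) < inverse (real (Suc m)) \<and> m \<le> n"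
   using eventually_ge_at_top[of m] by eventually_elim simp
  then show ?thesis unfolding eventually_sequentially dist_real_def by blast
 qed
 then obtain r where r: "\<And>m. r m \<ge> m" "\<And>m. \<bar>gs (r m) (vs m) - g (vs m)\<bar> < inverse (real (Suc m))" by metis
 have "filterlim r at_top sequentially" by (rule filterlim_at_top_mono[OF filterlim_ident]) (use r(1) in auto)
 from cc[OF this v] have 1: "(\<lambda>m. gs (r m) (vs m)) \<longlonglongrightarrow> g v" .
 have "(\<lambda>m. gs (r m) (vs m) - g (vs m)) \<longlonglongrightarrow> 0"
  by (rule Lim_null_comparison[OF _ LIMSEQ_inverse_real_of_nat]) (use r(2) in \<open>auto intro!: always_eventually less_imp_le\<close>)
 from tendsto_diff[OF 1 this] show "(\<lambda>n. g (vs n)) \<longlonglongrightarrow> g v" by simp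
qed

text \<open>A failure of uniformity yields points of \<open>K\<close> and growing indices with a gap
  of at least \<open>e\<close>; along a convergent subsequence of the points this contradicts
  \<open>cc\<close>.\<close>

lemma continuous_convergence_uniform:
 fixes g :: "fvec \<Rightarrow> real" and gs :: "nat \<Rightarrow> fvec \<Rightarrow> real"
 assumes cc: "\<And>(r :: nat \<Rightarrow> nat) vs v. filterlim r at_top sequentially \<Longrightarrow> vs \<longlonglongrightarrow> v \<Longrightarrow> (\<lambda>m. gs (r m) (vs m)) \<longlonglongrightarrow> g v"
  and K: "compact K" and e: "0 < e"
 shows "\<forall>\<^sub>F n in sequentially. \<forall>v\<in>K. \<bar>gs n v - g v\<bar> < e"
proof (rule ccontr)
 assume "\<not> ?thesis"
 then have "\<forall>m. \<exists>n\<ge>m. \<exists>v\<in>K. \<not> \<bar>gs n v - g v\<bar> < e" unfolding eventually_sequentially by blast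
 then obtain r vs where r: "\<And>m. r m \<ge> m" and vs: "\<And>m. vs m \<in> K" "\<And>m. \<not> \<bar>gs (r m) (vs m) - g (vs m)\<bar> < e" by metis
 obtain v s where s: "strict_mono (s :: nat \<Rightarrow> nat)" "(vs \<circ> s) \<longlonglongrightarrow> v"
  using compact_imp_seq_compact[OF K] vs(1) unfolding seq_compact_def by blast
 have "filterlim r at_top sequentially" by (rule filterlim_at_top_mono[OF filterlim_ident]) (use r in auto)
 then have "filterlim (\<lambda>m. r (s m)) at_top sequentially" using filterlim_compose filterlim_subseq[OF s(1)] by blast
 from cc[OF this s(2)] have 1: "(\<lambda>m. gs (r (s m)) (vs (s m))) \<longlonglongrightarrow> g v" by (simp add: comp_def)
 have "(\<lambda>m. g ((vs \<circ> s) m)) \<longlonglongrightarrow> g v"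
 proof -
  have "continuous_on UNIV g" by (rule continuous_convergence_limit_continuous[where gs = gs], rule cc)
  then show ?thesis using s(2) unfolding continuous_on_sequentially comp_def by blast
 qed
 from tendsto_diff[OF 1 this] have "(\<lambda>m. gs (r (s m)) (vs (s m)) - g (vs (s m))) \<longlonglongrightarrow> 0" by simp
 from tendstoD[OF this e] obtain m where "\<bar>gs (r (s m)) (vs (s m)) - g (vs (s m))\<bar> < e"
  unfolding eventually_sequentially dist_real_def by auto
 then show False using vs(2) by blast
qed

text \<open>Both the functionals and the random vectors vary with \<open>n\<close>. On a compact box
  the functionals converge uniformly; the mass outside is estimated by the expectation of a
  continuous cutoff, which converges to that of the limit law. Tightness is thus a by-product of
  \<open>conv\<close>.\<close>

lemma extended_continuous_mapping:
 fixes \<zeta> :: "nat \<Rightarrow> 'a \<Rightarrow> nat \<Rightarrow> real" and \<xi> :: "'c \<Rightarrow> nat \<Rightarrow> real"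
  and g :: "fvec \<Rightarrow> real" and gs :: "nat \<Rightarrow> fvec \<Rightarrow> real"
 assumes M: "prob_space M" and P: "prob_space P"
  and \<zeta>: "\<And>n. \<zeta> n \<in> borel_measurable M" and \<xi>: "\<xi> \<in> borel_measurable P"
  and supp: "\<And>n z i. J \<le> i \<Longrightarrow> \<zeta> n z i = 0"
  and conv: "\<And>h b. continuous_on UNIV h \<Longrightarrow> (\<And>v. \<bar>h v\<bar> \<le> (b::real)) \<Longrightarrow> (\<lambda>n. \<integral>z. h (\<zeta> n z) \<partial>M) \<longlonglongrightarrow> (\<integral>z. h (\<xi> z) \<partial>P)"
  and gs: "\<And>n v. \<bar>gs n v\<bar> \<le> b" "\<And>n. (\<lambda>z. gs n (\<zeta> n z)) \<in> borel_measurable M"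
  and cc: "\<And>(r :: nat \<Rightarrow> nat) vs v. filterlim r at_top sequentially \<Longrightarrow> vs \<longlonglongrightarrow> v \<Longrightarrow> (\<lambda>m. gs (r m) (vs m)) \<longlonglongrightarrow> g v"
 shows "(\<lambda>n. \<integral>z. gs n (\<zeta> n z) \<partial>M) \<longlonglongrightarrow> (\<integral>z. g (\<xi> z) \<partial>P)"
proof -
 interpret M: prob_space M by fact
 interpret P: prob_space P by fact
 have g_cont: "continuous_on UNIV g" by (rule continuous_convergence_limit_continuous[where gs = gs], rule cc)
 have g_b: "\<bar>g v\<bar> \<le> b" for v
 proof -
  have "(\<lambda>m. gs m v) \<longlonglongrightarrow> g v" using cc[of "\<lambda>m. m" "\<lambda>_. v"] by (simp add: filterlim_ident)
  from tendsto_rabs[OF this] show ?thesis by (rule LIMSEQ_le_const2) (use gs(1) in auto)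
 qed
 have b0: "0 \<le> b" using g_b[of undefined] by linarith
 have gm: "g \<in> borel_measurable borel" by (rule borel_measurable_continuous_onI[OF g_cont])
 have main: "(\<lambda>n. \<integral>z. g (\<zeta> n z) \<partial>M) \<longlonglongrightarrow> (\<integral>z. g (\<xi> z) \<partial>P)" by (rule conv[OF g_cont g_b])
 \<comment> \<open>Zero where the sum of the first \<open>J\<close> moduli is at most
   \<open>c\<close>, and one where it is at least \<open>c + 1\<close>; the remaining coordinates
   are zero by \<open>supp\<close>.\<close>
 define h where "h c v = min 1 (max 0 ((\<Sum>i<J. \<bar>v i\<bar>) - c))" for c and v :: "nat \<Rightarrow> real"
 have h_cont: "continuous_on UNIV (h c)" for c
  unfolding h_def by (intro continuous_intros) (auto intro: continuous_on_product_coordinates)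
 have h_b: "\<bar>h c v\<bar> \<le> 1" "0 \<le> h c v" for c v unfolding h_def by auto
 have h_m: "(\<lambda>z. h c (\<xi> z)) \<in> borel_measurable P" "(\<lambda>z. h c (\<zeta> n z)) \<in> borel_measurable M" for c n
  using measurable_compose[OF \<xi> borel_measurable_continuous_onI[OF h_cont]]
   measurable_compose[OF \<zeta> borel_measurable_continuous_onI[OF h_cont]] by auto
 have h0: "(\<lambda>c. \<integral>z. h (real c) (\<xi> z) \<partial>P) \<longlonglongrightarrow> (\<integral>z. 0 \<partial>P)"
 proof (rule integral_dominated_convergence[where w = "\<lambda>_. 1"])
  show "AE z in P. (\<lambda>c. h (real c) (\<xi> z)) \<longlonglongrightarrow> 0"
  proof (rule AE_I2)
   fix z
   have "\<forall>\<^sub>F c in sequentially. (\<Sum>i<J. \<bar>\<xi> z i\<bar>) \<le> real c"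
    using filterlim_real_sequentially unfolding filterlim_at_top by blast
   then have "\<forall>\<^sub>F c in sequentially. h (real c) (\<xi> z) = 0" by eventually_elim (simp add: h_def)
   then show "(\<lambda>c. h (real c) (\<xi> z)) \<longlonglongrightarrow> 0" by (rule tendsto_eventually)
  qed
 qed (use h_m h_b in auto)
 have diff: "(\<lambda>n. (\<integral>z. gs n (\<zeta> n z) \<partial>M) - (\<integral>z. g (\<zeta> n z) \<partial>M)) \<longlonglongrightarrow> 0"
 proof (rule LIMSEQ_I)
  fix e :: real assume e: "0 < e"
  \<comment> \<open>The error is \<open>e'\<close> on the box plus \<open>2 b\<close> times the mass
    \<open>e'\<close> outside, which adds up to \<open>e / 2\<close>.\<close>
  define e' where "e' = e / (2 * (2 * b + 1))"
  have e': "0 < e'" "e' * (2 * b + 1) = e / 2"     proof -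
   have p: "0 < 2 * b + 1" using b0 by simp
   show "0 < e'" using e p by (simp add: e'_def)
   have "e / (2 * x) * x = e / 2" if "0 < x" for x using that by simp
   from this[OF p] show "e' * (2 * b + 1) = e / 2" unfolding e'_def .
  qed
  have "\<forall>\<^sub>F c in sequentially. (\<integral>z. h (real c) (\<xi> z) \<partial>P) < e'" using h0 e' by (intro order_tendstoD(2)) auto
  then obtain c :: nat where c: "(\<integral>z. h (real c) (\<xi> z) \<partial>P) < e'" unfolding eventually_sequentially by blast
  have "\<forall>\<^sub>F n in sequentially. (\<integral>z. h (real c) (\<zeta> n z) \<partial>M) < e'"
   using order_tendstoD(2)[OF conv[OF h_cont h_b(1)] c] .
  moreover have "\<forall>\<^sub>F n in sequentially. \<forall>v\<in>{v. \<forall>i. \<bar>v i\<bar> \<le> (if i < J then real c + 1 else 0)}. \<bar>gs n v - g v\<bar> < e'"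
   by (rule continuous_convergence_uniform[where gs = gs, OF _ compact_box e'(1)], rule cc)
  ultimately have "\<forall>\<^sub>F n in sequentially. norm ((\<integral>z. gs n (\<zeta> n z) \<partial>M) - (\<integral>z. g (\<zeta> n z) \<partial>M) - 0) < e"
  proof eventually_elim
   case (elim n)
   have pt: "\<bar>gs n (\<zeta> n z) - g (\<zeta> n z)\<bar> \<le> e' + 2 * b * h (real c) (\<zeta> n z)" for z
   proof (cases "(\<Sum>i<J. \<bar>\<zeta> n z i\<bar>) \<le> real c + 1")
    case True
    have "\<bar>\<zeta> n z i\<bar> \<le> (if i < J then real c + 1 else 0)" for i
    proof (cases "i < J")
     case i: True
     have "\<bar>\<zeta> n z i\<bar> \<le> (\<Sum>i<J. \<bar>\<zeta> n z i\<bar>)" by (rule member_le_sum) (use i in auto)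
     then show ?thesis using True i by simp
    qed (use supp in auto)
    then have "\<bar>gs n (\<zeta> n z) - g (\<zeta> n z)\<bar> < e'" using elim(2) by blast
    moreover have "0 \<le> 2 * b * h (real c) (\<zeta> n z)" using b0 h_b(2) by simp
    ultimately show ?thesis by linarith
   next
    case False
    then have "h (real c) (\<zeta> n z) = 1" by (simp add: h_def)
    moreover have "\<bar>gs n (\<zeta> n z) - g (\<zeta> n z)\<bar> \<le> 2 * b" using gs(1)[of n "\<zeta> n z"] g_b[of "\<zeta> n z"] by linarith
    ultimately show ?thesis using e' by simp
   qed
   have m2: "(\<lambda>z. g (\<zeta> n z)) \<in> borel_measurable M" by (rule measurable_compose[OF \<zeta> gm])
   have i1: "integrable M (\<lambda>z. gs n (\<zeta> n z))" by (rule M.integrable_const_bound[of _ b]) (use gs in auto)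
   have i2: "integrable M (\<lambda>z. g (\<zeta> n z))" by (rule M.integrable_const_bound[of _ b]) (use m2 g_b in auto)
   have i3: "integrable M (\<lambda>z. h (real c) (\<zeta> n z))" by (rule M.integrable_const_bound[of _ 1]) (use h_m h_b in auto)
   have "\<bar>(\<integral>z. gs n (\<zeta> n z) \<partial>M) - (\<integral>z. g (\<zeta> n z) \<partial>M)\<bar> = \<bar>\<integral>z. gs n (\<zeta> n z) - g (\<zeta> n z) \<partial>M\<bar>"
    using i1 i2 by simp
   also have "\<dots> \<le> (\<integral>z. \<bar>gs n (\<zeta> n z) - g (\<zeta> n z)\<bar> \<partial>M)" by (rule integral_abs_bound)
   also have "\<dots> \<le> (\<integral>z. e' + 2 * b * h (real c) (\<zeta> n z) \<partial>M)"
    by (rule integral_mono) (use i1 i2 i3 pt in auto)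
   also have "\<dots> = e' + 2 * b * (\<integral>z. h (real c) (\<zeta> n z) \<partial>M)" using i3 M.prob_space by simp
   also have "\<dots> \<le> e' + 2 * b * e'" using elim(1) b0 by (intro add_left_mono mult_left_mono) auto
   also have "\<dots> = e / 2" using e'(2) by (simp add: algebra_simps)
   finally show ?case using e by simp
  qed
  then show "\<exists>N. \<forall>n\<ge>N. norm ((\<integral>z. gs n (\<zeta> n z) \<partial>M) - (\<integral>z. g (\<zeta> n z) \<partial>M) - 0) < e"
   unfolding eventually_sequentially .
 qed
 from tendsto_add[OF diff main] show ?thesis by simp
qed

section \<open>Splicing paths over time windows\<close>

text \<open>The local clock of window \<open>j\<close>: the time that \<open>[0, t]\<close> spends
  in it. The length \<open>1 / (\<gamma>_j \<gamma>_(j+1))\<close> becomes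
  \<open>\<gamma>_j / \<gamma>_(j+1)\<close>, which explodes, in the time scale of \<open>j\<close>,
  and \<open>\<gamma>_(j+1) / \<gamma>_j\<close>, which vanishes, in that of \<open>j + 1\<close>.
  The last window is unbounded.\<close>

definition splice_time :: "nat \<Rightarrow> fvec \<Rightarrow> nat \<Rightarrow> real \<Rightarrow> real" where
 "splice_time J \<gamma> j t = (let a = (\<Sum>i<j. 1 / (\<gamma> i * \<gamma> (Suc i))) in
   if Suc j < J then max 0 (min (t - a) (1 / (\<gamma> j * \<gamma> (Suc j)))) else max 0 (t - a))"

text \<open>The \<open>j\<close>-th path drives the process on the \<open>j\<close>-th of \<open>J\<close> consecutive time windows, where the window
 boundaries \<open>a\<^sub>j\<close> satisfy \<open>\<gamma>\<^sub>j\<^sup>2 a\<^sub>j \<rightarrow> 0\<close> and \<open>\<gamma>\<^sub>j\<^sup>2 a\<^sub>j\<^sub>+\<^sub>1 \<rightarrow> \<infinity>\<close>. Splicing independent Brownian motions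
 gives a Brownian motion whose rescaling at scale \<open>j\<close> is close to the \<open>j\<close>-th of them.\<close>

definition splice :: "nat \<Rightarrow> fvec \<Rightarrow> (nat \<Rightarrow> real \<Rightarrow> nat \<Rightarrow> real) \<Rightarrow> real \<Rightarrow> nat \<Rightarrow> real" where
 "splice J \<gamma> B t i = (\<Sum>j<J. B j ((\<gamma> j)\<^sup>2 * splice_time J \<gamma> j t) i / \<gamma> j)"

lemma splice_time_nonneg: "0 \<le> splice_time J \<gamma> j t" by (simp add: splice_time_def Let_def)

lemma splice_time_mono: "s \<le> t \<Longrightarrow> splice_time J \<gamma> j s \<le> splice_time J \<gamma> j t"
 unfolding splice_time_def Let_def by (cases "Suc j < J") (simp_all del: max.bounded_iff min.bounded_iff add: max.mono min.mono)

text \<open>The windows partition the half line: the clocks before window \<open>m\<close> have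
  together run for \<open>min t a_m\<close>, and the unbounded last window takes the rest.\<close>

lemma splice_time_sum:
 assumes \<gamma>: "\<And>j. j < J \<Longrightarrow> 0 < \<gamma> j" and J: "0 < J" and t: "0 \<le> t"
 shows "(\<Sum>j<J. splice_time J \<gamma> j t) = t"
proof -
 define a where "a j = (\<Sum>i<j. 1 / (\<gamma> i * \<gamma> (Suc i)))" for j
 have D: "0 \<le> 1 / (\<gamma> m * \<gamma> (Suc m))" if "Suc m < J" for m using \<gamma>[of m] \<gamma>[of "Suc m"] that by simp
 have 1: "(\<Sum>j<m. splice_time J \<gamma> j t) = min t (a m)" if "m < J" for m using that
 proof (induction m)
  case 0 show ?case using t by (simp add: a_def)
 next
  case (Suc m)
  have "splice_time J \<gamma> m t = max 0 (min (t - a m) (1 / (\<gamma> m * \<gamma> (Suc m))))"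
   using Suc.prems by (simp add: splice_time_def a_def)
  moreover have "a (Suc m) = a m + 1 / (\<gamma> m * \<gamma> (Suc m))" by (simp add: a_def)
  moreover have "(\<Sum>j<m. splice_time J \<gamma> j t) = min t (a m)" using Suc by simp
  moreover have "min t x + max 0 (min (t - x) y) = min t (x + y)" if "0 \<le> y" for x y
   using that by (simp add: min_def max_def)
  ultimately show ?case using D[OF Suc.prems] by simp
 qed
 obtain m where m: "J = Suc m" using J by (cases J) auto
 have "splice_time J \<gamma> m t = max 0 (t - a m)" by (simp add: splice_time_def a_def m)
 then show ?thesis using 1[of m] by (simp add: m min_def max_def)
qed

lemma cpath_compose:
 assumes "cpath d x" "continuous_on {0..} \<tau>" "\<And>t. 0 \<le> t \<Longrightarrow> 0 \<le> \<tau> t"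
 shows "i < d \<Longrightarrow> continuous_on {0..} (\<lambda>t. x (\<tau> t) i)"
proof -
 assume "i < d"
 then have "continuous_on {0..} (\<lambda>t. x t i)" using assms(1) by (simp add: cpath_def)
 from continuous_on_compose2[OF this assms(2)] show ?thesis using assms(3) by auto
qed

lemma continuous_splice_time: "continuous_on S (splice_time J \<gamma> j)"
proof (cases "Suc j < J")
 case True then show ?thesis unfolding splice_time_def Let_def by (auto intro!: continuous_intros)
next
 case False then show ?thesis unfolding splice_time_def Let_def by (auto intro!: continuous_intros)
qed

lemma cpath_splice:
 assumes B: "\<And>j. j < J \<Longrightarrow> cpath d (B j)"
 shows "cpath d (splice J \<gamma> B)" unfolding cpath_def
proof (intro allI impI)
 fix i assume i: "i < d"
 have "continuous_on {0..} (\<lambda>t. B j ((\<gamma> j)\<^sup>2 * splice_time J \<gamma> j t) i)" if "j < J" for j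
  by (rule cpath_compose[OF B[OF that] _ _ i])
    (auto intro!: continuous_intros continuous_splice_time simp: splice_time_nonneg)
 then show "continuous_on {0..} (\<lambda>t. splice J \<gamma> B t i)"
  unfolding splice_def divide_inverse by (intro continuous_intros) auto
qed

definition path_sup :: "real \<Rightarrow> nat \<Rightarrow> rpath \<Rightarrow> real" where
 "path_sup T i x = (SUP t\<in>{0..T}. \<bar>x t i\<bar>)"

lemma path_sup_bdd:
 assumes "cpath d x" "i < d" shows "bdd_above ((\<lambda>t. \<bar>x t i\<bar>) ` {0..T})"
proof -
 obtain m where "\<forall>u\<in>{0..T}. \<forall>i<d. \<bar>x u i\<bar> \<le> m" using cpath_bounded[OF assms(1)] by blast
 then show ?thesis using assms(2) unfolding bdd_above_def by blast
qed

lemma path_sup_upper: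
 assumes "cpath d x" "i < d" "0 \<le> t" "t \<le> T" shows "\<bar>x t i\<bar> \<le> path_sup T i x"
 unfolding path_sup_def by (rule cSUP_upper[OF _ path_sup_bdd[OF assms(1,2)]]) (use assms in auto)

lemma path_sup_nonneg:
 assumes "cpath d x" "i < d" "0 \<le> T" shows "0 \<le> path_sup T i x"
 by (rule order_trans[OF _ path_sup_upper[OF assms(1,2), of 0]]) (use assms in auto)

lemma path_sup_scale:
 assumes "0 < b" "0 \<le> a" "0 \<le> T" "cpath d x" "i < d"
 shows "path_sup T i (\<lambda>t i. a * x (b * t) i) = a * path_sup (b * T) i x"
proof (rule antisym)
 show "path_sup T i (\<lambda>t i. a * x (b * t) i) \<le> a * path_sup (b * T) i x" unfolding path_sup_def[of T]
 proof (rule cSUP_least)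
  fix t assume t: "t \<in> {0..T}"
  have "\<bar>x (b * t) i\<bar> \<le> path_sup (b * T) i x" by (rule path_sup_upper[OF assms(4,5)]) (use t assms in auto)
  then show "\<bar>a * x (b * t) i\<bar> \<le> a * path_sup (b * T) i x" using assms by (simp add: abs_mult mult_left_mono)
 qed (use assms in auto)
 have c: "cpath d (\<lambda>t i. a * x (b * t) i)" by (rule cpath_scale[OF assms(4)]) (use assms in simp)
 show "a * path_sup (b * T) i x \<le> path_sup T i (\<lambda>t i. a * x (b * t) i)"
 proof (cases "a = 0")
  case True then show ?thesis using path_sup_nonneg[OF c assms(5,3)] by simp
 next
  case False
  then have a: "0 < a" using assms by simp
  have "path_sup (b * T) i x \<le> path_sup T i (\<lambda>t i. a * x (b * t) i) / a" unfolding path_sup_def[of "b * T"]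
  proof (rule cSUP_least)
   fix t assume t: "t \<in> {0..b * T}"
   have "\<bar>a * x (b * (t / b)) i\<bar> \<le> path_sup T i (\<lambda>t i. a * x (b * t) i)"
    using path_sup_upper[OF c assms(5), of "t / b" T] t assms by (simp add: pos_divide_le_eq mult.commute)
   then show "\<bar>x t i\<bar> \<le> path_sup T i (\<lambda>t i. a * x (b * t) i) / a"
    using a assms by (simp add: abs_mult pos_le_divide_eq mult.commute)
  qed (use assms in auto)
  then show ?thesis using a by (simp add: pos_le_divide_eq mult.commute)
 qed
qed

lemma pcont_path_sup:
 assumes i: "i < d" and T: "0 \<le> T"
 shows "pcont d (\<lambda>x. min 1 (c * path_sup T i x))" unfolding pcont_def
proof (intro allI impI)
 fix xs x assume xs: "\<forall>n. cpath d (xs n)" and x: "cpath d x" and l: "lunif d xs x"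
 have "(\<lambda>n. path_sup T i (xs n)) \<longlonglongrightarrow> path_sup T i x"
 proof (rule LIMSEQ_I)
  fix e :: real assume e: "0 < e"
  then have "\<forall>\<^sub>F n in sequentially. \<forall>t\<in>{0..T}. \<forall>i<d. \<bar>xs n t i - x t i\<bar> < e / 2" by (intro lunifD[OF l]) simp
  then have "\<forall>\<^sub>F n in sequentially. norm (path_sup T i (xs n) - path_sup T i x) < e"
  proof eventually_elim
   case (elim n)
   have xn: "cpath d (xs n)" using xs by blast
   have "path_sup T i (xs n) \<le> path_sup T i x + e / 2" unfolding path_sup_def[of T i "xs n"]
   proof (rule cSUP_least)
    fix t assume t: "t \<in> {0..T}"
    then have "\<bar>xs n t i - x t i\<bar> < e / 2" using elim i by blast
    moreover have "\<bar>x t i\<bar> \<le> path_sup T i x" by (rule path_sup_upper[OF x i]) (use t in auto)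
    ultimately show "\<bar>xs n t i\<bar> \<le> path_sup T i x + e / 2" by linarith
   qed (use T in auto)
   moreover have "path_sup T i x \<le> path_sup T i (xs n) + e / 2" unfolding path_sup_def[of T i x]
   proof (rule cSUP_least)
    fix t assume t: "t \<in> {0..T}"
    then have "\<bar>xs n t i - x t i\<bar> < e / 2" using elim i by blast
    moreover have "\<bar>xs n t i\<bar> \<le> path_sup T i (xs n)" by (rule path_sup_upper[OF xn i]) (use t in auto)
    ultimately show "\<bar>x t i\<bar> \<le> path_sup T i (xs n) + e / 2" by linarith
   qed (use T in auto)
   ultimately show ?case using e by simp
  qed
  then show "\<exists>N. \<forall>n\<ge>N. norm (path_sup T i (xs n) - path_sup T i x) < e" unfolding eventually_sequentially .
 qed
 then show "(\<lambda>n. min 1 (c * path_sup T i (xs n))) \<longlonglongrightarrow> min 1 (c * path_sup T i x)" by (intro tendsto_intros)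
qed

text \<open>Three cases for window \<open>l\<close> seen on the scale of \<open>j\<close>. If
  \<open>l < j\<close>, the contribution is at most a bounded factor times the quantity in
  \<open>small\<close>; if \<open>l = j\<close>, it is \<open>B j\<close> up to a vanishing time
  shift; if \<open>l > j\<close>, the window has not been entered by time \<open>T\<close> for large
  \<open>n\<close>. The condition \<open>small\<close> concerns individual paths and is obtained
  later almost surely along a subsequence.\<close>

lemma splice_rescaled_limit:
 fixes \<gamma>s :: fmat
 assumes \<gamma>: "\<And>n j. j < J \<Longrightarrow> 0 < \<gamma>s n j"
  and ratio: "\<And>i j. i < j \<Longrightarrow> j < J \<Longrightarrow> (\<lambda>n. \<gamma>s n j / \<gamma>s n i) \<longlonglongrightarrow> 0"
  and B: "\<And>j. j < J \<Longrightarrow> cpath d (B j)" and B0: "\<And>j i. j < J \<Longrightarrow> i < d \<Longrightarrow> B j 0 i = 0"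
  and small: "\<And>j i. Suc j < J \<Longrightarrow> i < d \<Longrightarrow>
   (\<lambda>n. (\<gamma>s n (Suc j) / \<gamma>s n j) * path_sup (\<gamma>s n j / \<gamma>s n (Suc j)) i (B j)) \<longlonglongrightarrow> 0"
  and j: "j < J"
 shows "lunif d (\<lambda>n t i. \<gamma>s n j * splice J (\<gamma>s n) B (t / (\<gamma>s n j)\<^sup>2) i) (B j)"
 unfolding lunif_def
proof (intro allI impI)
 fix T i assume i: "i < d"
 define st where "st n l t = (\<gamma>s n l)\<^sup>2 * splice_time J (\<gamma>s n) l (t / (\<gamma>s n j)\<^sup>2)" for n l t
 have st_nonneg: "0 \<le> st n l t" for n l t unfolding st_def by (simp add: splice_time_nonneg)
 define f where "f l n t = (\<gamma>s n j / \<gamma>s n l) * B l (st n l t) i" for l n t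
 have eq: "\<gamma>s n j * splice J (\<gamma>s n) B (t / (\<gamma>s n j)\<^sup>2) i = (\<Sum>l<J. 1 * f l n t)" for n t
  unfolding splice_def f_def st_def by (simp add: sum_distrib_left)
 have big: "\<forall>\<^sub>F n in sequentially. T \<le> \<gamma>s n j / \<gamma>s n (Suc j)" if "Suc j < J"
 proof -
  have "\<forall>\<^sub>F n in sequentially. \<gamma>s n (Suc j) / \<gamma>s n j < 1 / (\<bar>T\<bar> + 1)"
   using ratio[of j "Suc j"] that by (intro order_tendstoD(2)) auto
  then show ?thesis
  proof eventually_elim
   case (elim n)
   have p: "0 < \<gamma>s n j" "0 < \<gamma>s n (Suc j)" using \<gamma> that j by auto
   then have "(\<bar>T\<bar> + 1) * \<gamma>s n (Suc j) < \<gamma>s n j" using elim by (simp add: field_simps)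
   then have "\<bar>T\<bar> + 1 < \<gamma>s n j / \<gamma>s n (Suc j)" using p by (simp add: pos_less_divide_eq)
   then show ?case by linarith
  qed
 qed
 \<comment> \<open>Equal to one for the window immediately before \<open>j\<close> and vanishing for
   the earlier ones; the limit matters only through boundedness.\<close>
 have next_ratio: "(\<lambda>n. \<gamma>s n j / \<gamma>s n (Suc m)) \<longlonglongrightarrow> (if j = Suc m then 1 else 0)" if "m < j" for m
 proof (cases "j = Suc m")
  case True
  have "\<gamma>s n j / \<gamma>s n (Suc m) = 1" for n using \<gamma>[OF j, of n] True by simp
  then show ?thesis using True by simp
 next
  case False then show ?thesis using ratio[of "Suc m" j] that j by simp
 qed
 have lt: "uniform_limit {0..T} (f l) (\<lambda>t. if l = j then B j t i else 0) sequentially" if l: "l < J" for l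
 proof -
  consider "l < j" | "l = j" | "j < l" by linarith
  then show ?thesis
  proof cases
   case 1
   then have Sl: "Suc l < J" "Suc l \<le> j" using j by auto
   \<comment> \<open>The factor \<open>\<gamma>_j / \<gamma>_l\<close> is split at
     \<open>l + 1\<close>: the first part converges by \<open>next_ratio\<close>, the second belongs
     to \<open>small\<close>.\<close>
   have bound: "\<bar>f l n t\<bar> \<le> (\<gamma>s n j / \<gamma>s n (Suc l)) * ((\<gamma>s n (Suc l) / \<gamma>s n l) * path_sup (\<gamma>s n l / \<gamma>s n (Suc l)) i (B l))" for n t
   proof -
    have p: "0 < \<gamma>s n j" "0 < \<gamma>s n l" "0 < \<gamma>s n (Suc l)" using \<gamma> Sl j l by auto
    have "splice_time J (\<gamma>s n) l (t / (\<gamma>s n j)\<^sup>2) \<le> 1 / (\<gamma>s n l * \<gamma>s n (Suc l))"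
     using Sl p by (simp add: splice_time_def Let_def)
    then have "st n l t \<le> (\<gamma>s n l)\<^sup>2 * (1 / (\<gamma>s n l * \<gamma>s n (Suc l)))" unfolding st_def by (rule mult_left_mono) simp
    also have "\<dots> = \<gamma>s n l / \<gamma>s n (Suc l)" using p by (simp add: power2_eq_square)
    finally have "\<bar>B l (st n l t) i\<bar> \<le> path_sup (\<gamma>s n l / \<gamma>s n (Suc l)) i (B l)"
     by (intro path_sup_upper[OF B[OF l] i st_nonneg])
    then have "\<bar>f l n t\<bar> \<le> (\<gamma>s n j / \<gamma>s n l) * path_sup (\<gamma>s n l / \<gamma>s n (Suc l)) i (B l)"
     unfolding f_def abs_mult using p by (simp add: mult_left_mono divide_right_mono)
    then show ?thesis using p by simp
   qed
   from tendsto_mult[OF next_ratio[OF 1] small[OF Sl(1) i]]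
   have lim0: "(\<lambda>n. (\<gamma>s n j / \<gamma>s n (Suc l)) * ((\<gamma>s n (Suc l) / \<gamma>s n l) * path_sup (\<gamma>s n l / \<gamma>s n (Suc l)) i (B l))) \<longlonglongrightarrow> 0" by simp
   have "uniform_limit {0..T} (f l) (\<lambda>t. 0) sequentially" unfolding uniform_limit_iff
   proof (intro allI impI)
    fix e :: real assume "0 < e"
    from order_tendstoD(2)[OF lim0 this] show "\<forall>\<^sub>F n in sequentially. \<forall>t\<in>{0..T}. dist (f l n t) 0 < e"
     unfolding dist_real_def diff_0_right by (rule eventually_mono) (use bound in \<open>blast intro: le_less_trans\<close>)
   qed
   then show ?thesis using 1 by simp
  next
   case 2
   \<comment> \<open>The starting time of window \<open>j\<close>, measured in its own time unit
     \<open>\<gamma>_j^(-2)\<close>.\<close>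
   define \<epsilon> where "\<epsilon> n = (\<Sum>m<j. (\<gamma>s n j / \<gamma>s n m) * (\<gamma>s n j / \<gamma>s n (Suc m)))" for n
   have "\<epsilon> \<longlonglongrightarrow> (\<Sum>m<j. 0 * (if j = Suc m then 1 else 0))" unfolding \<epsilon>_def
   proof (intro tendsto_sum tendsto_mult)
    fix m assume "m \<in> {..<j}"
    then have m: "m < j" by simp
    show "(\<lambda>n. \<gamma>s n j / \<gamma>s n m) \<longlonglongrightarrow> 0" by (rule ratio[OF m j])
    show "(\<lambda>n. \<gamma>s n j / \<gamma>s n (Suc m)) \<longlonglongrightarrow> (if j = Suc m then 1 else 0)" by (rule next_ratio[OF m])
   qed
   then have \<epsilon>0: "\<epsilon> \<longlonglongrightarrow> 0" by simp
   have \<epsilon>_nonneg: "0 \<le> \<epsilon> n" for n unfolding \<epsilon>_def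
   proof (intro sum_nonneg mult_nonneg_nonneg)
    fix m assume "m \<in> {..<j}"
    then show "0 \<le> \<gamma>s n j / \<gamma>s n m" "0 \<le> \<gamma>s n j / \<gamma>s n (Suc m)"
     using \<gamma>[OF j, of n] \<gamma>[of m n] \<gamma>[of "Suc m" n] j by auto
   qed
   have st_eq: "st n j t = (if Suc j < J then max 0 (min (t - \<epsilon> n) (\<gamma>s n j / \<gamma>s n (Suc j))) else max 0 (t - \<epsilon> n))" for n t
   proof -
    have p: "0 < (\<gamma>s n j)\<^sup>2" "\<gamma>s n j \<noteq> 0" using \<gamma>[OF j, of n] by auto
    have m: "p * max 0 x = max 0 (p * x)" "p * min x y = min (p * x) (p * y)" if "0 < p" for p x y :: real
     using that by (auto simp: max_def min_def zero_le_mult_iff mult_le_cancel_left_pos)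
    have e: "(\<gamma>s n j)\<^sup>2 * (\<Sum>m<j. 1 / (\<gamma>s n m * \<gamma>s n (Suc m))) = \<epsilon> n"
     unfolding \<epsilon>_def by (simp add: sum_distrib_left power2_eq_square)
    have d: "(\<gamma>s n j)\<^sup>2 * (t / (\<gamma>s n j)\<^sup>2 - (\<Sum>m<j. 1 / (\<gamma>s n m * \<gamma>s n (Suc m)))) = t - \<epsilon> n"
     using p unfolding right_diff_distrib e by simp
    have d2: "(\<gamma>s n j)\<^sup>2 * (1 / (\<gamma>s n j * \<gamma>s n (Suc j))) = \<gamma>s n j / \<gamma>s n (Suc j)" using p by (simp add: power2_eq_square)
    show ?thesis unfolding st_def splice_time_def Let_def using m[OF p(1)] d d2 by simp
   qed
   \<comment> \<open>For large \<open>n\<close> the end of the window lies beyond \<open>T\<close>,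
     so its clock lags behind \<open>t\<close> only by the late start.\<close>
   have close: "\<forall>\<^sub>F n in sequentially. \<forall>t\<in>{0..T}. 0 \<le> st n j t \<and> st n j t \<le> t \<and> t - st n j t \<le> \<epsilon> n"
   proof (cases "Suc j < J")
    case True
    from big[OF True] show ?thesis
    proof eventually_elim
     case (elim n)
     have "min (t - \<epsilon> n) (\<gamma>s n j / \<gamma>s n (Suc j)) = t - \<epsilon> n" if "t \<in> {0..T}" for t
      using that elim \<epsilon>_nonneg[of n] by auto
     then show ?case using \<epsilon>_nonneg[of n] True by (auto simp: st_eq)
    qed
   next
    case False
    then show ?thesis using \<epsilon>_nonneg by (auto simp: st_eq intro!: always_eventually)
   qed
   have "continuous_on {0..T} (\<lambda>t. B j t i)" using B[OF j] i unfolding cpath_def by (auto intro: continuous_on_subset)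
   then have uc: "uniformly_continuous_on {0..T} (\<lambda>t. B j t i)" by (intro compact_uniformly_continuous) auto
   have "uniform_limit {0..T} (f j) (\<lambda>t. B j t i) sequentially" unfolding uniform_limit_iff
   proof (intro allI impI)
    fix e :: real assume "0 < e"
    then obtain \<delta> where \<delta>: "\<delta> > 0" "\<And>s t. s \<in> {0..T} \<Longrightarrow> t \<in> {0..T} \<Longrightarrow> dist t s < \<delta> \<Longrightarrow> dist (B j t i) (B j s i) < e"
     using uc unfolding uniformly_continuous_on_def by metis
    have "\<forall>\<^sub>F n in sequentially. \<epsilon> n < \<delta>" using \<epsilon>0 \<delta>(1) by (rule order_tendstoD)
    with close show "\<forall>\<^sub>F n in sequentially. \<forall>t\<in>{0..T}. dist (f j n t) (B j t i) < e"
    proof eventually_elim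
     case (elim n)
     show ?case
     proof
      fix t assume t: "t \<in> {0..T}"
      have s: "0 \<le> st n j t" "st n j t \<le> t" "t - st n j t \<le> \<epsilon> n" using elim(1) t by auto
      have "dist (B j (st n j t) i) (B j t i) < e"
       by (rule \<delta>(2)) (use s t elim(2) in \<open>auto simp: dist_real_def\<close>)
      then show "dist (f j n t) (B j t i) < e" using \<gamma>[OF j, of n] by (simp add: f_def)
     qed
    qed
   qed
   then show ?thesis using 2 by simp
  next
   case 3
   then have Sj: "Suc j < J" using l by simp
   from big[OF Sj] have "\<forall>\<^sub>F n in sequentially. \<forall>t\<in>{0..T}. f l n t = 0"
   proof eventually_elim
    case (elim n)
    show ?case
    proof
     fix t assume t: "t \<in> {0..T}"
     have p: "0 < \<gamma>s n j" "0 < \<gamma>s n (Suc j)" using \<gamma> Sj j by auto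
     define a where "a = (\<Sum>m<l. 1 / (\<gamma>s n m * \<gamma>s n (Suc m)))"
     have "1 / (\<gamma>s n j * \<gamma>s n (Suc j)) \<le> a" unfolding a_def
     proof (rule member_le_sum)
      fix m assume "m \<in> {..<l} - {j}"
      then have "0 < \<gamma>s n m" "0 < \<gamma>s n (Suc m)" using \<gamma> l by auto
      then show "0 \<le> 1 / (\<gamma>s n m * \<gamma>s n (Suc m))" by simp
     qed (use 3 in auto)
     moreover have "t / (\<gamma>s n j)\<^sup>2 \<le> 1 / (\<gamma>s n j * \<gamma>s n (Suc j))"
     proof -
      have "t / (\<gamma>s n j)\<^sup>2 \<le> (\<gamma>s n j / \<gamma>s n (Suc j)) / (\<gamma>s n j)\<^sup>2" using elim t by (intro divide_right_mono) auto
      also have "\<dots> = 1 / (\<gamma>s n j * \<gamma>s n (Suc j))" using p by (simp add: power2_eq_square)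
      finally show ?thesis .
     qed
     ultimately have "t / (\<gamma>s n j)\<^sup>2 - a \<le> 0" by linarith
     then have "splice_time J (\<gamma>s n) l (t / (\<gamma>s n j)\<^sup>2) = 0"
      unfolding splice_time_def Let_def a_def[symmetric]
      using min.coboundedI1[of "t / (\<gamma>s n j)\<^sup>2 - a" 0] by (auto intro: max_absorb1)
     then show "f l n t = 0" using B0[OF l i] by (simp add: f_def st_def)
    qed
   qed
   then have "uniform_limit {0..T} (f l) (\<lambda>t. 0) sequentially"
    unfolding uniform_limit_iff by (auto elim: eventually_mono)
   then show ?thesis using 3 by simp
  qed
 qed
 have "uniform_limit {0..T} (\<lambda>n t. \<Sum>l<J. 1 * f l n t) (\<lambda>t. \<Sum>l<J. 1 * (if l = j then B j t i else 0)) sequentially"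
  by (rule lunif_lincomb) (rule lt)
 moreover have "(\<Sum>l<J. 1 * (if l = j then B j t i else 0)) = B j t i" for t using j by simp
 ultimately show "uniform_limit {0..T} (\<lambda>n t. \<gamma>s n j * splice J (\<gamma>s n) B (t / (\<gamma>s n j)\<^sup>2) i) (\<lambda>t. B j t i) sequentially"
  unfolding eq by simp
qed

section \<open>Laws of Brownian motions and of processes driven by them\<close>

text \<open>Brownian motion described by continuous paths and Gaussian characteristic functions
  alone. In this form the law is easy to verify for spliced, rescaled and pulled-back motions, and
  any two such processes satisfy \<open>same_fdd\<close>.\<close>

definition bm_law :: "'a measure \<Rightarrow> nat \<Rightarrow> ('a \<Rightarrow> real \<Rightarrow> nat \<Rightarrow> real) \<Rightarrow> bool" where
 "bm_law N d B \<longleftrightarrow> prob_space N \<and> cproc N d B \<and>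
   (\<forall>m \<tau> a. (\<forall>k. 0 \<le> \<tau> k) \<longrightarrow> fdd_char N d B m \<tau> a =
    complex_of_real (exp (- (\<Sum>k<m. \<Sum>l<m. min (\<tau> k) (\<tau> l) * (\<Sum>i<d. a k i * a l i)) / 2)))"

lemma bm_lawD:
 assumes "bm_law N d B"
 shows "prob_space N" "cproc N d B"
  "(\<And>k. 0 \<le> \<tau> k) \<Longrightarrow> fdd_char N d B m \<tau> a =
    complex_of_real (exp (- (\<Sum>k<m. \<Sum>l<m. min (\<tau> k) (\<tau> l) * (\<Sum>i<d. a k i * a l i)) / 2))"
 using assms unfolding bm_law_def by blast+

lemma std_brownian_motion_bm_law:
 assumes "std_brownian_motion M d W"
 shows "bm_law M d (\<lambda>w t i. W w t $ i)" unfolding bm_law_def fdd_char_def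
proof (intro conjI allI impI std_brownian_motion_prob_space[OF assms] bm_cproc[OF assms])
 fix m a and \<tau> :: "nat \<Rightarrow> real" assume "\<forall>k. 0 \<le> \<tau> k"
 then show "(\<integral>w. iexp (\<Sum>k<m. \<Sum>i<d. a k i * W w (\<tau> k) $ i) \<partial>M) =
   complex_of_real (exp (- (\<Sum>k<m. \<Sum>l<m. min (\<tau> k) (\<tau> l) * (\<Sum>i<d. a k i * a l i)) / 2))"
  by (intro bm_char[OF assms, of "{..<m}" \<tau> a]) (rule finite_lessThan, rule spec)
qed

lemma bm_law_same_fdd: "bm_law N d B \<Longrightarrow> bm_law N' d B' \<Longrightarrow> same_fdd d N B N' B'"
 unfolding same_fdd_def by (simp add: bm_lawD(3))

lemma cproc_compose:
 assumes "cproc N d B" and \<phi>: "\<phi> \<in> N' \<rightarrow>\<^sub>M N"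
 shows "cproc N' d (\<lambda>w. B (\<phi> w))"
 using assms(1) measurable_space[OF \<phi>] measurable_compose[OF \<phi>] unfolding cproc_def by blast

lemma cproc_fdd_measurable:
 assumes "cproc N d B" "\<And>k. 0 \<le> \<tau> k"
 shows "(\<lambda>w. \<Sum>k<m. \<Sum>i<d. a k i * B w (\<tau> k) i) \<in> borel_measurable N"
proof -
 have [measurable]: "(\<lambda>w. B w (\<tau> k) i) \<in> borel_measurable N" if "i < d" for i k
  using assms that unfolding cproc_def by blast
 show ?thesis by measurable
qed

lemma bm_law_compose:
 assumes B: "bm_law N d B" and \<phi>: "\<phi> \<in> N' \<rightarrow>\<^sub>M N" "distr N' N \<phi> = N" and N': "prob_space N'"
 shows "bm_law N' d (\<lambda>w. B (\<phi> w))" unfolding bm_law_def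
proof (intro conjI N' cproc_compose[OF bm_lawD(2)[OF B] \<phi>(1)] allI impI)
 fix m a and \<tau> :: "nat \<Rightarrow> real" assume \<tau>: "\<forall>k. 0 \<le> \<tau> k"
 define S where "S w = (\<Sum>k<m. \<Sum>i<d. a k i * B w (\<tau> k) i)" for w
 have [measurable]: "S \<in> borel_measurable N"
  using \<tau> unfolding S_def by (intro cproc_fdd_measurable[OF bm_lawD(2)[OF B]]) (rule spec)
 have m: "(\<lambda>w. iexp (S w)) \<in> borel_measurable N" by measurable
 have "fdd_char N' d (\<lambda>w. B (\<phi> w)) m \<tau> a = fdd_char (distr N' N \<phi>) d B m \<tau> a"
  unfolding fdd_char_def by (rule integral_distr[OF \<phi>(1) m, unfolded S_def, symmetric])
 then show "fdd_char N' d (\<lambda>w. B (\<phi> w)) m \<tau> a =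
   complex_of_real (exp (- (\<Sum>k<m. \<Sum>l<m. min (\<tau> k) (\<tau> l) * (\<Sum>i<d. a k i * a l i)) / 2))"
  unfolding \<phi>(2) using bm_lawD(3)[OF B] \<tau> by simp
qed

lemma bm_law_scale:
 assumes B: "bm_law N d B" and c: "0 < c"
 shows "bm_law N d (\<lambda>w t i. sqrt c * B w ((1 / c) * t) i)" unfolding bm_law_def
proof (intro conjI bm_lawD(1)[OF B] allI impI)
 show "cproc N d (\<lambda>w t i. sqrt c * B w ((1 / c) * t) i)" unfolding cproc_def
 proof (intro conjI ballI allI impI)
  fix w assume "w \<in> space N"
  then have "cpath d (B w)" using bm_lawD(2)[OF B] by (simp add: cproc_def)
  then show "cpath d (\<lambda>t i. sqrt c * B w ((1 / c) * t) i)" by (rule cpath_scale) (use c in simp)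
 next
  fix t :: real and i assume "0 \<le> t" "i < d"
  then have "(\<lambda>w. B w ((1 / c) * t) i) \<in> borel_measurable N"
   using bm_lawD(2)[OF B] c unfolding cproc_def by simp
  then show "(\<lambda>w. sqrt c * B w ((1 / c) * t) i) \<in> borel_measurable N" by measurable
 qed
 fix m a and \<tau> :: "nat \<Rightarrow> real" assume \<tau>: "\<forall>k. 0 \<le> \<tau> k"
 have "fdd_char N d (\<lambda>w t i. sqrt c * B w ((1 / c) * t) i) m \<tau> a = fdd_char N d B m (\<lambda>k. (1 / c) * \<tau> k) (\<lambda>k i. sqrt c * a k i)"
  unfolding fdd_char_def by (simp add: mult.left_commute mult.assoc)
 also have "\<dots> = complex_of_real (exp (- (\<Sum>k<m. \<Sum>l<m. min ((1 / c) * \<tau> k) ((1 / c) * \<tau> l) * (\<Sum>i<d. (sqrt c * a k i) * (sqrt c * a l i))) / 2))"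
  by (rule bm_lawD(3)[OF B]) (use \<tau> c in simp)
 also have "(\<Sum>k<m. \<Sum>l<m. min ((1 / c) * \<tau> k) ((1 / c) * \<tau> l) * (\<Sum>i<d. (sqrt c * a k i) * (sqrt c * a l i))) =
   (\<Sum>k<m. \<Sum>l<m. min (\<tau> k) (\<tau> l) * (\<Sum>i<d. a k i * a l i))"
 proof (intro sum.cong refl)
  fix k l
  have "(\<Sum>i<d. (sqrt c * a k i) * (sqrt c * a l i)) = c * (\<Sum>i<d. a k i * a l i)"
  proof -
   have "(sqrt c * a k i) * (sqrt c * a l i) = c * (a k i * a l i)" for i
   proof -
    have "(sqrt c * a k i) * (sqrt c * a l i) = (sqrt c * sqrt c) * (a k i * a l i)" by (simp only: ac_simps)
    then show ?thesis using c by simp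
   qed
   then show ?thesis unfolding sum_distrib_left by (intro sum.cong refl)
  qed
  moreover have "min ((1 / c) * \<tau> k) ((1 / c) * \<tau> l) = (1 / c) * min (\<tau> k) (\<tau> l)"
   using c by (auto simp: min_def divide_le_cancel)
  ultimately show "min ((1 / c) * \<tau> k) ((1 / c) * \<tau> l) * (\<Sum>i<d. (sqrt c * a k i) * (sqrt c * a l i)) = min (\<tau> k) (\<tau> l) * (\<Sum>i<d. a k i * a l i)"
   using c by simp
 qed
 finally show "fdd_char N d (\<lambda>w t i. sqrt c * B w ((1 / c) * t) i) m \<tau> a =
   complex_of_real (exp (- (\<Sum>k<m. \<Sum>l<m. min (\<tau> k) (\<tau> l) * (\<Sum>i<d. a k i * a l i)) / 2))" .
qed

text \<open>Independence of initial state and motion, expressed as factorization of the joint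
  characteristic function, the only consequence needed to identify laws. The dimensions of state and
  motion may differ.\<close>

definition driven :: "'a measure \<Rightarrow> nat \<Rightarrow> nat \<Rightarrow> ('a \<Rightarrow> nat \<Rightarrow> real) \<Rightarrow> ('a \<Rightarrow> real \<Rightarrow> nat \<Rightarrow> real) \<Rightarrow> bool" where
 "driven N d m \<xi> B \<longleftrightarrow> bm_law N m B \<and> (\<forall>i<d. (\<lambda>w. \<xi> w i) \<in> borel_measurable N) \<and>
   (\<forall>c q \<tau> a. (\<forall>k. 0 \<le> \<tau> k) \<longrightarrow>
    (\<integral>w. iexp (\<Sum>l<d. c l * \<xi> w l) * iexp (\<Sum>k<q. \<Sum>i<m. a k i * B w (\<tau> k) i) \<partial>N) =
    (\<integral>w. iexp (\<Sum>l<d. c l * \<xi> w l) \<partial>N) * fdd_char N m B q \<tau> a)"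

definition affine_path :: "nat \<Rightarrow> fvec \<Rightarrow> fvec \<Rightarrow> fmat \<Rightarrow> rpath \<Rightarrow> real \<Rightarrow> nat \<Rightarrow> real" where
 "affine_path m x0 \<theta> A B t l = x0 l + t * \<theta> l + (\<Sum>i<m. A l i * B t i)"

lemma cpath_affine: "cpath m B \<Longrightarrow> cpath d (affine_path m x0 \<theta> A B)"
 unfolding cpath_def affine_path_def by (auto intro!: continuous_intros)

lemma cproc_affine:
 assumes "cproc N m B" "\<And>i. i < d \<Longrightarrow> (\<lambda>w. \<xi> w i) \<in> borel_measurable N"
 shows "cproc N d (\<lambda>w. affine_path m (\<xi> w) \<theta> A (B w))" unfolding cproc_def
proof (intro conjI ballI allI impI)
 fix w assume "w \<in> space N"
 then show "cpath d (affine_path m (\<xi> w) \<theta> A (B w))" using assms(1) by (intro cpath_affine) (simp add: cproc_def)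
next
 fix t :: real and l assume t: "0 \<le> t" and l: "l < d"
 have [measurable]: "(\<lambda>w. B w t i) \<in> borel_measurable N" if "i < m" for i
  using assms(1) t that unfolding cproc_def by blast
 note [measurable] = assms(2)[OF l]
 show "(\<lambda>w. affine_path m (\<xi> w) \<theta> A (B w) t l) \<in> borel_measurable N"
  unfolding affine_path_def by measurable
qed

lemma driven_affine_char:
 assumes D: "driven N d m \<xi> B" and \<tau>: "\<And>k. 0 \<le> \<tau> k"
 shows "fdd_char N d (\<lambda>w. affine_path m (\<xi> w) \<theta> A (B w)) q \<tau> a =
  iexp (\<Sum>k<q. \<Sum>l<d. a k l * (\<tau> k * \<theta> l)) * ((\<integral>w. iexp (\<Sum>l<d. (\<Sum>k<q. a k l) * \<xi> w l) \<partial>N) *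
  complex_of_real (exp (- (\<Sum>k<q. \<Sum>k'<q. min (\<tau> k) (\<tau> k') * (\<Sum>l<d. \<Sum>l'<d. a k l * a k' l' * (\<Sum>i<m. A l i * A l' i))) / 2)))"
proof -
 have B: "bm_law N m B" using D by (simp add: driven_def)
 define b where "b k i = (\<Sum>l<d. a k l * A l i)" for k i
 have s: "(\<Sum>k<q. \<Sum>l<d. a k l * affine_path m (\<xi> w) \<theta> A (B w) (\<tau> k) l) =
   (\<Sum>k<q. \<Sum>l<d. a k l * (\<tau> k * \<theta> l)) + ((\<Sum>l<d. (\<Sum>k<q. a k l) * \<xi> w l) + (\<Sum>k<q. \<Sum>i<m. b k i * B w (\<tau> k) i))" for w
 proof -
  have 1: "(\<Sum>l<d. a k l * (\<Sum>i<m. A l i * B w (\<tau> k) i)) = (\<Sum>i<m. b k i * B w (\<tau> k) i)" for k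
   unfolding b_def sum_distrib_left sum_distrib_right by (subst sum.swap) (simp add: mult.assoc)
  have 2: "(\<Sum>k<q. \<Sum>l<d. a k l * \<xi> w l) = (\<Sum>l<d. (\<Sum>k<q. a k l) * \<xi> w l)"
   by (subst sum.swap) (simp add: sum_distrib_right)
  have "(\<Sum>k<q. \<Sum>l<d. a k l * affine_path m (\<xi> w) \<theta> A (B w) (\<tau> k) l) =
   (\<Sum>k<q. \<Sum>l<d. a k l * \<xi> w l) + (\<Sum>k<q. \<Sum>l<d. a k l * (\<tau> k * \<theta> l)) + (\<Sum>k<q. \<Sum>l<d. a k l * (\<Sum>i<m. A l i * B w (\<tau> k) i))"
   unfolding affine_path_def by (simp add: distrib_left sum.distrib)
  then show ?thesis unfolding 1 2 by simp
 qed
 have "fdd_char N d (\<lambda>w. affine_path m (\<xi> w) \<theta> A (B w)) q \<tau> a =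
   (\<integral>w. iexp (\<Sum>k<q. \<Sum>l<d. a k l * (\<tau> k * \<theta> l)) * (iexp (\<Sum>l<d. (\<Sum>k<q. a k l) * \<xi> w l) * iexp (\<Sum>k<q. \<Sum>i<m. b k i * B w (\<tau> k) i)) \<partial>N)"
  unfolding fdd_char_def s of_real_add distrib_left exp_add ..
 also have "\<dots> = iexp (\<Sum>k<q. \<Sum>l<d. a k l * (\<tau> k * \<theta> l)) * (\<integral>w. iexp (\<Sum>l<d. (\<Sum>k<q. a k l) * \<xi> w l) * iexp (\<Sum>k<q. \<Sum>i<m. b k i * B w (\<tau> k) i) \<partial>N)"
  by (rule integral_mult_right_zero)
 also have "(\<integral>w. iexp (\<Sum>l<d. (\<Sum>k<q. a k l) * \<xi> w l) * iexp (\<Sum>k<q. \<Sum>i<m. b k i * B w (\<tau> k) i) \<partial>N) =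
   (\<integral>w. iexp (\<Sum>l<d. (\<Sum>k<q. a k l) * \<xi> w l) \<partial>N) * fdd_char N m B q \<tau> b"
 proof -
  have "\<forall>c q \<tau> a. (\<forall>k. 0 \<le> \<tau> k) \<longrightarrow>
    (\<integral>w. iexp (\<Sum>l<d. c l * \<xi> w l) * iexp (\<Sum>k<q. \<Sum>i<m. a k i * B w (\<tau> k) i) \<partial>N) =
    (\<integral>w. iexp (\<Sum>l<d. c l * \<xi> w l) \<partial>N) * fdd_char N m B q \<tau> a"
   using D unfolding driven_def by (elim conjE)
  then have "(\<forall>k. 0 \<le> \<tau> k) \<longrightarrow> (\<integral>w. iexp (\<Sum>l<d. (\<Sum>k<q. a k l) * \<xi> w l) * iexp (\<Sum>k<q. \<Sum>i<m. b k i * B w (\<tau> k) i) \<partial>N) =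
    (\<integral>w. iexp (\<Sum>l<d. (\<Sum>k<q. a k l) * \<xi> w l) \<partial>N) * fdd_char N m B q \<tau> b" by (elim allE)
  then show ?thesis using \<tau> by blast
 qed
 also have "fdd_char N m B q \<tau> b = complex_of_real (exp (- (\<Sum>k<q. \<Sum>k'<q. min (\<tau> k) (\<tau> k') * (\<Sum>i<m. b k i * b k' i)) / 2))"
  by (rule bm_lawD(3)[OF B \<tau>])
 also have "(\<lambda>k k'. \<Sum>i<m. b k i * b k' i) = (\<lambda>k k'. \<Sum>l<d. \<Sum>l'<d. a k l * a k' l' * (\<Sum>i<m. A l i * A l' i))"
 proof (intro ext)
  fix k k'
  have "(\<Sum>i<m. b k i * b k' i) = (\<Sum>i<m. \<Sum>l<d. \<Sum>l'<d. a k l * a k' l' * (A l i * A l' i))"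
   unfolding b_def sum_product by (intro sum.cong refl) (simp add: ac_simps)
  also have "\<dots> = (\<Sum>l<d. \<Sum>i<m. \<Sum>l'<d. a k l * a k' l' * (A l i * A l' i))" by (rule sum.swap)
  also have "\<dots> = (\<Sum>l<d. \<Sum>l'<d. \<Sum>i<m. a k l * a k' l' * (A l i * A l' i))" by (intro sum.cong refl sum.swap)
  finally show "(\<Sum>i<m. b k i * b k' i) = (\<Sum>l<d. \<Sum>l'<d. a k l * a k' l' * (\<Sum>i<m. A l i * A l' i))"
   by (simp add: sum_distrib_left)
 qed
 finally show ?thesis .
qed

text \<open>The coefficient matrix enters the characteristic functions only through the inner
  products of its rows, that is, through the covariance. This permits comparison with a process
  driven by a motion of another dimension.\<close>

lemma driven_same_fdd:
 assumes "driven N d m \<xi> B" "driven N' d m' \<xi>' B'"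
  and \<xi>: "\<And>c. (\<integral>w. iexp (\<Sum>l<d. c l * \<xi> w l) \<partial>N) = (\<integral>w. iexp (\<Sum>l<d. c l * \<xi>' w l) \<partial>N')"
  and \<theta>: "\<And>l. l < d \<Longrightarrow> \<theta> l = \<theta>' l"
  and A: "\<And>l l'. l < d \<Longrightarrow> l' < d \<Longrightarrow> (\<Sum>i<m. A l i * A l' i) = (\<Sum>i<m'. A' l i * A' l' i)"
 shows "same_fdd d N (\<lambda>w. affine_path m (\<xi> w) \<theta> A (B w)) N' (\<lambda>w. affine_path m' (\<xi>' w) \<theta>' A' (B' w))"
 unfolding same_fdd_def
proof (intro allI impI)
 fix q a and \<tau> :: "nat \<Rightarrow> real" assume \<tau>: "\<forall>k. 0 \<le> \<tau> k"
 have 1: "(\<Sum>k<q. \<Sum>l<d. a k l * (\<tau> k * \<theta> l)) = (\<Sum>k<q. \<Sum>l<d. a k l * (\<tau> k * \<theta>' l))"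
  by (intro sum.cong refl) (simp add: \<theta>)
 have 2: "(\<Sum>k<q. \<Sum>k'<q. min (\<tau> k) (\<tau> k') * (\<Sum>l<d. \<Sum>l'<d. a k l * a k' l' * (\<Sum>i<m. A l i * A l' i))) =
   (\<Sum>k<q. \<Sum>k'<q. min (\<tau> k) (\<tau> k') * (\<Sum>l<d. \<Sum>l'<d. a k l * a k' l' * (\<Sum>i<m'. A' l i * A' l' i)))"
 proof -
  have "(\<Sum>l<d. \<Sum>l'<d. a k l * a k' l' * (\<Sum>i<m. A l i * A l' i)) = (\<Sum>l<d. \<Sum>l'<d. a k l * a k' l' * (\<Sum>i<m'. A' l i * A' l' i))" for k k'
   by (rule sum.cong[OF refl], rule sum.cong[OF refl], rule arg_cong[OF A]) simp_all
  then show ?thesis by (simp only:)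
 qed
 show "fdd_char N d (\<lambda>w. affine_path m (\<xi> w) \<theta> A (B w)) q \<tau> a = fdd_char N' d (\<lambda>w. affine_path m' (\<xi>' w) \<theta>' A' (B' w)) q \<tau> a"
  unfolding driven_affine_char[OF assms(1) \<tau>[rule_format]] driven_affine_char[OF assms(2) \<tau>[rule_format]] 1 2 \<xi> ..
qed

lemma driven_cproc:
 "driven N d m \<xi> B \<Longrightarrow> cproc N d (\<lambda>w. affine_path m (\<xi> w) \<theta> A (B w))"
 by (rule cproc_affine) (auto simp: driven_def bm_law_def)

lemma driven_indep_elements:
 assumes W: "std_brownian_motion N d W" and x0: "x0 \<in> N \<rightarrow>\<^sub>M vec_borel d"
  and ind: "indep_elements N (vec_borel d) x0 (\<Pi>\<^sub>M t\<in>{0..}. vec_borel d) (\<lambda>w. \<lambda>t\<in>{0..}. W w t)"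
 shows "driven N d d (\<lambda>w i. x0 w $ i) (\<lambda>w t i. W w t $ i)" unfolding driven_def
proof (intro conjI allI impI)
 show "bm_law N d (\<lambda>w t i. W w t $ i)" by (rule std_brownian_motion_bm_law[OF W])
 show "(\<lambda>w. x0 w $ i) \<in> borel_measurable N" if "i < d" for i
  by (rule measurable_compose[OF x0 vec_index_measurable[OF that]])
 fix c q a and \<tau> :: "nat \<Rightarrow> real" assume \<tau>: "\<forall>k. 0 \<le> \<tau> k"
 define g where "g v = iexp (\<Sum>l<d. c l * v $ l)" for v :: "real vec"
 define h where "h x = iexp (\<Sum>k<q. \<Sum>i<d. a k i * x (\<tau> k) $ i)" for x :: "real \<Rightarrow> real vec"
 have [measurable]: "(\<lambda>x. x (\<tau> k) $ i) \<in> borel_measurable (\<Pi>\<^sub>M u\<in>{0..}. vec_borel d)" if "i < d" for k i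
  by (rule measurable_compose[OF measurable_component_singleton[of "\<tau> k" "{0..}" "\<lambda>_. vec_borel d"] vec_index_measurable])
    (use \<tau> that in auto)
 have gm: "g \<in> borel_measurable (vec_borel d)" unfolding g_def using vec_index_measurable[of _ d] by measurable
 have hm: "h \<in> borel_measurable (\<Pi>\<^sub>M u\<in>{0..}. vec_borel d)" unfolding h_def by measurable
 have hW: "h (\<lambda>t\<in>{0..}. W w t) = iexp (\<Sum>k<q. \<Sum>i<d. a k i * W w (\<tau> k) $ i)" for w
  unfolding h_def by (rule arg_cong[where f = iexp], intro sum.cong refl) (use \<tau> in simp)
 have "(\<integral>w. g (x0 w) * h (\<lambda>t\<in>{0..}. W w t) \<partial>N) = (\<integral>w. g (x0 w) \<partial>N) * (\<integral>w. h (\<lambda>t\<in>{0..}. W w t) \<partial>N)"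
  by (rule indep_elements_integral[OF std_brownian_motion_prob_space[OF W] ind gm _ hm])
    (unfold g_def h_def norm_exp_i_times, simp_all)
 then show "(\<integral>w. iexp (\<Sum>l<d. c l * x0 w $ l) * iexp (\<Sum>k<q. \<Sum>i<d. a k i * W w (\<tau> k) $ i) \<partial>N) =
    (\<integral>w. iexp (\<Sum>l<d. c l * x0 w $ l) \<partial>N) * fdd_char N d (\<lambda>w t i. W w t $ i) q \<tau> a"
  unfolding hW fdd_char_def g_def .
qed

lemma distr_pair_snd:
 assumes N: "prob_space N" and P: "prob_space P"
 shows "distr (N \<Otimes>\<^sub>M P) P snd = P"
proof (rule measure_eqI)
 interpret N: prob_space N by fact
 interpret Pr: prob_space P by fact
 fix A assume "A \<in> sets (distr (N \<Otimes>\<^sub>M P) P snd)"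
 then have A: "A \<in> sets P" by simp
 have "snd -` A \<inter> space (N \<Otimes>\<^sub>M P) = space N \<times> A" using sets.sets_into_space[OF A] by (auto simp: space_pair_measure)
 then show "emeasure (distr (N \<Otimes>\<^sub>M P) P snd) A = emeasure P A"
  using A by (simp add: emeasure_distr Pr.emeasure_pair_measure_Times N.emeasure_space_1)
qed simp

text \<open>Independence on the product space comes from Fubini's theorem; such products carry the
  coupled copies of initial state and motion.\<close>

lemma driven_pair:
 assumes B: "bm_law N m B" and P: "prob_space P" and \<xi>: "\<And>i. i < d \<Longrightarrow> (\<lambda>p. \<xi> p i) \<in> borel_measurable P"
 shows "driven (N \<Otimes>\<^sub>M P) d m (\<lambda>w. \<xi> (snd w)) (\<lambda>w. B (fst w))"
  and "(\<integral>w. iexp (\<Sum>l<d. c l * \<xi> (snd w) l) \<partial>(N \<Otimes>\<^sub>M P)) = (\<integral>p. iexp (\<Sum>l<d. c l * \<xi> p l) \<partial>P)"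
proof -
 interpret N: prob_space N by (rule bm_lawD(1)[OF B])
 interpret Pr: prob_space P by fact
 interpret pair: pair_prob_space N P ..
 note [measurable] = \<xi>
 have d1: "distr (N \<Otimes>\<^sub>M P) N fst = N" by (rule Pr.distr_pair_fst)
 have d2: "distr (N \<Otimes>\<^sub>M P) P snd = P" by (rule distr_pair_snd[OF N.prob_space_axioms P])
 have bl: "bm_law (N \<Otimes>\<^sub>M P) m (\<lambda>w. B (fst w))"
  by (rule bm_law_compose[OF B measurable_fst d1 pair.prob_space_axioms])
 have i2: "(\<integral>w. iexp (\<Sum>l<d. c l * \<xi> (snd w) l) \<partial>(N \<Otimes>\<^sub>M P)) = (\<integral>p. iexp (\<Sum>l<d. c l * \<xi> p l) \<partial>P)" for c
  by (subst (2) d2[symmetric], subst integral_distr) auto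
 show "(\<integral>w. iexp (\<Sum>l<d. c l * \<xi> (snd w) l) \<partial>(N \<Otimes>\<^sub>M P)) = (\<integral>p. iexp (\<Sum>l<d. c l * \<xi> p l) \<partial>P)" by (rule i2)
 show "driven (N \<Otimes>\<^sub>M P) d m (\<lambda>w. \<xi> (snd w)) (\<lambda>w. B (fst w))" unfolding driven_def
 proof (intro conjI bl allI impI)
  show "(\<lambda>w. \<xi> (snd w) i) \<in> borel_measurable (N \<Otimes>\<^sub>M P)" if "i < d" for i
   by (rule measurable_compose[OF measurable_snd \<xi>[OF that]])
  fix c q a and \<tau> :: "nat \<Rightarrow> real" assume \<tau>: "\<forall>k. 0 \<le> \<tau> k"
  define f where "f p = iexp (\<Sum>l<d. c l * \<xi> p l)" for p
  define h where "h w = iexp (\<Sum>k<q. \<Sum>i<m. a k i * B w (\<tau> k) i)" for w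
  have hb[measurable]: "(\<lambda>w. \<Sum>k<q. \<Sum>i<m. a k i * B w (\<tau> k) i) \<in> borel_measurable N"
   using \<tau> by (intro cproc_fdd_measurable[OF bm_lawD(2)[OF B]]) auto
  have fm[measurable]: "f \<in> borel_measurable P" unfolding f_def by measurable
  have hm[measurable]: "h \<in> borel_measurable N" unfolding h_def by measurable
  have n: "norm (f p) = 1" "norm (h w) = 1" for p w unfolding f_def h_def by simp_all
  have fi: "integrable P f" by (rule Pr.integrable_const_bound[of _ 1]) (use n in auto)
  have hi: "integrable N h" by (rule N.integrable_const_bound[of _ 1]) (use n in auto)
  have int: "integrable (N \<Otimes>\<^sub>M P) (\<lambda>(w, p). f p * h w)"
   by (rule pair.integrable_const_bound[of _ 1]) (use n in \<open>auto simp: norm_mult split: prod.splits\<close>)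
  have "(\<integral>w. f (snd w) * h (fst w) \<partial>(N \<Otimes>\<^sub>M P)) = (\<integral>p. (\<integral>w. f p * h w \<partial>N) \<partial>P)"
   by (rule pair.integral_snd[OF int, unfolded case_prod_beta, symmetric])
  also have "\<dots> = (\<integral>p. f p \<partial>P) * (\<integral>w. h w \<partial>N)" using fi hi by simp
  also have "(\<integral>p. f p \<partial>P) = (\<integral>w. f (snd w) \<partial>(N \<Otimes>\<^sub>M P))" unfolding f_def by (rule i2[symmetric])
  also have "(\<integral>w. h w \<partial>N) = (\<integral>w. h (fst w) \<partial>(N \<Otimes>\<^sub>M P))"
   by (subst d1[symmetric], subst integral_distr) auto
  finally show "(\<integral>w. iexp (\<Sum>l<d. c l * \<xi> (snd w) l) * iexp (\<Sum>k<q. \<Sum>i<m. a k i * B (fst w) (\<tau> k) i) \<partial>(N \<Otimes>\<^sub>M P)) =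
   (\<integral>w. iexp (\<Sum>l<d. c l * \<xi> (snd w) l) \<partial>(N \<Otimes>\<^sub>M P)) * fdd_char (N \<Otimes>\<^sub>M P) m (\<lambda>w. B (fst w)) q \<tau> a"
   unfolding f_def h_def fdd_char_def .
 qed
qed

lemma pcont_compose:
 assumes "pcont d' F" and "\<And>x. cpath d x \<Longrightarrow> cpath d' (\<Psi> x)"
  and "\<And>xs x. (\<And>n. cpath d (xs n)) \<Longrightarrow> cpath d x \<Longrightarrow> lunif d xs x \<Longrightarrow> lunif d' (\<lambda>n. \<Psi> (xs n)) (\<Psi> x)"
 shows "pcont d (\<lambda>x. F (\<Psi> x))" unfolding pcont_def
proof (intro allI impI)
 fix xs x assume "\<forall>n. cpath d (xs n)" "cpath d x" "lunif d xs x"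
 then have "\<And>n. cpath d' (\<Psi> (xs n))" "cpath d' (\<Psi> x)" "lunif d' (\<lambda>n. \<Psi> (xs n)) (\<Psi> x)"
  using assms(2,3) by blast+
 then show "(\<lambda>n. F (\<Psi> (xs n))) \<longlonglongrightarrow> F (\<Psi> x)" using assms(1) unfolding pcont_def by (elim allE[of _ "\<lambda>n. \<Psi> (xs n)"] allE[of _ "\<Psi> x"] impE) auto
qed

lemma pcont_zmap:
 assumes "Mmat d R w" "pcont d F"
 shows "pcont d (\<lambda>x. F (zmap d R x))"
 by (rule pcont_compose[OF assms(2)]) (auto intro: cpath_zmap[OF assms(1)] lunif_zmap[OF assms(1)])

definition rescale :: "fvec \<Rightarrow> rpath \<Rightarrow> real \<Rightarrow> nat \<Rightarrow> real" where
 "rescale \<gamma> x t j = \<gamma> j * x (t / (\<gamma> j)\<^sup>2) j"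

lemma cpath_rescale:
 assumes "cpath d x" shows "cpath d (rescale \<gamma> x)" unfolding cpath_def rescale_def
proof (intro allI impI)
 fix i assume i: "i < d"
 have "continuous_on {0..} (\<lambda>t. x (t / (\<gamma> i)\<^sup>2) i)"
  by (rule cpath_compose[OF assms _ _ i]) (auto simp: divide_inverse intro!: continuous_intros)
 then show "continuous_on {0..} (\<lambda>t. \<gamma> i * x (t / (\<gamma> i)\<^sup>2) i)" by (intro continuous_intros)
qed

lemma lunif_rescale:
 assumes "lunif d xs x" shows "lunif d (\<lambda>n. rescale \<gamma> (xs n)) (rescale \<gamma> x)"
 unfolding lunif_def uniform_limit_iff
proof (intro allI impI)
 fix T i and e :: real assume i: "i < d" and e: "0 < e"
 have "0 < e / (\<bar>\<gamma> i\<bar> + 1)" using e by simp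
 from lunifD[OF assms this, of "T / (\<gamma> i)\<^sup>2"] show "\<forall>\<^sub>F n in sequentially. \<forall>t\<in>{0..T}. dist (rescale \<gamma> (xs n) t i) (rescale \<gamma> x t i) < e"
 proof eventually_elim
  case (elim n)
  show ?case
  proof
   fix t assume t: "t \<in> {0..T}"
   then have "t / (\<gamma> i)\<^sup>2 \<in> {0..T / (\<gamma> i)\<^sup>2}" by (auto intro: divide_right_mono)
   then have 1: "\<bar>xs n (t / (\<gamma> i)\<^sup>2) i - x (t / (\<gamma> i)\<^sup>2) i\<bar> < e / (\<bar>\<gamma> i\<bar> + 1)" using elim i by blast
   have "dist (rescale \<gamma> (xs n) t i) (rescale \<gamma> x t i) = \<bar>\<gamma> i\<bar> * \<bar>xs n (t / (\<gamma> i)\<^sup>2) i - x (t / (\<gamma> i)\<^sup>2) i\<bar>"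
    by (simp add: rescale_def dist_real_def right_diff_distrib[symmetric] abs_mult)
   also have "\<dots> \<le> (\<bar>\<gamma> i\<bar> + 1) * \<bar>xs n (t / (\<gamma> i)\<^sup>2) i - x (t / (\<gamma> i)\<^sup>2) i\<bar>" by (intro mult_right_mono) auto
   also have "\<dots> < (\<bar>\<gamma> i\<bar> + 1) * (e / (\<bar>\<gamma> i\<bar> + 1))" by (rule mult_strict_left_mono[OF 1]) simp
   also have "\<dots> = e"
   proof -
    have "a * (e / a) = e" if "0 < a" for a :: real using that by simp
    then show ?thesis by simp
   qed
   finally show "dist (rescale \<gamma> (xs n) t i) (rescale \<gamma> x t i) < e" .
  qed
 qed
qed

lemma pcont_rescale: "pcont d F \<Longrightarrow> pcont d (\<lambda>x. F (rescale \<gamma> x))"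
 by (rule pcont_compose) (auto intro: cpath_rescale lunif_rescale)

lemma pcontD:
 assumes "pcont d F" "\<And>n. cpath d (xs n)" "cpath d x" "lunif d xs x"
 shows "(\<lambda>n. F (xs n)) \<longlonglongrightarrow> F x"
 using assms(1)[unfolded pcont_def, THEN spec[of _ xs], THEN spec[of _ x]] assms(2-4) by blast

lemma pcont_coordinate: "i < d \<Longrightarrow> 0 \<le> t \<Longrightarrow> pcont d (\<lambda>x. x t i)"
 unfolding pcont_def by (intro allI impI) (rule lunif_tendsto)

lemma cproc_zmap:
 assumes R: "Mmat d R w" and X: "cproc N d X"
 shows "cproc N d (\<lambda>z. zmap d R (X z))" unfolding cproc_def
proof (intro conjI ballI allI impI)
 show "cpath d (zmap d R (X z))" if "z \<in> space N" for z using X that by (intro cpath_zmap[OF R]) (simp add: cproc_def)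
 show "(\<lambda>z. zmap d R (X z) t i) \<in> borel_measurable N" if "0 \<le> t" "i < d" for t i
  by (rule pcont_measurable[OF X pcont_zmap[OF R pcont_coordinate[OF that(2,1)]]])
qed

lemma cproc_rescale:
 assumes X: "cproc N d X"
 shows "cproc N d (\<lambda>w. rescale \<gamma> (X w))" unfolding cproc_def
proof (intro conjI ballI allI impI)
 show "cpath d (rescale \<gamma> (X w))" if "w \<in> space N" for w
  using X that by (intro cpath_rescale) (simp add: cproc_def)
 show "(\<lambda>w. rescale \<gamma> (X w) t i) \<in> borel_measurable N" if "0 \<le> t" "i < d" for t i
  by (rule pcont_measurable[OF X pcont_rescale[OF pcont_coordinate[OF that(2,1)]]])
qed

lemma zmap_cong:
 assumes R: "Mmat d R w" and x: "cpath d x" and e: "\<And>t i. 0 \<le> t \<Longrightarrow> i < d \<Longrightarrow> x t i = x' t i"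
  and "0 \<le> t" "i < d"
 shows "zmap d R x t i = zmap d R x' t i"
proof -
 have x': "cpath d x'" unfolding cpath_def
 proof (intro allI impI)
  fix i assume i: "i < d"
  have "continuous_on {0..} (\<lambda>t. x t i)" using x i by (simp add: cpath_def)
  then show "continuous_on {0..} (\<lambda>t. x' t i)" by (rule continuous_on_eq) (use e i in simp)
 qed
 have "zmap d R x t i = x' t i + (\<Sum>j<d. R i j * rmap d R x' t j)"
  by (rule zmap_eqI[OF R rsol_rmap[OF R x'] x e assms(4,5)])
 then show ?thesis by (simp add: zmap_def)
qed

section \<open>The coupling and its limit\<close>

text \<open>\<open>v\<close> is the initial state already multiplied by \<open>\<gamma> 0\<close>.
  Cutting off at zero makes the input admissible for every real vector \<open>v\<close>, so that the
  output is a function on the whole space, as the continuous mapping argument requires.\<close>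

definition coupled_input :: "nat \<Rightarrow> fmat \<Rightarrow> fmat \<Rightarrow> fvec \<Rightarrow> fvec \<Rightarrow>
  rpath \<Rightarrow> real \<Rightarrow> nat \<Rightarrow> real" where
 "coupled_input J R S \<gamma> v = affine_path J (\<lambda>i. max 0 (v i) / \<gamma> 0) (\<lambda>i. - (\<Sum>m<J. R i m * \<gamma> m)) S"

definition scaled_output :: "nat \<Rightarrow> fmat \<Rightarrow> fmat \<Rightarrow> fvec \<Rightarrow> fvec \<Rightarrow>
  rpath \<Rightarrow> real \<Rightarrow> nat \<Rightarrow> real" where
 "scaled_output J R S \<gamma> v b = rescale \<gamma> (zmap J R (coupled_input J R S \<gamma> v b))"

text \<open>\<open>q j\<close> is the dimension of the motion that drives component
  \<open>j\<close>: \<open>J\<close> in the coupling, where \<open>A j\<close> consists of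
  eliminated rows of \<open>L\<close>, and \<open>J - j\<close> in the construction of an SRBM,
  where \<open>A j\<close> is a square factor.\<close>

definition limit_input :: "fmat \<Rightarrow> (nat \<Rightarrow> nat \<Rightarrow> nat \<Rightarrow> real) \<Rightarrow> (nat \<Rightarrow> nat) \<Rightarrow> (nat \<Rightarrow> nat \<Rightarrow> nat \<Rightarrow> real) \<Rightarrow>
  fvec \<Rightarrow> rpath \<Rightarrow> nat \<Rightarrow> real \<Rightarrow> nat \<Rightarrow> real" where
 "limit_input R H q A v b j = affine_path (q j) (\<lambda>l. if j = 0 then max 0 (v l) else 0) (\<lambda>l. - Gfun R (H j) j l j) (A j) b"

definition limit_component :: "nat \<Rightarrow> fmat \<Rightarrow> (nat \<Rightarrow> nat \<Rightarrow> nat \<Rightarrow> real) \<Rightarrow> (nat \<Rightarrow> nat) \<Rightarrow> (nat \<Rightarrow> nat \<Rightarrow> nat \<Rightarrow> real) \<Rightarrow>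
  fvec \<Rightarrow> rpath \<Rightarrow> nat \<Rightarrow> real \<Rightarrow> real" where
 "limit_component J R H q A v b j t =
   zmap (J - j) (\<lambda>l m. Gfun R (H j) j l (j + m)) (limit_input R H q A v b j) t 0"

lemma Gfun_combine:
 "(\<Sum>m<n. Gfun S H k l m * b m) = (\<Sum>m<n. S (k + l) m * b m) - (\<Sum>i<k. H (k + l) i * (\<Sum>m<n. S i m * b m))"
proof -
 have "(\<Sum>m<n. (\<Sum>i<k. H (k + l) i * S i m) * b m) = (\<Sum>m<n. \<Sum>i<k. H (k + l) i * (S i m * b m))"
  by (simp only: sum_distrib_right mult.assoc)
 also have "\<dots> = (\<Sum>i<k. \<Sum>m<n. H (k + l) i * (S i m * b m))" by (rule sum.swap)
 also have "\<dots> = (\<Sum>i<k. H (k + l) i * (\<Sum>m<n. S i m * b m))" by (simp only: sum_distrib_left)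
 finally show ?thesis unfolding Gfun_def by (simp only: left_diff_distrib sum_subtractf)
qed

locale eliminated_system =
 fixes J :: nat and R :: fmat and w :: "nat \<Rightarrow> real" and AI H :: "nat \<Rightarrow> nat \<Rightarrow> nat \<Rightarrow> real"
 assumes J: "0 < J" and R: "Mmat J R w"
  and AI_nonneg: "\<And>k i m. k < J \<Longrightarrow> i < k \<Longrightarrow> m < k \<Longrightarrow> 0 \<le> AI k i m"
  and AI_left: "\<And>k i l. k < J \<Longrightarrow> i < k \<Longrightarrow> l < k \<Longrightarrow> (\<Sum>m<k. AI k i m * R m l) = (if i = l then 1 else 0)"
  and AI_right: "\<And>k i l. k < J \<Longrightarrow> i < k \<Longrightarrow> l < k \<Longrightarrow> (\<Sum>m<k. R i m * AI k m l) = (if i = l then 1 else 0)"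
  and G0: "\<And>k l m. k < J \<Longrightarrow> l < J - k \<Longrightarrow> m < k \<Longrightarrow> Gfun R (H k) k l m = 0"
  and G: "\<And>k. k < J \<Longrightarrow> Mmat (J - k) (\<lambda>l m. Gfun R (H k) k l (k + m)) (\<lambda>l. w (k + l))"
begin

text \<open>The multi-scale input is instantiated at \<open>j\<close> with all drift scales divided
  by \<open>\<gamma>_j\<close>, so that the earlier ones explode and the later ones vanish. Of the
  limiting block only its first coordinate is read off, which is coordinate \<open>j\<close> of the
  system.\<close>

lemma scaled_output_limit:
 assumes \<gamma>: "\<And>n j. j < J \<Longrightarrow> 0 < \<gamma>s n j"
  and ratio: "\<And>i j. i < j \<Longrightarrow> j < J \<Longrightarrow> (\<lambda>n. \<gamma>s n j / \<gamma>s n i) \<longlonglongrightarrow> 0"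
  and vs: "\<And>i. i < J \<Longrightarrow> (\<lambda>n. vs n i) \<longlonglongrightarrow> v i"
  and B: "\<And>n. cpath J (B n)" "\<And>n i. i < J \<Longrightarrow> B n 0 i = 0" "\<And>j. j < J \<Longrightarrow> cpath J (\<beta> j)"
  and B_lim: "\<And>j. j < J \<Longrightarrow> lunif J (\<lambda>n t i. \<gamma>s n j * B n (t / (\<gamma>s n j)\<^sup>2) i) (\<beta> j)"
 shows "lunif J (\<lambda>n. scaled_output J R S (\<gamma>s n) (vs n) (B n))
   (\<lambda>t j. limit_component J R H (\<lambda>_. J) (\<lambda>j. Gfun S (H j) j) v (\<beta> j) j t)"
 unfolding lunif_def
proof (intro allI impI)
 fix T j assume j: "j < J"
 \<comment> \<open>The initial state is of order \<open>1 / \<gamma>_0\<close> in every coordinate.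
   On the scale of \<open>j\<close> it carries the factor \<open>\<gamma>_j / \<gamma>_0\<close>,
   which is one for \<open>j = 0\<close> and tends to zero otherwise.\<close>
 define \<zeta> where "\<zeta> n i = (\<gamma>s n j / \<gamma>s n 0) * max 0 (vs n i)" for n i
 define \<zeta>0 where "\<zeta>0 i = (if j = 0 then max 0 (v i) else 0)" for i
 define c where "c n m = \<gamma>s n m / \<gamma>s n j" for n m
 define b where "b n t i = (\<Sum>m<J. S i m * (\<gamma>s n j * B n (t / (\<gamma>s n j)\<^sup>2) m))" for n t i
 define b0 where "b0 t i = (\<Sum>m<J. S i m * \<beta> j t m)" for t i
 have cB: "cpath J (\<lambda>t i. \<gamma>s n j * B n (t / (\<gamma>s n j)\<^sup>2) i)" for n
  using cpath_scale[OF B(1)[of n], of "1 / (\<gamma>s n j)\<^sup>2" "\<gamma>s n j"] by simp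
 interpret multi_scale_input J j R "AI j" "H j" w \<zeta> c b b0 \<zeta>0
 proof (unfold_locales; (rule R j AI_nonneg[OF j] AI_left[OF j] AI_right[OF j] G0[OF j] G[OF j] | succeed))
  show "0 \<le> \<zeta> n i" for n i unfolding \<zeta>_def using \<gamma>[OF j, of n] \<gamma>[OF J, of n] by simp
  show "(\<lambda>n. \<zeta> n i) \<longlonglongrightarrow> \<zeta>0 i" if "i < J" for i
  proof (cases "j = 0")
   case True
   have "\<gamma>s n 0 / \<gamma>s n 0 = 1" for n using \<gamma>[OF J, of n] by simp
   then show ?thesis using tendsto_max[OF tendsto_const vs[OF that], of 0] True unfolding \<zeta>_def \<zeta>0_def by simp
  next
   case False
   then have "(\<lambda>n. \<gamma>s n j / \<gamma>s n 0) \<longlonglongrightarrow> 0" using ratio[of 0 j] j by simp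
   from tendsto_mult[OF this tendsto_max[OF tendsto_const vs[OF that], of 0]] show ?thesis
    using False unfolding \<zeta>_def \<zeta>0_def by simp
  qed
  show "\<zeta>0 i = 0" if "0 < j" for i using that unfolding \<zeta>0_def by simp
  show "filterlim (\<lambda>n. c n i) at_top sequentially" if i: "i < j" for i
  proof -
   have "filterlim (\<lambda>n. \<gamma>s n j / \<gamma>s n i) (at_right 0) sequentially" unfolding filterlim_at
   proof (intro conjI ratio[OF i j] always_eventually allI)
    fix n show "\<gamma>s n j / \<gamma>s n i \<in> {0<..}" "\<gamma>s n j / \<gamma>s n i \<noteq> 0" using \<gamma>[OF j, of n] \<gamma>[of i n] i j by simp_all
   qed
   from filterlim_compose[OF filterlim_inverse_at_top_right this] show ?thesis unfolding c_def by simp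
  qed
  show "c n j = 1" for n unfolding c_def using \<gamma>[OF j, of n] by simp
  show "(\<lambda>n. c n i) \<longlonglongrightarrow> 0" if "j < i" "i < J" for i unfolding c_def by (rule ratio[OF that])
  show "cpath J (b n)" for n unfolding cpath_def b_def
  proof (intro allI impI, rule continuous_on_sum, rule continuous_on_mult_left)
   fix m assume "m \<in> {..<J}"
   then show "continuous_on {0..} (\<lambda>t. \<gamma>s n j * B n (t / (\<gamma>s n j)\<^sup>2) m)" using cB[of n] unfolding cpath_def by blast
  qed
  show "cpath J b0" using B(3)[OF j] unfolding cpath_def b0_def by (auto intro!: continuous_intros)
  show "lunif J b b0" unfolding lunif_def b_def b0_def
  proof (intro allI impI)
   fix T i
   show "uniform_limit {0..T} (\<lambda>n t. \<Sum>m<J. S i m * (\<gamma>s n j * B n (t / (\<gamma>s n j)\<^sup>2) m)) (\<lambda>t. \<Sum>m<J. S i m * \<beta> j t m) sequentially"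
    by (rule lunif_lincomb) (use B_lim[OF j] in \<open>unfold lunif_def, blast\<close>)
  qed
  show "b n 0 i = 0" for n i unfolding b_def using B(2) by simp
 qed
 have out: "scaled_output J R S (\<gamma>s n) (vs n) (B n) t j = z n t j" if t: "0 \<le> t" for n t
 proof -
  let ?in = "coupled_input J R S (\<gamma>s n) (vs n) (B n)"
  have p: "0 < \<gamma>s n j" "0 < 1 / (\<gamma>s n j)\<^sup>2" using \<gamma>[OF j, of n] by simp_all
  have ci: "cpath J ?in" unfolding coupled_input_def by (rule cpath_affine[OF B(1)])
  have "(\<lambda>t i. \<gamma>s n j * ?in ((1 / (\<gamma>s n j)\<^sup>2) * t) i) = x n"
  proof (intro ext)
   fix t i
   have 1: "\<gamma>s n j * (max 0 (vs n i) / \<gamma>s n 0) = \<zeta> n i" unfolding \<zeta>_def by simp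
   have 2: "\<gamma>s n j * (((1 / (\<gamma>s n j)\<^sup>2) * t) * - (\<Sum>m<J. R i m * \<gamma>s n m)) = - (t * (\<Sum>m<J. R i m * c n m))"
   proof -
    have "(\<Sum>m<J. R i m * c n m) = (\<Sum>m<J. R i m * \<gamma>s n m) / \<gamma>s n j"
     unfolding c_def sum_divide_distrib by simp
    then show ?thesis using p(1) by (simp add: field_simps power2_eq_square)
   qed
   have 3: "\<gamma>s n j * (\<Sum>m<J. S i m * B n ((1 / (\<gamma>s n j)\<^sup>2) * t) m) = b n t i"
    unfolding b_def sum_distrib_left by (intro sum.cong refl) (simp add: mult.left_commute)
   show "\<gamma>s n j * ?in ((1 / (\<gamma>s n j)\<^sup>2) * t) i = x n t i"
    unfolding coupled_input_def affine_path_def x_def distrib_left 1 2 3 by (rule arg_cong2[where f = "(+)"]) simp_all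
  qed
  then have "z n t j = zmap J R (\<lambda>t i. \<gamma>s n j * ?in ((1 / (\<gamma>s n j)\<^sup>2) * t) i) t j" by (simp only:)
  also have "\<dots> = \<gamma>s n j * zmap J R ?in ((1 / (\<gamma>s n j)\<^sup>2) * t) j" by (rule zmap_scale[OF R ci p t j])
  finally show ?thesis unfolding scaled_output_def rescale_def by simp
 qed
 have "limit_input R H (\<lambda>_. J) (\<lambda>j. Gfun S (H j) j) v (\<beta> j) j = x'"
 proof (intro ext)
  fix t l
  show "limit_input R H (\<lambda>_. J) (\<lambda>j. Gfun S (H j) j) v (\<beta> j) j t l = x' t l"
   unfolding limit_input_def affine_path_def x'_def Gfun_combine b0_def \<zeta>0_def by (cases "j = 0") simp_all
 qed
 then have lim: "limit_component J R H (\<lambda>_. J) (\<lambda>j. Gfun S (H j) j) v (\<beta> j) j =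
   (\<lambda>t. zmap (J - j) (\<lambda>l m. Gfun R (H j) j l (j + m)) x' t 0)"
  unfolding limit_component_def by (simp only:)
 have "uniform_limit {0..T} (\<lambda>n t. z n t j) (\<lambda>t. zmap (J - j) (\<lambda>l m. Gfun R (H j) j l (j + m)) x' t 0) sequentially"
  using high_coordinates_limit[unfolded lunif_def, rule_format, of 0 T] j by simp
 then show "uniform_limit {0..T} (\<lambda>n t. scaled_output J R S (\<gamma>s n) (vs n) (B n) t j)
   (\<lambda>t. limit_component J R H (\<lambda>_. J) (\<lambda>j. Gfun S (H j) j) v (\<beta> j) j t) sequentially"
  unfolding lim
 proof (rule uniform_limit_cong'[THEN iffD1, rotated -1])
  show "z n t j = scaled_output J R S (\<gamma>s n) (vs n) (B n) t j" if "t \<in> {0..T}" for n t using out[of t n] that by simp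
 qed (rule refl)
qed

lemma cproc_limit:
 assumes \<beta>: "\<And>j. j < J \<Longrightarrow> cproc N (q j) (\<lambda>u. \<beta> u j)" and v: "\<And>i. i < J \<Longrightarrow> (\<lambda>u. v u i) \<in> borel_measurable N"
 shows "cproc N J (\<lambda>u t j. limit_component J R H q A (v u) (\<beta> u j) j t)"
proof -
 have c: "cproc N (J - j) (\<lambda>u. zmap (J - j) (\<lambda>l m. Gfun R (H j) j l (j + m)) (limit_input R H q A (v u) (\<beta> u j) j))" if j: "j < J" for j
 proof (rule cproc_zmap[OF G[OF j]], unfold limit_input_def, rule cproc_affine[OF \<beta>[OF j]])
  fix i assume i: "i < J - j"
  then have [measurable]: "(\<lambda>u. v u i) \<in> borel_measurable N" using v by simp
  show "(\<lambda>u. if j = 0 then max 0 (v u i) else 0) \<in> borel_measurable N" by measurable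
 qed
 show ?thesis unfolding cproc_def cpath_def
 proof (intro conjI ballI allI impI)
  fix u j assume "u \<in> space N" and j: "j < J"
  then show "continuous_on {0..} (\<lambda>t. limit_component J R H q A (v u) (\<beta> u j) j t)"
   using c[OF j] unfolding cproc_def cpath_def limit_component_def by simp
 next
  fix t :: real and j assume t: "0 \<le> t" and j: "j < J"
  show "(\<lambda>u. limit_component J R H q A (v u) (\<beta> u j) j t) \<in> borel_measurable N"
   using c[OF j] t j unfolding cproc_def limit_component_def by simp
 qed
qed

end

text \<open>By independence the exponents add up over the windows. The clocks are monotone with sum
  \<open>t\<close>, so the minima of the clocks at two times sum to the minimum of the times, which
  is the Brownian covariance.\<close>

lemma splice_bm_law:
 fixes J d :: nat
 assumes B: "bm_law M d B" and \<gamma>: "\<And>j. j < J \<Longrightarrow> 0 < \<gamma> j" and J: "0 < J"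
 shows "bm_law (\<Pi>\<^sub>M j\<in>{..<J}. M) d (\<lambda>w. splice J \<gamma> (\<lambda>j. B (w j)))" unfolding bm_law_def
proof (intro conjI allI impI)
 let ?N = "\<Pi>\<^sub>M j\<in>{..<J}. M"
 interpret M: prob_space M by (rule bm_lawD(1)[OF B])
 interpret PS: product_sigma_finite "\<lambda>_ :: nat. M" by unfold_locales
 show "prob_space ?N" by (rule prob_space_PiM) (rule M.prob_space_axioms)
 have sp: "w j \<in> space M" if "w \<in> space ?N" "j < J" for w j using that by (auto simp: space_PiM)
 show "cproc ?N d (\<lambda>w. splice J \<gamma> (\<lambda>j. B (w j)))" unfolding cproc_def
 proof (intro conjI ballI allI impI)
  fix w assume "w \<in> space ?N"
  then show "cpath d (splice J \<gamma> (\<lambda>j. B (w j)))"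
   using bm_lawD(2)[OF B] sp unfolding cproc_def by (intro cpath_splice) blast
 next
  fix t :: real and i assume t: "0 \<le> t" and i: "i < d"
  have [measurable]: "(\<lambda>w. B (w j) ((\<gamma> j)\<^sup>2 * splice_time J \<gamma> j t) i) \<in> borel_measurable ?N" if j: "j \<in> {..<J}" for j
  proof (rule measurable_compose[OF measurable_component_singleton[OF j]])
   show "(\<lambda>x. B x ((\<gamma> j)\<^sup>2 * splice_time J \<gamma> j t) i) \<in> borel_measurable M"
    using bm_lawD(2)[OF B] i splice_time_nonneg[of J \<gamma> j t] unfolding cproc_def by simp
  qed
  show "(\<lambda>w. splice J \<gamma> (\<lambda>j. B (w j)) t i) \<in> borel_measurable ?N"
   unfolding splice_def by measurable
 qed
 fix m a and \<tau> :: "nat \<Rightarrow> real" assume \<tau>: "\<forall>k. 0 \<le> \<tau> k"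
 define T where "T j k = (\<gamma> j)\<^sup>2 * splice_time J \<gamma> j (\<tau> k)" for j k
 have T0: "0 \<le> T j k" for j k unfolding T_def by (simp add: splice_time_nonneg)
 define A where "A j x = (\<Sum>k<m. \<Sum>i<d. (a k i / \<gamma> j) * B x (T j k) i)" for j x
 define \<mu> where "\<mu> j k l = min (splice_time J \<gamma> j (\<tau> k)) (splice_time J \<gamma> j (\<tau> l))" for j k l
 define Q where "Q k l = (\<Sum>i<d. a k i * a l i)" for k l
 have Am[measurable]: "A j \<in> borel_measurable M" for j
  unfolding A_def by (rule cproc_fdd_measurable[OF bm_lawD(2)[OF B] T0])
 have sum: "(\<Sum>k<m. \<Sum>i<d. a k i * splice J \<gamma> (\<lambda>j. B (w j)) (\<tau> k) i) = (\<Sum>j<J. A j (w j))" for w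
 proof -
  have "(\<Sum>k<m. \<Sum>i<d. a k i * splice J \<gamma> (\<lambda>j. B (w j)) (\<tau> k) i) =
    (\<Sum>k<m. \<Sum>i<d. \<Sum>j<J. (a k i / \<gamma> j) * B (w j) (T j k) i)"
   unfolding splice_def sum_distrib_left T_def by simp
  also have "\<dots> = (\<Sum>k<m. \<Sum>j<J. \<Sum>i<d. (a k i / \<gamma> j) * B (w j) (T j k) i)"
   by (rule sum.cong[OF refl], rule sum.swap)
  also have "\<dots> = (\<Sum>j<J. A j (w j))" unfolding A_def by (rule sum.swap)
  finally show ?thesis .
 qed
 have e: "iexp (\<Sum>j<J. A j (w j)) = (\<Prod>j\<in>{..<J}. iexp (A j (w j)))" for w
  unfolding of_real_sum sum_distrib_left by (rule exp_sum) simp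
 have "fdd_char ?N d (\<lambda>w. splice J \<gamma> (\<lambda>j. B (w j))) m \<tau> a = (\<integral>w. (\<Prod>j\<in>{..<J}. iexp (A j (w j))) \<partial>?N)"
  unfolding fdd_char_def sum e ..
 also have "\<dots> = (\<Prod>j\<in>{..<J}. \<integral>x. iexp (A j x) \<partial>M)"
 proof (rule PS.product_integral_prod)
  show "integrable M (\<lambda>x. iexp (A j x))" for j by (rule M.integrable_const_bound[of _ 1]) auto
 qed simp
 also have "\<dots> = (\<Prod>j\<in>{..<J}. complex_of_real (exp (- (\<Sum>k<m. \<Sum>l<m. \<mu> j k l * Q k l) / 2)))"
 proof (rule prod.cong[OF refl])
  fix j assume "j \<in> {..<J}"
  then have g: "0 < \<gamma> j" using \<gamma> by simp
  have "(\<integral>x. iexp (A j x) \<partial>M) = fdd_char M d B m (T j) (\<lambda>k i. a k i / \<gamma> j)"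
   unfolding fdd_char_def A_def ..
  also have "\<dots> = complex_of_real (exp (- (\<Sum>k<m. \<Sum>l<m. min (T j k) (T j l) * (\<Sum>i<d. (a k i / \<gamma> j) * (a l i / \<gamma> j))) / 2))"
   by (rule bm_lawD(3)[OF B T0])
  also have "(\<Sum>k<m. \<Sum>l<m. min (T j k) (T j l) * (\<Sum>i<d. (a k i / \<gamma> j) * (a l i / \<gamma> j))) =
    (\<Sum>k<m. \<Sum>l<m. \<mu> j k l * Q k l)"
  proof (rule sum.cong[OF refl], rule sum.cong[OF refl])
   fix k l
   have q: "(\<Sum>i<d. (a k i / \<gamma> j) * (a l i / \<gamma> j)) = Q k l / (\<gamma> j)\<^sup>2"
    unfolding Q_def sum_divide_distrib by (rule sum.cong[OF refl]) (simp add: power2_eq_square)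
   have "min (T j k) (T j l) = (\<gamma> j)\<^sup>2 * \<mu> j k l"
    unfolding T_def \<mu>_def using g by (simp add: min_mult_distrib_left)
   then show "min (T j k) (T j l) * (\<Sum>i<d. (a k i / \<gamma> j) * (a l i / \<gamma> j)) =
     \<mu> j k l * Q k l" unfolding q using g by simp
  qed
  finally show "(\<integral>x. iexp (A j x) \<partial>M) = complex_of_real (exp (- (\<Sum>k<m. \<Sum>l<m. \<mu> j k l * Q k l) / 2))" .
 qed
 also have "\<dots> = complex_of_real (exp (\<Sum>j<J. - (\<Sum>k<m. \<Sum>l<m. \<mu> j k l * Q k l) / 2))"
  by (simp only: exp_sum finite_lessThan of_real_prod)
 also have "(\<Sum>j<J. - (\<Sum>k<m. \<Sum>l<m. \<mu> j k l * Q k l) / 2) =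
   - (\<Sum>k<m. \<Sum>l<m. min (\<tau> k) (\<tau> l) * Q k l) / 2"
 proof -
  have mn: "(\<Sum>j<J. min (splice_time J \<gamma> j s) (splice_time J \<gamma> j t)) = min s t" if "0 \<le> s" "0 \<le> t" for s t
  proof (cases "s \<le> t")
   case True
   then have "min (splice_time J \<gamma> j s) (splice_time J \<gamma> j t) = splice_time J \<gamma> j s" for j by (simp add: splice_time_mono)
   then show ?thesis using True splice_time_sum[where \<gamma> = \<gamma>, OF \<gamma> J that(1)] by simp
  next
   case False
   then have "min (splice_time J \<gamma> j s) (splice_time J \<gamma> j t) = splice_time J \<gamma> j t" for j by (simp add: splice_time_mono min_absorb2)
   then show ?thesis using False splice_time_sum[where \<gamma> = \<gamma>, OF \<gamma> J that(2)] by simp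
  qed
  have "(\<Sum>j<J. \<Sum>k<m. \<Sum>l<m. \<mu> j k l * Q k l) =
    (\<Sum>k<m. \<Sum>j<J. \<Sum>l<m. \<mu> j k l * Q k l)" by (rule sum.swap)
  also have "\<dots> = (\<Sum>k<m. \<Sum>l<m. \<Sum>j<J. \<mu> j k l * Q k l)" by (rule sum.cong[OF refl], rule sum.swap)
  also have "\<dots> = (\<Sum>k<m. \<Sum>l<m. min (\<tau> k) (\<tau> l) * Q k l)"
   unfolding sum_distrib_right[symmetric] \<mu>_def using mn \<tau> by simp
  finally have "(\<Sum>j<J. \<Sum>k<m. \<Sum>l<m. \<mu> j k l * Q k l) =
    (\<Sum>k<m. \<Sum>l<m. min (\<tau> k) (\<tau> l) * Q k l)" .
  then show ?thesis by (simp only: sum_divide_distrib[symmetric] sum_negf)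
 qed
 finally show "fdd_char ?N d (\<lambda>w. splice J \<gamma> (\<lambda>j. B (w j))) m \<tau> a =
  complex_of_real (exp (- (\<Sum>k<m. \<Sum>l<m. min (\<tau> k) (\<tau> l) * (\<Sum>i<d. a k i * a l i)) / 2))"
  unfolding Q_def .
qed

lemma pcont_max_0: "pcont d F \<Longrightarrow> pcont d (\<lambda>x. max 0 (F x))"
proof -
 assume F: "pcont d F"
 show "pcont d (\<lambda>x. max 0 (F x))" unfolding pcont_def
 proof (intro allI impI)
  fix xs x assume xs: "\<forall>n. cpath d (xs n)" and x: "cpath d x" "lunif d xs x"
  from pcontD[OF F spec[OF xs] x] show "(\<lambda>n. max 0 (F (xs n))) \<longlonglongrightarrow> max 0 (F x)" by (rule tendsto_max[OF tendsto_const])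
 qed
qed

text \<open>Brownian scaling turns \<open>\<rho>\<close> times the supremum over
  \<open>[0, 1 / \<rho>]\<close> into \<open>sqrt \<rho>\<close> times the supremum over
  \<open>[0, 1]\<close>. The truncations make the functional bounded on all functions, so that
  equality of laws can be applied.\<close>

lemma small_path_sup:
 assumes B: "bm_law M d B" and i: "i < d" and \<rho>: "\<And>n. 0 < \<rho> n" "\<rho> \<longlonglongrightarrow> 0"
 shows "(\<lambda>n. \<integral>z. max 0 (min 1 (\<rho> n * path_sup (1 / \<rho> n) i (B z))) \<partial>M) \<longlonglongrightarrow> 0"
proof -
 interpret M: prob_space M by (rule bm_lawD(1)[OF B])
 have cB: "cpath d (B z)" if "z \<in> space M" for z using bm_lawD(2)[OF B] that by (simp add: cproc_def)
 have eq: "(\<integral>z. max 0 (min 1 (\<rho> n * path_sup (1 / \<rho> n) i (B z))) \<partial>M) =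
   (\<integral>z. max 0 (min 1 (sqrt (\<rho> n) * path_sup 1 i (B z))) \<partial>M)" for n
 proof -
  define c where "c = 1 / \<rho> n"
  have c: "0 < c" "\<rho> n = 1 / c" unfolding c_def using \<rho>(1)[of n] by simp_all
  note B' = bm_law_scale[OF B c(1)]
  have "(\<integral>z. max 0 (min 1 (\<rho> n * path_sup c i (B z))) \<partial>M) =
    (\<integral>z. max 0 (min 1 (\<rho> n * path_sup c i (\<lambda>t i. sqrt c * B z ((1 / c) * t) i))) \<partial>M)"
   by (rule pcont_integral_eq[OF M.prob_space_axioms M.prob_space_axioms bm_lawD(2)[OF B] bm_lawD(2)[OF B']
     bm_law_same_fdd[OF B B'], where b = 1 and F = "\<lambda>x. max 0 (min 1 (\<rho> n * path_sup c i x))"])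
    (rule pcont_max_0[OF pcont_path_sup[OF i less_imp_le[OF c(1)]]], simp)
  also have "\<dots> = (\<integral>z. max 0 (min 1 (sqrt (\<rho> n) * path_sup 1 i (B z))) \<partial>M)"
  proof (rule Bochner_Integration.integral_cong[OF refl])
   fix z assume "z \<in> space M"
   then have "path_sup c i (\<lambda>t i. sqrt c * B z ((1 / c) * t) i) = sqrt c * path_sup ((1 / c) * c) i (B z)"
    by (intro path_sup_scale[OF _ _ _ cB i]) (use c in auto)
   then have "\<rho> n * path_sup c i (\<lambda>t i. sqrt c * B z ((1 / c) * t) i) = (\<rho> n * sqrt c) * path_sup 1 i (B z)"
    using c(1) by simp
   moreover have "\<rho> n * sqrt c = sqrt (\<rho> n)"
    unfolding c(2) using c(1) by (simp add: real_sqrt_divide field_simps)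
   ultimately show "max 0 (min 1 (\<rho> n * path_sup c i (\<lambda>t i. sqrt c * B z ((1 / c) * t) i))) =
     max 0 (min 1 (sqrt (\<rho> n) * path_sup 1 i (B z)))" by (simp only:)
  qed
  finally show ?thesis unfolding c_def .
 qed
 have "(\<lambda>n. \<integral>z. max 0 (min 1 (sqrt (\<rho> n) * path_sup 1 i (B z))) \<partial>M) \<longlonglongrightarrow> (\<integral>z. 0 \<partial>M)"
 proof (rule integral_dominated_convergence[where w = "\<lambda>_. 1"])
  show "(\<lambda>z. max 0 (min 1 (sqrt (\<rho> n) * path_sup 1 i (B z)))) \<in> borel_measurable M" for n
   by (rule pcont_measurable[OF bm_lawD(2)[OF B] pcont_max_0[OF pcont_path_sup[OF i]]]) simp
  have "(\<lambda>n. max 0 (min 1 (sqrt (\<rho> n) * y))) \<longlonglongrightarrow> 0" for y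
  proof -
   have "(\<lambda>n. sqrt (\<rho> n) * y) \<longlonglongrightarrow> 0 * y" using tendsto_real_sqrt[OF \<rho>(2)] by (intro tendsto_mult tendsto_const) simp
   then have "(\<lambda>n. max 0 (min 1 (sqrt (\<rho> n) * y))) \<longlonglongrightarrow> max 0 (min 1 (0 * y))" by (intro tendsto_max tendsto_min tendsto_const)
   then show ?thesis by simp
  qed
  then show "AE z in M. (\<lambda>n. max 0 (min 1 (sqrt (\<rho> n) * path_sup 1 i (B z)))) \<longlonglongrightarrow> 0" by simp
 qed auto
 then show ?thesis unfolding eq by simp
qed

text \<open>The truncated suprema vanish in mean, hence almost surely along a subsequence. Once a
  truncated value is below one it equals the untruncated one, which gives hypothesis
  \<open>small\<close> of \<open>splice_rescaled_limit\<close>.\<close>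

lemma splice_ae_subsequence:
 fixes J d :: nat
 assumes B: "bm_law M d B" and B0: "\<And>w i. w \<in> space M \<Longrightarrow> i < d \<Longrightarrow> B w 0 i = 0"
  and \<gamma>: "\<And>n j. j < J \<Longrightarrow> 0 < \<gamma>s n j"
  and ratio: "\<And>i j. i < j \<Longrightarrow> j < J \<Longrightarrow> (\<lambda>n. \<gamma>s n j / \<gamma>s n i) \<longlonglongrightarrow> 0"
 shows "\<exists>s :: nat \<Rightarrow> nat. strict_mono s \<and> (AE w in (\<Pi>\<^sub>M j\<in>{..<J}. M). \<forall>j<J.
   lunif d (\<lambda>n t i. \<gamma>s (s n) j * splice J (\<gamma>s (s n)) (\<lambda>j. B (w j)) (t / (\<gamma>s (s n) j)\<^sup>2) i) (B (w j)))"
proof -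
 let ?N = "\<Pi>\<^sub>M j\<in>{..<J}. M"
 interpret M: prob_space M by (rule bm_lawD(1)[OF B])
 interpret N: prob_space ?N by (rule prob_space_PiM) (rule M.prob_space_axioms)
 define \<rho> where "\<rho> n j = \<gamma>s n (Suc j) / \<gamma>s n j" for n j
 define e where "e n j i x = max 0 (min 1 (\<rho> n j * path_sup (1 / \<rho> n j) i (B x)))" for n j i x
 have \<rho>: "0 < \<rho> n j" "(\<lambda>n. \<rho> n j) \<longlonglongrightarrow> 0" if "j < J - 1" for n j
  unfolding \<rho>_def using that \<gamma>[of "Suc j"] \<gamma>[of j] ratio[of j "Suc j"] by simp_all
 have em: "e n j i \<in> borel_measurable M" if "i < d" "j < J - 1" for n j i
  unfolding e_def by (rule pcont_measurable[OF bm_lawD(2)[OF B] pcont_max_0[OF pcont_path_sup]]) (use that \<rho>(1)[of j n] in simp_all)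
 have e01: "0 \<le> e n j i x" "e n j i x \<le> 1" for n j i x unfolding e_def by auto
 have cm: "(\<lambda>w. w j) \<in> ?N \<rightarrow>\<^sub>M M" if "j < J" for j by (rule measurable_component_singleton) (use that in simp)
 have em': "(\<lambda>w. e n j i (w j)) \<in> borel_measurable ?N" if "i < d" "j < J - 1" for n j i
  by (rule measurable_compose[OF cm em]) (use that in simp_all)
 have ei: "integrable ?N (\<lambda>w. e n j i (w j))" if "i < d" "j < J - 1" for n j i
  by (rule N.integrable_const_bound[of _ 1, OF _ em'[OF that]]) (use e01 in auto)
 have eI: "(\<integral>w. e n j i (w j) \<partial>?N) = (\<integral>x. e n j i x \<partial>M)" if "i < d" "j < J - 1" for n j i
 proof -
  have j: "j < J" using that by simp
  have "(\<integral>x. e n j i x \<partial>(distr ?N M (\<lambda>w. w j))) = (\<integral>w. e n j i (w j) \<partial>?N)"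
   by (rule integral_distr[OF cm[OF j] em[OF that]])
  moreover have "distr ?N M (\<lambda>w. w j) = M" by (rule distr_PiM_component) (use j M.prob_space_axioms in auto)
  ultimately show ?thesis by simp
 qed
 \<comment> \<open>Adding the errors over all windows and coordinates lets one subsequence serve
   them all.\<close>
 define U where "U n w = (\<Sum>j<J - 1. \<Sum>i<d. e n j i (w j))" for n w
 have Ui: "integrable ?N (U n)" for n unfolding U_def by (intro Bochner_Integration.integrable_sum ei) simp_all
 have U0: "0 \<le> U n w" for n w unfolding U_def by (intro sum_nonneg e01)
 have "(\<integral>w. norm (U n w) \<partial>?N) = (\<Sum>j<J - 1. \<Sum>i<d. \<integral>x. e n j i x \<partial>M)" for n
 proof -
  have "(\<integral>w. norm (U n w) \<partial>?N) = (\<integral>w. (\<Sum>j<J - 1. \<Sum>i<d. e n j i (w j)) \<partial>?N)"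
   using U0 unfolding U_def[symmetric] by simp
  also have "\<dots> = (\<Sum>j<J - 1. \<integral>w. (\<Sum>i<d. e n j i (w j)) \<partial>?N)"
   by (intro Bochner_Integration.integral_sum Bochner_Integration.integrable_sum ei) simp_all
  also have "\<dots> = (\<Sum>j<J - 1. \<Sum>i<d. \<integral>w. e n j i (w j) \<partial>?N)"
   by (intro sum.cong refl Bochner_Integration.integral_sum ei) simp_all
  also have "\<dots> = (\<Sum>j<J - 1. \<Sum>i<d. \<integral>x. e n j i x \<partial>M)" by (intro sum.cong refl eI) simp_all
  finally show ?thesis .
 qed
 moreover have "(\<lambda>n. \<Sum>j<J - 1. \<Sum>i<d. \<integral>x. e n j i x \<partial>M) \<longlonglongrightarrow> (\<Sum>j<J - 1. \<Sum>i<d. 0)"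
  unfolding e_def by (intro tendsto_sum small_path_sup[OF B]) (use \<rho> in auto)
 ultimately have "(\<lambda>n. \<integral>w. norm (U n w) \<partial>?N) \<longlonglongrightarrow> 0" by simp
 from tendsto_L1_AE_subseq[OF Ui this] obtain s :: "nat \<Rightarrow> nat"
  where s: "strict_mono s" and ae: "AE w in ?N. (\<lambda>n. U (s n) w) \<longlonglongrightarrow> 0" by blast
 have "AE w in ?N. \<forall>j<J. lunif d (\<lambda>n t i. \<gamma>s (s n) j * splice J (\<gamma>s (s n)) (\<lambda>j. B (w j)) (t / (\<gamma>s (s n) j)\<^sup>2) i) (B (w j))"
  using ae AE_space
 proof eventually_elim
  case (elim w)
  have sp: "w j \<in> space M" if "j < J" for j using elim(2) that by (auto simp: space_PiM)
  have cB: "cpath d (B (w j))" if "j < J" for j using bm_lawD(2)[OF B] sp[OF that] by (simp add: cproc_def)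
  show ?case
  proof (intro allI impI)
   fix j assume j: "j < J"
   show "lunif d (\<lambda>n t i. \<gamma>s (s n) j * splice J (\<gamma>s (s n)) (\<lambda>j. B (w j)) (t / (\<gamma>s (s n) j)\<^sup>2) i) (B (w j))"
   proof (rule splice_rescaled_limit[where \<gamma>s = "\<lambda>n. \<gamma>s (s n)", OF \<gamma> _ cB B0[OF sp] _ j])
    show "(\<lambda>n. \<gamma>s (s n) l / \<gamma>s (s n) i) \<longlonglongrightarrow> 0" if "i < l" "l < J" for i l
     using LIMSEQ_subseq_LIMSEQ[OF ratio[OF that] s] by (simp add: comp_def)
    fix l i assume l: "Suc l < J" and i: "i < d"
    then have l1: "l < J - 1" by simp
    have le: "e n l i (w l) \<le> U n w" for n
    proof -
     have "e n l i (w l) \<le> (\<Sum>i<d. e n l i (w l))" by (rule member_le_sum) (use i e01 in auto)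
     also have "\<dots> \<le> U n w" unfolding U_def
      by (rule member_le_sum[where f = "\<lambda>l. \<Sum>i<d. e n l i (w l)"]) (use l1 e01 in \<open>auto intro: sum_nonneg\<close>)
     finally show ?thesis .
    qed
    have e0: "(\<lambda>n. e (s n) l i (w l)) \<longlonglongrightarrow> 0"
     by (rule tendsto_sandwich[OF _ _ tendsto_const elim(1)]) (use e01 le in auto)
    have ev: "\<forall>\<^sub>F n in sequentially. e (s n) l i (w l) < 1" by (rule order_tendstoD(2)[OF e0]) simp
    have "\<forall>\<^sub>F n in sequentially. e (s n) l i (w l) = \<rho> (s n) l * path_sup (1 / \<rho> (s n) l) i (B (w l))"
     using ev
    proof eventually_elim
     case (elim n)
     have "0 \<le> \<rho> (s n) l * path_sup (1 / \<rho> (s n) l) i (B (w l))"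
      using \<rho>(1)[OF l1, of "s n"] path_sup_nonneg[OF cB[of l] i, of "1 / \<rho> (s n) l"] l by simp
     then show ?case using elim unfolding e_def by (auto simp: min_def split: if_splits)
    qed
    from Lim_transform_eventually[OF e0 this]
    show "(\<lambda>n. \<gamma>s (s n) (Suc l) / \<gamma>s (s n) l * path_sup (\<gamma>s (s n) l / \<gamma>s (s n) (Suc l)) i (B (w l))) \<longlonglongrightarrow> 0"
     unfolding \<rho>_def by simp
   qed
  qed
 qed
 then show ?thesis using s by blast
qed

context eliminated_system
begin

text \<open>The coupling converges almost surely only along subsequences. This is enough for a limit
  of real numbers: each subsequence has a further one along which dominated convergence gives the
  same value.\<close>

lemma scaled_output_integral_limit:
 assumes B: "bm_law M J B" and B0: "\<And>u i. u \<in> space M \<Longrightarrow> i < J \<Longrightarrow> B u 0 i = 0"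
  and \<gamma>: "\<And>n j. j < J \<Longrightarrow> 0 < \<gamma>s n j"
  and ratio: "\<And>i j. i < j \<Longrightarrow> j < J \<Longrightarrow> (\<lambda>n. \<gamma>s n j / \<gamma>s n i) \<longlonglongrightarrow> 0"
  and vs: "\<And>i. i < J \<Longrightarrow> (\<lambda>n. vs n i) \<longlonglongrightarrow> v i"
  and f: "pcont J f" "\<And>x. \<bar>f x\<bar> \<le> b"
 shows "(\<lambda>n. \<integral>u. f (scaled_output J R S (\<gamma>s n) (vs n) (splice J (\<gamma>s n) (\<lambda>j. B (u j)))) \<partial>(\<Pi>\<^sub>M j\<in>{..<J}. M))
  \<longlonglongrightarrow> (\<integral>u. f (\<lambda>t j. limit_component J R H (\<lambda>_. J) (\<lambda>j. Gfun S (H j) j) v (B (u j)) j t) \<partial>(\<Pi>\<^sub>M j\<in>{..<J}. M))"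
proof (rule tendsto_if_subseq_tendsto)
 let ?N = "\<Pi>\<^sub>M j\<in>{..<J}. M"
 interpret M: prob_space M by (rule bm_lawD(1)[OF B])
 interpret N: prob_space ?N by (rule prob_space_PiM) (rule M.prob_space_axioms)
 define I where "I n u = scaled_output J R S (\<gamma>s n) (vs n) (splice J (\<gamma>s n) (\<lambda>j. B (u j)))" for n u
 define L where "L u = (\<lambda>t j. limit_component J R H (\<lambda>_. J) (\<lambda>j. Gfun S (H j) j) v (B (u j)) j t)" for u
 have cI: "cproc ?N J (I n)" for n unfolding I_def scaled_output_def coupled_input_def
  by (intro cproc_rescale cproc_zmap[OF R] cproc_affine bm_lawD(2)[OF splice_bm_law[OF B \<gamma> J]]) auto
 have cm: "(\<lambda>u. u j) \<in> ?N \<rightarrow>\<^sub>M M" if "j < J" for j by (rule measurable_component_singleton) (use that in simp)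
 have cL: "cproc ?N J L" unfolding L_def by (rule cproc_limit) (auto intro: cproc_compose[OF bm_lawD(2)[OF B] cm])
 fix s :: "nat \<Rightarrow> nat" assume s: "strict_mono s"
 have "(\<lambda>n. \<gamma>s (s n) j / \<gamma>s (s n) i) \<longlonglongrightarrow> 0" if "i < j" "j < J" for i j
  using LIMSEQ_subseq_LIMSEQ[OF ratio[OF that] s] by (simp add: comp_def)
 from splice_ae_subsequence[where \<gamma>s = "\<lambda>n. \<gamma>s (s n)" and J = J, OF B B0 \<gamma> this]
 obtain s' :: "nat \<Rightarrow> nat" where s': "strict_mono s'" and ae: "AE u in ?N. \<forall>j<J.
   lunif J (\<lambda>n t i. \<gamma>s (s (s' n)) j * splice J (\<gamma>s (s (s' n))) (\<lambda>j. B (u j)) (t / (\<gamma>s (s (s' n)) j)\<^sup>2) i) (B (u j))" by blast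
 have ss: "strict_mono (\<lambda>n. s (s' n))" using strict_mono_o[OF s s'] by (simp add: comp_def)
 have "(\<lambda>n. \<integral>u. f (I (s (s' n)) u) \<partial>?N) \<longlonglongrightarrow> (\<integral>u. f (L u) \<partial>?N)"
 proof (rule integral_dominated_convergence[where w = "\<lambda>_. b"])
  show "(\<lambda>u. f (L u)) \<in> borel_measurable ?N" by (rule pcont_measurable[OF cL f(1)])
  show "(\<lambda>u. f (I (s (s' n)) u)) \<in> borel_measurable ?N" for n by (rule pcont_measurable[OF cI f(1)])
  show "AE u in ?N. norm (f (I (s (s' n)) u)) \<le> b" for n using f(2) by simp
  show "AE u in ?N. (\<lambda>n. f (I (s (s' n)) u)) \<longlonglongrightarrow> f (L u)" using ae AE_space
  proof eventually_elim
   case (elim u)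
   have sp: "u j \<in> space M" if "j < J" for j using elim(2) that by (auto simp: space_PiM)
   have cB: "cpath J (B (u j))" if "j < J" for j using bm_lawD(2)[OF B] sp[OF that] by (simp add: cproc_def)
   have "lunif J (\<lambda>n. I (s (s' n)) u) (L u)" unfolding I_def L_def
   proof (rule scaled_output_limit[OF \<gamma> _ _ cpath_splice[OF cB] _ cB])
    show "(\<lambda>n. \<gamma>s (s (s' n)) j / \<gamma>s (s (s' n)) i) \<longlonglongrightarrow> 0" if "i < j" "j < J" for i j
     using LIMSEQ_subseq_LIMSEQ[OF ratio[OF that] ss] by (simp add: comp_def)
    show "(\<lambda>n. vs (s (s' n)) i) \<longlonglongrightarrow> v i" if "i < J" for i
     using LIMSEQ_subseq_LIMSEQ[OF vs[OF that] ss] by (simp add: comp_def)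
    show "lunif J (\<lambda>n t i. \<gamma>s (s (s' n)) j * splice J (\<gamma>s (s (s' n))) (\<lambda>j. B (u j)) (t / (\<gamma>s (s (s' n)) j)\<^sup>2) i) (B (u j))"
     if "j < J" for j using elim(1) that by blast
    show "splice J (\<gamma>s (s (s' n))) (\<lambda>j. B (u j)) 0 i = 0" if i: "i < J" for n i
    proof -
     \<comment> \<open>At time 0 the clocks are nonnegative with sum zero, so the spliced path
       starts where its pieces do, at zero.\<close>
     have "splice_time J \<gamma> j 0 = 0" if "j < J" "\<And>j. j < J \<Longrightarrow> 0 < \<gamma> j" for \<gamma> j
     proof -
      have "0 \<le> splice_time J \<gamma> j 0" "splice_time J \<gamma> j 0 \<le> (\<Sum>j<J. splice_time J \<gamma> j 0)"
       by (rule splice_time_nonneg, rule member_le_sum) (use that splice_time_nonneg in auto)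
      then show ?thesis using splice_time_sum[where \<gamma> = \<gamma> and t = 0, OF that(2) J] by simp
     qed
     from this[OF _ \<gamma>] show ?thesis unfolding splice_def by (intro sum.neutral) (use B0[OF sp i] in auto)
    qed
   qed
   then show ?case by (rule pcontD[OF f(1), rotated -1]) (use cI cL elim(2) in \<open>simp_all add: cproc_def\<close>)
  qed
 qed auto
 then show "\<exists>s'. strict_mono s' \<and> (\<lambda>n. \<integral>u. f (scaled_output J R S (\<gamma>s (s (s' n))) (vs (s (s' n))) (splice J (\<gamma>s (s (s' n))) (\<lambda>j. B (u j)))) \<partial>?N) \<longlonglongrightarrow>
   (\<integral>u. f (\<lambda>t j. limit_component J R H (\<lambda>_. J) (\<lambda>j. Gfun S (H j) j) v (B (u j)) j t) \<partial>?N)"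
  using s' unfolding I_def L_def by blast
qed

end

section \<open>Independence and measure-preserving maps\<close>

lemma indep_elements_iff:
 assumes "prob_space N"
 shows "indep_elements N S X T Y \<longleftrightarrow> X \<in> N \<rightarrow>\<^sub>M S \<and> Y \<in> N \<rightarrow>\<^sub>M T \<and>
  (\<forall>A\<in>sets S. \<forall>B\<in>sets T. measure N ((X -` A \<inter> space N) \<inter> (Y -` B \<inter> space N)) =
    measure N (X -` A \<inter> space N) * measure N (Y -` B \<inter> space N))"
proof -
 interpret prob_space N by fact
 have "indep_set {X -` A \<inter> space N |A. A \<in> sets S} {Y -` B \<inter> space N |B. B \<in> sets T} \<longleftrightarrow>
  (\<forall>A\<in>sets S. \<forall>B\<in>sets T. prob ((X -` A \<inter> space N) \<inter> (Y -` B \<inter> space N)) = prob (X -` A \<inter> space N) * prob (Y -` B \<inter> space N))"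
  if X: "X \<in> N \<rightarrow>\<^sub>M S" and Y: "Y \<in> N \<rightarrow>\<^sub>M T"
 proof
  assume i: "indep_set {X -` A \<inter> space N |A. A \<in> sets S} {Y -` B \<inter> space N |B. B \<in> sets T}"
  show "\<forall>A\<in>sets S. \<forall>B\<in>sets T. prob ((X -` A \<inter> space N) \<inter> (Y -` B \<inter> space N)) = prob (X -` A \<inter> space N) * prob (Y -` B \<inter> space N)"
   by (intro ballI indep_setD[OF i]) auto
 next
  assume p: "\<forall>A\<in>sets S. \<forall>B\<in>sets T. prob ((X -` A \<inter> space N) \<inter> (Y -` B \<inter> space N)) = prob (X -` A \<inter> space N) * prob (Y -` B \<inter> space N)"
  show "indep_set {X -` A \<inter> space N |A. A \<in> sets S} {Y -` B \<inter> space N |B. B \<in> sets T}"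
  proof (rule indep_setI)
   show "{X -` A \<inter> space N |A. A \<in> sets S} \<subseteq> events" using measurable_sets[OF X] by blast
   show "{Y -` B \<inter> space N |B. B \<in> sets T} \<subseteq> events" using measurable_sets[OF Y] by blast
   fix a b assume "a \<in> {X -` A \<inter> space N |A. A \<in> sets S}" "b \<in> {Y -` B \<inter> space N |B. B \<in> sets T}"
   then show "prob (a \<inter> b) = prob a * prob b" using p by blast
  qed
 qed
 then show ?thesis unfolding indep_elements_def by blast
qed

lemma indep_elements_cong:
 assumes N: "prob_space N" and "indep_elements N S X T Y"
  and X: "\<And>w. w \<in> space N \<Longrightarrow> X' w = X w" and Y: "\<And>w. w \<in> space N \<Longrightarrow> Y' w = Y w"
 shows "indep_elements N S X' T Y'"
proof -
 have "X' -` A \<inter> space N = X -` A \<inter> space N" "Y' -` B \<inter> space N = Y -` B \<inter> space N" for A B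
  using X Y by auto
 moreover have "X' \<in> N \<rightarrow>\<^sub>M S \<longleftrightarrow> X \<in> N \<rightarrow>\<^sub>M S" by (rule measurable_cong[OF X])
 moreover have "Y' \<in> N \<rightarrow>\<^sub>M T \<longleftrightarrow> Y \<in> N \<rightarrow>\<^sub>M T" by (rule measurable_cong[OF Y])
 ultimately show ?thesis using assms(2) unfolding indep_elements_iff[OF N] by simp
qed

lemma indep_elements_map:
 assumes N: "prob_space N" and XY: "indep_elements N S X T Y" and f: "f \<in> S \<rightarrow>\<^sub>M S'" and g: "g \<in> T \<rightarrow>\<^sub>M T'"
 shows "indep_elements N S' (\<lambda>w. f (X w)) T' (\<lambda>w. g (Y w))"
proof -
 note XY' = XY[unfolded indep_elements_iff[OF N]]
 have m: "X \<in> N \<rightarrow>\<^sub>M S" "Y \<in> N \<rightarrow>\<^sub>M T" using XY' by blast+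
 have e: "(\<lambda>w. f (X w)) -` A \<inter> space N = X -` (f -` A \<inter> space S) \<inter> space N"
  "(\<lambda>w. g (Y w)) -` B \<inter> space N = Y -` (g -` B \<inter> space T) \<inter> space N" for A B
  using measurable_space[OF m(1)] measurable_space[OF m(2)] by auto
 show ?thesis unfolding indep_elements_iff[OF N]
 proof (intro conjI ballI measurable_compose[OF m(1) f] measurable_compose[OF m(2) g])
  fix A B assume "A \<in> sets S'" "B \<in> sets T'"
  then have "f -` A \<inter> space S \<in> sets S" "g -` B \<inter> space T \<in> sets T"
   using measurable_sets[OF f] measurable_sets[OF g] by blast+
  then show "measure N ((\<lambda>w. f (X w)) -` A \<inter> space N \<inter> ((\<lambda>w. g (Y w)) -` B \<inter> space N)) =
   measure N ((\<lambda>w. f (X w)) -` A \<inter> space N) * measure N ((\<lambda>w. g (Y w)) -` B \<inter> space N)"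
   unfolding e using XY' by blast
 qed
qed

lemma measure_preserving_vimage:
 assumes "\<phi> \<in> N \<rightarrow>\<^sub>M M" "distr N M \<phi> = M" "A \<in> sets M"
 shows "measure N (\<phi> -` A \<inter> space N) = measure M A"
 using measure_distr[OF assms(1,3)] unfolding assms(2) by simp

lemma indep_elements_compose:
 assumes M: "prob_space M" and N: "prob_space N" and \<phi>: "\<phi> \<in> N \<rightarrow>\<^sub>M M" "distr N M \<phi> = M" and XY: "indep_elements M S X T Y"
 shows "indep_elements N S (\<lambda>w. X (\<phi> w)) T (\<lambda>w. Y (\<phi> w))"
proof -
 note XY' = XY[unfolded indep_elements_iff[OF M]]
 have m: "X \<in> M \<rightarrow>\<^sub>M S" "Y \<in> M \<rightarrow>\<^sub>M T" using XY' by blast+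
 have e: "(\<lambda>w. X (\<phi> w)) -` A \<inter> space N = \<phi> -` (X -` A \<inter> space M) \<inter> space N"
  "(\<lambda>w. Y (\<phi> w)) -` B \<inter> space N = \<phi> -` (Y -` B \<inter> space M) \<inter> space N" for A B
  using measurable_space[OF \<phi>(1)] by auto
 show ?thesis unfolding indep_elements_iff[OF N]
 proof (intro conjI ballI measurable_compose[OF \<phi>(1) m(1)] measurable_compose[OF \<phi>(1) m(2)])
  fix A B assume AB: "A \<in> sets S" "B \<in> sets T"
  have s: "X -` A \<inter> space M \<in> sets M" "Y -` B \<inter> space M \<in> sets M"
   by (rule measurable_sets[OF m(1) AB(1)], rule measurable_sets[OF m(2) AB(2)])
  have "\<phi> -` (X -` A \<inter> space M) \<inter> space N \<inter> (\<phi> -` (Y -` B \<inter> space M) \<inter> space N) =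
   \<phi> -` ((X -` A \<inter> space M) \<inter> (Y -` B \<inter> space M)) \<inter> space N" by blast
  then show "measure N ((\<lambda>w. X (\<phi> w)) -` A \<inter> space N \<inter> ((\<lambda>w. Y (\<phi> w)) -` B \<inter> space N)) =
    measure N ((\<lambda>w. X (\<phi> w)) -` A \<inter> space N) * measure N ((\<lambda>w. Y (\<phi> w)) -` B \<inter> space N)"
   unfolding e using XY' AB by (simp only: measure_preserving_vimage[OF \<phi>] s sets.Int)
 qed
qed

lemma indep_elements_pair:
 assumes N: "prob_space N" and P: "prob_space P"
 shows "indep_elements (N \<Otimes>\<^sub>M P) P snd N fst"
proof -
 interpret N: prob_space N by fact
 interpret Pr: prob_space P by fact
 interpret pair: pair_prob_space N P ..
 show ?thesis unfolding indep_elements_iff[OF pair.prob_space_axioms]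
 proof (intro conjI ballI measurable_fst measurable_snd)
  fix A B assume A: "A \<in> sets P" and B: "B \<in> sets N"
  have 1: "snd -` A \<inter> space (N \<Otimes>\<^sub>M P) = space N \<times> A" "fst -` B \<inter> space (N \<Otimes>\<^sub>M P) = B \<times> space P"
   using sets.sets_into_space[OF A] sets.sets_into_space[OF B] by (auto simp: space_pair_measure)
  have 2: "measure (N \<Otimes>\<^sub>M P) (C \<times> D) = measure N C * measure P D" if "C \<in> sets N" "D \<in> sets P" for C D
   using Pr.emeasure_pair_measure_Times[OF that] by (simp add: measure_def enn2real_mult)
  have 3: "(space N \<times> A) \<inter> (B \<times> space P) = B \<times> A"
   using sets.sets_into_space[OF A] sets.sets_into_space[OF B] by auto
  show "measure (N \<Otimes>\<^sub>M P) (snd -` A \<inter> space (N \<Otimes>\<^sub>M P) \<inter> (fst -` B \<inter> space (N \<Otimes>\<^sub>M P))) =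
   measure (N \<Otimes>\<^sub>M P) (snd -` A \<inter> space (N \<Otimes>\<^sub>M P)) * measure (N \<Otimes>\<^sub>M P) (fst -` B \<inter> space (N \<Otimes>\<^sub>M P))"
   unfolding 1 3 using A B by (simp add: 2 N.prob_space Pr.prob_space)
 qed
qed

text \<open>Independence says that the joint law is the product of the marginal laws, and a
  measure-preserving map changes none of these laws.\<close>

lemma indep_vars_measure_preserving:
 assumes M: "prob_space M" and N: "prob_space N" and \<phi>: "\<phi> \<in> N \<rightarrow>\<^sub>M M" "distr N M \<phi> = M"
  and X: "prob_space.indep_vars M K X I" and I: "I \<noteq> {}"
  and X': "\<And>i w. i \<in> I \<Longrightarrow> w \<in> space N \<Longrightarrow> X' i w = X i (\<phi> w)"
 shows "prob_space.indep_vars N K X' I"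
proof -
 interpret M: prob_space M by fact
 interpret N: prob_space N by fact
 have m: "X i \<in> M \<rightarrow>\<^sub>M K i" if "i \<in> I" for i using X that by (simp add: M.indep_vars_def)
 have m': "X' i \<in> N \<rightarrow>\<^sub>M K i" if i: "i \<in> I" for i
  using measurable_compose[OF \<phi>(1) m[OF i]] by (subst measurable_cong[OF X'[OF i]])
 have mp: "(\<lambda>x. \<lambda>i\<in>I. X i x) \<in> M \<rightarrow>\<^sub>M (\<Pi>\<^sub>M i\<in>I. K i)" by (rule measurable_restrict) (rule m)
 have "distr N (\<Pi>\<^sub>M i\<in>I. K i) (\<lambda>x. \<lambda>i\<in>I. X' i x) = distr N (\<Pi>\<^sub>M i\<in>I. K i) ((\<lambda>x. \<lambda>i\<in>I. X i x) \<circ> \<phi>)"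
  by (rule distr_cong[OF refl refl]) (auto simp: X' restrict_def)
 also have "\<dots> = distr (distr N M \<phi>) (\<Pi>\<^sub>M i\<in>I. K i) (\<lambda>x. \<lambda>i\<in>I. X i x)" by (rule distr_distr[OF mp \<phi>(1), symmetric])
 also have "\<dots> = (\<Pi>\<^sub>M i\<in>I. distr M (K i) (X i))"
  unfolding \<phi>(2) using X M.indep_vars_iff_distr_eq_PiM'[OF I m] by simp
 also have "\<dots> = (\<Pi>\<^sub>M i\<in>I. distr N (K i) (X' i))"
 proof (rule PiM_cong[OF refl])
  fix i assume i: "i \<in> I"
  have "distr N (K i) (X' i) = distr N (K i) (X i \<circ> \<phi>)" by (rule distr_cong[OF refl refl]) (simp add: X'[OF i])
  also have "\<dots> = distr (distr N M \<phi>) (K i) (X i)" by (rule distr_distr[OF m[OF i] \<phi>(1), symmetric])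
  finally show "distr M (K i) (X i) = distr N (K i) (X' i)" unfolding \<phi>(2) by simp
 qed
 finally show ?thesis using N.indep_vars_iff_distr_eq_PiM'[OF I m'] by simp
qed

text \<open>Produces the motion of dimension \<open>J - j\<close> that the limit requires on a
  product space: a coordinate projection is measure preserving, and the motion found there is
  truncated to its first \<open>d'\<close> coordinates.\<close>

lemma std_brownian_motion_compose:
 assumes W: "std_brownian_motion M d W" and N: "prob_space N" and \<phi>: "\<phi> \<in> N \<rightarrow>\<^sub>M M" "distr N M \<phi> = M"
  and d': "0 < d'" "d' \<le> d"
 shows "std_brownian_motion N d' (\<lambda>w t. vec d' (\<lambda>i. W (\<phi> w) t $ i))"
proof -
 have M: "prob_space M" by (rule std_brownian_motion_prob_space[OF W])
 define tr where "tr v = vec d' (\<lambda>i. v $ i)" for v :: "real vec"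
 have tr: "tr \<in> vec_borel d \<rightarrow>\<^sub>M vec_borel d'"
  by (rule measurable_vec_borelI) (use d' in \<open>auto simp: tr_def intro: vec_index_measurable\<close>)
 have sp: "\<phi> w \<in> space M" if "w \<in> space N" for w by (rule measurable_space[OF \<phi>(1) that])
 have car: "W (\<phi> w) t \<in> carrier_vec d" if "w \<in> space N" "0 \<le> t" for w t by (rule bm_path(3)[OF W sp that(2)]) fact
 have diff: "tr (W (\<phi> w) t) - tr (W (\<phi> w) s) = tr (W (\<phi> w) t - W (\<phi> w) s)"
  if "w \<in> space N" "0 \<le> s" "0 \<le> t" for w s t
  using car[OF that(1,2)] d' unfolding tr_def by (intro eq_vecI) auto
 have diffi: "(tr (W (\<phi> w) t) - tr (W (\<phi> w) s)) $ i = (W (\<phi> w) t - W (\<phi> w) s) $ i"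
  if "w \<in> space N" "0 \<le> s" "0 \<le> t" "i < d'" for w s t i
  by (subst diff[OF that(1-3)]) (simp add: tr_def that(4))
 have inc: "indep_elements M (\<Pi>\<^sub>M u\<in>{0..s}. vec_borel d) (\<lambda>w. \<lambda>u\<in>{0..s}. W w u) (vec_borel d) (\<lambda>w. W w t - W w s) \<and>
    prob_space.indep_vars M (\<lambda>_. borel) (\<lambda>i w. (W w t - W w s) $ i) {..<d} \<and>
    (\<forall>i<d. distributed M lborel (\<lambda>w. (W w t - W w s) $ i) (normal_density 0 (sqrt (t - s))))"
  if "0 \<le> s \<and> s < t" for s t using W that unfolding std_brownian_motion_def by blast
 have "std_brownian_motion N d' (\<lambda>w t. tr (W (\<phi> w) t))" unfolding std_brownian_motion_def
 proof (intro conjI allI impI ballI N)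
  show "(\<lambda>w. tr (W (\<phi> w) t)) \<in> N \<rightarrow>\<^sub>M vec_borel d'" if "0 \<le> t" for t
  proof -
   have "(\<lambda>w. W w t) \<in> M \<rightarrow>\<^sub>M vec_borel d" using W that unfolding std_brownian_motion_def by blast
   from measurable_compose[OF measurable_compose[OF \<phi>(1) this] tr] show ?thesis .
  qed
  fix w assume w: "w \<in> space N"
  show "tr (W (\<phi> w) 0) = 0\<^sub>v d'" using bm_path(1)[OF W sp[OF w]] d' by (auto simp: tr_def)
  have "continuous_map (vec_topology d) (vec_topology d') tr" unfolding vec_topology_def[of d']
  proof (rule continuous_map_pullback')
   show "topspace (vec_topology d) \<subseteq> tr -` carrier_vec d'" by (auto simp: tr_def)
   show "continuous_map (vec_topology d) (product_topology (\<lambda>_. euclideanreal) {..<d'}) ((\<lambda>v. \<lambda>i\<in>{..<d'}. v $ i) \<circ> tr)"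
    unfolding continuous_map_componentwise
   proof (intro conjI ballI)
    fix k assume k: "k \<in> {..<d'}"
    have "continuous_map (vec_topology d) euclideanreal (\<lambda>v. v $ k)" by (rule continuous_map_vec_index) (use k d' in simp)
    then show "continuous_map (vec_topology d) euclideanreal (\<lambda>x. ((\<lambda>v. \<lambda>i\<in>{..<d'}. v $ i) \<circ> tr) x k)"
     using k by (simp add: tr_def)
   qed auto
  qed
  moreover have "continuous_map (top_of_set {0..}) (vec_topology d) (W (\<phi> w))"
   using W sp[OF w] unfolding std_brownian_motion_def by blast
  ultimately show "continuous_map (top_of_set {0..}) (vec_topology d') (\<lambda>t. tr (W (\<phi> w) t))"
   using continuous_map_compose[of _ _ "W (\<phi> w)" _ tr] by (simp add: comp_def)
 next
  fix s t :: real assume st: "0 \<le> s \<and> s < t"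
  then have st': "0 \<le> s" "0 \<le> t" by auto
  note i = inc[OF st]
  have f: "(\<lambda>x. \<lambda>u\<in>{0..s}. tr (x u)) \<in> (\<Pi>\<^sub>M u\<in>{0..s}. vec_borel d) \<rightarrow>\<^sub>M (\<Pi>\<^sub>M u\<in>{0..s}. vec_borel d')"
  proof (rule measurable_restrict)
   fix u assume "u \<in> {0..s}"
   from measurable_compose[OF measurable_component_singleton[OF this, of "\<lambda>_. vec_borel d"] tr]
   show "(\<lambda>x. tr (x u)) \<in> (\<Pi>\<^sub>M u\<in>{0..s}. vec_borel d) \<rightarrow>\<^sub>M vec_borel d'" .
  qed
  have "indep_elements N (\<Pi>\<^sub>M u\<in>{0..s}. vec_borel d') (\<lambda>w. (\<lambda>u\<in>{0..s}. tr ((\<lambda>u\<in>{0..s}. W (\<phi> w) u) u)))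
    (vec_borel d') (\<lambda>w. tr (W (\<phi> w) t - W (\<phi> w) s))"
   by (rule indep_elements_map[OF N indep_elements_compose[OF M N \<phi> conjunct1[OF i]] f tr])
  then show "indep_elements N (\<Pi>\<^sub>M u\<in>{0..s}. vec_borel d') (\<lambda>w. \<lambda>u\<in>{0..s}. tr (W (\<phi> w) u))
    (vec_borel d') (\<lambda>w. tr (W (\<phi> w) t) - tr (W (\<phi> w) s))"
   by (rule indep_elements_cong[OF N]) (simp add: restrict_def cong: if_cong, rule diff[OF _ st'])
  interpret M: prob_space M by fact
  have "M.indep_vars (\<lambda>_. borel) (\<lambda>i w. (W w t - W w s) $ i) {..<d'}"
   by (rule M.indep_vars_subset[OF conjunct1[OF conjunct2[OF i]]]) (use d' in auto)
  then show "prob_space.indep_vars N (\<lambda>_. borel) (\<lambda>i w. (tr (W (\<phi> w) t) - tr (W (\<phi> w) s)) $ i) {..<d'}"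
   by (rule indep_vars_measure_preserving[OF M N \<phi>]) (use d' diffi[OF _ st'] in auto)
  fix k assume k: "k < d'"
  then have "k < d" using d' by simp
  with i have dM: "distributed M lborel (\<lambda>w. (W w t - W w s) $ k) (normal_density 0 (sqrt (t - s)))" by blast
  note dM' = dM[unfolded distributed_def]
  have mM: "(\<lambda>w. (W w t - W w s) $ k) \<in> M \<rightarrow>\<^sub>M lborel" using dM' by blast
  have "distr N lborel (\<lambda>w. (tr (W (\<phi> w) t) - tr (W (\<phi> w) s)) $ k) = distr N lborel ((\<lambda>w. (W w t - W w s) $ k) \<circ> \<phi>)"
   by (rule distr_cong[OF refl refl]) (simp add: diffi[OF _ st' k])
  also have "\<dots> = distr (distr N M \<phi>) lborel (\<lambda>w. (W w t - W w s) $ k)" by (rule distr_distr[OF mM \<phi>(1), symmetric])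
  finally have dd: "distr N lborel (\<lambda>w. (tr (W (\<phi> w) t) - tr (W (\<phi> w) s)) $ k) = density lborel (normal_density 0 (sqrt (t - s)))"
   unfolding \<phi>(2) using dM' by simp
  have mN: "(\<lambda>w. (tr (W (\<phi> w) t) - tr (W (\<phi> w) s)) $ k) \<in> N \<rightarrow>\<^sub>M lborel"
   by (subst measurable_cong[OF diffi[OF _ st' k]], assumption, rule measurable_compose[OF \<phi>(1) mM])
  show "distributed N lborel (\<lambda>w. (tr (W (\<phi> w) t) - tr (W (\<phi> w) s)) $ k) (normal_density 0 (sqrt (t - s)))"
   unfolding distributed_def using dd mN dM' by blast
 qed
 then show ?thesis unfolding tr_def .
qed

text \<open>The second factor, which carries the initial state, influences component 0 only. For
  fixed \<open>p\<close> the events depend on different coordinates and their probabilities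
  multiply; those with \<open>j > 0\<close> do not depend on \<open>p\<close> and can be taken out
  of the integral over \<open>P\<close>.\<close>

lemma indep_vars_pair_product:
 fixes J :: nat and Y :: "nat \<Rightarrow> 'a \<times> 'c \<Rightarrow> 'd"
 assumes M: "prob_space M" and P: "prob_space P" and J: "0 < J"
  and Y: "\<And>j. j < J \<Longrightarrow> Y j \<in> M \<Otimes>\<^sub>M P \<rightarrow>\<^sub>M K j"
  and const: "\<And>j x p p'. 0 < j \<Longrightarrow> j < J \<Longrightarrow> x \<in> space M \<Longrightarrow> p \<in> space P \<Longrightarrow> p' \<in> space P \<Longrightarrow> Y j (x, p) = Y j (x, p')"
 shows "prob_space.indep_vars ((\<Pi>\<^sub>M j\<in>{..<J}. M) \<Otimes>\<^sub>M P) K (\<lambda>j w. Y j (fst w j, snd w)) {..<J}"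
proof -
 let ?N = "\<Pi>\<^sub>M j\<in>{..<J}. M"
 interpret M: prob_space M by fact
 interpret Pr: prob_space P by fact
 interpret N: prob_space ?N by (rule prob_space_PiM) (rule M)
 interpret pair: pair_prob_space ?N P ..
 interpret MP: pair_prob_space M P ..
 interpret PS: product_sigma_finite "\<lambda>_ :: nat. M" by unfold_locales
 obtain p0 where p0: "p0 \<in> space P" using Pr.not_empty by blast
 have cm: "(\<lambda>w. w j) \<in> ?N \<rightarrow>\<^sub>M M" if "j < J" for j by (rule measurable_component_singleton) (use that in simp)
 have ev: "(\<lambda>w. (fst w j, snd w)) \<in> ?N \<Otimes>\<^sub>M P \<rightarrow>\<^sub>M M \<Otimes>\<^sub>M P" if "j < J" for j
  by (rule measurable_Pair[OF measurable_compose[OF measurable_fst cm[OF that]] measurable_snd])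
 have rv: "(\<lambda>w. Y j (fst w j, snd w)) \<in> ?N \<Otimes>\<^sub>M P \<rightarrow>\<^sub>M K j" if "j < J" for j
  by (rule measurable_compose[OF ev[OF that] Y[OF that]])
 have "pair.prob (\<Inter>j\<in>{..<J}. (\<lambda>w. Y j (fst w j, snd w)) -` C j \<inter> space (?N \<Otimes>\<^sub>M P)) =
   (\<Prod>j\<in>{..<J}. pair.prob ((\<lambda>w. Y j (fst w j, snd w)) -` C j \<inter> space (?N \<Otimes>\<^sub>M P)))"
  if C: "\<And>j. j < J \<Longrightarrow> C j \<in> sets (K j)" for C
 proof -
  define D where "D j = Y j -` C j \<inter> space (M \<Otimes>\<^sub>M P)" for j
  have D: "D j \<in> sets (M \<Otimes>\<^sub>M P)" if "j < J" for j unfolding D_def by (rule measurable_sets[OF Y[OF that] C[OF that]])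
  define F :: "nat \<Rightarrow> 'a \<Rightarrow> 'c \<Rightarrow> real" where "F j x p = indicator (D j) (x, p)" for j x p
  define E where "E j = (\<lambda>w. Y j (fst w j, snd w)) -` C j \<inter> space (?N \<Otimes>\<^sub>M P)" for j
  have E: "E j \<in> sets (?N \<Otimes>\<^sub>M P)" if "j < J" for j unfolding E_def by (rule measurable_sets[OF rv[OF that] C[OF that]])
  have EF: "indicator (E j) w = F j (fst w j) (snd w)" if "w \<in> space (?N \<Otimes>\<^sub>M P)" "j < J" for w j
   using measurable_space[OF ev[OF that(2)] that(1)] that unfolding E_def F_def D_def by (simp add: indicator_def)
  have Fm: "(\<lambda>w. F j (fst w) (snd w)) \<in> borel_measurable (M \<Otimes>\<^sub>M P)" if "j < J" for j
   unfolding F_def using D[OF that] by simp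
  have Fm1: "(\<lambda>x. F j x p) \<in> borel_measurable M" if "j < J" "p \<in> space P" for j p
   using measurable_compose[OF measurable_Pair2'[OF that(2)] Fm[OF that(1)]] by simp
  have Fb: "\<bar>F j x p\<bar> \<le> 1" for j x p unfolding F_def by (simp add: indicator_def)
  have Fi: "integrable M (\<lambda>x. F j x p)" if "j < J" "p \<in> space P" for j p
   by (rule M.integrable_const_bound[of _ 1, OF _ Fm1[OF that]]) (use Fb in auto)
  define m where "m j p = (\<integral>x. F j x p \<partial>M)" for j p
  have mc: "m j p = m j p0" if j: "0 < j" "j < J" and p: "p \<in> space P" for j p unfolding m_def
  proof (rule Bochner_Integration.integral_cong[OF refl])
   fix x assume x: "x \<in> space M"
   show "F j x p = F j x p0"
    using const[OF j x p p0] x p p0 unfolding F_def D_def by (simp add: indicator_def space_pair_measure)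
  qed
  have intE: "(\<integral>w. (\<Prod>j\<in>A. F j (fst w j) (snd w)) \<partial>(?N \<Otimes>\<^sub>M P)) = (\<integral>p. (\<Prod>j\<in>A. m j p) \<partial>P)"
   if A: "A \<subseteq> {..<J}" for A
  proof -
   have fA: "finite A" using A by (rule finite_subset) simp
   have Fmj: "(\<lambda>w. F j (fst w j) (snd w)) \<in> borel_measurable (?N \<Otimes>\<^sub>M P)" if "j \<in> A" for j
    using measurable_compose[OF ev Fm, of j] that A by auto
   have b: "\<bar>\<Prod>j\<in>A. F j (y j) p\<bar> \<le> 1" for y p unfolding abs_prod by (rule prod_le_1) (use Fb in auto)
   have i: "integrable (?N \<Otimes>\<^sub>M P) (\<lambda>w. \<Prod>j\<in>A. F j (fst w j) (snd w))"
    by (rule pair.integrable_const_bound[of _ 1], rule AE_I2, unfold real_norm_def, rule b)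
      (rule borel_measurable_prod, rule Fmj)
   have i': "integrable (?N \<Otimes>\<^sub>M P) (\<lambda>(y, p). \<Prod>j\<in>A. F j (y j) p)" using i unfolding case_prod_beta .
   have "(\<integral>w. (\<Prod>j\<in>A. F j (fst w j) (snd w)) \<partial>(?N \<Otimes>\<^sub>M P)) = (\<integral>p. (\<integral>y. (\<Prod>j\<in>A. F j (y j) p) \<partial>?N) \<partial>P)"
    by (rule pair.integral_snd[OF i', unfolded case_prod_beta, symmetric])
   also have "\<dots> = (\<integral>p. (\<Prod>j\<in>A. m j p) \<partial>P)"
   proof (rule Bochner_Integration.integral_cong[OF refl])
    fix p assume p: "p \<in> space P"
    \<comment> \<open>Factors outside \<open>A\<close> are set to one, so that the product formula
      over all of \<open>{..<J}\<close> applies.\<close>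
    define F' where "F' j x = (if j \<in> A then F j x p else 1)" for j x
    have "(\<integral>y. (\<Prod>j\<in>A. F j (y j) p) \<partial>?N) = (\<integral>y. (\<Prod>j\<in>{..<J}. F' j (y j)) \<partial>?N)"
     using A unfolding F'_def by (simp add: prod.If_cases Int_absorb1)
    also have "\<dots> = (\<Prod>j\<in>{..<J}. \<integral>x. F' j x \<partial>M)"
    proof (rule PS.product_integral_prod)
     show "integrable M (F' j)" if "j \<in> {..<J}" for j
      using Fi[OF _ p, of j] that unfolding F'_def by (cases "j \<in> A") simp_all
    qed simp
    also have "\<dots> = (\<Prod>j\<in>{..<J}. if j \<in> A then m j p else 1)"
     by (rule prod.cong[OF refl]) (simp add: F'_def m_def M.prob_space)
    also have "\<dots> = (\<Prod>j\<in>A. m j p)" using A by (simp add: prod.If_cases Int_absorb1)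
    finally show "(\<integral>y. (\<Prod>j\<in>A. F j (y j) p) \<partial>?N) = (\<Prod>j\<in>A. m j p)" .
   qed
   finally show ?thesis .
  qed
  have prE: "pair.prob (\<Inter>j\<in>A. E j) = (\<integral>p. (\<Prod>j\<in>A. m j p) \<partial>P)" if A: "A \<subseteq> {..<J}" "A \<noteq> {}" for A
  proof -
   have fA: "finite A" using A(1) by (rule finite_subset) simp
   have s: "(\<Inter>j\<in>A. E j) \<in> sets (?N \<Otimes>\<^sub>M P)" by (rule sets.finite_INT[OF fA A(2)]) (use A E in auto)
   have "pair.prob (\<Inter>j\<in>A. E j) = (\<integral>w. indicator (\<Inter>j\<in>A. E j) w \<partial>(?N \<Otimes>\<^sub>M P))"
    using s sets.sets_into_space[OF s] by (simp add: Int_absorb2)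
   also have "\<dots> = (\<integral>w. (\<Prod>j\<in>A. F j (fst w j) (snd w)) \<partial>(?N \<Otimes>\<^sub>M P))"
   proof (rule Bochner_Integration.integral_cong[OF refl])
    fix w assume w: "w \<in> space (?N \<Otimes>\<^sub>M P)"
    have "indicator (\<Inter>j\<in>A. E j) w = (\<Prod>j\<in>A. indicator (E j) w :: real)"
     using fA by (induction rule: finite_induct) (simp_all add: indicator_inter_arith)
    also have "\<dots> = (\<Prod>j\<in>A. F j (fst w j) (snd w))"
     by (rule prod.cong[OF refl], rule EF[OF w]) (use A in auto)
    finally show "indicator (\<Inter>j\<in>A. E j) w = (\<Prod>j\<in>A. F j (fst w j) (snd w))" .
   qed
   finally show ?thesis unfolding intE[OF A(1)] .
  qed
  have single: "pair.prob (E j) = (\<integral>p. m j p \<partial>P)" if "j < J" for j using prE[of "{j}"] that by simp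
  have pc: "pair.prob (E j) = m j p0" if "0 < j" "j < J" for j
  proof -
   have "(\<integral>p. m j p \<partial>P) = (\<integral>p. m j p0 \<partial>P)" by (rule Bochner_Integration.integral_cong[OF refl], rule mc[OF that])
   then show ?thesis using single[OF that(2)] by (simp add: Pr.prob_space)
  qed
  have "pair.prob (\<Inter>j\<in>{..<J}. E j) = (\<integral>p. (\<Prod>j\<in>{..<J}. m j p) \<partial>P)" by (rule prE) (use J in auto)
  also have "\<dots> = (\<integral>p. m 0 p * (\<Prod>j\<in>{..<J} - {0}. m j p0) \<partial>P)"
  proof (rule Bochner_Integration.integral_cong[OF refl])
   fix p assume p: "p \<in> space P"
   have "(\<Prod>j\<in>{..<J}. m j p) = m 0 p * (\<Prod>j\<in>{..<J} - {0}. m j p)" by (rule prod.remove) (use J in auto)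
   also have "(\<Prod>j\<in>{..<J} - {0}. m j p) = (\<Prod>j\<in>{..<J} - {0}. m j p0)"
    by (rule prod.cong[OF refl]) (use mc[OF _ _ p] in auto)
   finally show "(\<Prod>j\<in>{..<J}. m j p) = m 0 p * (\<Prod>j\<in>{..<J} - {0}. m j p0)" .
  qed
  also have "\<dots> = pair.prob (E 0) * (\<Prod>j\<in>{..<J} - {0}. pair.prob (E j))"
  proof -
   have "(\<Prod>j\<in>{..<J} - {0}. m j p0) = (\<Prod>j\<in>{..<J} - {0}. pair.prob (E j))"
    by (rule prod.cong[OF refl]) (use pc in auto)
   then show ?thesis using single[OF J] by simp
  qed
  also have "\<dots> = (\<Prod>j\<in>{..<J}. pair.prob (E j))" by (rule prod.remove[symmetric]) (use J in auto)
  finally show ?thesis unfolding E_def .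
 qed
 note key = this
 show ?thesis
 proof (rule pair.indep_vars_finite[THEN iffD2])
  show "\<forall>A\<in>\<Pi> i\<in>{..<J}. sets (K i). pair.prob (\<Inter>j\<in>{..<J}. (\<lambda>w. Y j (fst w j, snd w)) -` A j \<inter> space (?N \<Otimes>\<^sub>M P)) =
   (\<Prod>j\<in>{..<J}. pair.prob ((\<lambda>w. Y j (fst w j, snd w)) -` A j \<inter> space (?N \<Otimes>\<^sub>M P)))"
   by (intro ballI key) auto
  show "Int_stable (sets (K i))" for i by (auto simp: Int_stable_def)
  show "sets (K i) = sigma_sets (space (K i)) (sets (K i))" for i by (rule sets.sigma_sets_eq[symmetric])
  show "sets (K i) \<subseteq> Pow (space (K i))" for i by (rule sets.space_closed)
 qed (use J rv in auto)
qed

text \<open>Cosine and sine of a path-continuous functional are bounded and path continuous, so the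
  equality of real expectations extends to unbounded \<open>S\<close> inside an exponential.\<close>

lemma pcont_char_eq:
 assumes M: "prob_space M" and M': "prob_space M'" and X: "cproc M d X" and X': "cproc M' d X'"
  and XX': "same_fdd d M X M' X'" and S: "pcont d S"
 shows "(\<integral>w. iexp (S (X w)) \<partial>M) = (\<integral>w. iexp (S (X' w)) \<partial>M')"
proof -
 have *: "(\<integral>w. iexp (S (Y w)) \<partial>N) = complex_of_real (\<integral>w. cos (S (Y w)) \<partial>N) + \<i> * complex_of_real (\<integral>w. sin (S (Y w)) \<partial>N)"
  if N: "prob_space N" and Y: "cproc N d Y" for N :: "'z measure" and Y
 proof -
  interpret N: prob_space N by fact
  have [measurable]: "(\<lambda>w. S (Y w)) \<in> borel_measurable N" by (rule pcont_measurable[OF Y S])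
  have i: "integrable N (\<lambda>w. cos (S (Y w)))" "integrable N (\<lambda>w. sin (S (Y w)))"
   by (rule N.integrable_const_bound[of _ 1]; simp)+
  have "(\<integral>w. iexp (S (Y w)) \<partial>N) = (\<integral>w. complex_of_real (cos (S (Y w))) + \<i> * complex_of_real (sin (S (Y w))) \<partial>N)"
   unfolding exp_Euler cos_of_real sin_of_real ..
  also have "\<dots> = (\<integral>w. complex_of_real (cos (S (Y w))) \<partial>N) + (\<integral>w. \<i> * complex_of_real (sin (S (Y w))) \<partial>N)"
   by (rule Bochner_Integration.integral_add) (use i in simp_all)
  finally show ?thesis by simp
 qed
 have c: "pcont d (\<lambda>x. cos (S x))" "pcont d (\<lambda>x. sin (S x))"
  unfolding pcont_def by (auto intro!: tendsto_cos tendsto_sin pcontD[OF S])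
 show ?thesis unfolding *[OF M X] *[OF M' X']
  using pcont_integral_eq[OF M M' X X' XX' c(1), of 1] pcont_integral_eq[OF M M' X X' XX' c(2), of 1] by simp
qed

lemma fdd_char_indep:
 fixes J :: nat and \<tau> :: "nat \<Rightarrow> real"
 assumes N: "prob_space N" and ind: "prob_space.indep_vars N (\<lambda>_. \<Pi>\<^sub>M t\<in>{0..}. borel) (\<lambda>j w. \<lambda>t\<in>{0..}. X w t j) {..<J}"
  and \<tau>: "\<And>k. 0 \<le> \<tau> k"
 shows "fdd_char N J X m \<tau> a = (\<Prod>j\<in>{..<J}. \<integral>w. iexp (\<Sum>k<m. a k j * X w (\<tau> k) j) \<partial>N)"
proof -
 interpret N: prob_space N by fact
 define g where "g j x = iexp (\<Sum>k<m. a k j * x (\<tau> k))" for j and x :: "real \<Rightarrow> real"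
 have gm: "g j \<in> borel_measurable (\<Pi>\<^sub>M t\<in>{0::real..}. borel)" for j
 proof -
  have [measurable]: "(\<lambda>x. x (\<tau> k)) \<in> borel_measurable (\<Pi>\<^sub>M t\<in>{0::real..}. (borel :: real measure))" for k
   by (rule measurable_component_singleton) (use \<tau> in simp)
  show ?thesis unfolding g_def by measurable
 qed
 have gX: "g j (\<lambda>t\<in>{0..}. X w t j) = iexp (\<Sum>k<m. a k j * X w (\<tau> k) j)" for j w
  unfolding g_def using \<tau> by simp
 have ind': "N.indep_vars (\<lambda>_. borel) (\<lambda>j w. g j (\<lambda>t\<in>{0..}. X w t j)) {..<J}"
  by (rule N.indep_vars_compose2[OF ind gm])
 have "iexp (\<Sum>k<m. \<Sum>j<J. a k j * X w (\<tau> k) j) = (\<Prod>j\<in>{..<J}. g j (\<lambda>t\<in>{0..}. X w t j))" for w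
 proof -
  have "(\<Sum>k<m. \<Sum>j<J. a k j * X w (\<tau> k) j) = (\<Sum>j<J. \<Sum>k<m. a k j * X w (\<tau> k) j)" by (rule sum.swap)
  then show ?thesis unfolding gX by (simp only: of_real_sum[of _ "{..<J}"] sum_distrib_left[of _ _ "{..<J}"] exp_sum finite_lessThan)
 qed
 then have "fdd_char N J X m \<tau> a = (\<integral>w. (\<Prod>j\<in>{..<J}. g j (\<lambda>t\<in>{0..}. X w t j)) \<partial>N)"
  unfolding fdd_char_def by (simp only:)
 also have "\<dots> = (\<Prod>j\<in>{..<J}. \<integral>w. g j (\<lambda>t\<in>{0..}. X w t j) \<partial>N)"
 proof (rule N.indep_vars_lebesgue_integral[OF _ ind'])
  fix j assume j: "j \<in> {..<J}"
  have "(\<lambda>w. g j (\<lambda>t\<in>{0..}. X w t j)) \<in> borel_measurable N"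
   using ind' j by (simp add: N.indep_vars_def)
  then show "integrable N (\<lambda>w. g j (\<lambda>t\<in>{0..}. X w t j))"
   by (rule N.integrable_const_bound[of _ 1, rotated]) (simp add: g_def)
 qed simp
 finally show ?thesis unfolding gX .
qed

lemma Mmat_cong: "Mmat d R w \<Longrightarrow> (\<And>i j. i < d \<Longrightarrow> j < d \<Longrightarrow> R' i j = R i j) \<Longrightarrow> Mmat d R' w"
 unfolding Mmat_def by simp

lemma rsol_cong:
 assumes "rsol d R x y" "\<And>i j. i < d \<Longrightarrow> j < d \<Longrightarrow> R' i j = R i j" "\<And>t i. 0 \<le> t \<Longrightarrow> i < d \<Longrightarrow> x' t i = x t i"
 shows "rsol d R' x' y" using assms(1) unfolding rsol_def by (simp add: assms(2,3))

section \<open>The limit process: uniqueness in law and existence\<close>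

text \<open>Uniqueness of the least regulator identifies a given SRBM with the reflection map
  applied to its input; this makes it a path-continuous functional of a driven process.\<close>

lemma srbm_driven_zmap:
 assumes Z: "srbm_driven_by N d A W x0 \<theta> RM Z" and R: "Mmat d R w"
  and RM: "\<And>i j. i < d \<Longrightarrow> j < d \<Longrightarrow> RM $$ (i, j) = R i j"
 shows "driven N d d (\<lambda>z i. x0 z $ i) (\<lambda>z t i. W z t $ i)"
  and "z \<in> space N \<Longrightarrow> 0 \<le> t \<Longrightarrow> i < d \<Longrightarrow> Z z t $ i =
   zmap d R (affine_path d (\<lambda>i. x0 z $ i) (\<lambda>i. \<theta> $ i) (\<lambda>i m. A $$ (i, m)) (\<lambda>t i. W z t $ i)) t i"
proof -
 have W: "std_brownian_motion N d W" and A: "A \<in> carrier_mat d d" and \<theta>: "\<theta> \<in> carrier_vec d"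
  and Mm: "M_matrix d RM" and x0: "x0 \<in> N \<rightarrow>\<^sub>M vec_borel d" and nn: "\<forall>z\<in>space N. nonneg_vec d (x0 z)"
  and ind: "indep_elements N (vec_borel d) x0 (\<Pi>\<^sub>M t\<in>{0..}. vec_borel d) (\<lambda>z. \<lambda>t\<in>{0..}. W z t)"
  and sk: "\<forall>z\<in>space N. \<exists>y. skorokhod d RM (\<lambda>t. x0 z + t \<cdot>\<^sub>v \<theta> + A *\<^sub>v W z t) (Z z) y"
  using Z unfolding srbm_driven_by_def by blast+
 show "driven N d d (\<lambda>z i. x0 z $ i) (\<lambda>z t i. W z t $ i)" by (rule driven_indep_elements[OF W x0 ind])
 assume z: "z \<in> space N" and t: "0 \<le> t" and i: "i < d"
 let ?x = "\<lambda>t. x0 z + t \<cdot>\<^sub>v \<theta> + A *\<^sub>v W z t"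
 let ?X = "affine_path d (\<lambda>i. x0 z $ i) (\<lambda>i. \<theta> $ i) (\<lambda>i m. A $$ (i, m)) (\<lambda>t i. W z t $ i)"
 obtain y where y: "skorokhod d RM ?x (Z z) y" using sk z by blast
 have RM': "Mmat d (\<lambda>i j. RM $$ (i, j)) w" by (rule Mmat_cong[OF R RM])
 note s = skorokhod_imp_rsol[OF y M_matrix_imp_Mmat(1)[OF Mm] RM']
 have X: "?X t i = ?x t $ i" if "0 \<le> t" "i < d" for t i
 proof -
  have "W z t \<in> carrier_vec d" by (rule bm_path(3)[OF W z that(1)])
  moreover have "x0 z \<in> carrier_vec d" using nn z by (simp add: nonneg_vec_def)
  ultimately show ?thesis using that A \<theta> unfolding affine_path_def by (simp add: scalar_prod_def atLeast0LessThan)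
 qed
 have r: "rsol d R (\<lambda>t i. ?x t $ i) (\<lambda>t i. y t $ i)" by (rule rsol_cong[OF s(1)]) (simp_all add: RM)
 have "zmap d R ?X t i = ?x t $ i + (\<Sum>j<d. R i j * y t $ j)"
  by (rule zmap_eqI[OF R r cpath_affine[OF bm_path(2)[OF W z]] X t i])
 also have "\<dots> = Z z t $ i" unfolding s(2)[OF t i] using RM i by simp
 finally show "Z z t $ i = zmap d R ?X t i" ..
qed

lemma skorokhod_zmap:
 assumes R: "Mmat d R w" and RM: "RM \<in> carrier_mat d d" "\<And>i j. i < d \<Longrightarrow> j < d \<Longrightarrow> RM $$ (i, j) = R i j"
  and X: "cpath d X" "\<And>i. i < d \<Longrightarrow> 0 \<le> X 0 i" and x: "\<And>t. x t = vec d (X t)"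
 shows "\<exists>y. skorokhod d RM x (\<lambda>t. vec d (zmap d R X t)) y"
proof -
 have RM': "Mmat d (\<lambda>i j. RM $$ (i, j)) w" by (rule Mmat_cong[OF R RM(2)])
 have xi: "x t $ i = X t i" if "i < d" for t i using that by (simp add: x)
 have cx: "cpath d (\<lambda>t i. x t $ i)" using X(1) unfolding cpath_def by (simp add: xi)
 have r: "rsol d (\<lambda>i j. RM $$ (i, j)) (\<lambda>t i. x t $ i) (rmap d R X)"
  by (rule rsol_cong[OF rsol_rmap[OF R X(1)]]) (simp_all add: RM xi)
 have "skorokhod d RM x (\<lambda>t. vec d (\<lambda>i. x t $ i + (\<Sum>j<d. RM $$ (i, j) * rmap d R X t j))) (\<lambda>t. vec d (rmap d R X t))"
 proof (rule refl_sol_imp_skorokhod[OF rsol_imp_refl_sol[OF RM' r cx] RM(1) _ cx])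
  show "x t \<in> carrier_vec d" for t by (simp add: x)
  show "0 \<le> x 0 $ i" if "i < d" for i using X(2) that by (simp add: xi)
  show "rmap d R X 0 i = 0" if "i < d" for i by (rule rsol_init[OF R rsol_rmap[OF R X(1)] X(2) that])
 qed
 moreover have "(\<lambda>t. vec d (\<lambda>i. x t $ i + (\<Sum>j<d. RM $$ (i, j) * rmap d R X t j))) = (\<lambda>t. vec d (zmap d R X t))"
  by (intro ext eq_vecI) (simp_all add: zmap_def xi RM)
 ultimately show ?thesis by auto
qed

lemma cproc_mono: "cproc N d X \<Longrightarrow> d' \<le> d \<Longrightarrow> cproc N d' X"
 unfolding cproc_def cpath_def by simp

text \<open>The initial vector enters component 0 only, which is the source of the independence of
  the components.\<close>

lemma limit_component_cong:
 "0 < j \<Longrightarrow> limit_component J R H q A v b j = limit_component J R H q A v' b j"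
 unfolding limit_component_def limit_input_def by simp

context eliminated_system
begin

lemma limit_components:
 assumes M: "prob_space M" and P: "prob_space P" and B: "cproc M J B" and q: "\<And>j. q j \<le> J"
  and \<xi>: "\<And>i. i < J \<Longrightarrow> (\<lambda>p. \<xi> p i) \<in> borel_measurable P"
 shows "cproc ((\<Pi>\<^sub>M j\<in>{..<J}. M) \<Otimes>\<^sub>M P) J (\<lambda>u t j. limit_component J R H q A (\<xi> (snd u)) (B (fst u j)) j t)"
  and "prob_space.indep_vars ((\<Pi>\<^sub>M j\<in>{..<J}. M) \<Otimes>\<^sub>M P) (\<lambda>_. \<Pi>\<^sub>M t\<in>{0..}. borel)
   (\<lambda>j u. \<lambda>t\<in>{0..}. limit_component J R H q A (\<xi> (snd u)) (B (fst u j)) j t) {..<J}"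
proof -
 show "cproc ((\<Pi>\<^sub>M j\<in>{..<J}. M) \<Otimes>\<^sub>M P) J (\<lambda>u t j. limit_component J R H q A (\<xi> (snd u)) (B (fst u j)) j t)"
 proof (rule cproc_limit)
  fix j assume j: "j < J"
  have "(\<lambda>u. fst u j) \<in> (\<Pi>\<^sub>M j\<in>{..<J}. M) \<Otimes>\<^sub>M P \<rightarrow>\<^sub>M M"
   by (rule measurable_compose[OF measurable_fst measurable_component_singleton]) (use j in simp)
  from cproc_compose[OF B this]
  show "cproc ((\<Pi>\<^sub>M j\<in>{..<J}. M) \<Otimes>\<^sub>M P) (q j) (\<lambda>u. B (fst u j))" by (rule cproc_mono) (rule q)
  show "(\<lambda>u. \<xi> (snd u) j) \<in> borel_measurable ((\<Pi>\<^sub>M j\<in>{..<J}. M) \<Otimes>\<^sub>M P)"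
   by (rule measurable_compose[OF measurable_snd \<xi>[OF j]])
 qed
 define Y where "Y j z = (\<lambda>t\<in>{0..}. limit_component J R H q A (\<xi> (snd z)) (B (fst z)) j t)" for j z
 have "cproc (M \<Otimes>\<^sub>M P) J (\<lambda>z t j. limit_component J R H q A (\<xi> (snd z)) (B (fst z)) j t)"
  by (rule cproc_limit[where \<beta> = "\<lambda>z j. B (fst z)"])
    (rule cproc_mono[OF cproc_compose[OF B measurable_fst] q], rule measurable_compose[OF measurable_snd \<xi>])
 then have Y: "Y j \<in> M \<Otimes>\<^sub>M P \<rightarrow>\<^sub>M (\<Pi>\<^sub>M t\<in>{0..}. borel)" if "j < J" for j
  unfolding Y_def cproc_def using that by (intro measurable_restrict) simp
 have "prob_space.indep_vars ((\<Pi>\<^sub>M j\<in>{..<J}. M) \<Otimes>\<^sub>M P) (\<lambda>_. \<Pi>\<^sub>M t\<in>{0..}. borel) (\<lambda>j u. Y j (fst u j, snd u)) {..<J}"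
 proof (rule indep_vars_pair_product[OF M P J Y])
  fix j :: nat and x p p' assume "0 < j"
  from limit_component_cong[OF this] show "Y j (x, p) = Y j (x, p')" unfolding Y_def fst_conv snd_conv by metis
 qed
 then show "prob_space.indep_vars ((\<Pi>\<^sub>M j\<in>{..<J}. M) \<Otimes>\<^sub>M P) (\<lambda>_. \<Pi>\<^sub>M t\<in>{0..}. borel)
   (\<lambda>j u. \<lambda>t\<in>{0..}. limit_component J R H q A (\<xi> (snd u)) (B (fst u j)) j t) {..<J}"
  unfolding Y_def fst_conv snd_conv .
qed

end

text \<open>Ties the functions \<open>R\<close>, \<open>S\<close> and \<open>H\<close> to the block
  matrices in which \<open>limit_process\<close> is stated; \<open>S\<close> is going to be the
  Cholesky factor of \<open>\<Gamma>\<close>.\<close>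

locale eliminated_matrices = eliminated_system J R w AI H for J R w AI H +
 fixes RM \<Gamma> :: "real mat" and S :: fmat
 assumes G_block: "\<And>k. k < J \<Longrightarrow> submatrix (G_mat J RM k) {k..<J} {k..<J} = mat (J - k) (J - k) (\<lambda>(l, m). Gfun R (H k) k l (k + m))"
  and G_col: "\<And>k. k < J \<Longrightarrow> col (submatrix (G_mat J RM k) {k..<J} {k}) 0 = vec (J - k) (\<lambda>l. Gfun R (H k) k l k)"
  and cov_block: "\<And>k. k < J \<Longrightarrow> submatrix (E_mat J RM k * \<Gamma> * transpose_mat (E_mat J RM k)) {k..<J} {k..<J} =
    mat (J - k) (J - k) (\<lambda>(l, l'). \<Sum>m<J. Gfun S (H k) k l m * Gfun S (H k) k l' m)"
begin

abbreviation lim_comp :: "fvec \<Rightarrow> rpath \<Rightarrow> nat \<Rightarrow> real \<Rightarrow> real" where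
 "lim_comp \<equiv> limit_component J R H (\<lambda>_. J) (\<lambda>j. Gfun S (H j) j)"

text \<open>The factor and the motion behind an SRBM on \<open>N\<close> are unknown, but its law
  depends only on the initial law, the drift and the covariance, all of which are prescribed. Each
  component therefore has the law of the corresponding component in the coupling; for
  \<open>j = 0\<close> the initial states are matched through their distributions.\<close>

lemma limit_process_marginal:
 assumes lp: "limit_process J \<Gamma> RM P \<xi> N Zstar" and j: "j < J" and B: "bm_law M J B"
  and P: "prob_space P" and \<xi>: "\<xi> \<in> P \<rightarrow>\<^sub>M vec_borel J" "\<And>p. p \<in> space P \<Longrightarrow> nonneg_vec J (\<xi> p)"
 shows "(\<And>k. 0 \<le> \<tau> k) \<Longrightarrow> (\<integral>u. iexp (\<Sum>k<m. c k * Zstar u (\<tau> k) $ j) \<partial>N) =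
   (\<integral>u. iexp (\<Sum>k<m. c k * lim_comp (\<lambda>i. \<xi> (snd u) $ i) (B (fst u j)) j (\<tau> k)) \<partial>((\<Pi>\<^sub>M j\<in>{..<J}. M) \<Otimes>\<^sub>M P))"
  and "u \<in> space N \<Longrightarrow> continuous_on {0..} (\<lambda>t. Zstar u t $ j)"
  and "0 \<le> t \<Longrightarrow> (\<lambda>u. Zstar u t $ j) \<in> borel_measurable N"
proof -
 let ?PM = "\<Pi>\<^sub>M j\<in>{..<J}. M"
 let ?G = "\<lambda>l m. Gfun R (H j) j l (j + m)"
 have M: "prob_space M" by (rule bm_lawD(1)[OF B])
 have N0: "prob_space ?PM" by (rule prob_space_PiM) (rule M)
 interpret N0: prob_space ?PM by fact
 interpret Pr: prob_space P by fact
 interpret pair: pair_prob_space ?PM P ..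
 have N: "prob_space N" using lp by (simp add: limit_process_def)
 obtain \<xi>j Zj where sr: "srbm N (J - j) \<xi>j (- col (submatrix (G_mat J RM j) {j..<J} {j}) 0)
     (submatrix (E_mat J RM j * \<Gamma> * transpose_mat (E_mat J RM j)) {j..<J} {j..<J})
     (submatrix (G_mat J RM j) {j..<J} {j..<J}) Zj"
  and init: "if j = 0 then distr N (vec_borel J) \<xi>j = distr P (vec_borel J) \<xi> else \<forall>u\<in>space N. \<xi>j u = 0\<^sub>v (J - j)"
  and Zj: "\<forall>u\<in>space N. \<forall>t\<ge>0. Zstar u t $ j = Zj u t $ 0"
  using lp j unfolding limit_process_def by blast
 obtain A W where A: "A * transpose_mat A = mat (J - j) (J - j) (\<lambda>(l, l'). \<Sum>m<J. Gfun S (H j) j l m * Gfun S (H j) j l' m)"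
  and D: "srbm_driven_by N (J - j) A W \<xi>j (- vec (J - j) (\<lambda>l. Gfun R (H j) j l j)) (mat (J - j) (J - j) (\<lambda>(l, m). ?G l m)) Zj"
  using sr unfolding srbm_def G_block[OF j] G_col[OF j] cov_block[OF j] by blast
 have Ac: "A \<in> carrier_mat (J - j) (J - j)" and \<xi>jm: "\<xi>j \<in> N \<rightarrow>\<^sub>M vec_borel (J - j)"
  using D unfolding srbm_driven_by_def by blast+
 have en: "(mat (J - j) (J - j) (\<lambda>(l, m). ?G l m)) $$ (i, i') = ?G i i'" if "i < J - j" "i' < J - j" for i i' using that by simp
 have dr: "driven N (J - j) (J - j) (\<lambda>u i. \<xi>j u $ i) (\<lambda>u t i. W u t $ i)"
  by (rule srbm_driven_zmap(1)[OF D G[OF j] en])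
 define X where "X u = affine_path (J - j) (\<lambda>i. \<xi>j u $ i) (\<lambda>i. (- vec (J - j) (\<lambda>l. Gfun R (H j) j l j)) $ i) (\<lambda>i m. A $$ (i, m)) (\<lambda>t i. W u t $ i)" for u
 have Z: "Zstar u t $ j = zmap (J - j) ?G (X u) t 0" if "u \<in> space N" "0 \<le> t" for u t
 proof -
  have "Zj u t $ 0 = zmap (J - j) ?G (X u) t 0"
   unfolding X_def by (rule srbm_driven_zmap(2)[OF D G[OF j] en that]) (use j in simp_all)
  then show ?thesis using Zj that by simp
 qed
 have cX: "cproc N (J - j) X" unfolding X_def by (rule driven_cproc[OF dr])
 note cz = cproc_zmap[OF G[OF j] cX]
 show "continuous_on {0..} (\<lambda>t. Zstar u t $ j)" if u: "u \<in> space N"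
 proof -
  have "continuous_on {0..} (\<lambda>t. zmap (J - j) ?G (X u) t 0)" using cz u j unfolding cproc_def cpath_def by simp
  then show ?thesis by (rule continuous_on_eq) (simp add: Z[OF u])
 qed
 show "(\<lambda>u. Zstar u t $ j) \<in> borel_measurable N" if t: "0 \<le> t"
 proof -
  have "(\<lambda>u. zmap (J - j) ?G (X u) t 0) \<in> borel_measurable N" using cz t j unfolding cproc_def by simp
  moreover have "(\<lambda>u. Zstar u t $ j) \<in> borel_measurable N \<longleftrightarrow> (\<lambda>u. zmap (J - j) ?G (X u) t 0) \<in> borel_measurable N"
   by (rule measurable_cong) (rule Z[OF _ t])
  ultimately show ?thesis by simp
 qed
 assume \<tau>: "\<And>k. 0 \<le> \<tau> k"
 define \<xi>' where "\<xi>' p l = (if j = 0 then max 0 (\<xi> p $ l) else 0)" for p l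
 have \<xi>i[measurable]: "(\<lambda>p. \<xi> p $ i) \<in> borel_measurable P" if "i < J" for i
  by (rule measurable_compose[OF \<xi>(1) vec_index_measurable[OF that]])
 have \<xi>'m: "(\<lambda>p. \<xi>' p i) \<in> borel_measurable P" if "i < J - j" for i
 proof -
  have [measurable]: "(\<lambda>p. \<xi> p $ i) \<in> borel_measurable P" by (rule \<xi>i) (use that in simp)
  show ?thesis unfolding \<xi>'_def by measurable
 qed
 have cm: "(\<lambda>y. y j) \<in> ?PM \<rightarrow>\<^sub>M M" by (rule measurable_component_singleton) (use j in simp)
 have bl: "bm_law ?PM J (\<lambda>y. B (y j))"
  by (rule bm_law_compose[OF B cm _ N0]) (rule distr_PiM_component, use M j in auto)
 have dp: "driven (?PM \<Otimes>\<^sub>M P) (J - j) J (\<lambda>u. \<xi>' (snd u)) (\<lambda>u. B (fst u j))"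
  by (rule driven_pair(1)[OF bl P \<xi>'m])
 have dp2: "(\<integral>u. iexp (\<Sum>l<J - j. c l * \<xi>' (snd u) l) \<partial>(?PM \<Otimes>\<^sub>M P)) = (\<integral>p. iexp (\<Sum>l<J - j. c l * \<xi>' p l) \<partial>P)" for c
  by (rule driven_pair(2)[OF bl P \<xi>'m])
 define X' where "X' u = affine_path J (\<xi>' (snd u)) (\<lambda>l. - Gfun R (H j) j l j) (Gfun S (H j) j) (B (fst u j))" for u
 have lc: "lim_comp (\<lambda>i. \<xi> (snd u) $ i) (B (fst u j)) j t = zmap (J - j) ?G (X' u) t 0" for u t
  unfolding limit_component_def limit_input_def X'_def \<xi>'_def ..
 have cX': "cproc (?PM \<Otimes>\<^sub>M P) (J - j) X'" unfolding X'_def by (rule driven_cproc[OF dp])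
 have sf: "same_fdd (J - j) N X (?PM \<Otimes>\<^sub>M P) X'" unfolding X_def X'_def
 proof (rule driven_same_fdd[OF dr dp])
  fix c :: "nat \<Rightarrow> real"
  show "(\<integral>u. iexp (\<Sum>l<J - j. c l * \<xi>j u $ l) \<partial>N) = (\<integral>u. iexp (\<Sum>l<J - j. c l * \<xi>' (snd u) l) \<partial>(?PM \<Otimes>\<^sub>M P))"
   unfolding dp2
  proof (cases "j = 0")
   case True
   define g where "g v = iexp (\<Sum>l<J. c l * v $ l)" for v :: "real vec"
   have gm: "g \<in> borel_measurable (vec_borel J)" unfolding g_def using vec_index_measurable[of _ J] by measurable
   have "(\<integral>u. g (\<xi>j u) \<partial>N) = (\<integral>v. g v \<partial>distr N (vec_borel J) \<xi>j)"
    by (rule integral_distr[OF _ gm, symmetric]) (use \<xi>jm True in simp)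
   also have "\<dots> = (\<integral>v. g v \<partial>distr P (vec_borel J) \<xi>)" using init True by simp
   also have "\<dots> = (\<integral>p. g (\<xi> p) \<partial>P)" by (rule integral_distr[OF \<xi>(1) gm])
   also have "\<dots> = (\<integral>p. iexp (\<Sum>l<J. c l * \<xi>' p l) \<partial>P)"
   proof (rule Bochner_Integration.integral_cong[OF refl])
    fix p assume "p \<in> space P"
    then have "max 0 (\<xi> p $ l) = \<xi> p $ l" if "l < J" for l using \<xi>(2)[of p] that by (simp add: nonneg_vec_def)
    then have "(\<Sum>l<J. c l * \<xi> p $ l) = (\<Sum>l<J. c l * \<xi>' p l)"
     unfolding \<xi>'_def using True by (intro sum.cong refl) simp
    then show "g (\<xi> p) = iexp (\<Sum>l<J. c l * \<xi>' p l)" unfolding g_def by (simp only:)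
   qed
   finally show "(\<integral>u. iexp (\<Sum>l<J - j. c l * \<xi>j u $ l) \<partial>N) = (\<integral>p. iexp (\<Sum>l<J - j. c l * \<xi>' p l) \<partial>P)"
    using True by (simp add: g_def)
  next
   case False
   interpret N: prob_space N by fact
   have "(\<integral>u. iexp (\<Sum>l<J - j. c l * \<xi>j u $ l) \<partial>N) = (\<integral>u. 1 \<partial>N)"
    by (rule Bochner_Integration.integral_cong[OF refl]) (use init False in simp)
   then show "(\<integral>u. iexp (\<Sum>l<J - j. c l * \<xi>j u $ l) \<partial>N) = (\<integral>p. iexp (\<Sum>l<J - j. c l * \<xi>' p l) \<partial>P)"
    using False by (simp add: \<xi>'_def N.prob_space Pr.prob_space)
  qed
 next
  show "(- vec (J - j) (\<lambda>l. Gfun R (H j) j l j)) $ l = - Gfun R (H j) j l j" if "l < J - j" for l using that by simp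
  show "(\<Sum>i<J - j. A $$ (l, i) * A $$ (l', i)) = (\<Sum>i<J. Gfun S (H j) j l i * Gfun S (H j) j l' i)" if "l < J - j" "l' < J - j" for l l'
   using mult_transpose_index[OF Ac that] that unfolding A by simp
 qed
 define F where "F x = (\<Sum>k<m. c k * zmap (J - j) ?G x (\<tau> k) 0)" for x
 have F: "pcont (J - j) F" unfolding F_def
 proof (rule pcont_zmap[OF G[OF j], where F = "\<lambda>x. \<Sum>k<m. c k * x (\<tau> k) 0"])
  show "pcont (J - j) (\<lambda>x. \<Sum>k<m. c k * x (\<tau> k) 0)" unfolding pcont_def
  proof (intro allI impI tendsto_sum tendsto_mult tendsto_const)
   fix xs x k assume "lunif (J - j) xs x"
   then show "(\<lambda>n. xs n (\<tau> k) 0) \<longlonglongrightarrow> x (\<tau> k) 0" by (rule lunif_tendsto[OF _ \<tau>]) (use j in simp)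
  qed
 qed
 have "(\<integral>u. iexp (F (X u)) \<partial>N) = (\<integral>u. iexp (F (X' u)) \<partial>(?PM \<Otimes>\<^sub>M P))"
  by (rule pcont_char_eq[OF N pair.prob_space_axioms cX cX' sf F])
 moreover have "(\<integral>u. iexp (\<Sum>k<m. c k * Zstar u (\<tau> k) $ j) \<partial>N) = (\<integral>u. iexp (F (X u)) \<partial>N)"
  by (rule Bochner_Integration.integral_cong[OF refl]) (simp add: F_def Z \<tau>)
 ultimately show "(\<integral>u. iexp (\<Sum>k<m. c k * Zstar u (\<tau> k) $ j) \<partial>N) =
   (\<integral>u. iexp (\<Sum>k<m. c k * lim_comp (\<lambda>i. \<xi> (snd u) $ i) (B (fst u j)) j (\<tau> k)) \<partial>(?PM \<Otimes>\<^sub>M P))"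
  unfolding lc F_def by simp
qed

text \<open>Marginal laws and independence determine the joint law, so expectations may be computed
  on the product space of the coupling and iterated by Fubini's theorem with the initial state
  outermost, the form in which the prelimit appears as well.\<close>

lemma limit_process_integral:
 assumes lp: "limit_process J \<Gamma> RM P \<xi> N Zstar" and B: "bm_law M J B"
  and P: "prob_space P" and \<xi>: "\<xi> \<in> P \<rightarrow>\<^sub>M vec_borel J" "\<And>p. p \<in> space P \<Longrightarrow> nonneg_vec J (\<xi> p)"
  and f: "pcont J f" "\<And>x. \<bar>f x\<bar> \<le> b"
 shows "cproc N J (\<lambda>u t j. Zstar u t $ j)"
  and "(\<integral>u. f (\<lambda>t j. Zstar u t $ j) \<partial>N) =
   (\<integral>p. (\<integral>y. f (\<lambda>t j. lim_comp (\<lambda>i. \<xi> p $ i) (B (y j)) j t) \<partial>(\<Pi>\<^sub>M j\<in>{..<J}. M)) \<partial>P)"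
proof -
 let ?PM = "\<Pi>\<^sub>M j\<in>{..<J}. M"
 have M: "prob_space M" by (rule bm_lawD(1)[OF B])
 have N0: "prob_space ?PM" by (rule prob_space_PiM) (rule M)
 interpret N0: prob_space ?PM by fact
 interpret Pr: prob_space P by fact
 interpret pair: pair_prob_space ?PM P ..
 have N: "prob_space N" and ind: "prob_space.indep_vars N (\<lambda>_. \<Pi>\<^sub>M t\<in>{0..}. borel) (\<lambda>j u. \<lambda>t\<in>{0..}. Zstar u t $ j) {..<J}"
  using lp unfolding limit_process_def by blast+
 note mg = limit_process_marginal[OF lp _ B P \<xi>]
 show cN: "cproc N J (\<lambda>u t j. Zstar u t $ j)" unfolding cproc_def cpath_def using mg(2,3) by blast
 have \<xi>i: "(\<lambda>p. \<xi> p $ i) \<in> borel_measurable P" if "i < J" for i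
  by (rule measurable_compose[OF \<xi>(1) vec_index_measurable[OF that]])
 let ?L = "\<lambda>u t j. lim_comp (\<lambda>i. \<xi> (snd u) $ i) (B (fst u j)) j t"
 have lcs1: "cproc (?PM \<Otimes>\<^sub>M P) J ?L"
  by (rule limit_components(1)[OF M P bm_lawD(2)[OF B], where \<xi> = "\<lambda>p i. \<xi> p $ i", OF le_refl \<xi>i])
 have lcs2: "pair.indep_vars (\<lambda>_. \<Pi>\<^sub>M t\<in>{0..}. borel) (\<lambda>j u. \<lambda>t\<in>{0..}. ?L u t j) {..<J}"
  by (rule limit_components(2)[OF M P bm_lawD(2)[OF B], where \<xi> = "\<lambda>p i. \<xi> p $ i", OF le_refl \<xi>i])
 have sf: "same_fdd J N (\<lambda>u t j. Zstar u t $ j) (?PM \<Otimes>\<^sub>M P) ?L" unfolding same_fdd_def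
 proof (intro allI impI)
  fix m a and \<tau> :: "nat \<Rightarrow> real" assume "\<forall>k. 0 \<le> \<tau> k"
  then have \<tau>: "\<And>k. 0 \<le> \<tau> k" by (rule spec)
  show "fdd_char N J (\<lambda>u t j. Zstar u t $ j) m \<tau> a = fdd_char (?PM \<Otimes>\<^sub>M P) J ?L m \<tau> a"
   unfolding fdd_char_indep[OF N ind \<tau>] fdd_char_indep[OF pair.prob_space_axioms lcs2 \<tau>]
   by (rule prod.cong[OF refl], rule mg(1)[OF _ _ \<tau>]) simp_all
 qed
 have "(\<integral>u. f (\<lambda>t j. Zstar u t $ j) \<partial>N) = (\<integral>u. f (?L u) \<partial>(?PM \<Otimes>\<^sub>M P))"
  by (rule pcont_integral_eq[OF N pair.prob_space_axioms cN lcs1 sf f])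
 also have "\<dots> = (\<integral>p. (\<integral>y. f (\<lambda>t j. lim_comp (\<lambda>i. \<xi> p $ i) (B (y j)) j t) \<partial>?PM) \<partial>P)"
 proof -
  have "(\<lambda>u. f (?L u)) \<in> borel_measurable (?PM \<Otimes>\<^sub>M P)" by (rule pcont_measurable[OF lcs1 f(1)])
  then have "integrable (?PM \<Otimes>\<^sub>M P) (\<lambda>u. f (?L u))"
   by (rule pair.integrable_const_bound[of _ b, rotated]) (use f(2) in simp)
  then have "integrable (?PM \<Otimes>\<^sub>M P) (\<lambda>(y, p). f (?L (y, p)))" unfolding case_prod_beta by simp
  from pair.integral_snd[OF this] show ?thesis unfolding case_prod_beta by simp
 qed
 finally show "(\<integral>u. f (\<lambda>t j. Zstar u t $ j) \<partial>N) =
   (\<integral>p. (\<integral>y. f (\<lambda>t j. lim_comp (\<lambda>i. \<xi> p $ i) (B (y j)) j t) \<partial>?PM) \<partial>P)" .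
qed

text \<open>The space carries \<open>J\<close> independent copies of the given motion and a copy of
  \<open>\<xi>\<close>. Component \<open>j\<close> is driven by the first \<open>J - j\<close>
  coordinates of copy \<open>j\<close>.\<close>

lemma limit_process_exists:
 assumes W: "std_brownian_motion M J W"
  and P: "prob_space P" and \<xi>: "\<xi> \<in> P \<rightarrow>\<^sub>M vec_borel J" "\<And>p. p \<in> space P \<Longrightarrow> nonneg_vec J (\<xi> p)"
 shows "\<exists>Zstar. limit_process J \<Gamma> RM P \<xi> ((\<Pi>\<^sub>M j\<in>{..<J}. M) \<Otimes>\<^sub>M P) Zstar"
proof -
 let ?PM = "\<Pi>\<^sub>M j\<in>{..<J}. M"
 let ?N = "?PM \<Otimes>\<^sub>M P"
 have M: "prob_space M" by (rule std_brownian_motion_prob_space[OF W])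
 have N0: "prob_space ?PM" by (rule prob_space_PiM) (rule M)
 interpret N0: prob_space ?PM by fact
 interpret Pr: prob_space P by fact
 interpret pair: pair_prob_space ?PM P ..
 note N = pair.prob_space_axioms
 \<comment> \<open>Square factors of all covariance blocks, chosen simultaneously.\<close>
 have "\<exists>A. \<forall>j. \<forall>l<J - j. \<forall>l'<J - j. (\<Sum>m<J - j. A j l m * A j l' m) = (\<Sum>m<J. Gfun S (H j) j l m * Gfun S (H j) j l' m)"
  by (rule choice, rule allI, rule gram_square_root)
 then obtain A where A: "\<And>j l l'. l < J - j \<Longrightarrow> l' < J - j \<Longrightarrow> (\<Sum>m<J - j. A j l m * A j l' m) = (\<Sum>m<J. Gfun S (H j) j l m * Gfun S (H j) j l' m)"
  by blast
 let ?lc = "limit_component J R H (\<lambda>j. J - j) A"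
 define Zstar where "Zstar u t = vec J (\<lambda>j. ?lc (\<lambda>i. \<xi> (snd u) $ i) (\<lambda>t i. W (fst u j) t $ i) j t)" for u t
 have \<xi>i: "(\<lambda>p. \<xi> p $ i) \<in> borel_measurable P" if "i < J" for i
  by (rule measurable_compose[OF \<xi>(1) vec_index_measurable[OF that]])
 have ind: "prob_space.indep_vars ?N (\<lambda>_. \<Pi>\<^sub>M t\<in>{0..}. borel)
   (\<lambda>j u. \<lambda>t\<in>{0..}. ?lc (\<lambda>i. \<xi> (snd u) $ i) (\<lambda>t i. W (fst u j) t $ i) j t) {..<J}"
  by (rule limit_components(2)[OF M P bm_cproc[OF W], where \<xi> = "\<lambda>p i. \<xi> p $ i", OF _ \<xi>i]) auto
 have "limit_process J \<Gamma> RM P \<xi> ?N Zstar" unfolding limit_process_def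
 proof (intro conjI N ballI allI impI)
  show "Zstar u t \<in> carrier_vec J" for u t by (simp add: Zstar_def)
  show "prob_space.indep_vars ?N (\<lambda>_. \<Pi>\<^sub>M t\<in>{0..}. borel) (\<lambda>j u. \<lambda>t\<in>{0..}. Zstar u t $ j) {..<J}"
   by (rule pair.indep_vars_cong[OF refl _ refl, THEN iffD1, OF _ ind]) (simp add: Zstar_def)
  fix j assume j: "j < J"
  define d where "d = J - j"
  have d: "0 < d" "d \<le> J" using j by (simp_all add: d_def)
  let ?G = "\<lambda>l m. Gfun R (H j) j l (j + m)"
  define \<phi> where "\<phi> u = fst u j" for u :: "(nat \<Rightarrow> 'a) \<times> 'b"
  have cm: "(\<lambda>y. y j) \<in> ?PM \<rightarrow>\<^sub>M M" by (rule measurable_component_singleton) (use j in simp)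
  have \<phi>: "\<phi> \<in> ?N \<rightarrow>\<^sub>M M" unfolding \<phi>_def by (rule measurable_compose[OF measurable_fst cm])
  have "distr ?N M \<phi> = distr (distr ?N ?PM fst) M (\<lambda>y. y j)"
   unfolding distr_distr[OF cm measurable_fst] by (rule distr_cong[OF refl refl]) (simp add: \<phi>_def)
  also have "\<dots> = M" unfolding Pr.distr_pair_fst by (rule distr_PiM_component) (use M j in auto)
  finally have \<phi>d: "distr ?N M \<phi> = M" .
  define Wj where "Wj u t = vec d (\<lambda>i. W (\<phi> u) t $ i)" for u t
  have Wj: "std_brownian_motion ?N d Wj" unfolding Wj_def by (rule std_brownian_motion_compose[OF W N \<phi> \<phi>d d])
  define x0 where "x0 p = (if j = 0 then \<xi> p else 0\<^sub>v d)" for p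
  have x0: "x0 \<in> P \<rightarrow>\<^sub>M vec_borel d" unfolding x0_def using \<xi>(1) d_def by (cases "j = 0") simp_all
  define X where "X u = limit_input R H (\<lambda>j. J - j) A (\<lambda>i. \<xi> (snd u) $ i) (\<lambda>t i. W (\<phi> u) t $ i) j" for u
  define Zj where "Zj u t = vec d (zmap d ?G (X u) t)" for u t
  define AM where "AM = mat d d (\<lambda>(l, m). A j l m)"
  define GM where "GM = mat d d (\<lambda>(l, m). ?G l m)"
  have GMe: "GM $$ (i, i') = ?G i i'" if "i < d" "i' < d" for i i' using that by (simp add: GM_def)
  have GM: "Mmat d ?G (\<lambda>l. w (j + l))" using G[OF j] by (simp add: d_def)
  have AMS: "AM * transpose_mat AM = mat d d (\<lambda>(l, l'). \<Sum>m<J. Gfun S (H j) j l m * Gfun S (H j) j l' m)"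
  proof (rule eq_matI)
   fix i i' assume "i < dim_row (mat d d (\<lambda>(l, l'). \<Sum>m<J. Gfun S (H j) j l m * Gfun S (H j) j l' m))"
    "i' < dim_col (mat d d (\<lambda>(l, l'). \<Sum>m<J. Gfun S (H j) j l m * Gfun S (H j) j l' m))"
   then have i: "i < d" "i' < d" by simp_all
   have "(AM * transpose_mat AM) $$ (i, i') = (\<Sum>q<d. AM $$ (i, q) * AM $$ (i', q))"
    by (rule mult_transpose_index) (use i in \<open>simp_all add: AM_def\<close>)
   also have "\<dots> = (\<Sum>q<d. A j i q * A j i' q)" using i by (simp add: AM_def)
   also have "\<dots> = (\<Sum>m<J. Gfun S (H j) j i m * Gfun S (H j) j i' m)" unfolding d_def by (rule A) (use i d_def in simp_all)
   finally show "(AM * transpose_mat AM) $$ (i, i') = mat d d (\<lambda>(l, l'). \<Sum>m<J. Gfun S (H j) j l m * Gfun S (H j) j l' m) $$ (i, i')"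
    using i by simp
  qed (simp_all add: AM_def)
  have x0n: "nonneg_vec d (x0 p)" if "p \<in> space P" for p
   using \<xi>(2)[OF that] d_def by (cases "j = 0") (simp_all add: x0_def nonneg_vec_def)
  have "srbm_driven_by ?N d AM Wj (\<lambda>u. x0 (snd u)) (- vec d (\<lambda>l. Gfun R (H j) j l j)) GM Zj"
   unfolding srbm_driven_by_def
  proof (intro conjI Wj ballI)
   show "AM \<in> carrier_mat d d" "- vec d (\<lambda>l. Gfun R (H j) j l j) \<in> carrier_vec d" by (simp_all add: AM_def)
   have GMc: "GM \<in> carrier_mat d d" by (simp add: GM_def)
   show "M_matrix d GM" by (rule Mmat_imp_M_matrix[OF Mmat_cong[OF GM GMe] GMc d(1)])
   show "(\<lambda>u. x0 (snd u)) \<in> ?N \<rightarrow>\<^sub>M vec_borel d" by (rule measurable_compose[OF measurable_snd x0])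
   show "nonneg_vec d (x0 (snd u))" if "u \<in> space ?N" for u
    by (rule x0n) (use that in \<open>auto simp: space_pair_measure\<close>)
   have g: "(\<lambda>y. \<lambda>t\<in>{0..}. vec d (\<lambda>i. W (y j) t $ i)) \<in> ?PM \<rightarrow>\<^sub>M (\<Pi>\<^sub>M t\<in>{0..}. vec_borel d)"
   proof (rule measurable_restrict, rule measurable_vec_borelI)
    fix t :: real and i assume t: "t \<in> {0..}" and i: "i < d"
    have "(\<lambda>x. W x t $ i) \<in> borel_measurable M" using bm_cproc[OF W] t i d unfolding cproc_def by simp
    from measurable_compose[OF cm this] show "(\<lambda>y. vec d (\<lambda>i. W (y j) t $ i) $ i) \<in> borel_measurable ?PM" using i by simp
   qed simp
   show "indep_elements ?N (vec_borel d) (\<lambda>u. x0 (snd u)) (\<Pi>\<^sub>M t\<in>{0..}. vec_borel d) (\<lambda>u. \<lambda>t\<in>{0..}. Wj u t)"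
    using indep_elements_map[OF N indep_elements_pair[OF N0 P] x0 g] unfolding Wj_def \<phi>_def .
   fix u assume u: "u \<in> space ?N"
   then have \<phi>u: "\<phi> u \<in> space M" and p: "snd u \<in> space P"
    by (rule measurable_space[OF \<phi>]) (use u in \<open>auto simp: space_pair_measure\<close>)
   show "\<exists>y. skorokhod d GM (\<lambda>t. x0 (snd u) + t \<cdot>\<^sub>v - vec d (\<lambda>l. Gfun R (H j) j l j) + AM *\<^sub>v Wj u t) (Zj u) y"
    unfolding Zj_def
   proof (rule skorokhod_zmap[OF GM GMc GMe])
    have "cpath (J - j) (\<lambda>t i. W (\<phi> u) t $ i)" using bm_path(2)[OF W \<phi>u] unfolding cpath_def by simp
    then show "cpath d (X u)" unfolding X_def limit_input_def by (rule cpath_affine)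
    show "0 \<le> X u 0 i" if "i < d" for i
    proof -
     have "W (\<phi> u) 0 $ m = 0" if "m < J" for m using bm_path(1)[OF W \<phi>u] that by simp
     then show ?thesis unfolding X_def limit_input_def affine_path_def by simp
    qed
    fix t
    show "x0 (snd u) + t \<cdot>\<^sub>v - vec d (\<lambda>l. Gfun R (H j) j l j) + AM *\<^sub>v Wj u t = vec d (X u t)"
    proof (rule eq_vecI)
     fix i assume "i < dim_vec (vec d (X u t))"
     then have i: "i < d" by simp
     have x: "x0 (snd u) $ i = (if j = 0 then max 0 (\<xi> (snd u) $ i) else 0)"
      using \<xi>(2)[OF p] i d_def unfolding x0_def nonneg_vec_def by simp
     have Aw: "(AM *\<^sub>v Wj u t) $ i = (\<Sum>m<J - j. A j i m * W (\<phi> u) t $ m)"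
      using i by (simp add: AM_def Wj_def scalar_prod_def atLeast0LessThan d_def)
     show "(x0 (snd u) + t \<cdot>\<^sub>v - vec d (\<lambda>l. Gfun R (H j) j l j) + AM *\<^sub>v Wj u t) $ i = vec d (X u t) $ i"
      using i x0n[OF p] Aw x unfolding X_def limit_input_def affine_path_def by (simp add: AM_def nonneg_vec_def)
    qed (simp add: AM_def)
   qed
  qed
  then have sr: "srbm ?N (J - j) (\<lambda>u. x0 (snd u)) (- col (submatrix (G_mat J RM j) {j..<J} {j}) 0)
     (submatrix (E_mat J RM j * \<Gamma> * transpose_mat (E_mat J RM j)) {j..<J} {j..<J})
     (submatrix (G_mat J RM j) {j..<J} {j..<J}) Zj"
   unfolding srbm_def G_block[OF j] G_col[OF j] cov_block[OF j] using AMS unfolding d_def GM_def by blast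
  have init: "if j = 0 then distr ?N (vec_borel J) (\<lambda>u. x0 (snd u)) = distr P (vec_borel J) \<xi> else \<forall>u\<in>space ?N. x0 (snd u) = 0\<^sub>v (J - j)"
  proof (cases "j = 0")
   case True
   have "distr ?N (vec_borel J) (\<lambda>u. x0 (snd u)) = distr ?N (vec_borel J) (\<xi> \<circ> snd)"
    by (rule distr_cong[OF refl refl]) (simp add: x0_def True)
   also have "\<dots> = distr (distr ?N P snd) (vec_borel J) \<xi>" by (rule distr_distr[OF \<xi>(1) measurable_snd, symmetric])
   finally show ?thesis using True unfolding distr_pair_snd[OF N0 P] by simp
  next
   case False then show ?thesis by (simp add: x0_def d_def)
  qed
  have "Zstar u t $ j = Zj u t $ 0" for u t
   using j d(1) unfolding Zstar_def Zj_def X_def limit_component_def \<phi>_def d_def by simp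
  then show "\<exists>\<xi>j Zj. srbm ?N (J - j) \<xi>j (- col (submatrix (G_mat J RM j) {j..<J} {j}) 0)
     (submatrix (E_mat J RM j * \<Gamma> * transpose_mat (E_mat J RM j)) {j..<J} {j..<J})
     (submatrix (G_mat J RM j) {j..<J} {j..<J}) Zj \<and>
    (if j = 0 then distr ?N (vec_borel J) \<xi>j = distr P (vec_borel J) \<xi>
     else \<forall>u\<in>space ?N. \<xi>j u = 0\<^sub>v (J - j)) \<and>
    (\<forall>u\<in>space ?N. \<forall>t\<ge>0. Zstar u t $ j = Zj u t $ 0)" using sr init by blast
 qed
 then show ?thesis by blast
qed

end

section \<open>From path functionals to weak convergence\<close>

text \<open>Neighbourhoods look at intervals \<open>[0, T]\<close> only, so the topology cannot
  separate functions that agree for \<open>t \<ge> 0\<close>. Values at negative times are left open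
  by the definitions of \<open>srbm\<close> and \<open>limit_process\<close>.\<close>

lemma path_topology_cong:
 assumes U: "openin (path_topology d) U" and x: "x \<in> U" and y: "cadlag d y" "\<And>t. 0 \<le> t \<Longrightarrow> y t = x t"
 shows "y \<in> U"
proof -
 obtain T \<epsilon> where T: "(0 :: real) < T" "(0 :: real) < \<epsilon>"
  and nb: "\<forall>y. cadlag d y \<longrightarrow> (\<forall>t\<in>{0..T}. \<forall>i<d. \<bar>y t $ i - x t $ i\<bar> < \<epsilon>) \<longrightarrow> y \<in> U"
  using U x unfolding openin_path_topology by blast
 have "\<forall>t\<in>{0..T}. \<forall>i<d. \<bar>y t $ i - x t $ i\<bar> < \<epsilon>" using y(2) T(2) by simp
 then show ?thesis using nb y(1) by blast
qed

lemma path_functional_cong: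
 assumes f: "continuous_map (path_topology d) euclideanreal f" and x: "cadlag d x" and y: "cadlag d y"
  and e: "\<And>t. 0 \<le> t \<Longrightarrow> y t = x t"
 shows "f y = f x"
proof (rule ccontr)
 assume "f y \<noteq> f x"
 have "openin (path_topology d) {z \<in> topspace (path_topology d). f z \<in> - {f y}}"
  by (rule openin_continuous_map_preimage[OF f]) (simp add: open_openin[symmetric] open_Compl)
 moreover have "x \<in> {z \<in> topspace (path_topology d). f z \<in> - {f y}}"
  using x \<open>f y \<noteq> f x\<close> by (simp add: topspace_path_topology)
 ultimately have "y \<in> {z \<in> topspace (path_topology d). f z \<in> - {f y}}" by (rule path_topology_cong[OF _ _ y e])
 then show False by simp
qed

lemma pcont_path_functional:
 assumes f: "continuous_map (path_topology d) euclideanreal f"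
 shows "pcont d (\<lambda>x. f (\<lambda>t. vec d (x t)))" unfolding pcont_def
proof (intro allI impI)
 fix xs x assume xs: "\<forall>n. cpath d (xs n)" and x: "cpath d x" and l: "lunif d xs x"
 show "(\<lambda>n. f (\<lambda>t. vec d (xs n t))) \<longlonglongrightarrow> f (\<lambda>t. vec d (x t))"
 proof (rule topological_tendstoI)
  fix S :: "real set" assume S: "open S" "f (\<lambda>t. vec d (x t)) \<in> S"
  define U where "U = {z \<in> topspace (path_topology d). f z \<in> S}"
  have U: "openin (path_topology d) U" unfolding U_def by (rule openin_continuous_map_preimage[OF f open_openin[THEN iffD1, OF S(1)]])
  have xU: "(\<lambda>t. vec d (x t)) \<in> U" using cadlag_cpath[OF x refl] S(2) unfolding U_def topspace_path_topology by blast
  obtain T \<epsilon> where T: "(0 :: real) < T" "(0 :: real) < \<epsilon>"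
   and nb: "\<forall>y. cadlag d y \<longrightarrow> (\<forall>t\<in>{0..T}. \<forall>i<d. \<bar>y t $ i - vec d (x t) $ i\<bar> < \<epsilon>) \<longrightarrow> y \<in> U"
   using bspec[OF conjunct2[OF U[unfolded openin_path_topology]] xU] by (elim exE conjE)
  from lunifD[OF l T(2), of T] show "\<forall>\<^sub>F n in sequentially. f (\<lambda>t. vec d (xs n t)) \<in> S"
  proof eventually_elim
   case (elim n)
   have "\<forall>t\<in>{0..T}. \<forall>i<d. \<bar>vec d (xs n t) $ i - vec d (x t) $ i\<bar> < \<epsilon>"
   proof (intro ballI allI impI)
    fix t i assume t: "t \<in> {0..T}" and i: "i < d"
    show "\<bar>vec d (xs n t) $ i - vec d (x t) $ i\<bar> < \<epsilon>" unfolding index_vec[OF i] using elim t i by blast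
   qed
   then have "(\<lambda>t. vec d (xs n t)) \<in> U"
    by (rule nb[THEN spec, THEN mp, THEN mp, OF cadlag_cpath[OF spec[OF xs] refl]])
   then show ?case unfolding U_def by blast
  qed
 qed
qed

lemma measurable_path_cong:
 assumes X: "X \<in> N \<rightarrow>\<^sub>M borel_of (path_topology d)" and Y: "\<And>w. w \<in> space N \<Longrightarrow> cadlag d (Y w)"
  and e: "\<And>w t. w \<in> space N \<Longrightarrow> 0 \<le> t \<Longrightarrow> Y w t = X w t"
 shows "Y \<in> N \<rightarrow>\<^sub>M borel_of (path_topology d)"
proof -
 have P: "{U. openin (path_topology d) U} \<subseteq> Pow (topspace (path_topology d))" by (auto dest: openin_subset)
 have s: "space (borel_of (path_topology d)) = Collect (cadlag d)"
  unfolding borel_of_def space_measure_of[OF P] by (rule topspace_path_topology)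
 have Xc: "cadlag d (X w)" if "w \<in> space N" for w using measurable_space[OF X that] unfolding s by simp
 show ?thesis unfolding borel_of_def
 proof (rule measurable_measure_of[OF P])
  show "Y \<in> space N \<rightarrow> topspace (path_topology d)" using Y by (simp add: topspace_path_topology)
  fix U assume U: "U \<in> {U. openin (path_topology d) U}"
  then have o: "openin (path_topology d) U" by simp
  have "X w \<in> U \<longleftrightarrow> Y w \<in> U" if w: "w \<in> space N" for w
   using path_topology_cong[OF o _ Y[OF w] e[OF w]] path_topology_cong[OF o _ Xc[OF w] e[OF w, symmetric]] by blast
  then have "Y -` U \<inter> space N = X -` U \<inter> space N" by auto
  moreover have "U \<in> sets (borel_of (path_topology d))"
   unfolding borel_of_def sets_measure_of[OF P] by (rule sigma_sets.Basic[OF U])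
  ultimately show "Y -` U \<inter> space N \<in> sets N" using measurable_sets[OF X] by simp
 qed
qed

lemma cproc_cong:
 assumes X: "cproc N d X" and e: "\<And>w t i. w \<in> space N \<Longrightarrow> 0 \<le> t \<Longrightarrow> i < d \<Longrightarrow> Y w t i = X w t i"
 shows "cproc N d Y" unfolding cproc_def cpath_def
proof (intro conjI ballI allI impI)
 fix w i assume w: "w \<in> space N" and i: "i < d"
 have "continuous_on {0..} (\<lambda>t. X w t i)" using X w i unfolding cproc_def cpath_def by blast
 then show "continuous_on {0..} (\<lambda>t. Y w t i)" by (rule continuous_on_eq) (simp add: e[OF w _ i])
next
 fix t :: real and i assume t: "0 \<le> t" and i: "i < d"
 have "(\<lambda>w. Y w t i) \<in> borel_measurable N \<longleftrightarrow> (\<lambda>w. X w t i) \<in> borel_measurable N"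
  by (rule measurable_cong) (rule e[OF _ t i])
 then show "(\<lambda>w. Y w t i) \<in> borel_measurable N" using X t i unfolding cproc_def by blast
qed

text \<open>A test function is bounded on cadlag paths only; clamping makes it bounded on all
  functions and does not change it at continuous paths.\<close>

lemma pcont_clamp:
 assumes F: "pcont d F" shows "pcont d (\<lambda>x. max (- b) (min b (F x)))" unfolding pcont_def
proof (intro allI impI)
 fix xs x assume xs: "\<forall>n. cpath d (xs n)" and x: "cpath d x" "lunif d xs x"
 from pcontD[OF F spec[OF xs] x]
 show "(\<lambda>n. max (- b) (min b (F (xs n)))) \<longlonglongrightarrow> max (- b) (min b (F x))"
  by (rule tendsto_max[OF tendsto_const tendsto_min[OF tendsto_const]])
qed

context eliminated_system
begin

text \<open>The initial state and its independent motion are replaced by a product of a copy of the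
  initial state and a spliced motion with the same joint characteristic functions. Fubini's theorem
  then separates the average over the motions from that over the initial state.\<close>

lemma prelimit_integral:
 assumes D: "driven M J J \<zeta> B" and \<gamma>: "\<And>j. j < J \<Longrightarrow> 0 < \<gamma> j"
  and \<zeta>: "\<And>u i. u \<in> space M \<Longrightarrow> i < J \<Longrightarrow> 0 \<le> \<zeta> u i"
  and v: "\<And>u i. u \<in> space M \<Longrightarrow> i < J \<Longrightarrow> v u i = \<gamma> 0 * \<zeta> u i"
  and \<theta>: "\<And>i. i < J \<Longrightarrow> \<theta> i = - (\<Sum>m<J. R i m * \<gamma> m)"
  and f: "pcont J f" "\<And>x. \<bar>f x\<bar> \<le> b"
 shows "(\<integral>u. f (rescale \<gamma> (zmap J R (affine_path J (\<zeta> u) \<theta> S (B u)))) \<partial>M) =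
  (\<integral>u. (\<integral>y. f (scaled_output J R S \<gamma> (v u) (splice J \<gamma> (\<lambda>j. B (y j)))) \<partial>(\<Pi>\<^sub>M j\<in>{..<J}. M)) \<partial>M)"
proof -
 let ?PM = "\<Pi>\<^sub>M j\<in>{..<J}. M"
 have B: "bm_law M J B" and \<zeta>m: "\<And>i. i < J \<Longrightarrow> (\<lambda>u. \<zeta> u i) \<in> borel_measurable M" using D unfolding driven_def by blast+
 have M: "prob_space M" by (rule bm_lawD(1)[OF B])
 have PM: "prob_space ?PM" by (rule prob_space_PiM) (rule M)
 interpret M: prob_space M by fact
 interpret PM: prob_space ?PM by fact
 interpret pair: pair_prob_space ?PM M ..
 define \<zeta>' where "\<zeta>' u i = max 0 (v u i) / \<gamma> 0" for u i
 have \<zeta>'e: "\<zeta>' u i = \<zeta> u i" if "u \<in> space M" "i < J" for u i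
  using \<gamma>[OF J] \<zeta>[OF that] unfolding \<zeta>'_def v[OF that] by simp
 have \<zeta>'m: "(\<lambda>u. \<zeta>' u i) \<in> borel_measurable M" if i: "i < J" for i
 proof -
  have "(\<lambda>u. \<zeta>' u i) \<in> borel_measurable M \<longleftrightarrow> (\<lambda>u. \<zeta> u i) \<in> borel_measurable M"
   by (rule measurable_cong) (rule \<zeta>'e[OF _ i])
  then show ?thesis using \<zeta>m[OF i] by blast
 qed
 note sb = splice_bm_law[OF B \<gamma> J]
 have dp: "driven (?PM \<Otimes>\<^sub>M M) J J (\<lambda>u. \<zeta>' (snd u)) (\<lambda>u. splice J \<gamma> (\<lambda>j. B (fst u j)))"
  by (rule driven_pair(1)[OF sb M \<zeta>'m])
 have dp2: "(\<integral>u. iexp (\<Sum>l<J. c l * \<zeta>' (snd u) l) \<partial>(?PM \<Otimes>\<^sub>M M)) = (\<integral>p. iexp (\<Sum>l<J. c l * \<zeta>' p l) \<partial>M)" for c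
  by (rule driven_pair(2)[OF sb M \<zeta>'m])
 let ?X = "\<lambda>u. affine_path J (\<zeta> u) \<theta> S (B u)"
 let ?Y = "\<lambda>u. coupled_input J R S \<gamma> (v (snd u)) (splice J \<gamma> (\<lambda>j. B (fst u j)))"
 have Y: "?Y u = affine_path J (\<zeta>' (snd u)) (\<lambda>i. - (\<Sum>m<J. R i m * \<gamma> m)) S (splice J \<gamma> (\<lambda>j. B (fst u j)))" for u
  unfolding coupled_input_def \<zeta>'_def ..
 have sf: "same_fdd J M ?X (?PM \<Otimes>\<^sub>M M) ?Y" unfolding Y
 proof (rule driven_same_fdd[OF D dp])
  show "(\<integral>u. iexp (\<Sum>l<J. c l * \<zeta> u l) \<partial>M) = (\<integral>u. iexp (\<Sum>l<J. c l * \<zeta>' (snd u) l) \<partial>(?PM \<Otimes>\<^sub>M M))" for c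
   unfolding dp2 by (rule Bochner_Integration.integral_cong[OF refl]) (simp add: \<zeta>'e)
 qed (simp_all add: \<theta>)
 have cX: "cproc M J ?X" by (rule driven_cproc[OF D])
 have cY: "cproc (?PM \<Otimes>\<^sub>M M) J ?Y" unfolding Y by (rule driven_cproc[OF dp])
 define F where "F x = f (rescale \<gamma> (zmap J R x))" for x
 have F: "pcont J F" unfolding F_def by (rule pcont_zmap[OF R pcont_rescale[OF f(1)]])
 have Fb: "\<bar>F x\<bar> \<le> b" for x unfolding F_def by (rule f(2))
 have FY: "F (?Y u) = f (scaled_output J R S \<gamma> (v (snd u)) (splice J \<gamma> (\<lambda>j. B (fst u j))))" for u
  unfolding F_def scaled_output_def ..
 have "(\<integral>u. F (?X u) \<partial>M) = (\<integral>u. F (?Y u) \<partial>(?PM \<Otimes>\<^sub>M M))"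
  by (rule pcont_integral_eq[OF M pair.prob_space_axioms cX cY sf F Fb])
 also have "\<dots> = (\<integral>u. (\<integral>y. F (?Y (y, u)) \<partial>?PM) \<partial>M)"
 proof -
  have "integrable (?PM \<Otimes>\<^sub>M M) (\<lambda>u. F (?Y u))"
   by (rule pair.integrable_const_bound[of _ b, OF _ pcont_measurable[OF cY F]]) (use Fb in simp)
  then have "integrable (?PM \<Otimes>\<^sub>M M) (\<lambda>(y, u). F (?Y (y, u)))" unfolding case_prod_beta by simp
  from pair.integral_snd[OF this] show ?thesis unfolding case_prod_beta by simp
 qed
 finally show ?thesis unfolding FY unfolding F_def fst_conv snd_conv .
qed

end

context eliminated_matrices
begin

lemma lim_comp_cong:
 assumes "\<And>i. i < J \<Longrightarrow> v i = v' i" and b: "cpath J b" and j: "j < J" and t: "0 \<le> t"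
 shows "lim_comp v b j t = lim_comp v' b j t" unfolding limit_component_def
proof (rule zmap_cong[OF G[OF j] _ _ t])
 show "cpath (J - j) (limit_input R H (\<lambda>_. J) (\<lambda>j. Gfun S (H j) j) v b j)"
  unfolding limit_input_def by (rule cpath_affine[OF b])
 show "limit_input R H (\<lambda>_. J) (\<lambda>j. Gfun S (H j) j) v b j t i = limit_input R H (\<lambda>_. J) (\<lambda>j. Gfun S (H j) j) v' b j t i"
  if "i < J - j" for t i using that assms(1)[of i] unfolding limit_input_def affine_path_def by simp
qed (use j in simp)

text \<open>With the initial vector frozen at \<open>v\<close>, the average over the spliced motions
  is \<open>gs n v\<close>. The coupling shows that \<open>gs n\<close> at convergent arguments
  tends to \<open>g\<close>, and convergence in law of the initial vectors enters through
  \<open>extended_continuous_mapping\<close>.\<close>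

lemma scaled_integral_limit:
 assumes W: "std_brownian_motion M J W" and RM: "\<And>i j. i < J \<Longrightarrow> j < J \<Longrightarrow> RM $$ (i, j) = R i j"
  and L: "S = (\<lambda>i m. L $$ (i, m))"
  and Z: "\<And>n. srbm_driven_by M J L W (\<lambda>u. Z n u 0) (\<theta> n) RM (Z n)"
  and \<theta>: "\<And>n i. i < J \<Longrightarrow> \<theta> n $ i = - (\<Sum>m<J. R i m * \<gamma>s n m)"
  and \<gamma>: "\<And>n j. j < J \<Longrightarrow> 0 < \<gamma>s n j"
  and ratio: "\<And>i j. i < j \<Longrightarrow> j < J \<Longrightarrow> (\<lambda>n. \<gamma>s n j / \<gamma>s n i) \<longlonglongrightarrow> 0"
  and P: "prob_space P" and \<xi>: "\<xi> \<in> P \<rightarrow>\<^sub>M vec_borel J"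
  and init: "\<And>h b. continuous_on UNIV h \<Longrightarrow> (\<And>v. \<bar>h v\<bar> \<le> (b :: real)) \<Longrightarrow>
   (\<lambda>n. \<integral>u. h (\<lambda>i. if i < J then \<gamma>s n 0 * Z n u 0 $ i else 0) \<partial>M) \<longlonglongrightarrow> (\<integral>p. h (\<lambda>i. if i < J then \<xi> p $ i else 0) \<partial>P)"
  and f: "pcont J f" "\<And>x. \<bar>f x\<bar> \<le> b"
 shows "cproc M J (\<lambda>u t i. Z n u t $ i)"
  and "(\<lambda>n. \<integral>u. f (rescale (\<gamma>s n) (\<lambda>t i. Z n u t $ i)) \<partial>M) \<longlonglongrightarrow>
   (\<integral>p. (\<integral>y. f (\<lambda>t j. lim_comp (\<lambda>i. \<xi> p $ i) (\<lambda>t i. W (y j) t $ i) j t) \<partial>(\<Pi>\<^sub>M j\<in>{..<J}. M)) \<partial>P)"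
proof -
 let ?PM = "\<Pi>\<^sub>M j\<in>{..<J}. M"
 let ?B = "\<lambda>u t i. W u t $ i"
 have B: "bm_law M J ?B" by (rule std_brownian_motion_bm_law[OF W])
 have B0: "?B u 0 i = 0" if "u \<in> space M" "i < J" for u i using bm_path(1)[OF W that(1)] that(2) by simp
 have M: "prob_space M" by (rule bm_lawD(1)[OF B])
 have PM: "prob_space ?PM" by (rule prob_space_PiM) (rule M)
 interpret M: prob_space M by fact
 interpret PM: prob_space ?PM by fact
 interpret pair: pair_prob_space M ?PM ..
 define A where "A n u = affine_path J (\<lambda>i. Z n u 0 $ i) (\<lambda>i. \<theta> n $ i) S (?B u)" for n u
 have D: "driven M J J (\<lambda>u i. Z n u 0 $ i) ?B" for n by (rule srbm_driven_zmap(1)[OF Z R RM])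
 have ZA: "Z n u t $ i = zmap J R (A n u) t i" if "u \<in> space M" "0 \<le> t" "i < J" for n u t i
  unfolding A_def L by (rule srbm_driven_zmap(2)[OF Z R RM that])
 have cA: "cproc M J (A n)" for n unfolding A_def by (rule driven_cproc[OF D])
 have cZ: "cproc M J (\<lambda>u t i. Z n u t $ i)" for n by (rule cproc_cong[OF cproc_zmap[OF R cA] ZA])
 then show "cproc M J (\<lambda>u t i. Z n u t $ i)" .
 have Z0: "0 \<le> Z n u 0 $ i" if "u \<in> space M" "i < J" for n u i
  using Z[of n] that unfolding srbm_driven_by_def nonneg_vec_def by blast
 have Z0m: "(\<lambda>u. Z n u 0 $ i) \<in> borel_measurable M" if "i < J" for n i
  using D[of n] that unfolding driven_def by blast
 define \<zeta> where "\<zeta> n u = (\<lambda>i. if i < J then \<gamma>s n 0 * Z n u 0 $ i else 0)" for n u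
 define \<xi>' where "\<xi>' p = (\<lambda>i. if i < J then \<xi> p $ i else 0)" for p
 define gs where "gs n v = (\<integral>y. f (scaled_output J R S (\<gamma>s n) v (splice J (\<gamma>s n) (\<lambda>j. ?B (y j)))) \<partial>?PM)" for n v
 define g where "g v = (\<integral>y. f (\<lambda>t j. lim_comp v (?B (y j)) j t) \<partial>?PM)" for v
 have \<zeta>m: "(\<lambda>u. \<zeta> n u i) \<in> borel_measurable M" for n i
  unfolding \<zeta>_def using Z0m[of i n] by (cases "i < J") simp_all
 have csp: "cproc ?PM J (\<lambda>y. splice J (\<gamma>s n) (\<lambda>j. ?B (y j)))" for n by (rule bm_lawD(2)[OF splice_bm_law[OF B \<gamma> J]])
 have co: "cproc ?PM J (\<lambda>y. scaled_output J R S (\<gamma>s n) v (splice J (\<gamma>s n) (\<lambda>j. ?B (y j))))" for n v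
  unfolding scaled_output_def coupled_input_def
  by (rule cproc_rescale, rule cproc_zmap[OF R], rule cproc_affine[OF csp]) simp
 have "(\<lambda>n. \<integral>u. gs n (\<zeta> n u) \<partial>M) \<longlonglongrightarrow> (\<integral>p. g (\<xi>' p) \<partial>P)"
 proof (rule extended_continuous_mapping[where \<zeta> = \<zeta> and \<xi> = \<xi>' and gs = gs and g = g and J = J and b = b, OF M P])
  show "\<zeta> n \<in> borel_measurable M" for n by (rule measurable_coordinatewise_then_product) (rule \<zeta>m)
  show "\<xi>' \<in> borel_measurable P"
  proof (rule measurable_coordinatewise_then_product)
   show "(\<lambda>p. \<xi>' p i) \<in> borel_measurable P" for i
    using measurable_compose[OF \<xi> vec_index_measurable[of i J]] by (cases "i < J") (simp_all add: \<xi>'_def)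
  qed
  show "\<zeta> n u i = 0" if "J \<le> i" for n u i using that by (simp add: \<zeta>_def)
  show "(\<lambda>n. \<integral>u. h (\<zeta> n u) \<partial>M) \<longlonglongrightarrow> (\<integral>p. h (\<xi>' p) \<partial>P)"
   if "continuous_on UNIV h" "\<And>v. \<bar>h v\<bar> \<le> (b :: real)" for h b
   unfolding \<zeta>_def \<xi>'_def by (rule init[OF that])
  show "\<bar>gs n v\<bar> \<le> b" for n v
  proof -
   have m: "(\<lambda>y. f (scaled_output J R S (\<gamma>s n) v (splice J (\<gamma>s n) (\<lambda>j. ?B (y j))))) \<in> borel_measurable ?PM"
    by (rule pcont_measurable[OF co f(1)])
   have i: "integrable ?PM (\<lambda>y. f (scaled_output J R S (\<gamma>s n) v (splice J (\<gamma>s n) (\<lambda>j. ?B (y j)))))"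
    by (rule PM.integrable_const_bound[of _ b, OF _ m]) (use f(2) in simp)
   have "\<bar>gs n v\<bar> \<le> (\<integral>y. \<bar>f (scaled_output J R S (\<gamma>s n) v (splice J (\<gamma>s n) (\<lambda>j. ?B (y j))))\<bar> \<partial>?PM)"
    unfolding gs_def by (rule integral_abs_bound)
   also have "\<dots> \<le> b" by (rule PM.integral_le_const) (use i f(2) in simp_all)
   finally show ?thesis .
  qed
  show "(\<lambda>u. gs n (\<zeta> n u)) \<in> borel_measurable M" for n
  proof -
   have cs: "cproc (M \<Otimes>\<^sub>M ?PM) J (\<lambda>z. splice J (\<gamma>s n) (\<lambda>j. ?B (snd z j)))"
    by (rule cproc_compose[OF csp measurable_snd])
   have "cproc (M \<Otimes>\<^sub>M ?PM) J (\<lambda>z. scaled_output J R S (\<gamma>s n) (\<zeta> n (fst z)) (splice J (\<gamma>s n) (\<lambda>j. ?B (snd z j))))"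
    unfolding scaled_output_def coupled_input_def
   proof (rule cproc_rescale, rule cproc_zmap[OF R], rule cproc_affine[OF cs])
    fix i
    have [measurable]: "(\<lambda>z. \<zeta> n (fst z) i) \<in> borel_measurable (M \<Otimes>\<^sub>M ?PM)" by (rule measurable_compose[OF measurable_fst \<zeta>m])
    show "(\<lambda>z. max 0 (\<zeta> n (fst z) i) / \<gamma>s n 0) \<in> borel_measurable (M \<Otimes>\<^sub>M ?PM)" by measurable
   qed
   from pcont_measurable[OF this f(1)]
   have "(\<lambda>(u, y). f (scaled_output J R S (\<gamma>s n) (\<zeta> n u) (splice J (\<gamma>s n) (\<lambda>j. ?B (y j))))) \<in> borel_measurable (M \<Otimes>\<^sub>M ?PM)"
    unfolding case_prod_beta .
   from PM.borel_measurable_lebesgue_integral[OF this] show ?thesis unfolding gs_def .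
  qed
  show "(\<lambda>m. gs (r m) (vs m)) \<longlonglongrightarrow> g v" if r: "filterlim r at_top sequentially" and vs: "vs \<longlonglongrightarrow> v" for r vs v
   unfolding gs_def g_def
  proof (rule scaled_output_integral_limit[where \<gamma>s = "\<lambda>m. \<gamma>s (r m)", OF B B0 \<gamma> _ _ f])
   show "(\<lambda>n. \<gamma>s (r n) j / \<gamma>s (r n) i) \<longlonglongrightarrow> 0" if "i < j" "j < J" for i j
    by (rule filterlim_compose[OF ratio[OF that] r])
   show "(\<lambda>n. vs n i) \<longlonglongrightarrow> v i" for i using vs unfolding tendsto_fun_iff by blast
  qed
 qed
 moreover have "(\<integral>u. gs n (\<zeta> n u) \<partial>M) = (\<integral>u. f (rescale (\<gamma>s n) (\<lambda>t i. Z n u t $ i)) \<partial>M)" for n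
 proof -
  have "(\<integral>u. f (rescale (\<gamma>s n) (zmap J R (A n u))) \<partial>M) = (\<integral>u. gs n (\<zeta> n u) \<partial>M)"
   unfolding A_def gs_def by (rule prelimit_integral[OF D \<gamma> Z0 _ \<theta> f]) (simp_all add: \<zeta>_def)
  moreover have "(\<integral>u. f (rescale (\<gamma>s n) (zmap J R (A n u))) \<partial>M) = (\<integral>u. f (rescale (\<gamma>s n) (\<lambda>t i. Z n u t $ i)) \<partial>M)"
  proof (rule Bochner_Integration.integral_cong[OF refl])
   fix u assume u: "u \<in> space M"
   show "f (rescale (\<gamma>s n) (zmap J R (A n u))) = f (rescale (\<gamma>s n) (\<lambda>t i. Z n u t $ i))"
   proof (rule pcont_cong[OF pcont_rescale[OF f(1)]])
    show "cpath J (zmap J R (A n u))" using cproc_zmap[OF R cA] u unfolding cproc_def by blast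
   qed (rule ZA[OF u, symmetric])
  qed
  ultimately show ?thesis by simp
 qed
 moreover have "g (\<xi>' p) = (\<integral>y. f (\<lambda>t j. lim_comp (\<lambda>i. \<xi> p $ i) (?B (y j)) j t) \<partial>?PM)" for p
  unfolding g_def
 proof (rule Bochner_Integration.integral_cong[OF refl])
  fix y assume y: "y \<in> space ?PM"
  have yj: "cpath J (?B (y j))" if "j < J" for j
   by (rule bm_path(2)[OF W]) (use y that in \<open>auto simp: space_PiM\<close>)
  have cm: "(\<lambda>y. y j) \<in> ?PM \<rightarrow>\<^sub>M M" if "j < J" for j by (rule measurable_component_singleton) (use that in simp)
  have "cproc ?PM J (\<lambda>y t j. lim_comp (\<xi>' p) (?B (y j)) j t)"
   by (rule cproc_limit) (auto intro: cproc_compose[OF bm_lawD(2)[OF B] cm])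
  then have c: "cpath J (\<lambda>t j. lim_comp (\<xi>' p) (?B (y j)) j t)" using y unfolding cproc_def by blast
  show "f (\<lambda>t j. lim_comp (\<xi>' p) (?B (y j)) j t) = f (\<lambda>t j. lim_comp (\<lambda>i. \<xi> p $ i) (?B (y j)) j t)"
   by (rule pcont_cong[OF f(1) c], rule lim_comp_cong) (simp_all add: \<xi>'_def yj)
 qed
 ultimately show "(\<lambda>n. \<integral>u. f (rescale (\<gamma>s n) (\<lambda>t i. Z n u t $ i)) \<partial>M) \<longlonglongrightarrow>
   (\<integral>p. (\<integral>y. f (\<lambda>t j. lim_comp (\<lambda>i. \<xi> p $ i) (?B (y j)) j t) \<partial>?PM) \<partial>P)" by simp
qed

text \<open>The limit at \<open>r = 0\<close> is tested along sequences in \<open>(0, 1)\<close>,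
  and a bounded continuous test function is replaced by its clamped version on continuous paths.
  Measurability of prelimit and limit follows from their continuous paths.\<close>

lemma scaled_srbm_converges:
 assumes W: "std_brownian_motion M J W" and RM: "RM \<in> carrier_mat J J" "\<And>i j. i < J \<Longrightarrow> j < J \<Longrightarrow> RM $$ (i, j) = R i j"
  and L: "S = (\<lambda>i m. L $$ (i, m))"
  and Z: "\<And>r. r \<in> {0<..<1} \<Longrightarrow> srbm_driven_by M J L W (\<lambda>q. Z r q 0) (\<theta> r) RM (Z r)"
  and \<theta>: "\<And>r. r \<in> {0<..<1} \<Longrightarrow> \<theta> r = - (RM *\<^sub>v vec J (\<lambda>j. \<gamma> j r))"
  and \<gamma>: "\<And>r j. r \<in> {0<..<1} \<Longrightarrow> j < J \<Longrightarrow> 0 < \<gamma> j r"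
  and ratio: "\<And>i j. i < j \<Longrightarrow> j < J \<Longrightarrow> ((\<lambda>r. \<gamma> j r / \<gamma> i r) \<longlongrightarrow> 0) (at_right (0 :: real))"
  and P: "prob_space P" and \<xi>: "\<xi> \<in> P \<rightarrow>\<^sub>M vec_borel J" "\<And>p. p \<in> space P \<Longrightarrow> nonneg_vec J (\<xi> p)"
  and init: "converges_weakly (vec_topology J) (at_right 0) M (\<lambda>r q. vec J (\<lambda>j. \<gamma> 0 r * Z r q 0 $ j)) P \<xi>"
  and lp: "limit_process J \<Gamma> RM P \<xi> N Zstar"
 shows "converges_weakly (path_topology J) (at_right 0)
  M (\<lambda>r q t. vec J (\<lambda>j. \<gamma> j r * Z r q (t / (\<gamma> j r)\<^sup>2) $ j)) N Zstar"
proof -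
 have B: "bm_law M J (\<lambda>q t i. W q t $ i)" by (rule std_brownian_motion_bm_law[OF W])
 have sc: "(\<lambda>t. vec J (\<lambda>j. \<gamma> j r * Z r q (t / (\<gamma> j r)\<^sup>2) $ j)) = (\<lambda>t. vec J (rescale (\<lambda>j. \<gamma> j r) (\<lambda>t i. Z r q t $ i) t))" for r q
  unfolding rescale_def ..
 have \<theta>i: "\<theta> r $ i = - (\<Sum>m<J. R i m * \<gamma> m r)" if "r \<in> {0<..<1}" "i < J" for r i
  unfolding \<theta>[OF that(1)] using RM that(2) by (simp add: scalar_prod_def atLeast0LessThan)
 have seq: "(\<lambda>n. \<integral>q. h (\<lambda>i. if i < J then \<gamma> 0 (r n) * Z (r n) q 0 $ i else 0) \<partial>M) \<longlonglongrightarrow> (\<integral>p. h (\<lambda>i. if i < J then \<xi> p $ i else 0) \<partial>P)"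
  if r: "\<And>n. 0 < r n" "r \<longlonglongrightarrow> 0" and h: "continuous_on UNIV h" "\<And>v. \<bar>h v\<bar> \<le> (b :: real)" for r h b
 proof -
  \<comment> \<open>Translates a test function on sequences into one on vectors, as convergence of
    the initial states is given in \<open>vec_topology\<close>.\<close>
  define k where "k v = h (\<lambda>i. if i < J then v $ i else 0)" for v :: "real vec"
  have "continuous_map (vec_topology J) (product_topology (\<lambda>_. euclideanreal) UNIV) (\<lambda>v i. if i < J then v $ i else 0)"
   unfolding continuous_map_componentwise_UNIV
  proof
   show "continuous_map (vec_topology J) euclideanreal (\<lambda>v. if i < J then v $ i else 0)" for i
    using continuous_map_vec_index[of i J] by (cases "i < J") simp_all
  qed
  then have "continuous_map (vec_topology J) euclidean (\<lambda>v i. if i < J then v $ i else 0 :: real)"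
   unfolding euclidean_product_topology .
  moreover have "continuous_map euclidean euclideanreal h" using h(1) by simp
  ultimately have kc: "continuous_map (vec_topology J) euclideanreal k"
   unfolding k_def using continuous_map_compose[of "vec_topology J" euclidean "\<lambda>v i. if i < J then v $ i else 0" euclideanreal h] by (simp add: comp_def)
  have kb: "bounded (k ` topspace (vec_topology J))"
   unfolding bounded_iff by (rule exI[of _ b]) (use h(2) in \<open>auto simp: k_def\<close>)
  have t: "((\<lambda>r. \<integral>q. k (vec J (\<lambda>j. \<gamma> 0 r * Z r q 0 $ j)) \<partial>M) \<longlongrightarrow> (\<integral>p. k (\<xi> p) \<partial>P)) (at_right 0)"
   using init kc kb unfolding converges_weakly_def by blast
  have kv: "k (vec J u) = h (\<lambda>i. if i < J then u i else 0)" for u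
   unfolding k_def by (rule arg_cong[where f = h]) (rule ext, simp)
  have "filterlim r (at_right 0) sequentially"
   unfolding filterlim_at using r by (auto intro: always_eventually simp: less_imp_neq[symmetric])
  from filterlim_compose[OF t this] show ?thesis unfolding kv unfolding k_def .
 qed
 have conv: "(\<lambda>n. \<integral>q. F (rescale (\<lambda>j. \<gamma> j (r n)) (\<lambda>t i. Z (r n) q t $ i)) \<partial>M) \<longlonglongrightarrow> (\<integral>q. F (\<lambda>t j. Zstar q t $ j) \<partial>N)"
  if r: "\<And>n. 0 < r n" "\<And>n. r n < 1" "r \<longlonglongrightarrow> 0" and F: "pcont J F" "\<And>x. \<bar>F x\<bar> \<le> b" for r F b
 proof -
  have le: "(\<integral>q. F (\<lambda>t j. Zstar q t $ j) \<partial>N) =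
   (\<integral>p. (\<integral>y. F (\<lambda>t j. lim_comp (\<lambda>i. \<xi> p $ i) (\<lambda>t i. W (y j) t $ i) j t) \<partial>(\<Pi>\<^sub>M j\<in>{..<J}. M)) \<partial>P)"
   by (rule limit_process_integral(2)[OF lp B P \<xi> F])
  show ?thesis unfolding le
 proof (rule scaled_integral_limit(2)[where \<gamma>s = "\<lambda>n j. \<gamma> j (r n)" and Z = "\<lambda>n. Z (r n)" and \<theta> = "\<lambda>n. \<theta> (r n)", OF W RM(2) L _ _ _ _ P \<xi>(1) _ F])
  have r01: "r n \<in> {0<..<1}" for n using r by simp
  show "srbm_driven_by M J L W (\<lambda>q. Z (r n) q 0) (\<theta> (r n)) RM (Z (r n))" for n by (rule Z[OF r01])
  show "\<theta> (r n) $ i = - (\<Sum>m<J. R i m * \<gamma> m (r n))" if "i < J" for n i by (rule \<theta>i[OF r01 that])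
  show "0 < \<gamma> j (r n)" if "j < J" for n j by (rule \<gamma>[OF r01 that])
  have rl: "filterlim r (at_right 0) sequentially"
   unfolding filterlim_at using r(1,3) by (auto intro: always_eventually simp: less_imp_neq[symmetric])
  show "(\<lambda>n. \<gamma> j (r n) / \<gamma> i (r n)) \<longlonglongrightarrow> 0" if "i < j" "j < J" for i j by (rule filterlim_compose[OF ratio[OF that] rl])
  show "(\<lambda>n. \<integral>q. h (\<lambda>i. if i < J then \<gamma> 0 (r n) * Z (r n) q 0 $ i else 0) \<partial>M) \<longlonglongrightarrow> (\<integral>p. h (\<lambda>i. if i < J then \<xi> p $ i else 0) \<partial>P)"
   if "continuous_on UNIV h" "\<And>v. \<bar>h v\<bar> \<le> (b :: real)" for h b by (rule seq[OF r(1,3) that])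
 qed
 qed
 have cZ: "cproc M J (rescale (\<lambda>j. \<gamma> j r) \<circ> (\<lambda>q t i. Z r q t $ i))" if r: "r \<in> {0<..<1}" for r
 proof -
  have cA: "cproc M J (\<lambda>q. affine_path J (\<lambda>i. Z r q 0 $ i) (\<lambda>i. \<theta> r $ i) (\<lambda>i m. L $$ (i, m)) (\<lambda>t i. W q t $ i))"
   by (rule driven_cproc[OF srbm_driven_zmap(1)[OF Z[OF r] R RM(2)]])
  have "cproc M J (\<lambda>q t i. Z r q t $ i)"
   by (rule cproc_cong[OF cproc_zmap[OF R cA] srbm_driven_zmap(2)[OF Z[OF r] R RM(2)]])
  then show ?thesis unfolding comp_def by (rule cproc_rescale)
 qed
 \<comment> \<open>The conclusion used here does not involve the functional, so the zero functional
   is inserted.\<close>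
 have cS: "cproc N J (\<lambda>q t j. Zstar q t $ j)"
  by (rule limit_process_integral(1)[OF lp B P \<xi>, of "\<lambda>_. 0" 0]) (simp_all add: pcont_def)
 have car: "Zstar q t \<in> carrier_vec J" if "q \<in> space N" "0 \<le> t" for q t
  using lp that unfolding limit_process_def by blast
 have Sv: "Zstar q t = vec J (\<lambda>j. Zstar q t $ j)" if "q \<in> space N" "0 \<le> t" for q t
  using car[OF that] by auto
 have Sc: "cadlag J (Zstar q)" "cadlag J (\<lambda>t. vec J (\<lambda>j. Zstar q t $ j))" if q: "q \<in> space N" for q
 proof -
  have c: "cpath J (\<lambda>t j. Zstar q t $ j)" using cS q unfolding cproc_def by blast
  show "cadlag J (Zstar q)" by (rule cadlag_cpath[OF c Sv[OF q]])
  show "cadlag J (\<lambda>t. vec J (\<lambda>j. Zstar q t $ j))" by (rule cadlag_cpath[OF c refl])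
 qed
 show ?thesis unfolding converges_weakly_def sc
 proof (intro conjI allI impI)
  have "(\<lambda>q t. vec J (rescale (\<lambda>j. \<gamma> j r) (\<lambda>t i. Z r q t $ i) t)) \<in> M \<rightarrow>\<^sub>M borel_of (path_topology J)"
   if "r \<in> {0<..<1}" for r using cproc_measurable_path[OF cZ[OF that]] by (simp add: comp_def)
  then show "\<forall>\<^sub>F r in at_right 0. (\<lambda>q t. vec J (rescale (\<lambda>j. \<gamma> j r) (\<lambda>t i. Z r q t $ i) t)) \<in> M \<rightarrow>\<^sub>M borel_of (path_topology J)"
   unfolding eventually_at_right_field by (intro exI[of _ 1]) simp
  show "Zstar \<in> N \<rightarrow>\<^sub>M borel_of (path_topology J)"
   by (rule measurable_path_cong[OF cproc_measurable_path[OF cS] Sc(1) Sv])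
  fix f assume f: "continuous_map (path_topology J) euclideanreal f \<and> bounded (f ` topspace (path_topology J))"
  then obtain b where b: "\<And>x. cadlag J x \<Longrightarrow> \<bar>f x\<bar> \<le> b" unfolding bounded_iff topspace_path_topology by auto
  define F where "F x = max (- b) (min b (f (\<lambda>t. vec J (x t))))" for x
  have Fe: "F x = f (\<lambda>t. vec J (x t))" if "cpath J x" for x
   using b[OF cadlag_cpath[OF that refl]] unfolding F_def by (simp add: abs_le_iff)
  have F: "pcont J F" unfolding F_def by (rule pcont_clamp[OF pcont_path_functional]) (use f in blast)
  have b0: "0 \<le> b"
  proof -
   have "cpath J (\<lambda>t i. 0)" by (simp add: cpath_def)
   from b[OF cadlag_cpath[OF this refl]] show ?thesis by linarith
  qed
  have Fb: "\<bar>F x\<bar> \<le> b" for x unfolding F_def using b0 by (simp add: abs_le_iff min_def max_def)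
  have lim: "(\<integral>q. F (\<lambda>t j. Zstar q t $ j) \<partial>N) = (\<integral>q. f (Zstar q) \<partial>N)"
  proof (rule Bochner_Integration.integral_cong[OF refl])
   fix q assume q: "q \<in> space N"
   have "F (\<lambda>t j. Zstar q t $ j) = f (\<lambda>t. vec J (\<lambda>j. Zstar q t $ j))" by (rule Fe) (use cS q in \<open>simp add: cproc_def\<close>)
   also have "\<dots> = f (Zstar q)"
    by (rule path_functional_cong[OF conjunct1[OF f] Sc[OF q]]) (rule Sv[OF q, symmetric])
   finally show "F (\<lambda>t j. Zstar q t $ j) = f (Zstar q)" .
  qed
  show "((\<lambda>r. \<integral>q. f (\<lambda>t. vec J (rescale (\<lambda>j. \<gamma> j r) (\<lambda>t i. Z r q t $ i) t)) \<partial>M) \<longlongrightarrow> (\<integral>q. f (Zstar q) \<partial>N)) (at_right 0)"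
  proof (rule tendsto_at_right_sequentially[of 0 1])
   fix r :: "nat \<Rightarrow> real" assume r: "\<And>n. 0 < r n" "\<And>n. r n < 1" "r \<longlonglongrightarrow> 0"
   have "(\<integral>q. F (rescale (\<lambda>j. \<gamma> j (r n)) (\<lambda>t i. Z (r n) q t $ i)) \<partial>M) =
     (\<integral>q. f (\<lambda>t. vec J (rescale (\<lambda>j. \<gamma> j (r n)) (\<lambda>t i. Z (r n) q t $ i) t)) \<partial>M)" for n
    by (rule Bochner_Integration.integral_cong[OF refl], rule Fe) (use cZ[of "r n"] r in \<open>simp add: cproc_def\<close>)
   then show "(\<lambda>n. \<integral>q. f (\<lambda>t. vec J (rescale (\<lambda>j. \<gamma> j (r n)) (\<lambda>t i. Z (r n) q t $ i) t)) \<partial>M) \<longlonglongrightarrow> (\<integral>q. f (Zstar q) \<partial>N)"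
    using conv[OF r F Fb] unfolding lim by simp
  qed simp
 qed
qed

end

text \<open>A limit process is fixed only in law. The second conjunct therefore covers every
  realization of it on any space, and the first provides one on the product of \<open>J\<close>
  copies of \<open>M\<close> with \<open>P\<close>, so that the claim is not vacuous.\<close>

theorem theorem4:
  fixes J :: nat and \<epsilon> :: real and \<gamma> :: "nat \<Rightarrow> real \<Rightarrow> real"
    and \<Gamma> L R :: "real mat"
    and M :: "'a measure" and W :: "'a \<Rightarrow> real \<Rightarrow> real vec"
    and \<theta> :: "real \<Rightarrow> real vec" and Z :: "real \<Rightarrow> 'a \<Rightarrow> real \<Rightarrow> real vec"
    and P :: "'c measure" and \<xi> :: "'c \<Rightarrow> real vec"
  assumes "J \<ge> 1"
    and "0 < \<epsilon>" "\<epsilon> < 1" "scale_functions J \<epsilon> \<gamma>"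
    and "positive_definite J \<Gamma>" "cholesky_factor J \<Gamma> L"
    and "M_matrix J R"
    and "std_brownian_motion M J W"
    and "\<And>r. r \<in> {0<..<1} \<Longrightarrow> srbm_driven_by M J L W (\<lambda>\<omega>. Z r \<omega> 0) (\<theta> r) R (Z r)"
    and "\<And>r. r \<in> {0<..<1} \<Longrightarrow> \<theta> r = - (R *\<^sub>v vec J (\<lambda>j. \<gamma> j r))"
    and "prob_space P" "\<xi> \<in> P \<rightarrow>\<^sub>M vec_borel J" "\<And>\<omega>. \<omega> \<in> space P \<Longrightarrow> nonneg_vec J (\<xi> \<omega>)"
    and "converges_weakly (vec_topology J) (at_right 0)
           M (\<lambda>r \<omega>. vec J (\<lambda>j. \<gamma> 0 r * Z r \<omega> 0 $ j)) P \<xi>"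
  shows
    "(\<exists>(N :: ((nat \<Rightarrow> 'a) \<times> 'c) measure) Zstar.
        limit_process J \<Gamma> R P \<xi> N Zstar \<and>
        converges_weakly (path_topology J) (at_right 0)
          M (\<lambda>r \<omega> t. vec J (\<lambda>j. \<gamma> j r * Z r \<omega> (t / (\<gamma> j r)\<^sup>2) $ j)) N Zstar) \<and>
     (\<forall>(N :: 'b measure) Zstar.
        limit_process J \<Gamma> R P \<xi> N Zstar \<longrightarrow>
        converges_weakly (path_topology J) (at_right 0)
          M (\<lambda>r \<omega> t. vec J (\<lambda>j. \<gamma> j r * Z r \<omega> (t / (\<gamma> j r)\<^sup>2) $ j)) N Zstar)"
proof -
 have R_carrier: "R \<in> carrier_mat J J" by (rule M_matrix_imp_Mmat(1)[OF assms(7)])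
 obtain w where w: "Mmat J (\<lambda>i j. R $$ (i, j)) w" using M_matrix_imp_Mmat(2)[OF assms(7)] by blast
 have L: "L \<in> carrier_mat J J" and \<Gamma>: "\<Gamma> = L * transpose_mat L" using assms(6) unfolding cholesky_factor_def by blast+
 let ?R = "\<lambda>i j. R $$ (i, j)" and ?L = "\<lambda>i j. L $$ (i, j)"
 \<comment> \<open>The inverse block and the multipliers are chosen as a pair for all
   \<open>k\<close> at once; the implication lets indices \<open>k \<ge> J\<close> take arbitrary
   values.\<close>
 have "\<exists>p. k < J \<longrightarrow> eliminates J R L w k (fst p) (snd p)" for k
 proof (cases "k < J")
  case True
  from elimination[OF R_carrier w True L] obtain A h where "eliminates J R L w k A h" by (elim exE)
  then have "k < J \<longrightarrow> eliminates J R L w k (fst (A, h)) (snd (A, h))" by simp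
  then show ?thesis by (rule exI)
 qed simp
 then have "\<forall>k. \<exists>p. k < J \<longrightarrow> eliminates J R L w k (fst p) (snd p)" by (rule allI)
 from choice[OF this] obtain p where p: "\<forall>k. k < J \<longrightarrow> eliminates J R L w k (fst (p k)) (snd (p k))" by (elim exE)
 define AI where "AI k = fst (p k)" for k
 define H where "H k = snd (p k)" for k
 have el: "eliminates J R L w k (AI k) (H k)" if "k < J" for k using p that unfolding AI_def H_def by blast
 interpret eliminated_matrices J ?R w AI H R \<Gamma> ?L
 proof
  show "0 < J" using assms(1) by simp
  show "Mmat J ?R w" by (rule w)
  fix k assume k: "k < J"
  note e = el[OF k, unfolded eliminates_def]
  show "0 \<le> AI k i m" if "i < k" "m < k" for i m using e that by blast
  show "(\<Sum>m<k. AI k i m * R $$ (m, l)) = (if i = l then 1 else 0)" if "i < k" "l < k" for i l using e that by blast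
  show "(\<Sum>m<k. R $$ (i, m) * AI k m l) = (if i = l then 1 else 0)" if "i < k" "l < k" for i l using e that by blast
  show "Gfun ?R (H k) k l m = 0" if "l < J - k" "m < k" for l m using e that by blast
  show "Mmat (J - k) (\<lambda>l m. Gfun ?R (H k) k l (k + m)) (\<lambda>l. w (k + l))" using e by (elim conjE)
  show "submatrix (G_mat J R k) {k..<J} {k..<J} = mat (J - k) (J - k) (\<lambda>(l, m). Gfun ?R (H k) k l (k + m))" using e by (elim conjE)
  show "col (submatrix (G_mat J R k) {k..<J} {k}) 0 = vec (J - k) (\<lambda>l. Gfun ?R (H k) k l k)" using e by (elim conjE)
  show "submatrix (E_mat J R k * \<Gamma> * transpose_mat (E_mat J R k)) {k..<J} {k..<J} =
    mat (J - k) (J - k) (\<lambda>(l, l'). \<Sum>m<J. Gfun ?L (H k) k l m * Gfun ?L (H k) k l' m)" unfolding \<Gamma> using e by (elim conjE)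
 qed
 have \<gamma>: "0 < \<gamma> j r" if "r \<in> {0<..<1}" "j < J" for r j using assms(4) that unfolding scale_functions_def by blast
 have ratio: "((\<lambda>r. \<gamma> j r / \<gamma> i r) \<longlongrightarrow> 0) (at_right (0 :: real))" if "i < j" "j < J" for i j
  using assms(4) that unfolding scale_functions_def by blast
 let ?X = "\<lambda>r \<omega> t. vec J (\<lambda>j. \<gamma> j r * Z r \<omega> (t / (\<gamma> j r)\<^sup>2) $ j)"
 show ?thesis
 proof (intro conjI allI impI)
  have "\<exists>Zstar. limit_process J \<Gamma> R P \<xi> ((\<Pi>\<^sub>M j\<in>{..<J}. M) \<Otimes>\<^sub>M P) Zstar"
   by (rule limit_process_exists[OF assms(8,11-13)])
  then obtain Zstar where Zs: "limit_process J \<Gamma> R P \<xi> ((\<Pi>\<^sub>M j\<in>{..<J}. M) \<Otimes>\<^sub>M P) Zstar"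
   by (elim exE)
  have "converges_weakly (path_topology J) (at_right 0) M ?X ((\<Pi>\<^sub>M j\<in>{..<J}. M) \<Otimes>\<^sub>M P) Zstar"
   by (rule scaled_srbm_converges[where M = M and W = W and Z = Z and P = P and \<xi> = \<xi> and L = L and \<theta> = \<theta> and \<gamma> = \<gamma>,
      OF assms(8) R_carrier _ _ _ _ _ _ assms(11,12) _ assms(14) Zs],
     rule refl, rule refl, (rule assms(9), assumption), (rule assms(10), assumption),
     (rule \<gamma>, assumption, assumption), (rule ratio, assumption, assumption), rule assms(13), assumption)
  with Zs show "\<exists>(N :: ((nat \<Rightarrow> 'a) \<times> 'c) measure) Zstar.
    limit_process J \<Gamma> R P \<xi> N Zstar \<and>
    converges_weakly (path_topology J) (at_right 0) M ?X N Zstar" by (intro exI conjI)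
 next
  fix N :: "'b measure" and Zstar assume Zs: "limit_process J \<Gamma> R P \<xi> N Zstar"
  show "converges_weakly (path_topology J) (at_right 0) M ?X N Zstar"
   by (rule scaled_srbm_converges[where M = M and W = W and Z = Z and P = P and \<xi> = \<xi> and L = L and \<theta> = \<theta> and \<gamma> = \<gamma>,
      OF assms(8) R_carrier _ _ _ _ _ _ assms(11,12) _ assms(14) Zs],
     rule refl, rule refl, (rule assms(9), assumption), (rule assms(10), assumption),
     (rule \<gamma>, assumption, assumption), (rule ratio, assumption, assumption), rule assms(13), assumption)
 qed
qed

end
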